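(* Suppose the mFT scheme described in the context is defined for $t\le T$ with the uniform variation bound $\mathcal V(\Gamma^t)<V$ for $0\le t\le T$, with $V$ independent of $\epsilon$, and suppose that $Q(\epsilon)$ can be chosen so that $Q(\epsilon)=o(1)$ and $W_H(\Gamma^t,\epsilon)=o(1)$ as $\epsilon\to0^+$, uniformly for $t\in[0,T]$. Then, for any $b>1/2$, a subsequence of the mFT approximations $U^\epsilon$ converges to an $H^{-b}$ weak* solution of the system $q(u)_t+f(u)_x=0$.
   Context: System. $q(u)_t+f(u)_x=0$, $(x,t)\in\mathbb R\times(0,T)$, $u\in\mathcal U\subset\mathbb R^N$, with $q,f:\mathcal U\to\mathbb R^N$ of class $C^2$ and data $u(\cdot,0)=u^o\in BV_{loc}$. It is strictly hyperbolic: $Df(u)r_i(u)=\lambda_i(u)Dq(u)r_i(u)$ with real $\lambda_1(u)<\dots<\lambda_N(u)$; each field is either genuinely nonlinear (GNL, $r_k\cdot\nabla\lambda_k>0$) or linearly degenerate (LD, $r_k\cdot\nabla\lambda_k=0$). $W_k(u_0,\zeta)$ is the value at parameter $\zeta$ of the solution of $dU/d\zeta=r_k(U)$, $U(0)=u_0$ (simple waves; in a GNL family $\zeta>0$ is a rarefaction, $\zeta<0$ a compression). A $k$-shock joins $u_-$ to $u_+$ with speed $\sigma_k$ if $f(u_+)-f(u_-)=\sigma_k(q(u_+)-q(u_-))$, $\lambda_k(u_-)>\sigma_k>\lambda_k(u_+)$ and $\lambda_{k-1}(u_-)<\sigma_k<\lambda_{k+1}(u_+)$; it is assumed that $\sigma_k(u_\ell,u_m)<\sigma_{k'}(u_m,u_r)$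 for $k<k'$ (extended Lax condition). $E_k(u_-,\zeta)$ equals $W_k(u_-,\zeta)$ for $\zeta\ge0$ and parameterizes the admissible $k$-shock curve for $\zeta<0$ (for LD families $E_k=W_k$, contacts). $|\zeta|$ is the wave strength. Generalized Riemann problem (gRP): given $u_L,u_R$ and widths $w_k\ge0$ ($w_k=0$ for LD $k$), put $u_0=u_L$, $u_k=E_k(u_{k-1},\zeta_k)$ if $w_k=0$, $u_k=W_k(u_{k-1},\zeta_k)$ if $w_k>0$, and solve $u_N=u_R$. It is assumed that this always has a unique solution $(\zeta_k)$. States are in a fixed compact subset of $\mathcal U$, and waves in a compact spatial interval. Parameters. $\epsilon>0$; positive exponents with maximum rarefaction strength $\epsilon^{e_r}$, maximum and minimum absolute compression strengths $\epsilon^{e_c},\epsilon^{e_w}$, maximum passenger strength $\epsilon^{e_p}$, minimum initial discrete jump $\epsilon^{e_d}$, initial error $\epsilon^{e_i}$; $e_s=\min\{e_r,e_c\}$; $0<\kappa<1/3$ with $\epsilon^{e_p}<\kappa\epsilon^{e_r}$; $Q(\epsilon)\in(0,1)$. Wave sequence. $\Gamma^t=\{\gamma_j\}_{j=1}^{n}$ is a finite list of waves ordered in space. Each $\gamma_j$ has a family $k_j$, strength $\zeta_j$, left and right states $u_{j-1},u_j$ (exactly related by $W_{k_j}$ or $E_{k_j}$), speed $s_j$, position $x^p_j(t)$ moving with speed $s_j$, and virtual width $w_j(t)\ge0$ with $\dot w_j=\lambda_{k_j}(u_j)-\lambda_{k_j}(u_{j-1})$ for simple waves; the virtual edges move with speeds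 $\lambda_{k_j}(u_{j-1}),\lambda_{k_j}(u_j)$ and meet at the virtual center $(x^c_j,t^c_j)$. A compressive GNL wave is a shock iff its width is $0$. $\mathcal V(\Gamma)=\sum_j|\zeta_j|$ and $U^\epsilon(x,t)=u_0+\sum_j(u_j-u_{j-1})H(x-x_j^p(t))$ with $H$ the Heaviside function, $H(0)=1/2$. Each wave carries a preconditioner $A_j$ ($N\times N$, uniformly bounded with uniformly bounded inverse). Shocks and contacts have their exact speed; simple waves have the speed $s$ minimizing $|A_j([f]_j-s[q]_j)|$, where $[g]_j=g(u_j)-g(u_{j-1})$, except as modified below. Initialization. At each of the finitely many discontinuities of $u^o$ of size $\ge\epsilon^{e_d}$ the Riemann problem (all widths $0$) is solved, with rarefactions split into pieces of strength $<\epsilon^{e_r}$. Between consecutive such points finitely many points $x_j$ are chosen so that the total $BV$ and $L^1$ errors are $<\epsilon^{e_i}$; on each $(x_{j-1},x_j)$ the gRP with states $u^o(x_{j-1}+),u^o(x_j-)$ and GNL widths $w_k>0$, $\sum w_k<x_j-x_{j-1}$, is solved inside the interval, and each resulting wave is replaced by one jump with the corresponding center, least squares speed and virtual width at most $w_k$, without overlap. Interactions. Interaction times $0<t_1\le t_2\le\dots$ are the times at which adjacent waves meet or a compression collapses (its virtual width reaches $0$). At an interaction point $(x^!,t^!)$ the gRP is solved with the outer left and right states and outgoing widths $w_k'$, and every outgoing wave is a jump issuing from $(x^!,t^!)$. Widths: $w'_k=0$ for LD $k$; all $w'_k=0$ at a collapse; when two waves of the same family $k$ meet, $w'_k=0$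 and the other widths are at most the larger incident width; when waves of different families meet, the outgoing widths in those families are at most those of the incident wave of the same family, and the other widths are at most the larger incident width. Further: (i) if an outgoing compression has strength outside $[-\epsilon^{e_c},-\epsilon^{e_w}]$ its width is reset to $0$ (making it a shock) and the gRP is re-solved, repeatedly, widths once reset remaining $0$; (ii) if an outermost outgoing simple wave would overlap the neighbouring simple wave of the same family, the virtual widths of both are reduced to avoid overlap, positions and speeds unchanged; (iii) an outgoing zero-width rarefaction stronger than $\epsilon^{e_r}$ is split, along the wave curve, into rarefactions of strengths in $[\kappa\epsilon^{e_r},\epsilon^{e_r}]$ with increasing speeds; (iv) an outgoing rarefaction of positive width stronger than $\epsilon^{e_r}$ is split into $2m+1$ rarefactions $i=-m,\dots,m$ of strengths in $[\kappa\epsilon^{e_r},\epsilon^{e_r}]$, symmetric in $i\mapsto-i$, all issuing from $(x^!,t^!)$ with temporary speeds $\tilde s^{(i)}$ given by $(\tilde s^{(i)}-s^{(i)})(t^\#-t^!)=(s^{(i)}-\lambda_k(\bar u))(t^!-t^c)$, where $s^{(i)}$ are the least squares speeds, $\bar u$ is the parameter midpoint of the whole rarefaction and $t^c$ the time of its virtual center; $t^\#$ is chosen with $(t^!-t^c)/(t^\#-t^!)=O(m\epsilon^{e_r})$, and at $t^\#$ the speeds revert to $s^{(i)}$ (multi-rarefaction). Composite waves. Outgoing waves of strength $\ge\epsilon^{e_p}$ are base waves (carriers). Every weaker outgoing wave is a passenger of a base wave issuing from the same point: the stronger of the base waves to its left and right, or the base wave on the only available side; all waves between a passenger and its carrier are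 passengers with the same carrier. If no base wave emerges, all outgoing waves are carried by the strongest of them (a lonely weak wave). A carrier and its passengers move as one discontinuity with a common speed and the carrier's width. A passenger $\gamma_j$ with carrier $\gamma_b$ is light if $|\zeta_j|\le Q(\epsilon)|\zeta_b|$, otherwise heavy. If all passengers are light the common speed is that of the carrier; otherwise it minimizes $|\sum_k A_k([f]_k-s[q]_k)|$, summed over all components. At its next interaction a composite wave enters through its outer left and right states. Weight of heavy passengers. $W_H(\Gamma,\epsilon):=\sum_{b\in B_H}\sqrt{\sum_{h:\,b_h=b}\zeta_h^2}$, where $B_H$ is the set of carriers with at least one heavy passenger, $b_h$ denotes the carrier of $\gamma_h$, and $h$ runs over heavy passengers only. $H^{-b}$ weak* solutions. $H^{-b}=(H^b)^*$. $L^\infty_*(0,T;X^* )$ denotes bounded Gelfand integrable functions, and $W^{1,\infty}_*(0,T;H^{1-b},H^{-b})$ the functions with values in $H^{1-b}$ whose Gelfand-weak time derivative exists in $L^\infty_*(0,T;H^{-b})$. An $H^{-b}$ weak* solution is a function $u\in\mathcal Z^{-b,\infty}:=f^{-1}(L^\infty_*(0,T;H^{1-b}))\cap q^{-1}(W^{1,\infty}_*(0,T;H^{1-b},H^{-b}))$ such that, for all $t\in[0,T)$ and all $\varphi\in H^b$, $\langle q(u(\cdot,t)),\varphi\rangle-\langle q(u^o),\varphi\rangle-\int_0^t\langle f(u(\cdot,\tau)),\varphi_x\rangle\,d\tau=0$. Convergence is in the weak-$*$ topology of the corresponding dual spaces.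
   Formalization: Speeds of composites with heavy passengers are assumed bounded uniformly in ε (the minimizer can be undefined or unbounded when the preconditioned jumps cancel); E_k is assumed locally Lipschitz on an open domain, r_k is C^1; solution and convergence are on bounded intervals. *)

theory Defs
  imports "HOL-Analysis.Analysis"
begin

section \<open>The hyperbolic system\<close>

definition C1_on :: "'a::real_normed_vector set \<Rightarrow> ('a \<Rightarrow> 'b::real_normed_vector) \<Rightarrow> bool" where
  "C1_on X g \<longleftrightarrow> (\<exists>g'. (\<forall>x\<in>X. (g has_derivative blinfun_apply (g' x)) (at x)) \<and> continuous_on X g')"

definition C2_on :: "'a::real_normed_vector set \<Rightarrow> ('a \<Rightarrow> 'b::real_normed_vector) \<Rightarrow> bool" where
  "C2_on X g \<longleftrightarrow> (\<exists>g'. (\<forall>x\<in>X. (g has_derivative blinfun_apply (g' x)) (at x)) \<and> C1_on X g')"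

text \<open>Families are numbered \<open>1, \<dots>, CARD('n)\<close>; \<open>gnl\<close> is the set of genuinely nonlinear families, all
  others are linearly degenerate. \<open>ecv S k u \<zeta>\<close> is the state \<open>E\<^sub>k(u,\<zeta>)\<close>, meaningful for
  \<open>(u,\<zeta>) \<in> edom S k\<close>.\<close>

record ('n::finite) hsys =
  states :: "(real^'n) set"
  qfun :: "real^'n \<Rightarrow> real^'n"
  ffun :: "real^'n \<Rightarrow> real^'n"
  lam :: "nat \<Rightarrow> real^'n \<Rightarrow> real"
  rvec :: "nat \<Rightarrow> real^'n \<Rightarrow> real^'n"
  gnl :: "nat set"
  ecv :: "nat \<Rightarrow> real^'n \<Rightarrow> real \<Rightarrow> real^'n"
  edom :: "nat \<Rightarrow> ((real^'n) \<times> real) set"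

definition families :: "'n::finite hsys \<Rightarrow> nat set" where
  "families S = {1..CARD('n)}"

text \<open>\<open>u' = W\<^sub>k(u,\<zeta>)\<close>: a relation, because the integral curve may leave the state space.\<close>

definition W_curve :: "'n::finite hsys \<Rightarrow> nat \<Rightarrow> real^'n \<Rightarrow> real \<Rightarrow> real^'n \<Rightarrow> bool" where
  "W_curve S k u \<zeta> u' \<longleftrightarrow> (\<exists>c. c 0 = u \<and> c \<zeta> = u' \<and>
     (\<forall>z\<in>closed_segment 0 \<zeta>. c z \<in> states S \<and>
        (c has_vector_derivative rvec S k (c z)) (at z within closed_segment 0 \<zeta>)))"

definition E_curve :: "'n::finite hsys \<Rightarrow> nat \<Rightarrow> real^'n \<Rightarrow> real \<Rightarrow> real^'n \<Rightarrow> bool" where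
  "E_curve S k u \<zeta> u' \<longleftrightarrow> (u, \<zeta>) \<in> edom S k \<and> u' = ecv S k u \<zeta>"

definition kshock :: "'n::finite hsys \<Rightarrow> nat \<Rightarrow> real^'n \<Rightarrow> real^'n \<Rightarrow> real \<Rightarrow> bool" where
  "kshock S k u u' s \<longleftrightarrow> u \<in> states S \<and> u' \<in> states S \<and>
     ffun S u' - ffun S u = s *\<^sub>R (qfun S u' - qfun S u) \<and>
     lam S k u > s \<and> s > lam S k u' \<and>
     (1 < k \<longrightarrow> lam S (k - 1) u < s) \<and> (k < CARD('n) \<longrightarrow> s < lam S (k + 1) u')"

text \<open>\<open>z\<close> are the strengths and \<open>v 0, \<dots>, v CARD('n)\<close> the intermediate states; the widths \<open>w\<close> matter
  only through their being zero or not.\<close>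

definition gRP :: "'n::finite hsys \<Rightarrow> real^'n \<Rightarrow> real^'n \<Rightarrow> (nat \<Rightarrow> real) \<Rightarrow> (nat \<Rightarrow> real) \<Rightarrow>
    (nat \<Rightarrow> real^'n) \<Rightarrow> bool" where
  "gRP S uL uR w z v \<longleftrightarrow> v 0 = uL \<and> v (CARD('n)) = uR \<and>
     (\<forall>k\<in>families S. if w k = 0 then E_curve S k (v (k - 1)) (z k) (v k)
                      else W_curve S k (v (k - 1)) (z k) (v k))"

text \<open>Invertibility of \<open>Dq\<close> is part of strict hyperbolicity: without it the pencil
  \<open>Df - \<lambda> Dq\<close> does not have \<open>N\<close> well-defined eigenvalues.\<close>

definition strictly_hyperbolic :: "'n::finite hsys \<Rightarrow> bool" where
  "strictly_hyperbolic S \<longleftrightarrow>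
     open (states S) \<and> C2_on (states S) (qfun S) \<and> C2_on (states S) (ffun S) \<and>
     (\<forall>k\<in>families S. C1_on (states S) (lam S k) \<and> C1_on (states S) (rvec S k)) \<and>
     (\<forall>u\<in>states S. bij (frechet_derivative (qfun S) (at u)) \<and>
        (\<forall>k\<in>families S. rvec S k u \<noteq> 0 \<and>
           frechet_derivative (ffun S) (at u) (rvec S k u) =
             lam S k u *\<^sub>R frechet_derivative (qfun S) (at u) (rvec S k u)) \<and>
        (\<forall>k\<in>families S. \<forall>k'\<in>families S. k < k' \<longrightarrow> lam S k u < lam S k' u))"

definition gnl_or_ld :: "'n::finite hsys \<Rightarrow> bool" where
  "gnl_or_ld S \<longleftrightarrow> (\<forall>k\<in>families S. \<forall>u\<in>states S.
     if k \<in> gnl S then 0 < frechet_derivative (lam S k) (at u) (rvec S k u)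
     else frechet_derivative (lam S k) (at u) (rvec S k u) = 0)"

text \<open>Regularity of the parameterization \<open>E\<^sub>k\<close>: an open domain and joint local Lipschitz continuity.\<close>

definition wave_curves :: "'n::finite hsys \<Rightarrow> bool" where
  "wave_curves S \<longleftrightarrow> (\<forall>k\<in>families S.
     edom S k \<subseteq> states S \<times> UNIV \<and> open (edom S k) \<and>
     (\<forall>p\<in>edom S k. \<exists>\<delta>>0. \<exists>L. L-lipschitz_on (ball p \<delta> \<inter> edom S k) (\<lambda>(u, \<zeta>). ecv S k u \<zeta>)) \<and>
     (\<forall>u\<in>states S. \<forall>\<zeta> u'. 0 \<le> \<zeta> \<or> k \<notin> gnl S \<longrightarrow> (E_curve S k u \<zeta> u' \<longleftrightarrow> W_curve S k u \<zeta> u')) \<and>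
     (k \<in> gnl S \<longrightarrow> (\<forall>u \<zeta>. \<zeta> < 0 \<and> (u, \<zeta>) \<in> edom S k \<longrightarrow> (\<exists>s. kshock S k u (ecv S k u \<zeta>) s))))"

definition extended_Lax :: "'n::finite hsys \<Rightarrow> bool" where
  "extended_Lax S \<longleftrightarrow> (\<forall>k\<in>families S \<inter> gnl S. \<forall>k'\<in>families S \<inter> gnl S. \<forall>ul um ur s s'.
     k < k' \<and> kshock S k ul um s \<and> kshock S k' um ur s' \<longrightarrow> s < s')"

definition gRP_solvable :: "'n::finite hsys \<Rightarrow> bool" where
  "gRP_solvable S \<longleftrightarrow> (\<forall>uL\<in>states S. \<forall>uR\<in>states S. \<forall>w.
     (\<forall>k\<in>families S. 0 \<le> w k \<and> (k \<notin> gnl S \<longrightarrow> w k = 0)) \<longrightarrow>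
     (\<exists>z v. gRP S uL uR w z v) \<and>
     (\<forall>z v z' v'. gRP S uL uR w z v \<and> gRP S uL uR w z' v' \<longrightarrow> (\<forall>k\<in>families S. z k = z' k)))"

definition hyperbolic_system :: "'n::finite hsys \<Rightarrow> bool" where
  "hyperbolic_system S \<longleftrightarrow> strictly_hyperbolic S \<and> gnl_or_ld S \<and> wave_curves S \<and>
     extended_Lax S \<and> gRP_solvable S"

section \<open>Waves and composite waves\<close>

text \<open>The exponents \<open>e\<^sub>r, e\<^sub>c, e\<^sub>w, e\<^sub>p, e\<^sub>d, e\<^sub>i\<close>, the splitting constant \<open>\<kappa>\<close> and \<open>Q(\<epsilon>)\<close>.\<close>

record mft_params =
  er :: real
  ec :: real
  ew :: real
  ep :: real
  ed :: real
  ei :: real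
  kap :: real
  Qlight :: "real \<Rightarrow> real"

definition valid_params :: "mft_params \<Rightarrow> real \<Rightarrow> bool" where
  "valid_params P \<epsilon> \<longleftrightarrow> 0 < \<epsilon> \<and> 0 < er P \<and> 0 < ec P \<and> 0 < ew P \<and> 0 < ep P \<and> 0 < ed P \<and> 0 < ei P \<and>
     0 < kap P \<and> kap P < 1/3 \<and> \<epsilon> powr ep P < kap P * \<epsilon> powr er P \<and> 0 < Qlight P \<epsilon> \<and> Qlight P \<epsilon> < 1"

text \<open>\<open>smooth\<close> records that the wave was solved on the simple wave curve \<open>W\<close>, i.e. with a positive
  generalized Riemann problem width.\<close>

record ('n::finite) wave =
  fam :: nat
  str :: real
  lst :: "real^'n"
  rst :: "real^'n"
  smooth :: bool
  pre :: "real^'n^'n"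

definition is_shock :: "'n::finite hsys \<Rightarrow> 'n wave \<Rightarrow> bool" where
  "is_shock S \<gamma> \<longleftrightarrow> fam \<gamma> \<in> gnl S \<and> str \<gamma> < 0 \<and> \<not> smooth \<gamma>"

definition is_simple :: "'n::finite hsys \<Rightarrow> 'n wave \<Rightarrow> bool" where
  "is_simple S \<gamma> \<longleftrightarrow> fam \<gamma> \<in> gnl S \<and> \<not> is_shock S \<gamma>"

definition is_compression :: "'n::finite hsys \<Rightarrow> 'n wave \<Rightarrow> bool" where
  "is_compression S \<gamma> \<longleftrightarrow> is_simple S \<gamma> \<and> str \<gamma> < 0"

definition valid_wave :: "'n::finite hsys \<Rightarrow> 'n wave \<Rightarrow> bool" where
  "valid_wave S \<gamma> \<longleftrightarrow> fam \<gamma> \<in> families S \<and> str \<gamma> \<noteq> 0 \<and>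
     (if smooth \<gamma> then W_curve S (fam \<gamma>) (lst \<gamma>) (str \<gamma>) (rst \<gamma>)
      else E_curve S (fam \<gamma>) (lst \<gamma>) (str \<gamma>) (rst \<gamma>))"

definition wave_residual :: "'n::finite hsys \<Rightarrow> 'n wave \<Rightarrow> real \<Rightarrow> real^'n" where
  "wave_residual S \<gamma> s =
     pre \<gamma> *v ((ffun S (rst \<gamma>) - ffun S (lst \<gamma>)) - s *\<^sub>R (qfun S (rst \<gamma>) - qfun S (lst \<gamma>)))"

definition wave_speed :: "'n::finite hsys \<Rightarrow> 'n wave \<Rightarrow> real \<Rightarrow> bool" where
  "wave_speed S \<gamma> s \<longleftrightarrow>
     (if is_shock S \<gamma> then kshock S (fam \<gamma>) (lst \<gamma>) (rst \<gamma>) s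
      else if is_simple S \<gamma> then is_arg_min (\<lambda>\<sigma>. norm (wave_residual S \<gamma> \<sigma>)) (\<lambda>_. True) s
      else s = lam S (fam \<gamma>) (lst \<gamma>))"

text \<open>A front is one travelling discontinuity: a carrier (component number \<open>car\<close>) with its
  passengers, ordered in space. \<open>pos\<close> and \<open>spd\<close> are the current position and speed, \<open>regspd\<close> is the
  regular speed, and \<open>(xc,tc)\<close> the virtual center of a simple carrier, which determines its virtual
  edges. \<open>trev = Some t\<close> means that a temporary speed is in force until time \<open>t\<close>.\<close>

record ('n::finite) front =
  comps :: "'n wave list"
  car :: nat
  pos :: real
  spd :: real
  regspd :: real
  xc :: real
  tc :: real
  trev :: "real option"

definition carrier :: "'n::finite front \<Rightarrow> 'n wave" where
  "carrier F = comps F ! car F"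

definition left_state :: "'n::finite front \<Rightarrow> real^'n" where
  "left_state F = lst (hd (comps F))"

definition right_state :: "'n::finite front \<Rightarrow> real^'n" where
  "right_state F = rst (last (comps F))"

definition heavy :: "mft_params \<Rightarrow> real \<Rightarrow> 'n::finite front \<Rightarrow> nat set" where
  "heavy P \<epsilon> F = {i. i < length (comps F) \<and> i \<noteq> car F \<and>
     \<bar>str (comps F ! i)\<bar> > Qlight P \<epsilon> * \<bar>str (carrier F)\<bar>}"

text \<open>The bound \<open>\<bar>s\<bar> \<le> C\<close> makes finite propagation speed explicit for composites with heavy passengers.
  Unlike the other speeds, this minimizer need not be controlled by the remaining uniform bounds: the
  preconditioners of different components are unrelated, so the preconditioned jumps
  \<open>A\<^sub>k[q]\<^sub>k\<close> may cancel, and then every \<open>s\<close> is a minimizer.\<close>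

definition regular_speed :: "'n::finite hsys \<Rightarrow> mft_params \<Rightarrow> real \<Rightarrow> real \<Rightarrow> 'n front \<Rightarrow> real \<Rightarrow> bool" where
  "regular_speed S P C \<epsilon> F s \<longleftrightarrow>
     (if heavy P \<epsilon> F = {} then wave_speed S (carrier F) s
      else is_arg_min (\<lambda>\<sigma>. norm (\<Sum>\<gamma>\<leftarrow>comps F. wave_residual S \<gamma> \<sigma>)) (\<lambda>_. True) s \<and> \<bar>s\<bar> \<le> C)"

text \<open>In \<open>left_edge\<close> and \<open>right_edge\<close>, \<open>pos F\<close> has to be the position at time \<open>t\<close>; shocks and contacts
  have width 0.\<close>

definition left_edge :: "'n::finite hsys \<Rightarrow> real \<Rightarrow> 'n front \<Rightarrow> real" where
  "left_edge S t F = (if is_simple S (carrier F)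
     then xc F + lam S (fam (carrier F)) (lst (carrier F)) * (t - tc F) else pos F)"

definition right_edge :: "'n::finite hsys \<Rightarrow> real \<Rightarrow> 'n front \<Rightarrow> real" where
  "right_edge S t F = (if is_simple S (carrier F)
     then xc F + lam S (fam (carrier F)) (rst (carrier F)) * (t - tc F) else pos F)"

definition vwidth :: "'n::finite hsys \<Rightarrow> real \<Rightarrow> 'n front \<Rightarrow> real" where
  "vwidth S t F = right_edge S t F - left_edge S t F"

definition advance :: "real \<Rightarrow> 'n::finite front \<Rightarrow> 'n front" where
  "advance d F = F\<lparr>pos := pos F + d * spd F\<rparr>"

text \<open>Grouping of the waves \<open>ws\<close> issuing from one point into composite waves. Components of a front
  being consecutive, all waves between a passenger and its carrier have the same carrier.\<close>

definition composites :: "mft_params \<Rightarrow> real \<Rightarrow> 'n::finite wave list \<Rightarrow> 'n front list \<Rightarrow> bool" where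
  "composites P \<epsilon> ws Fs \<longleftrightarrow>
     concat (map comps Fs) = ws \<and> (\<forall>F\<in>set Fs. car F < length (comps F)) \<and>
     (if \<exists>\<gamma>\<in>set ws. \<epsilon> powr ep P \<le> \<bar>str \<gamma>\<bar> then
        (\<forall>F\<in>set Fs. \<forall>i<length (comps F). \<epsilon> powr ep P \<le> \<bar>str (comps F ! i)\<bar> \<longleftrightarrow> i = car F) \<and>
        (\<forall>j. Suc j < length Fs \<longrightarrow>
           (Suc (car (Fs ! j)) < length (comps (Fs ! j)) \<longrightarrow>
              \<bar>str (carrier (Fs ! Suc j))\<bar> \<le> \<bar>str (carrier (Fs ! j))\<bar>) \<and>
           (0 < car (Fs ! Suc j) \<longrightarrow>
              \<bar>str (carrier (Fs ! j))\<bar> \<le> \<bar>str (carrier (Fs ! Suc j))\<bar>))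
      else length Fs \<le> 1 \<and> (\<forall>F\<in>set Fs. \<forall>\<gamma>\<in>set (comps F). \<bar>str \<gamma>\<bar> \<le> \<bar>str (carrier F)\<bar>))"

definition singles :: "'n::finite wave list \<Rightarrow> 'n front list \<Rightarrow> bool" where
  "singles ws Fs \<longleftrightarrow> map comps Fs = map (\<lambda>\<gamma>. [\<gamma>]) ws \<and> (\<forall>F\<in>set Fs. car F = 0)"

section \<open>Splitting of waves\<close>

fun joined :: "real^'n::finite \<Rightarrow> 'n wave list \<Rightarrow> real^'n \<Rightarrow> bool" where
  "joined u [] u' \<longleftrightarrow> u = u'"
| "joined u (\<gamma> # \<gamma>s) u' \<longleftrightarrow> lst \<gamma> = u \<and> joined (rst \<gamma>) \<gamma>s u'"

definition unsplit :: "nat \<Rightarrow> real^'n::finite \<Rightarrow> real \<Rightarrow> real^'n \<Rightarrow> bool \<Rightarrow> 'n wave list \<Rightarrow> bool" where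
  "unsplit k u z u' sm ps \<longleftrightarrow> (if z = 0 then ps = []
     else \<exists>A. ps = [\<lparr>fam = k, str = z, lst = u, rst = u', smooth = sm, pre = A\<rparr>])"

definition split_rarefaction :: "'n::finite hsys \<Rightarrow> nat \<Rightarrow> real^'n \<Rightarrow> real \<Rightarrow> real^'n \<Rightarrow> bool \<Rightarrow>
    'n wave list \<Rightarrow> bool" where
  "split_rarefaction S k u z u' sm ps \<longleftrightarrow> joined u ps u' \<and> (\<Sum>\<gamma>\<leftarrow>ps. str \<gamma>) = z \<and>
     (\<forall>\<gamma>\<in>set ps. valid_wave S \<gamma> \<and> fam \<gamma> = k \<and> 0 < str \<gamma> \<and> smooth \<gamma> = sm)"

definition too_strong :: "'n::finite hsys \<Rightarrow> mft_params \<Rightarrow> real \<Rightarrow> nat \<Rightarrow> real \<Rightarrow> bool" where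
  "too_strong S P \<epsilon> k z \<longleftrightarrow> k \<in> gnl S \<and> \<epsilon> powr er P < z"

definition outgoing_pieces :: "'n::finite hsys \<Rightarrow> mft_params \<Rightarrow> real \<Rightarrow> nat \<Rightarrow> real^'n \<Rightarrow> real \<Rightarrow>
    real^'n \<Rightarrow> bool \<Rightarrow> 'n wave list \<Rightarrow> bool" where
  "outgoing_pieces S P \<epsilon> k u z u' sm ps \<longleftrightarrow>
     (if too_strong S P \<epsilon> k z then
        split_rarefaction S k u z u' sm ps \<and>
        (\<forall>\<gamma>\<in>set ps. kap P * \<epsilon> powr er P \<le> str \<gamma> \<and> str \<gamma> \<le> \<epsilon> powr er P) \<and>
        (if sm then (\<exists>m\<ge>1. length ps = 2 * m + 1) \<and> rev (map str ps) = map str ps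
         else \<exists>ss. list_all2 (wave_speed S) ps ss \<and> sorted_wrt (<) ss)
      else unsplit k u z u' sm ps)"

definition initial_pieces :: "'n::finite hsys \<Rightarrow> mft_params \<Rightarrow> real \<Rightarrow> nat \<Rightarrow> real^'n \<Rightarrow> real \<Rightarrow>
    real^'n \<Rightarrow> 'n wave list \<Rightarrow> bool" where
  "initial_pieces S P \<epsilon> k u z u' ps \<longleftrightarrow>
     (if k \<in> gnl S \<and> 0 < z then
        split_rarefaction S k u z u' False ps \<and> (\<forall>\<gamma>\<in>set ps. str \<gamma> < \<epsilon> powr er P)
      else unsplit k u z u' False ps)"

definition in_order :: "'n::finite hsys \<Rightarrow> (nat \<Rightarrow> 'n wave list) \<Rightarrow> 'n wave list" where
  "in_order S pcs = concat (map pcs [1..<CARD('n) + 1])"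

section \<open>Interactions\<close>

definition bad_compressions :: "'n::finite hsys \<Rightarrow> mft_params \<Rightarrow> real \<Rightarrow> (nat \<Rightarrow> real) \<Rightarrow> (nat \<Rightarrow> real) \<Rightarrow>
    nat set" where
  "bad_compressions S P \<epsilon> w z = {k \<in> families S \<inter> gnl S. 0 < w k \<and> z k < 0 \<and>
     z k \<notin> {- (\<epsilon> powr ec P) .. - (\<epsilon> powr ew P)}}"

text \<open>Rule (i). Whether the offending compressions are reset one at a time or several at once is
  left open.\<close>

inductive resets :: "'n::finite hsys \<Rightarrow> mft_params \<Rightarrow> real \<Rightarrow> real^'n \<Rightarrow> real^'n \<Rightarrow>
    (nat \<Rightarrow> real) \<Rightarrow> (nat \<Rightarrow> real) \<Rightarrow> bool" for S P \<epsilon> uL uR where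
  finished: "gRP S uL uR w z v \<Longrightarrow> bad_compressions S P \<epsilon> w z = {} \<Longrightarrow> resets S P \<epsilon> uL uR w w"
| reset: "gRP S uL uR w z v \<Longrightarrow> B \<noteq> {} \<Longrightarrow> B \<subseteq> bad_compressions S P \<epsilon> w z \<Longrightarrow>
    resets S P \<epsilon> uL uR (\<lambda>k. if k \<in> B then 0 else w k) w' \<Longrightarrow> resets S P \<epsilon> uL uR w w'"

definition width_rule :: "'n::finite hsys \<Rightarrow> nat \<Rightarrow> real \<Rightarrow> nat \<Rightarrow> real \<Rightarrow> (nat \<Rightarrow> real) \<Rightarrow> bool" where
  "width_rule S k1 a1 k2 a2 w \<longleftrightarrow>
     (\<forall>k\<in>families S. 0 \<le> w k \<and> (k \<notin> gnl S \<longrightarrow> w k = 0) \<and>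
        (k \<noteq> k1 \<and> k \<noteq> k2 \<longrightarrow> w k \<le> max a1 a2)) \<and>
     (if k1 = k2 then w k1 = 0 else w k1 \<le> a1 \<and> w k2 \<le> a2)"

text \<open>The fronts \<open>Fs\<close> issuing from \<open>(x,t)\<close>. The pieces of a split wave share the virtual center
  \<open>(X k, Tc k)\<close> of the whole wave, whose virtual interval at time \<open>t\<close> has length \<open>w k\<close> and contains
  \<open>x\<close>. A multi-rarefaction of family \<open>k\<close> has temporary speeds until \<open>th k\<close>, \<open>mid k\<close> is its parameter
  midpoint.\<close>

definition outgoing :: "'n::finite hsys \<Rightarrow> mft_params \<Rightarrow> real \<Rightarrow> real \<Rightarrow> real \<Rightarrow> real \<Rightarrow>
    real^'n \<Rightarrow> real^'n \<Rightarrow> (nat \<Rightarrow> real) \<Rightarrow> 'n front list \<Rightarrow> bool" where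
  "outgoing S P C \<epsilon> x t uL uR w Fs \<longleftrightarrow>
     (\<exists>z v pcs X Tc th mid.
        gRP S uL uR w z v \<and>
        (\<forall>k\<in>families S. outgoing_pieces S P \<epsilon> k (v (k - 1)) (z k) (v k) (0 < w k) (pcs k)) \<and>
        (\<forall>k\<in>families S \<inter> gnl S.
           Tc k = t - w k / (lam S k (v k) - lam S k (v (k - 1))) \<and>
           X k + lam S k (v (k - 1)) * (t - Tc k) \<le> x \<and> x \<le> X k + lam S k (v k) * (t - Tc k)) \<and>
        (\<forall>k\<in>families S. too_strong S P \<epsilon> k (z k) \<and> 0 < w k \<longrightarrow>
           W_curve S k (v (k - 1)) (z k / 2) (mid k) \<and> t < th k \<and>
           (\<forall>m. length (pcs k) = 2 * m + 1 \<longrightarrow>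
              t - Tc k \<le> C * real m * \<epsilon> powr er P * (th k - t))) \<and>
        composites P \<epsilon> (in_order S pcs) Fs \<and>
        (\<forall>F\<in>set Fs. let k = fam (carrier F) in
           pos F = x \<and> regular_speed S P C \<epsilon> F (regspd F) \<and>
           (is_simple S (carrier F) \<longrightarrow> xc F = X k \<and> tc F = Tc k) \<and>
           (if too_strong S P \<epsilon> k (z k) \<and> 0 < w k \<and> heavy P \<epsilon> F = {}
            then trev F = Some (th k) \<and>
                 (spd F - regspd F) * (th k - t) = (regspd F - lam S k (mid k)) * (t - Tc k)
            else trev F = None \<and> spd F = regspd F)))"

definition overlap :: "'n::finite hsys \<Rightarrow> real \<Rightarrow> 'n front \<Rightarrow> 'n front \<Rightarrow> bool" where
  "overlap S t F G \<longleftrightarrow> is_simple S (carrier F) \<and> is_simple S (carrier G) \<and>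
     fam (carrier F) = fam (carrier G) \<and> left_edge S t G < right_edge S t F"

definition narrowed :: "'n::finite hsys \<Rightarrow> real \<Rightarrow> 'n front \<Rightarrow> 'n front \<Rightarrow> bool" where
  "narrowed S t F F' \<longleftrightarrow> (\<exists>x' t'. F' = F\<lparr>xc := x', tc := t'\<rparr>) \<and>
     left_edge S t F \<le> left_edge S t F' \<and> right_edge S t F' \<le> right_edge S t F \<and>
     0 \<le> vwidth S t F' \<and> (0 < vwidth S t F \<longrightarrow> 0 < vwidth S t F')"

text \<open>Rule (ii): \<open>n\<close> new fronts start at index \<open>i\<close> of \<open>L\<close>; \<open>L'\<close> is the list after removal of overlaps with
  the two neighbours.\<close>

definition overlap_removed :: "'n::finite hsys \<Rightarrow> real \<Rightarrow> nat \<Rightarrow> nat \<Rightarrow> 'n front list \<Rightarrow> 'n front list \<Rightarrow> bool"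
  where
  "overlap_removed S t i n L L' \<longleftrightarrow>
     (let B = {p. 0 < n \<and> Suc p < length L \<and> (Suc p = i \<or> Suc p = i + n)} in
        length L' = length L \<and>
        (\<forall>j<length L. L' ! j = L ! j \<or>
           narrowed S t (L ! j) (L' ! j) \<and>
           (\<exists>p\<in>B. (j = p \<or> j = Suc p) \<and> overlap S t (L ! p) (L ! Suc p))) \<and>
        (\<forall>p\<in>B. \<not> overlap S t (L' ! p) (L' ! Suc p)))"

text \<open>The three events turning the fronts \<open>L\<close> present at time \<open>t\<close> into \<open>L'\<close>. Fronts issuing from one
  point share their position, so a meeting also requires the left one to be faster.\<close>

inductive mft_event :: "'n::finite hsys \<Rightarrow> mft_params \<Rightarrow> real \<Rightarrow> real \<Rightarrow> real \<Rightarrow> 'n front list \<Rightarrow>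
    'n front list \<Rightarrow> bool" for S P C \<epsilon> t where
  meeting: "pos F = pos G \<Longrightarrow> spd G < spd F \<Longrightarrow>
    width_rule S (fam (carrier F)) (vwidth S t F) (fam (carrier G)) (vwidth S t G) w0 \<Longrightarrow>
    resets S P \<epsilon> (left_state F) (right_state G) w0 w \<Longrightarrow>
    outgoing S P C \<epsilon> (pos F) t (left_state F) (right_state G) w Fs \<Longrightarrow>
    overlap_removed S t (length L1) (length Fs) (L1 @ Fs @ L2) L' \<Longrightarrow>
    mft_event S P C \<epsilon> t (L1 @ [F, G] @ L2) L'"
| collapse: "is_compression S (carrier F) \<Longrightarrow> tc F = t \<Longrightarrow>
    outgoing S P C \<epsilon> (pos F) t (left_state F) (right_state F) (\<lambda>_. 0) Fs \<Longrightarrow>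
    overlap_removed S t (length L1) (length Fs) (L1 @ Fs @ L2) L' \<Longrightarrow>
    mft_event S P C \<epsilon> t (L1 @ [F] @ L2) L'"
| reversion: "\<exists>F\<in>set L. trev F = Some t \<Longrightarrow>
    mft_event S P C \<epsilon> t L
      (map (\<lambda>F. if trev F = Some t then F\<lparr>spd := regspd F, trev := None\<rparr> else F) L)"

text \<open>No event is due strictly before \<open>t1\<close>, for fronts \<open>L\<close> with positions at time \<open>t0\<close>.\<close>

definition quiet :: "'n::finite hsys \<Rightarrow> real \<Rightarrow> real \<Rightarrow> 'n front list \<Rightarrow> bool" where
  "quiet S t0 t1 L \<longleftrightarrow> sorted (map (\<lambda>F. pos (advance (t1 - t0) F)) L) \<and>
     (\<forall>F\<in>set L. (is_compression S (carrier F) \<longrightarrow> t1 \<le> tc F) \<and> (\<forall>s. trev F = Some s \<longrightarrow> t1 \<le> s))"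

section \<open>Initialization\<close>

definition llim :: "(real \<Rightarrow> 'a::t2_space) \<Rightarrow> real \<Rightarrow> 'a" where
  "llim g x = Lim (at_left x) g"

definition rlim :: "(real \<Rightarrow> 'a::t2_space) \<Rightarrow> real \<Rightarrow> 'a" where
  "rlim g x = Lim (at_right x) g"

definition variation_on :: "real set \<Rightarrow> (real \<Rightarrow> 'a::metric_space) \<Rightarrow> ennreal" where
  "variation_on X g = (SUP xs\<in>{xs. sorted xs \<and> set xs \<subseteq> X}.
     ennreal (\<Sum>i<length xs - 1. dist (g (xs ! i)) (g (xs ! Suc i))))"

definition BV_loc :: "(real \<Rightarrow> 'a::metric_space) \<Rightarrow> bool" where
  "BV_loc g \<longleftrightarrow> (\<forall>l r. variation_on {l..r} g < top)"

definition big_jumps :: "mft_params \<Rightarrow> real \<Rightarrow> (real \<Rightarrow> real^'n::finite) \<Rightarrow> real set" where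
  "big_jumps P \<epsilon> uo = {x. \<epsilon> powr ed P \<le> norm (rlim uo x - llim uo x)}"

text \<open>Whether waves of an initial Riemann problem are grouped into composites is left open; if they
  are, pieces of a split rarefaction have to be base waves.\<close>

definition initial_riemann :: "'n::finite hsys \<Rightarrow> mft_params \<Rightarrow> real \<Rightarrow> real \<Rightarrow> real \<Rightarrow>
    real^'n \<Rightarrow> real^'n \<Rightarrow> 'n front list \<Rightarrow> bool" where
  "initial_riemann S P C \<epsilon> x uL uR Fs \<longleftrightarrow>
     (\<exists>z v pcs. gRP S uL uR (\<lambda>_. 0) z v \<and>
        (\<forall>k\<in>families S. initial_pieces S P \<epsilon> k (v (k - 1)) (z k) (v k) (pcs k)) \<and>
        (singles (in_order S pcs) Fs \<or>
         composites P \<epsilon> (in_order S pcs) Fs \<and>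
           (\<forall>k\<in>families S. 1 < length (pcs k) \<longrightarrow> (\<forall>\<gamma>\<in>set (pcs k). \<epsilon> powr ep P \<le> str \<gamma>))) \<and>
        (\<forall>F\<in>set Fs. pos F = x \<and> xc F = x \<and> tc F = 0 \<and> trev F = None \<and>
           spd F = regspd F \<and> regular_speed S P C \<epsilon> F (regspd F)))"

definition initial_cell :: "'n::finite hsys \<Rightarrow> mft_params \<Rightarrow> real \<Rightarrow> real \<Rightarrow> real \<Rightarrow> real \<Rightarrow>
    real^'n \<Rightarrow> real^'n \<Rightarrow> 'n front list \<Rightarrow> bool" where
  "initial_cell S P C \<epsilon> x x' uL uR Fs \<longleftrightarrow>
     (\<exists>w z v pcs. (\<forall>k\<in>families S. if k \<in> gnl S then 0 < w k else w k = 0) \<and>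
        (\<Sum>k\<in>families S. w k) < x' - x \<and>
        gRP S uL uR w z v \<and>
        (\<forall>k\<in>families S. unsplit k (v (k - 1)) (z k) (v k) (0 < w k) (pcs k)) \<and>
        singles (in_order S pcs) Fs \<and>
        (\<forall>F\<in>set Fs. trev F = None \<and> spd F = regspd F \<and> regular_speed S P C \<epsilon> F (regspd F) \<and>
           x \<le> left_edge S 0 F \<and> left_edge S 0 F \<le> pos F \<and> pos F \<le> right_edge S 0 F \<and>
           right_edge S 0 F \<le> x' \<and> vwidth S 0 F \<le> w (fam (carrier F)) \<and>
           (is_simple S (carrier F) \<longrightarrow> 0 < vwidth S 0 F)) \<and>
        (\<forall>j. Suc j < length Fs \<longrightarrow> right_edge S 0 (Fs ! j) \<le> left_edge S 0 (Fs ! Suc j)))"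

definition heaviside :: "real \<Rightarrow> real" where
  "heaviside y = (if y < 0 then 0 else if y = 0 then 1/2 else 1)"

definition front_function :: "real^'n::finite \<Rightarrow> 'n front list \<Rightarrow> real \<Rightarrow> real^'n" where
  "front_function u0 L x =
     u0 + (\<Sum>F\<leftarrow>L. \<Sum>\<gamma>\<leftarrow>comps F. heaviside (x - pos F) *\<^sub>R (rst \<gamma> - lst \<gamma>))"

text \<open>Division points that are not big jumps are continuity points of the data. The BV error is the
  variation of the data lost by sampling one-sided limits at the division points; \<open>rlim uo\<close> makes
  it independent of the values of \<open>uo\<close> at its discontinuities.\<close>

definition initialized :: "'n::finite hsys \<Rightarrow> mft_params \<Rightarrow> real \<Rightarrow> real \<Rightarrow> (real \<Rightarrow> real^'n) \<Rightarrow> real^'n \<Rightarrow>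
    'n front list \<Rightarrow> bool" where
  "initialized S P C \<epsilon> uo u0 L \<longleftrightarrow>
     finite (big_jumps P \<epsilon> uo) \<and>
     (\<exists>xs rp cell. xs \<noteq> [] \<and> sorted_wrt (<) xs \<and> big_jumps P \<epsilon> uo \<subseteq> set xs \<and>
        u0 = llim uo (hd xs) \<and>
        (\<forall>j<length xs. if xs ! j \<in> big_jumps P \<epsilon> uo
           then initial_riemann S P C \<epsilon> (xs ! j) (llim uo (xs ! j)) (rlim uo (xs ! j)) (rp j)
           else llim uo (xs ! j) = rlim uo (xs ! j) \<and> rp j = []) \<and>
        (\<forall>j<length xs. if Suc j < length xs
           then initial_cell S P C \<epsilon> (xs ! j) (xs ! Suc j) (rlim uo (xs ! j)) (llim uo (xs ! Suc j)) (cell j)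
           else cell j = []) \<and>
        L = concat (map (\<lambda>j. rp j @ cell j) [0..<length xs]) \<and>
        variation_on UNIV (rlim uo) <
          ennreal ((\<Sum>j<length xs. dist (llim uo (xs ! j)) (rlim uo (xs ! j))) +
            (\<Sum>j<length xs - 1. dist (rlim uo (xs ! j)) (llim uo (xs ! Suc j))) + \<epsilon> powr ei P)) \<and>
     integrable lborel (\<lambda>x. norm (front_function u0 L x - uo x)) \<and>
     (LINT x|lborel. norm (front_function u0 L x - uo x)) < \<epsilon> powr ei P"

section \<open>Runs of the scheme\<close>

text \<open>\<open>frs n\<close> are the fronts just after the \<open>n\<close>-th event, with positions at its time \<open>tim n\<close>;
  \<open>n = 0\<close> is the initialization.\<close>

record ('n::finite) run =
  left0 :: "real^'n"
  nev :: nat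
  tim :: "nat \<Rightarrow> real"
  frs :: "nat \<Rightarrow> 'n front list"

definition fronts_at :: "'n::finite run \<Rightarrow> real \<Rightarrow> 'n front list" where
  "fronts_at R t = (let n = Max {n. n \<le> nev R \<and> tim R n \<le> t} in map (advance (t - tim R n)) (frs R n))"

definition approx :: "'n::finite run \<Rightarrow> real \<Rightarrow> real \<Rightarrow> real^'n" where
  "approx R t = front_function (left0 R) (fronts_at R t)"

definition wave_variation :: "'n::finite run \<Rightarrow> real \<Rightarrow> real" where
  "wave_variation R t = (\<Sum>F\<leftarrow>fronts_at R t. \<Sum>\<gamma>\<leftarrow>comps F. \<bar>str \<gamma>\<bar>)"

definition heavy_weight :: "mft_params \<Rightarrow> real \<Rightarrow> 'n::finite run \<Rightarrow> real \<Rightarrow> real" where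
  "heavy_weight P \<epsilon> R t =
     (\<Sum>F\<leftarrow>filter (\<lambda>F. heavy P \<epsilon> F \<noteq> {}) (fronts_at R t).
        sqrt (\<Sum>h\<in>heavy P \<epsilon> F. (str (comps F ! h))\<^sup>2))"

text \<open>The constants \<open>K\<close> (states), \<open>[xa,xb]\<close> (positions) and \<open>C\<close> are meant to be independent of \<open>\<epsilon>\<close>.\<close>

definition uniform_wave :: "'n::finite hsys \<Rightarrow> mft_params \<Rightarrow> (real^'n) set \<Rightarrow> real \<Rightarrow> real \<Rightarrow> 'n wave \<Rightarrow> bool"
  where
  "uniform_wave S P K C \<epsilon> \<gamma> \<longleftrightarrow> valid_wave S \<gamma> \<and> lst \<gamma> \<in> K \<and> rst \<gamma> \<in> K \<and>
     invertible (pre \<gamma>) \<and> onorm ((*v) (pre \<gamma>)) \<le> C \<and> onorm ((*v) (matrix_inv (pre \<gamma>))) \<le> C \<and>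
     (is_simple S \<gamma> \<longrightarrow> - (\<epsilon> powr ec P) \<le> str \<gamma> \<and> str \<gamma> \<le> \<epsilon> powr er P)"

definition mft_run :: "'n::finite hsys \<Rightarrow> mft_params \<Rightarrow> (real \<Rightarrow> real^'n) \<Rightarrow> real \<Rightarrow> (real^'n) set \<Rightarrow>
    real \<Rightarrow> real \<Rightarrow> real \<Rightarrow> real \<Rightarrow> 'n run \<Rightarrow> bool" where
  "mft_run S P uo T K xa xb C \<epsilon> R \<longleftrightarrow>
     valid_params P \<epsilon> \<and>
     initialized S P C \<epsilon> uo (left0 R) (frs R 0) \<and>
     tim R 0 = 0 \<and> tim R (nev R) \<le> T \<and>
     (\<forall>n<nev R. 0 < tim R (Suc n) \<and> tim R n \<le> tim R (Suc n) \<and>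
        quiet S (tim R n) (tim R (Suc n)) (frs R n) \<and>
        mft_event S P C \<epsilon> (tim R (Suc n))
          (map (advance (tim R (Suc n) - tim R n)) (frs R n)) (frs R (Suc n))) \<and>
     quiet S (tim R (nev R)) T (frs R (nev R)) \<and>
     left0 R \<in> K \<and>
     (\<forall>n\<le>nev R. \<forall>F\<in>set (frs R n). \<forall>\<gamma>\<in>set (comps F). uniform_wave S P K C \<epsilon> \<gamma>) \<and>
     (\<forall>t\<in>{0..T}. \<forall>F\<in>set (fronts_at R t). pos F \<in> {xa..xb})"

section \<open>Sobolev spaces and weak* solutions\<close>

text \<open>\<open>H\<^sup>s(\<real>)\<close>, for every real \<open>s\<close>, is represented by Fourier transforms: \<open>Hs s\<close> is the
  weighted \<open>L\<^sup>2\<close> space of these transforms and \<open>hpair\<close> is the duality pairing of \<open>H\<^sup>s\<close> with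
  \<open>H\<^sup>-\<^sup>s\<close>, equal to \<open>\<integral> g \<bullet> h dx\<close> for real functions, by Parseval. The inner product on
  \<open>complex^'n\<close> is the real part of the Hermitian one; transforms in \<open>Hs s\<close> of non-real distributions
  do no harm, as only their real part enters a pairing with a real function.\<close>

definition fourier :: "(real \<Rightarrow> real^'n::finite) \<Rightarrow> real \<Rightarrow> complex^'n" where
  "fourier g \<xi> = (\<chi> i. LINT x|lborel. cis (- (\<xi> * x)) * complex_of_real (g x $ i))"

definition Hs :: "real \<Rightarrow> (real \<Rightarrow> complex^'n::finite) set" where
  "Hs s = {\<Psi>. \<Psi> \<in> borel_measurable lborel \<and>
     integrable lborel (\<lambda>\<xi>. (1 + \<xi>\<^sup>2) powr s * (norm (\<Psi> \<xi>))\<^sup>2)}"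

definition Hs_norm :: "real \<Rightarrow> (real \<Rightarrow> complex^'n::finite) \<Rightarrow> real" where
  "Hs_norm s \<Psi> = sqrt ((LINT \<xi>|lborel. (1 + \<xi>\<^sup>2) powr s * (norm (\<Psi> \<xi>))\<^sup>2) / (2 * pi))"

definition hpair :: "(real \<Rightarrow> complex^'n::finite) \<Rightarrow> (real \<Rightarrow> complex^'n) \<Rightarrow> real" where
  "hpair \<Phi> \<Psi> = (LINT \<xi>|lborel. \<Phi> \<xi> \<bullet> \<Psi> \<xi>) / (2 * pi)"

text \<open>Transform of the distributional derivative.\<close>

definition Dx :: "(real \<Rightarrow> complex^'n::finite) \<Rightarrow> real \<Rightarrow> complex^'n" where
  "Dx \<Phi> \<xi> = (\<i> * complex_of_real \<xi>) *s \<Phi> \<xi>"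

text \<open>States do not vanish at infinity, so everything is localized to bounded intervals \<open>(l,r)\<close>: test
  functions are those \<open>\<phi> \<in> H\<^sup>b(\<real>)\<close> that vanish outside \<open>(l,r)\<close>, and functions with values in
  \<open>H\<^sup>1\<^sup>-\<^sup>b\<close> are cut off. As \<open>1 - b < 1/2\<close>, multiplication by the indicator of an interval acts
  boundedly on \<open>H\<^sup>1\<^sup>-\<^sup>b\<close> if \<open>b \<le> 1\<close>, and for \<open>b > 1\<close> functions in \<open>L\<^sup>2(l,r)\<close> are elements.\<close>

definition cut :: "real \<Rightarrow> real \<Rightarrow> (real \<Rightarrow> real^'n::finite) \<Rightarrow> real \<Rightarrow> real^'n" where
  "cut l r g x = (if l < x \<and> x < r then g x else 0)"

definition cut_hat :: "real \<Rightarrow> real \<Rightarrow> (real \<Rightarrow> real^'n::finite) \<Rightarrow> real \<Rightarrow> complex^'n" where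
  "cut_hat l r g = fourier (cut l r g)"

definition Htest :: "real \<Rightarrow> real \<Rightarrow> real \<Rightarrow> (real \<Rightarrow> real^'n::finite) set" where
  "Htest b l r = {\<phi>. integrable lborel \<phi> \<and> fourier \<phi> \<in> Hs b \<and> (\<forall>x. x \<notin> {l<..<r} \<longrightarrow> \<phi> x = 0)}"

text \<open>\<open>L\<^sup>\<infinity>\<^sub>*(0,T;H\<^sup>s)\<close> for time dependent functions, and \<open>L\<^sup>\<infinity>\<^sub>*(0,T;H\<^sup>-\<^sup>b)\<close> for time dependent functionals.\<close>

definition Linf_H :: "real \<Rightarrow> real \<Rightarrow> real \<Rightarrow> real \<Rightarrow> (real \<Rightarrow> real \<Rightarrow> real^'n::finite) \<Rightarrow> bool" where
  "Linf_H T s l r g \<longleftrightarrow>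
     (\<exists>M. \<forall>t\<in>{0<..<T}. integrable lborel (cut l r (g t)) \<and> cut_hat l r (g t) \<in> Hs s \<and>
        Hs_norm s (cut_hat l r (g t)) \<le> M) \<and>
     (\<forall>\<Psi>\<in>Hs (- s). set_borel_measurable lborel {0<..<T} (\<lambda>t. hpair (cut_hat l r (g t)) \<Psi>))"

definition Linf_dual :: "real \<Rightarrow> real \<Rightarrow> real \<Rightarrow> real \<Rightarrow> (real \<Rightarrow> (real \<Rightarrow> real^'n::finite) \<Rightarrow> real) \<Rightarrow> bool"
  where
  "Linf_dual T b l r D \<longleftrightarrow>
     (\<forall>t\<in>{0<..<T}. \<forall>\<phi>\<in>Htest b l r. \<forall>\<psi>\<in>Htest b l r. \<forall>c d.
        D t (\<lambda>x. c *\<^sub>R \<phi> x + d *\<^sub>R \<psi> x) = c * D t \<phi> + d * D t \<psi>) \<and>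
     (\<exists>M. \<forall>t\<in>{0<..<T}. \<forall>\<phi>\<in>Htest b l r. \<bar>D t \<phi>\<bar> \<le> M * Hs_norm b (fourier \<phi>)) \<and>
     (\<forall>\<phi>\<in>Htest b l r. set_borel_measurable lborel {0<..<T} (\<lambda>t. D t \<phi>))"

definition smooth_compact :: "real \<Rightarrow> (real \<Rightarrow> real) \<Rightarrow> bool" where
  "smooth_compact T \<eta> \<longleftrightarrow> (\<forall>n t. (deriv ^^ n) \<eta> differentiable (at t)) \<and>
     (\<exists>c d. 0 < c \<and> d < T \<and> (\<forall>t. t \<notin> {c..d} \<longrightarrow> \<eta> t = 0))"

definition gelfand_derivative :: "real \<Rightarrow> real \<Rightarrow> real \<Rightarrow> real \<Rightarrow> (real \<Rightarrow> real \<Rightarrow> real^'n::finite) \<Rightarrow>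
    (real \<Rightarrow> (real \<Rightarrow> real^'n) \<Rightarrow> real) \<Rightarrow> bool" where
  "gelfand_derivative T b l r g D \<longleftrightarrow> (\<forall>\<eta>. smooth_compact T \<eta> \<longrightarrow> (\<forall>\<phi>\<in>Htest b l r.
     (LINT t:{0<..<T}|lborel. deriv \<eta> t * hpair (cut_hat l r (g t)) (fourier \<phi>)) =
     - (LINT t:{0<..<T}|lborel. \<eta> t * D t \<phi>)))"

text \<open>\<open>W\<^sup>1\<^sup>,\<^sup>\<infinity>\<^sub>*(0,T;H\<^sup>1\<^sup>-\<^sup>b,H\<^sup>-\<^sup>b)\<close>, with the derivative \<open>D\<close>.\<close>

definition W1inf :: "real \<Rightarrow> real \<Rightarrow> real \<Rightarrow> real \<Rightarrow> (real \<Rightarrow> real \<Rightarrow> real^'n::finite) \<Rightarrow>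
    (real \<Rightarrow> (real \<Rightarrow> real^'n) \<Rightarrow> real) \<Rightarrow> bool" where
  "W1inf T b l r g D \<longleftrightarrow> Linf_H T (1 - b) l r g \<and> Linf_dual T b l r D \<and> gelfand_derivative T b l r g D"

definition weakstar_solution :: "'n::finite hsys \<Rightarrow> real \<Rightarrow> real \<Rightarrow> real \<Rightarrow> real \<Rightarrow> (real \<Rightarrow> real^'n) \<Rightarrow>
    (real \<Rightarrow> real \<Rightarrow> real^'n) \<Rightarrow> bool" where
  "weakstar_solution S T b l r uo u \<longleftrightarrow>
     (\<forall>t\<in>{0..<T}. \<forall>x. u t x \<in> states S) \<and>
     Linf_H T (1 - b) l r (\<lambda>t x. ffun S (u t x)) \<and>
     (\<exists>D. W1inf T b l r (\<lambda>t x. qfun S (u t x)) D) \<and>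
     (\<forall>t\<in>{0..<T}. \<forall>\<phi>\<in>Htest b l r.
        hpair (cut_hat l r (\<lambda>x. qfun S (u t x))) (fourier \<phi>)
        - hpair (cut_hat l r (\<lambda>x. qfun S (uo x))) (fourier \<phi>)
        - (LINT \<tau>:{0<..<t}|lborel.
             hpair (cut_hat l r (\<lambda>x. ffun S (u \<tau> x))) (Dx (fourier \<phi>))) = 0)"

text \<open>Weak* convergence in \<open>L\<^sup>\<infinity>\<^sub>*(0,T;H\<^sup>s) = (L\<^sup>1(0,T;H\<^sup>-\<^sup>s))\<^sup>*\<close> and in
  \<open>L\<^sup>\<infinity>\<^sub>*(0,T;H\<^sup>-\<^sup>b) = (L\<^sup>1(0,T;H\<^sup>b))\<^sup>*\<close>.\<close>

definition weakstar_lim_H :: "real \<Rightarrow> real \<Rightarrow> real \<Rightarrow> real \<Rightarrow> (nat \<Rightarrow> real \<Rightarrow> real \<Rightarrow> real^'n::finite) \<Rightarrow>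
    (real \<Rightarrow> real \<Rightarrow> real^'n) \<Rightarrow> bool" where
  "weakstar_lim_H T s l r G g \<longleftrightarrow> (\<forall>n. Linf_H T s l r (G n)) \<and> Linf_H T s l r g \<and>
     (\<forall>\<Psi>. case_prod \<Psi> \<in> borel_measurable (lborel \<Otimes>\<^sub>M lborel) \<and> (\<forall>t\<in>{0<..<T}. \<Psi> t \<in> Hs (- s)) \<and>
        set_integrable lborel {0<..<T} (\<lambda>t. Hs_norm (- s) (\<Psi> t)) \<longrightarrow>
        (\<lambda>n. LINT t:{0<..<T}|lborel. hpair (cut_hat l r (G n t)) (\<Psi> t)) \<longlonglongrightarrow>
        (LINT t:{0<..<T}|lborel. hpair (cut_hat l r (g t)) (\<Psi> t)))"

definition weakstar_lim_dual :: "real \<Rightarrow> real \<Rightarrow> real \<Rightarrow> real \<Rightarrow>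
    (nat \<Rightarrow> real \<Rightarrow> (real \<Rightarrow> real^'n::finite) \<Rightarrow> real) \<Rightarrow> (real \<Rightarrow> (real \<Rightarrow> real^'n) \<Rightarrow> real) \<Rightarrow> bool" where
  "weakstar_lim_dual T b l r E D \<longleftrightarrow>
     (\<forall>\<phi>. case_prod \<phi> \<in> borel_measurable (lborel \<Otimes>\<^sub>M lborel) \<and> (\<forall>t\<in>{0<..<T}. \<phi> t \<in> Htest b l r) \<and>
        set_integrable lborel {0<..<T} (\<lambda>t. Hs_norm b (fourier (\<phi> t))) \<longrightarrow>
        (\<lambda>n. LINT t:{0<..<T}|lborel. E n t (\<phi> t)) \<longlonglongrightarrow> (LINT t:{0<..<T}|lborel. D t (\<phi> t)))"

text \<open>Convergence of \<open>U n\<close> to \<open>u\<close>: of \<open>U n\<close> and \<open>f(U n)\<close> in \<open>L\<^sup>\<infinity>\<^sub>*(0,T;H\<^sup>1\<^sup>-\<^sup>b)\<close> and of \<open>q(U n)\<close> in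
  \<open>W\<^sup>1\<^sup>,\<^sup>\<infinity>\<^sub>*(0,T;H\<^sup>1\<^sup>-\<^sup>b,H\<^sup>-\<^sup>b)\<close>.\<close>

definition weakstar_converges :: "'n::finite hsys \<Rightarrow> real \<Rightarrow> real \<Rightarrow> real \<Rightarrow> real \<Rightarrow>
    (nat \<Rightarrow> real \<Rightarrow> real \<Rightarrow> real^'n) \<Rightarrow> (real \<Rightarrow> real \<Rightarrow> real^'n) \<Rightarrow> bool" where
  "weakstar_converges S T b l r U u \<longleftrightarrow>
     weakstar_lim_H T (1 - b) l r U u \<and>
     weakstar_lim_H T (1 - b) l r (\<lambda>n t x. ffun S (U n t x)) (\<lambda>t x. ffun S (u t x)) \<and>
     weakstar_lim_H T (1 - b) l r (\<lambda>n t x. qfun S (U n t x)) (\<lambda>t x. qfun S (u t x)) \<and>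
     (\<exists>E D. (\<forall>n. W1inf T b l r (\<lambda>t x. qfun S (U n t x)) (E n)) \<and>
        W1inf T b l r (\<lambda>t x. qfun S (u t x)) D \<and> weakstar_lim_dual T b l r E D)"

end

theory Submission
  imports Defs "HOL-Probability.Probability" "HOL-Complex_Analysis.Great_Picard"
begin

text \<open>
Between events the approximation \<open>U\<^sup>\<epsilon>\<close> is a step function whose jumps travel with constant speeds, so
\<open>q(U\<^sup>\<epsilon>)\<^sub>t + f(U\<^sup>\<epsilon>)\<^sub>x\<close> is a measure carried by the fronts, with mass \<open>\<bar>[f] - s[q]\<bar>\<close> on a front of speed \<open>s\<close>.
At an event the outer states of the fronts involved are kept, hence so is \<open>U\<^sup>\<epsilon>\<close>. The theorem therefore
needs two things: the total mass of the residual tends to zero uniformly in time, and the approximations are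
compact strongly enough to pass to the limit in \<open>f\<close> and \<open>q\<close>.

Residual (\<open>front_estimates\<close>, \<open>jumps_residual\<close>). Shocks and contacts with their exact speeds contribute nothing.
A simple wave of strength \<open>\<zeta>\<close> contributes \<open>O(\<zeta>\<^sup>2)\<close>: the characteristic speed leaves a residual of this size, by
Taylor's formula and the eigenvalue equation, and the least squares speed does at least as well up to the
condition number of the preconditioner. As the strengths of simple waves are bounded by powers of \<open>\<epsilon>\<close>, the
sum over all of them is \<open>o(1)\<close> times the variation. Light passengers contribute at most a multiple of
\<open>Q(\<epsilon>)\<close> times the strength of the carrier, heavy ones a multiple of their weight.

What remains are the temporary speeds of the pieces of a multi-rarefaction. They differ from the regular
speeds by \<open>O(m \<epsilon> powr er)\<close>, which is of the order of the strength \<open>z\<close> of the whole rarefaction, so \<open>z\<close> itself has to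
be small. Here one uses that a wave of positive width emerges only if one of the colliding carriers is a
simple wave, hence weak. So the outer states are close to equal states, or to the two states of a single shock
or contact whose family has width zero; in both comparison problems the wave in question has strength zero.
The strengths of the generalized Riemann problem depend uniformly continuously on its states
(\<open>gRP_strength_uniform\<close>): this follows from unique solvability alone, because the map from a left state and
strengths to both outer states is continuous and injective on an open set, and invariance of domain makes its
inverse continuous. Hence \<open>z\<close> is small (\<open>meeting_strengths\<close>), and all fronts of a run stay regular up to a small
error in speed (\<open>outgoing_good\<close>, \<open>event_good\<close>, \<open>good_frs\<close>).

Compactness (\<open>exists_limit\<close>). Variation and speeds being bounded, \<open>t \<mapsto> U\<^sup>\<epsilon>(t)\<close> is Lipschitz in \<open>L\<^sup>1\<close>, and the primitives
of \<open>U\<^sup>\<epsilon>\<close> in space are Lipschitz in time and space. Ascoli's theorem gives a subsequence along which the primitives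
converge uniformly. A function of bounded variation is close in \<open>L\<^sup>1\<close> to its averages over short intervals, which
are difference quotients of the primitive, so the \<open>U\<^sup>\<epsilon>\<close> converge in \<open>L\<^sup>1\<close> uniformly in time, and after another
selection almost everywhere for every \<open>t\<close>.

Sobolev spaces. Transforms of localized step functions are bounded by a multiple of \<open>1/(1 + \<bar>\<xi>\<bar>)\<close>, uniformly for
bounded variation (\<open>decays_cut_step\<close>), so they are bounded in \<open>H\<close> of order \<open>1 - b\<close> for every \<open>b > 1/2\<close>, and pairings
with a fixed element of the dual space converge by dominated convergence. Test functions in \<open>H\<close> of order \<open>b\<close> have
integrable transforms, hence continuous representatives bounded by their norm (\<open>Hs_integrable\<close>). This turns the
pairing of \<open>f(U\<^sup>\<epsilon>)\<close> with a derivative into a sum over jumps (\<open>hpair_cut_step_Dx\<close>), to be compared with the time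
derivative of \<open>q(U\<^sup>\<epsilon>)\<close>, also a sum over jumps (\<open>conservation\<close>). The difference is controlled by the residual
(\<open>rate_flux\<close>), and in the limit it vanishes (\<open>limit_conservation\<close>).
\<close>

section \<open>Fourier transforms of vector-valued functions\<close>

text \<open>Multiplication of a vector by a complex number and its adjoint for the real inner product, so that real
functions and complex transforms can be treated as vectors rather than by components.\<close>

definition cscale :: "complex => real^'n::finite => complex^'n" where
  "cscale c v = (\<chi> i. c * complex_of_real (v $ i))"

definition cscale_adj :: "complex => complex^'n::finite => real^'n" where
  "cscale_adj c w = (\<chi> i. Re (cnj c * w $ i))"

lemma cscale_inner: "cscale c v \<bullet> w = v \<bullet> cscale_adj c w"
  by (simp add: cscale_def cscale_adj_def inner_vec_def inner_complex_def algebra_simps)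

lemma norm_cscale: "norm (cscale c v) = norm c * norm v"
proof -
  have "norm (cscale c v) = L2_set (\<lambda>i. norm c * norm (v $ i)) UNIV"
    by (simp add: norm_vec_def cscale_def norm_mult)
  then show ?thesis
    by (simp add: norm_vec_def L2_set_right_distrib)
qed

lemma norm_cscale_adj: "norm (cscale_adj c w) <= norm c * norm w"
proof -
  have "norm (cscale_adj c w) <= L2_set (\<lambda>i. norm c * norm (w $ i)) UNIV"
    unfolding norm_vec_def[of "cscale_adj c w"]
  proof (rule L2_set_mono)
    fix i
    have "\<bar>Re (cnj c * w $ i)\<bar> <= cmod (cnj c * w $ i)" by (rule abs_Re_le_cmod)
    then show "norm (cscale_adj c w $ i) <= norm c * norm (w $ i)"
      by (simp add: cscale_adj_def norm_mult)
  qed auto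
  then show ?thesis
    by (simp add: norm_vec_def[of w] L2_set_right_distrib)
qed

lemma bounded_bilinear_cscale: "bounded_bilinear (cscale :: complex => real^'n::finite => complex^'n)"
proof
  show "\<exists>K. \<forall>a (b::real^'n). norm (cscale a b) <= norm a * norm b * K"
    by (intro exI[of _ 1]) (simp add: norm_cscale)
qed (auto simp: cscale_def vec_eq_iff algebra_simps scaleR_conv_of_real[where 'a=complex])

lemma bounded_bilinear_cscale_adj:
  "bounded_bilinear (cscale_adj :: complex => complex^'n::finite => real^'n)"
proof
  show "\<exists>K. \<forall>a (b::complex^'n). norm (cscale_adj a b) <= norm a * norm b * K"
    by (intro exI[of _ 1]) (simp add: norm_cscale_adj)
qed (auto simp: cscale_adj_def vec_eq_iff algebra_simps)

interpretation cscale: bounded_bilinear "cscale :: complex => real^'n::finite => complex^'n"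
  by (rule bounded_bilinear_cscale)
interpretation cscale_adj: bounded_bilinear "cscale_adj :: complex => complex^'n::finite => real^'n"
  by (rule bounded_bilinear_cscale_adj)

lemma measurable_cscale [measurable]:
  assumes "f \<in> borel_measurable M" "g \<in> borel_measurable M"
  shows "(\<lambda>x. cscale (f x) (g x :: real^'n::finite)) \<in> borel_measurable M"
  by (rule borel_measurable_continuous_Pair[OF assms])
     (intro cscale.continuous_on continuous_intros)

lemma measurable_cscale_adj [measurable]:
  assumes "f \<in> borel_measurable M" "g \<in> borel_measurable M"
  shows "(\<lambda>x. cscale_adj (f x) (g x :: complex^'n::finite)) \<in> borel_measurable M"
  by (rule borel_measurable_continuous_Pair[OF assms])
     (intro cscale_adj.continuous_on continuous_intros)

lemma measurable_cis [measurable]: "f \<in> borel_measurable M ==> (\<lambda>x. cis (f x)) \<in> borel_measurable M"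
  by (rule borel_measurable_continuous_on[of cis]) (intro continuous_intros)

lemma measurable_vec_nth [measurable]:
  fixes f :: "'a => ('b::euclidean_space)^'n::finite"
  shows "f \<in> borel_measurable M ==> (\<lambda>x. f x $ i) \<in> borel_measurable M"
  by (rule borel_measurable_continuous_on[of "\<lambda>v. v $ i"]) (intro continuous_intros)

lemma bounded_linear_vec_nth_complex: "bounded_linear (\<lambda>v :: 'a::real_normed_vector^'n. v $ i)"
  by (rule bounded_linear_vec_nth)

lemma fourier_eq:
  fixes g :: "real => real^'n::finite"
  assumes "integrable lborel g"
  shows "integrable lborel (\<lambda>x. cscale (cis (- (\<xi> * x))) (g x))"
    and "fourier g \<xi> = (LINT x|lborel. cscale (cis (- (\<xi> * x))) (g x))"
proof -
  show int: "integrable lborel (\<lambda>x. cscale (cis (- (\<xi> * x))) (g x))"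
    using assms by (rule Bochner_Integration.integrable_bound) (use assms in \<open>auto simp: norm_cscale\<close>)
  show "fourier g \<xi> = (LINT x|lborel. cscale (cis (- (\<xi> * x))) (g x))"
    unfolding fourier_def vec_eq_iff
    using integral_bounded_linear[OF bounded_linear_vec_nth_complex int]
    by (simp add: cscale_def)
qed

lemma norm_fourier_le:
  fixes g :: "real => real^'n::finite"
  assumes "integrable lborel g"
  shows "norm (fourier g \<xi>) <= (LINT x|lborel. norm (g x))"
proof -
  have "norm (fourier g \<xi>) <= (LINT x|lborel. norm (cscale (cis (- (\<xi> * x))) (g x)))"
    unfolding fourier_eq(2)[OF assms] by (rule integral_norm_bound)
  then show ?thesis by (simp add: norm_cscale)
qed

lemma fourier_diff:
  fixes g h :: "real => real^'n::finite"
  assumes "integrable lborel g" "integrable lborel h"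
  shows "fourier (\<lambda>x. g x - h x) \<xi> = fourier g \<xi> - fourier h \<xi>"
  using assms by (simp add: fourier_eq cscale.diff_right)

lemma fourier_lincomb:
  fixes g h :: "real => real^'n::finite"
  assumes "integrable lborel g" "integrable lborel h"
  shows "fourier (\<lambda>x. c *\<^sub>R g x + d *\<^sub>R h x) \<xi> = c *\<^sub>R fourier g \<xi> + d *\<^sub>R fourier h \<xi>"
proof -
  have *: "integrable lborel (\<lambda>x. c *\<^sub>R g x)" "integrable lborel (\<lambda>x. d *\<^sub>R h x)" 
       "integrable lborel (\<lambda>x. c *\<^sub>R g x + d *\<^sub>R h x)"
    using assms by auto
  show ?thesis
    using assms * by (simp add: fourier_eq cscale.add_right cscale.scaleR_right)
qed

lemma fourier_cong_AE:
  fixes g h :: "real => real^'n::finite"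
  assumes [measurable]: "g \<in> borel_measurable lborel" "h \<in> borel_measurable lborel"
    and "AE x in lborel. g x = h x"
  shows "fourier g = fourier h"
  unfolding fourier_def
  by (intro ext vec_eq_iff[THEN iffD2] allI) (simp, rule integral_cong_AE, use assms(3) in \<open>auto\<close>)

lemma measurable_vec_lambda [measurable (raw)]:
  fixes f :: "'a => 'n::finite => 'b::euclidean_space"
  assumes "\<And>i. (\<lambda>x. f x i) \<in> borel_measurable M"
  shows "(\<lambda>x. \<chi> i. f x i) \<in> borel_measurable M"
proof (subst borel_measurable_euclidean_space, intro ballI)
  fix e :: "'b^'n" assume "e \<in> Basis"
  then obtain i c where e: "e = axis i c" by (auto simp: Basis_vec_def)
  show "(\<lambda>x. (\<chi> i. f x i) \<bullet> e) \<in> borel_measurable M"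
    using assms[of i] by (simp add: e inner_axis)
qed

lemma measurable_fourier [measurable (raw)]:
  fixes g :: "'a => real => real^'n::finite"
  assumes [measurable]: "case_prod g \<in> borel_measurable (M \<Otimes>\<^sub>M lborel)" "X \<in> borel_measurable M"
  shows "(\<lambda>t. fourier (g t) (X t)) \<in> borel_measurable M"
  unfolding fourier_def by measurable

text \<open>The real part of the inverse transform: the only part seen by pairings with real functions.\<close>

definition inv_fourier :: "(real => complex^'n::finite) => real => real^'n" where
  "inv_fourier \<Psi> x = (LINT \<xi>|lborel. cscale_adj (cis (- (\<xi> * x))) (\<Psi> \<xi>)) /\<^sub>R (2 * pi)"

lemma integrable_cscale_adj:
  fixes \<Psi> :: "real => complex^'n::finite"
  assumes "integrable lborel \<Psi>"
  shows "integrable lborel (\<lambda>\<xi>. cscale_adj (cis (- (\<xi> * x))) (\<Psi> \<xi>))"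
  using assms by (rule Bochner_Integration.integrable_bound)
    (use assms in \<open>auto intro!: AE_I2 order.trans[OF norm_cscale_adj]\<close>)

lemma norm_inv_fourier_le:
  fixes \<Psi> :: "real => complex^'n::finite"
  assumes "integrable lborel \<Psi>"
  shows "norm (inv_fourier \<Psi> x) <= (LINT \<xi>|lborel. norm (\<Psi> \<xi>)) / (2 * pi)"
proof -
  have "norm (LINT \<xi>|lborel. cscale_adj (cis (- (\<xi> * x))) (\<Psi> \<xi>)) <=
      (LINT \<xi>|lborel. norm (cscale_adj (cis (- (\<xi> * x))) (\<Psi> \<xi>)))"
    by (rule integral_norm_bound)
  also have "\<dots> <= (LINT \<xi>|lborel. norm (\<Psi> \<xi>))"
    by (rule integral_mono)
      (use assms integrable_cscale_adj[OF assms] norm_cscale_adj[of "cis _"] in auto)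
  finally show ?thesis
    by (simp add: inv_fourier_def divide_simps)
qed

lemma continuous_inv_fourier:
  fixes \<Psi> :: "real => complex^'n::finite"
  assumes \<Psi>: "integrable lborel \<Psi>"
  shows "continuous_on UNIV (inv_fourier \<Psi>)"
proof -
  have "isCont (\<lambda>x. LINT \<xi>|lborel. cscale_adj (cis (- (\<xi> * x))) (\<Psi> \<xi>)) x" for x
    unfolding continuous_at_sequentially comp_def
  proof (intro allI impI)
    fix X assume X: "X \<longlonglongrightarrow> x"
    show "(\<lambda>n. LINT \<xi>|lborel. cscale_adj (cis (- (\<xi> * X n))) (\<Psi> \<xi>))
        \<longlonglongrightarrow> (LINT \<xi>|lborel. cscale_adj (cis (- (\<xi> * x))) (\<Psi> \<xi>))"
    proof (rule integral_dominated_convergence[where w = "\<lambda>\<xi>. norm (\<Psi> \<xi>)"])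
      have "continuous_on UNIV (\<lambda>y. cscale_adj (cis (- (\<xi> * y))) (\<Psi> \<xi>))" for \<xi>
        by (intro cscale_adj.continuous_on continuous_intros)
      then show "AE \<xi> in lborel. (\<lambda>n. cscale_adj (cis (- (\<xi> * X n))) (\<Psi> \<xi>)) \<longlonglongrightarrow>
          cscale_adj (cis (- (\<xi> * x))) (\<Psi> \<xi>)"
        using X by (auto simp: continuous_on_eq_continuous_at intro!: AE_I2 isCont_tendsto_compose[of x])
      show "AE \<xi> in lborel. norm (cscale_adj (cis (- (\<xi> * X n))) (\<Psi> \<xi>)) <= norm (\<Psi> \<xi>)" for n
        using norm_cscale_adj[of "cis _"] by (auto intro!: AE_I2)
    qed (use \<Psi> in auto)
  qed
  then have "continuous_on UNIV (\<lambda>x. LINT \<xi>|lborel. cscale_adj (cis (- (\<xi> * x))) (\<Psi> \<xi>))"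
    by (simp add: continuous_on_eq_continuous_at)
  then show ?thesis
    unfolding inv_fourier_def[abs_def] by (intro continuous_intros)
qed

lemma measurable_inv_fourier [measurable]:
  fixes \<Psi> :: "real => real => complex^'n::finite"
  assumes [measurable]: "case_prod \<Psi> \<in> borel_measurable (lborel \<Otimes>\<^sub>M lborel)" "X \<in> borel_measurable lborel"
  shows "(\<lambda>t. inv_fourier (\<Psi> t) (X t)) \<in> borel_measurable lborel"
  unfolding inv_fourier_def by measurable

text \<open>Parseval's identity in the form in which it is only Fubini's theorem: the transform of \<open>g\<close> is shifted onto the
  integrable function \<open>\<Psi>\<close>.\<close>

lemma hpair_fourier_eq_integral:
  fixes g :: "real => real^'n::finite" and \<Psi> :: "real => complex^'n"
  assumes g: "integrable lborel g" and \<Psi>: "integrable lborel \<Psi>"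
  shows "hpair (fourier g) \<Psi> = (LINT x|lborel. g x \<bullet> inv_fourier \<Psi> x)"
proof -
  have [measurable]: "g \<in> borel_measurable borel" "\<Psi> \<in> borel_measurable borel"
    using g \<Psi> by auto
  define H where "H = (\<lambda>\<xi> x. cscale (cis (- (\<xi> * x))) (g x) \<bullet> \<Psi> \<xi>)"
  have Hle: "\<bar>H \<xi> x\<bar> <= norm (\<Psi> \<xi>) * norm (g x)" for \<xi> x
    using Cauchy_Schwarz_ineq2[of "cscale (cis (- (\<xi> * x))) (g x)" "\<Psi> \<xi>"]
    by (simp add: H_def norm_cscale mult.commute)
  have prod: "integrable (lborel \<Otimes>\<^sub>M lborel) (\<lambda>(\<xi>, x). norm (\<Psi> \<xi>) * norm (g x))"
    by (rule lborel_pair.Fubini_integrable) (use g \<Psi> in auto)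
  have Hint: "integrable (lborel \<Otimes>\<^sub>M lborel) (case_prod H)"
    by (rule Bochner_Integration.integrable_bound[OF prod])
      (auto simp: H_def[abs_def] intro!: AE_I2 order.trans[OF Hle[unfolded H_def]])
  have "(LINT \<xi>|lborel. fourier g \<xi> \<bullet> \<Psi> \<xi>) = (LINT \<xi>|lborel. LINT x|lborel. H \<xi> x)"
    unfolding H_def fourier_eq(2)[OF g]
    by (intro Bochner_Integration.integral_cong refl)
       (rule integral_inner_left[symmetric], use fourier_eq(1)[OF g] in auto)
  also have "\<dots> = (LINT x|lborel. LINT \<xi>|lborel. H \<xi> x)"
    by (rule lborel_pair.Fubini_integral[symmetric]) (rule Hint)
  also have "\<dots> = (LINT x|lborel. (2 * pi) * (g x \<bullet> inv_fourier \<Psi> x))"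
  proof (intro Bochner_Integration.integral_cong refl)
    fix x
    have "(LINT \<xi>|lborel. H \<xi> x) = (LINT \<xi>|lborel. g x \<bullet> cscale_adj (cis (- (\<xi> * x))) (\<Psi> \<xi>))"
      by (simp add: H_def cscale_inner)
    also have "\<dots> = g x \<bullet> (LINT \<xi>|lborel. cscale_adj (cis (- (\<xi> * x))) (\<Psi> \<xi>))"
      by (rule integral_inner_right) (use integrable_cscale_adj[OF \<Psi>] in auto)
    finally show "(LINT \<xi>|lborel. H \<xi> x) = (2 * pi) * (g x \<bullet> inv_fourier \<Psi> x)"
      by (simp add: inv_fourier_def)
  qed
  finally show ?thesis
    by (simp add: hpair_def)
qed

lemma integral_gaussian_cos:
  fixes s a :: real
  assumes s: "0 < s"
  shows "integrable lborel (\<lambda>\<xi>. exp (- (s * \<xi>)\<^sup>2 / 2))"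
    and "(LINT \<xi>|lborel. exp (- (s * \<xi>)\<^sup>2 / 2) * cos (\<xi> * a)) = sqrt (2 * pi) / s * exp (- (a / s)\<^sup>2 / 2)"
proof -
  have nd: "integrable lborel (\<lambda>x. exp (- x\<^sup>2 / 2) :: real)"
    using integrable_mult_right[OF integrable_std_normal_moment[of 0], of "sqrt (2 * pi)"]
    by (simp add: std_normal_density_def)
  show "integrable lborel (\<lambda>\<xi>. exp (- (s * \<xi>)\<^sup>2 / 2))"
    using lborel_integrable_real_affine[OF nd, of s 0] s by simp
  have "complex_of_real (exp (- (t\<^sup>2) / 2)) = (CLINT x|lborel. std_normal_density x *\<^sub>R iexp (t * x))" for t
  proof -
    have "char std_normal_distribution t = (CLINT x|lborel. std_normal_density x *\<^sub>R iexp (t * x))"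
      unfolding char_def by (subst integral_density) (auto simp: normal_density_nonneg)
    then show ?thesis by (simp add: char_std_normal_distribution)
  qed
  then have "Re (complex_of_real (exp (- (t\<^sup>2) / 2))) = Re (CLINT x|lborel. std_normal_density x *\<^sub>R iexp (t * x))" for t
    by metis
  moreover have "integrable lborel (\<lambda>x. std_normal_density x *\<^sub>R iexp (t * x))" for t
  proof (rule Bochner_Integration.integrable_bound[of _ "std_normal_density"])
    show "integrable lborel std_normal_density"
      using integrable_std_normal_moment[of 0] by simp
  qed (auto simp: normal_density_nonneg)
  then have "Re (CLINT x|lborel. std_normal_density x *\<^sub>R iexp (t * x)) =
      (LINT x|lborel. Re (std_normal_density x *\<^sub>R iexp (t * x)))" for t
    by (subst integral_Re) auto
  ultimately have c: "(LINT x|lborel. std_normal_density x * cos (t * x)) = exp (- (t\<^sup>2) / 2)" for t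
    by (simp add: Re_exp)
  have "(LINT \<xi>|lborel. exp (- (s * \<xi>)\<^sup>2 / 2) * cos (\<xi> * a)) =
     (1 / s) * (LINT x|lborel. exp (- x\<^sup>2 / 2) * cos (x / s * a))"
    using lborel_integral_real_affine[of s "\<lambda>x. exp (- x\<^sup>2 / 2) * cos (x / s * a)" 0] s
    by simp
  also have "(LINT x|lborel. exp (- x\<^sup>2 / 2) * cos (x / s * a)) =
     (LINT x|lborel. sqrt (2 * pi) * (std_normal_density x * cos ((a / s) * x)))"
    by (intro Bochner_Integration.integral_cong refl) (simp add: std_normal_density_def mult.commute)
  also have "\<dots> = sqrt (2 * pi) * exp (- (a / s)\<^sup>2 / 2)"
    by (subst integral_mult_right_zero) (simp only: c)
  finally show "(LINT \<xi>|lborel. exp (- (s * \<xi>)\<^sup>2 / 2) * cos (\<xi> * a)) = sqrt (2 * pi) / s * exp (- (a / s)\<^sup>2 / 2)"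
    by simp
qed


text \<open>Inversion away from the support. With a Gaussian factor of width \<open>1/s\<close> the inversion integral becomes, by Fubini, the
convolution of \<open>\<phi>\<close> with a Gaussian of width \<open>s\<close>; at a distance \<open>d > 0\<close> from the support its kernel tends to zero uniformly as
\<open>s \<rightarrow> 0\<close>, while the integral itself tends to the one without the factor.\<close>

lemma inv_fourier_eq_0_outside:
  fixes \<phi> :: "real => real^'n::finite"
  assumes \<phi>: "integrable lborel \<phi>" and \<Psi>: "integrable lborel (fourier \<phi>)"
    and supp: "\<And>x. x \<notin> {l<..<r} ==> \<phi> x = 0" and x: "x \<notin> {l..r}"
  shows "inv_fourier (fourier \<phi>) x = 0"
proof -
  define \<Psi> where "\<Psi> = fourier \<phi>"
  have [measurable]: "\<phi> \<in> borel_measurable borel" "\<Psi> \<in> borel_measurable borel"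
    using \<phi> \<Psi> by (auto simp: \<Psi>_def)
  obtain d where d: "0 < d" "\<And>y. y \<in> {l<..<r} ==> d <= \<bar>x - y\<bar>"
  proof
    show "0 < (if x < l then l - x else if r < x then x - r else 1)" using x by auto
  qed (use x in auto)
  define s where "s = (\<lambda>n. 1 / real (Suc n))"
  have s0: "0 < s n" for n by (simp add: s_def)
  define k where "k = (\<lambda>n \<xi>. exp (- (s n * \<xi>)\<^sup>2 / 2))"
  have k1: "0 <= k n \<xi>" "k n \<xi> <= 1" for n \<xi> by (auto simp: k_def)
  have [measurable]: "k n \<in> borel_measurable borel" for n unfolding k_def by measurable
  define I where "I = (\<lambda>n. LINT \<xi>|lborel. k n \<xi> *\<^sub>R cscale_adj (cis (- (\<xi> * x))) (\<Psi> \<xi>))"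
  define N where "N = (LINT y|lborel. norm (\<phi> y))"
  have "I \<longlonglongrightarrow> (LINT \<xi>|lborel. 1 *\<^sub>R cscale_adj (cis (- (\<xi> * x))) (\<Psi> \<xi>))"
    unfolding I_def
  proof (rule integral_dominated_convergence[where w = "\<lambda>\<xi>. norm (\<Psi> \<xi>)"])
    have "s \<longlonglongrightarrow> 0" unfolding s_def by (rule LIMSEQ_Suc) (rule lim_1_over_n)
    then have "(\<lambda>n. k n \<xi>) \<longlonglongrightarrow> exp (- (0 * \<xi>)\<^sup>2 / 2)" for \<xi>
      unfolding k_def by (intro tendsto_intros) auto
    then show "AE \<xi> in lborel. (\<lambda>n. k n \<xi> *\<^sub>R cscale_adj (cis (- (\<xi> * x))) (\<Psi> \<xi>)) \<longlonglongrightarrow>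
        1 *\<^sub>R cscale_adj (cis (- (\<xi> * x))) (\<Psi> \<xi>)"
      by (intro AE_I2 tendsto_intros) simp
    show "AE \<xi> in lborel. norm (k n \<xi> *\<^sub>R cscale_adj (cis (- (\<xi> * x))) (\<Psi> \<xi>)) <= norm (\<Psi> \<xi>)" for n
    proof (intro AE_I2)
      fix \<xi>
      have "norm (k n \<xi> *\<^sub>R cscale_adj (cis (- (\<xi> * x))) (\<Psi> \<xi>)) <= 1 * (1 * norm (\<Psi> \<xi>))"
        unfolding norm_scaleR using k1[of n \<xi>] norm_cscale_adj[of "cis (- (\<xi> * x))" "\<Psi> \<xi>"]
        by (intro mult_mono) auto
      then show "norm (k n \<xi> *\<^sub>R cscale_adj (cis (- (\<xi> * x))) (\<Psi> \<xi>)) <= norm (\<Psi> \<xi>)" by simp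
    qed
  qed (use \<Psi> in \<open>auto simp: \<Psi>_def[symmetric]\<close>)
  then have I1: "I \<longlonglongrightarrow> (2 * pi) *\<^sub>R inv_fourier \<Psi> x"
    by (simp add: inv_fourier_def)
  have In: "norm (I n) <= sqrt (2 * pi) / s n * exp (- (d / s n)\<^sup>2 / 2) * N" for n
  proof -
    have kint: "integrable lborel (k n)"
      using integral_gaussian_cos(1)[OF s0[of n]] by (simp add: k_def)
    define H where "H = (\<lambda>\<xi> y. (k n \<xi> * cos (\<xi> * (x - y))) *\<^sub>R \<phi> y)"
    have prod: "integrable (lborel \<Otimes>\<^sub>M lborel) (\<lambda>(\<xi>, y). k n \<xi> * norm (\<phi> y))"
      by (rule lborel_pair.Fubini_integrable) (use \<phi> kint k1 in auto)
    have Hint: "integrable (lborel \<Otimes>\<^sub>M lborel) (case_prod H)"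
    proof (rule Bochner_Integration.integrable_bound[OF prod])
      show "case_prod H \<in> borel_measurable (lborel \<Otimes>\<^sub>M lborel)" unfolding H_def by measurable
      show "AE p in lborel \<Otimes>\<^sub>M lborel. norm (case p of (\<xi>, y) => H \<xi> y) <= norm (case p of (\<xi>, y) => k n \<xi> * norm (\<phi> y))"
        using k1(1) by (auto simp: H_def abs_mult intro!: AE_I2 mult_right_mono mult_left_le)
    qed
    have "I n = (LINT \<xi>|lborel. LINT y|lborel. H \<xi> y)"
      unfolding I_def
    proof (intro Bochner_Integration.integral_cong refl)
      fix \<xi>
      have "k n \<xi> *\<^sub>R cscale_adj (cis (- (\<xi> * x))) (\<Psi> \<xi>) =
         k n \<xi> *\<^sub>R cscale_adj (cis (- (\<xi> * x))) (LINT y|lborel. cscale (cis (- (\<xi> * y))) (\<phi> y))"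
        by (simp add: \<Psi>_def fourier_eq(2)[OF \<phi>])
      also have "\<dots> = (LINT y|lborel. k n \<xi> *\<^sub>R cscale_adj (cis (- (\<xi> * x))) (cscale (cis (- (\<xi> * y))) (\<phi> y)))"
        using integral_bounded_linear[OF bounded_linear_compose[OF bounded_linear_scaleR_right[of "k n \<xi>"]
              cscale_adj.bounded_linear_right[of "cis (- (\<xi> * x))"]] fourier_eq(1)[OF \<phi>, of \<xi>]]
        by (rule sym)
      also have "\<dots> = (LINT y|lborel. H \<xi> y)"
      proof (intro Bochner_Integration.integral_cong refl)
        fix y
        have "cscale_adj (cis (- (\<xi> * x))) (cscale (cis (- (\<xi> * y))) (\<phi> y)) = cos (\<xi> * (x - y)) *\<^sub>R \<phi> y"
          by (simp add: vec_eq_iff cscale_adj_def cscale_def right_diff_distrib cos_diff algebra_simps)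
        then show "k n \<xi> *\<^sub>R cscale_adj (cis (- (\<xi> * x))) (cscale (cis (- (\<xi> * y))) (\<phi> y)) = H \<xi> y"
          by (simp add: H_def)
      qed
      finally show "k n \<xi> *\<^sub>R cscale_adj (cis (- (\<xi> * x))) (\<Psi> \<xi>) = (LINT y|lborel. H \<xi> y)" .
    qed
    also have "\<dots> = (LINT y|lborel. LINT \<xi>|lborel. H \<xi> y)"
      by (rule lborel_pair.Fubini_integral[symmetric]) (rule Hint)
    also have "\<dots> = (LINT y|lborel. (sqrt (2 * pi) / s n * exp (- ((x - y) / s n)\<^sup>2 / 2)) *\<^sub>R \<phi> y)"
    proof (intro Bochner_Integration.integral_cong refl)
      fix y
      have "integrable lborel (\<lambda>\<xi>. k n \<xi> * cos (\<xi> * (x - y)))"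
        by (rule Bochner_Integration.integrable_bound[OF kint])
          (auto simp: abs_mult k1 intro!: AE_I2 mult_right_le_one_le)
      then have "(LINT \<xi>|lborel. H \<xi> y) = (LINT \<xi>|lborel. k n \<xi> * cos (\<xi> * (x - y))) *\<^sub>R \<phi> y"
        unfolding H_def by (intro integral_scaleR_left) simp
      then show "(LINT \<xi>|lborel. H \<xi> y) = (sqrt (2 * pi) / s n * exp (- ((x - y) / s n)\<^sup>2 / 2)) *\<^sub>R \<phi> y"
        using integral_gaussian_cos(2)[OF s0[of n], of "x - y"] by (simp add: k_def)
    qed
    also have "norm \<dots> <= (LINT y|lborel. sqrt (2 * pi) / s n * exp (- (d / s n)\<^sup>2 / 2) * norm (\<phi> y))"
    proof (rule order.trans[OF integral_norm_bound integral_mono'])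
      show "integrable lborel (\<lambda>y. sqrt (2 * pi) / s n * exp (- (d / s n)\<^sup>2 / 2) * norm (\<phi> y))"
        using \<phi> by simp
      show "norm ((sqrt (2 * pi) / s n * exp (- ((x - y) / s n)\<^sup>2 / 2)) *\<^sub>R \<phi> y)
          <= sqrt (2 * pi) / s n * exp (- (d / s n)\<^sup>2 / 2) * norm (\<phi> y)" for y
      proof (cases "y \<in> {l<..<r}")
        case True
        then have "d <= \<bar>x - y\<bar>" by (rule d)
        then have "(d / s n)\<^sup>2 <= ((x - y) / s n)\<^sup>2"
          using d(1) s0[of n] by (simp add: power_divide divide_right_mono flip: abs_le_square_iff)
        then have "sqrt (2 * pi) / s n * exp (- ((x - y) / s n)\<^sup>2 / 2) <= sqrt (2 * pi) / s n * exp (- (d / s n)\<^sup>2 / 2)"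
          using s0[of n] by (intro mult_left_mono) auto
        from mult_right_mono[OF this norm_ge_zero[of "\<phi> y"]] show ?thesis
          using s0[of n] by (simp add: abs_mult)
      qed (simp add: supp)
    qed (use s0[of n] in \<open>simp\<close>)
    finally show ?thesis by (simp add: N_def)
  qed
  have "(\<lambda>n. sqrt (2 * pi) / s n * exp (- (d / s n)\<^sup>2 / 2) * N) \<longlonglongrightarrow> 0"
    unfolding s_def using d(1) by real_asymp
  then have "I \<longlonglongrightarrow> 0"
    by (rule Lim_null_comparison[rotated]) (use In in auto)
  with I1 have "(2 * pi) *\<^sub>R inv_fourier \<Psi> x = 0"
    by (rule LIMSEQ_unique)
  then show ?thesis by (simp add: \<Psi>_def)
qed

text \<open>The end points are reached by continuity of the representative. An empty interval forces \<open>\<phi> = 0\<close>.\<close>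

lemma inv_fourier_eq_0:
  fixes \<phi> :: "real => real^'n::finite"
  assumes \<phi>: "integrable lborel \<phi>" and \<Psi>: "integrable lborel (fourier \<phi>)"
    and supp: "\<And>x. x \<notin> {l<..<r} ==> \<phi> x = 0" and x: "x \<notin> {l<..<r}"
  shows "inv_fourier (fourier \<phi>) x = 0"
proof (cases "l < r")
  case True
  have cont: "isCont (inv_fourier (fourier \<phi>)) x"
    using continuous_inv_fourier[OF \<Psi>] by (simp add: continuous_on_eq_continuous_at)
  show ?thesis
  proof (cases "x <= l")
    case True
    have "(\<lambda>n. x - 1 / real (Suc n)) \<longlonglongrightarrow> x"
      by real_asymp
    then have "(\<lambda>n. inv_fourier (fourier \<phi>) (x - 1 / real (Suc n))) \<longlonglongrightarrow> inv_fourier (fourier \<phi>) x"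
      by (rule isCont_tendsto_compose[OF cont])
    moreover have "x - 1 / real (Suc n) < l" for n
      using True by (smt (verit) of_nat_0_less_iff zero_less_Suc zero_less_divide_1_iff)
    then have "inv_fourier (fourier \<phi>) (x - 1 / real (Suc n)) = 0" for n
      by (intro inv_fourier_eq_0_outside[OF \<phi> \<Psi> supp]) (auto simp: not_le)
    ultimately show ?thesis by (simp add: LIMSEQ_const_iff)
  next
    case False
    then have "r <= x" using x by auto
    have "(\<lambda>n. x + 1 / real (Suc n)) \<longlonglongrightarrow> x"
      by real_asymp
    then have "(\<lambda>n. inv_fourier (fourier \<phi>) (x + 1 / real (Suc n))) \<longlonglongrightarrow> inv_fourier (fourier \<phi>) x"
      by (rule isCont_tendsto_compose[OF cont])
    moreover have "r < x + 1 / real (Suc n)" for n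
      using \<open>r <= x\<close> by (smt (verit) of_nat_0_less_iff zero_less_Suc zero_less_divide_1_iff)
    then have "inv_fourier (fourier \<phi>) (x + 1 / real (Suc n)) = 0" for n
      by (intro inv_fourier_eq_0_outside[OF \<phi> \<Psi> supp]) (auto simp: not_le)
    ultimately show ?thesis by (simp add: LIMSEQ_const_iff)
  qed
next
  case False
  then have "\<phi> = (\<lambda>x. 0)" using supp by fastforce
  then have "fourier \<phi> = (\<lambda>x. 0)" by (simp add: fourier_def fun_eq_iff vec_eq_iff)
  then show ?thesis by (simp add: inv_fourier_def cscale_adj.zero_right)
qed

section \<open>The weighted spaces\<close>

lemma integrable_Cauchy_Schwarz:
  fixes f g :: "'a => real"
  assumes [measurable]: "f \<in> borel_measurable M" "g \<in> borel_measurable M"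
    and f: "integrable M (\<lambda>x. (f x)\<^sup>2)" and g: "integrable M (\<lambda>x. (g x)\<^sup>2)"
  shows "integrable M (\<lambda>x. f x * g x)"
    and "(LINT x|M. \<bar>f x * g x\<bar>) <= sqrt (LINT x|M. (f x)\<^sup>2) * sqrt (LINT x|M. (g x)\<^sup>2)"
proof -
  have le: "\<bar>f x * g x\<bar> <= (f x)\<^sup>2 + (g x)\<^sup>2" for x
    using sum_squares_bound[of "\<bar>f x\<bar>" "\<bar>g x\<bar>"] mult_nonneg_nonneg[OF abs_ge_zero abs_ge_zero, of "f x" "g x"]
    unfolding abs_mult power2_abs by linarith
  show int: "integrable M (\<lambda>x. f x * g x)"
    by (rule Bochner_Integration.integrable_bound[OF Bochner_Integration.integrable_add[OF f g]])
      (use le in \<open>auto intro!: AE_I2\<close>)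
  have int': "integrable M (\<lambda>x. \<bar>f x\<bar> * \<bar>g x\<bar>)"
    using integrable_abs[OF int] by (simp add: abs_mult)
  have "(\<integral>\<^sup>+x. ennreal \<bar>f x\<bar> * ennreal \<bar>g x\<bar> \<partial>M)\<^sup>2 <=
      (\<integral>\<^sup>+x. ennreal \<bar>f x\<bar> ^ 2 \<partial>M) * (\<integral>\<^sup>+x. ennreal \<bar>g x\<bar> ^ 2 \<partial>M)"
    by (rule Cauchy_Schwarz_nn_integral) measurable
  moreover have "(\<integral>\<^sup>+x. ennreal \<bar>f x\<bar> * ennreal \<bar>g x\<bar> \<partial>M) = ennreal (LINT x|M. \<bar>f x * g x\<bar>)"
    by (subst nn_integral_eq_integral[symmetric]) (use int' in \<open>auto simp: abs_mult ennreal_mult\<close>)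
  moreover have "(\<integral>\<^sup>+x. ennreal \<bar>f x\<bar> ^ 2 \<partial>M) = ennreal (LINT x|M. (f x)\<^sup>2)"
    by (subst nn_integral_eq_integral[symmetric]) (use f in \<open>auto simp: ennreal_power\<close>)
  moreover have "(\<integral>\<^sup>+x. ennreal \<bar>g x\<bar> ^ 2 \<partial>M) = ennreal (LINT x|M. (g x)\<^sup>2)"
    by (subst nn_integral_eq_integral[symmetric]) (use g in \<open>auto simp: ennreal_power\<close>)
  ultimately have "ennreal ((LINT x|M. \<bar>f x * g x\<bar>)\<^sup>2) <= ennreal ((LINT x|M. (f x)\<^sup>2) * (LINT x|M. (g x)\<^sup>2))"
    by (simp add: ennreal_power ennreal_mult)
  then have "(LINT x|M. \<bar>f x * g x\<bar>)\<^sup>2 <= (LINT x|M. (f x)\<^sup>2) * (LINT x|M. (g x)\<^sup>2)"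
    by (subst (asm) ennreal_le_iff) auto
  then show "(LINT x|M. \<bar>f x * g x\<bar>) <= sqrt (LINT x|M. (f x)\<^sup>2) * sqrt (LINT x|M. (g x)\<^sup>2)"
    unfolding real_sqrt_mult[symmetric] by (rule real_le_rsqrt)
qed

lemma integrable_weight:
  assumes b: "1/2 < b"
  shows "integrable lborel (\<lambda>\<xi>::real. (1 + \<xi>\<^sup>2) powr (- b))"
proof -
  define p where "p = (\<lambda>x::real. indicator {1..} x * x powr (- 2 * b))"
  have "((\<lambda>x. x powr (- 2 * b)) has_integral -(1 powr (- 2 * b + 1)) / (- 2 * b + 1)) {1::real..}"
    by (rule has_integral_powr_to_inf) (use b in auto)
  then have "(\<lambda>x::real. x powr (- 2 * b)) absolutely_integrable_on {1..}"
    by (intro nonnegative_absolutely_integrable_1) auto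
  then have p: "integrable lborel p"
    unfolding set_integrable_def p_def by (subst (asm) integrable_completion) auto
  have p': "integrable lborel (\<lambda>x. p (- x))"
    using lborel_integrable_real_affine[OF p, of "-1" 0] by simp
  have "integrable lborel (\<lambda>x. indicator {-1..1} x + p x + p (- x))"
    using p p' by (intro Bochner_Integration.integrable_add) auto
  then show ?thesis
  proof (rule Bochner_Integration.integrable_bound)
    show "AE \<xi> in lborel. norm ((1 + \<xi>\<^sup>2) powr (- b)) <= norm (indicator {-1..1} \<xi> + p \<xi> + p (- \<xi>))"
    proof (intro AE_I2)
      fix \<xi> :: real
      show "norm ((1 + \<xi>\<^sup>2) powr (- b)) <= norm (indicator {-1..1} \<xi> + p \<xi> + p (- \<xi>))"
      proof (cases "\<xi> \<in> {-1..1}")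
        case True
        have "(1 + \<xi>\<^sup>2) powr (- b) <= 1 powr (- b)"
          using b by (intro powr_mono2') auto
        moreover have "0 <= p \<xi>" "0 <= p (- \<xi>)" by (auto simp: p_def)
        ultimately show ?thesis using True by simp
      next
        case False
        then have \<xi>: "1 < \<bar>\<xi>\<bar>" by auto
        have "(1 + \<xi>\<^sup>2) powr (- b) <= (\<xi>\<^sup>2) powr (- b)"
          using b \<xi> by (intro powr_mono2') auto
        also have "(\<xi>\<^sup>2) powr (- b) = (\<bar>\<xi>\<bar> powr 2) powr (- b)" using \<xi> by (simp add: powr_numeral)
        also have "(\<bar>\<xi>\<bar> powr 2) powr (- b) = \<bar>\<xi>\<bar> powr (- 2 * b)"
          unfolding powr_powr by simp
        finally show ?thesis using \<xi> False
          by (cases "\<xi> < 0") (auto simp: p_def abs_of_nonneg)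
      qed
    qed
  qed measurable
qed

text \<open>The norm of evaluation at a point in the dual of \<open>H\<^sup>b\<close>.\<close>

definition eval_norm :: "real => real" where
  "eval_norm b = sqrt ((LINT \<xi>|lborel. (1 + \<xi>\<^sup>2) powr (- b)) / (2 * pi))"

lemma eval_norm_nonneg: "0 <= eval_norm b"
  by (simp add: eval_norm_def)

lemma Hs_norm_nonneg: "0 <= Hs_norm s \<Psi>"
  by (simp add: Hs_norm_def)

lemma HsD:
  assumes "\<Psi> \<in> Hs s"
  shows "\<Psi> \<in> borel_measurable borel" "integrable lborel (\<lambda>\<xi>. (1 + \<xi>\<^sup>2) powr s * (norm (\<Psi> \<xi>))\<^sup>2)"
  using assms by (auto simp: Hs_def)

lemma pos_one_plus_sq: "0 < 1 + (x::real)\<^sup>2"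
  by (smt (verit) zero_le_power2)

lemma powr_half_sq: "((1 + (x::real)\<^sup>2) powr (s / 2))\<^sup>2 = (1 + x\<^sup>2) powr s"
  using pos_one_plus_sq[of x] by (simp add: power2_eq_square flip: powr_add)

text \<open>The weight is split into \<open>(1 + \<xi>\<^sup>2) powr (s/2)\<close>, which goes with \<open>\<Psi>\<close>, and \<open>(1 + \<xi>\<^sup>2) powr (- b/2)\<close>, which is square
integrable as \<open>b > 1/2\<close>.\<close>

lemma weighted_Cauchy_Schwarz:
  fixes \<Psi> :: "real => complex^'n::finite"
  assumes b: "1/2 < b" and \<Psi>: "\<Psi> \<in> Hs s"
  shows "integrable lborel (\<lambda>\<xi>. (1 + \<xi>\<^sup>2) powr ((s - b) / 2) * norm (\<Psi> \<xi>))"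
    and "(LINT \<xi>|lborel. (1 + \<xi>\<^sup>2) powr ((s - b) / 2) * norm (\<Psi> \<xi>)) / (2 * pi) <= eval_norm b * Hs_norm s \<Psi>"
proof -
  note [measurable] = HsD(1)[OF \<Psi>]
  define f where "f = (\<lambda>\<xi>::real. (1 + \<xi>\<^sup>2) powr (- b / 2))"
  define g where "g = (\<lambda>\<xi>::real. (1 + \<xi>\<^sup>2) powr (s / 2) * norm (\<Psi> \<xi>))"
  have [measurable]: "f \<in> borel_measurable lborel" "g \<in> borel_measurable lborel"
    unfolding f_def g_def by measurable
  have f2: "(f \<xi>)\<^sup>2 = (1 + \<xi>\<^sup>2) powr (- b)" for \<xi>
    using powr_half_sq[of \<xi> "- b"] by (simp add: f_def)
  have g2: "(g \<xi>)\<^sup>2 = (1 + \<xi>\<^sup>2) powr s * (norm (\<Psi> \<xi>))\<^sup>2" for \<xi>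
    by (simp add: g_def power_mult_distrib powr_half_sq)
  have fg: "f \<xi> * g \<xi> = (1 + \<xi>\<^sup>2) powr ((s - b) / 2) * norm (\<Psi> \<xi>)" for \<xi>
    by (simp add: f_def g_def diff_divide_distrib flip: powr_add)
  have nn: "0 <= f \<xi> * g \<xi>" for \<xi> by (simp add: f_def g_def)
  note CS = integrable_Cauchy_Schwarz[of f lborel g, unfolded f2 g2 fg]
  show "integrable lborel (\<lambda>\<xi>. (1 + \<xi>\<^sup>2) powr ((s - b) / 2) * norm (\<Psi> \<xi>))"
    by (rule CS(1)) (use integrable_weight[OF b] HsD(2)[OF \<Psi>] in auto)
  have "(LINT \<xi>|lborel. \<bar>(1 + \<xi>\<^sup>2) powr ((s - b) / 2) * norm (\<Psi> \<xi>)\<bar>) <=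
     sqrt (LINT \<xi>|lborel. (1 + \<xi>\<^sup>2) powr (- b)) * sqrt (LINT \<xi>|lborel. (1 + \<xi>\<^sup>2) powr s * (norm (\<Psi> \<xi>))\<^sup>2)"
    by (rule CS(2)) (use integrable_weight[OF b] HsD(2)[OF \<Psi>] in auto)
  then show "(LINT \<xi>|lborel. (1 + \<xi>\<^sup>2) powr ((s - b) / 2) * norm (\<Psi> \<xi>)) / (2 * pi) <= eval_norm b * Hs_norm s \<Psi>"
    by (simp add: eval_norm_def Hs_norm_def real_sqrt_divide field_simps)
qed

text \<open>Sobolev embedding on the side of transforms.\<close>

lemma Hs_integrable:
  fixes \<Psi> :: "real => complex^'n::finite"
  assumes b: "1/2 < b" and \<Psi>: "\<Psi> \<in> Hs b"
  shows "integrable lborel \<Psi>" and "norm (inv_fourier \<Psi> x) <= eval_norm b * Hs_norm b \<Psi>"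
proof -
  have p: "(1 + (\<xi>::real)\<^sup>2) powr ((b - b) / 2) * norm (\<Psi> \<xi>) = norm (\<Psi> \<xi>)" for \<xi>
    using pos_one_plus_sq[of \<xi>] by simp
  note CS = weighted_Cauchy_Schwarz[OF b \<Psi>, unfolded p]
  show int: "integrable lborel \<Psi>"
    by (rule integrable_norm_cancel[OF CS(1)]) (use HsD(1)[OF \<Psi>] in simp)
  show "norm (inv_fourier \<Psi> x) <= eval_norm b * Hs_norm b \<Psi>"
    by (rule order.trans[OF norm_inv_fourier_le[OF int] CS(2)])
qed

text \<open>Decay like \<open>1/\<bar>\<xi>\<bar>\<close>, written with the weight of the spaces \<open>Hs\<close>. It is what functions of bounded variation provide, and it
passes to pointwise limits.\<close>

definition decays :: "real => (real => complex^'n::finite) => bool" where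
  "decays M \<Phi> \<longleftrightarrow> (\<forall>\<xi>. norm (\<Phi> \<xi>) <= M * (1 + \<xi>\<^sup>2) powr (- (1/2)))"

lemma decaysD: "decays M \<Phi> ==> norm (\<Phi> \<xi>) <= M * (1 + \<xi>\<^sup>2) powr (- (1/2))"
  by (simp add: decays_def)

lemma decays_nonneg: "decays M \<Phi> ==> 0 <= M"
  using order.trans[OF norm_ge_zero decaysD[of M \<Phi> 0]] by simp

lemma decays_Hs:
  fixes \<Phi> :: "real => complex^'n::finite"
  assumes b: "1/2 < b" and [measurable]: "\<Phi> \<in> borel_measurable borel" and \<Phi>: "decays M \<Phi>"
  shows "\<Phi> \<in> Hs (1 - b)" and "Hs_norm (1 - b) \<Phi> <= M * eval_norm b"
proof -
  have le: "(1 + \<xi>\<^sup>2) powr (1 - b) * (norm (\<Phi> \<xi>))\<^sup>2 <= M\<^sup>2 * (1 + \<xi>\<^sup>2) powr (- b)" for \<xi>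
  proof -
    have "(norm (\<Phi> \<xi>))\<^sup>2 <= (M * (1 + \<xi>\<^sup>2) powr (- (1/2)))\<^sup>2"
      using decaysD[OF \<Phi>] by (intro power_mono) auto
    also have "\<dots> = M\<^sup>2 * (1 + \<xi>\<^sup>2) powr (- 1)"
      using powr_half_sq[of \<xi> "- 1"] by (simp add: power_mult_distrib)
    finally have "(1 + \<xi>\<^sup>2) powr (1 - b) * (norm (\<Phi> \<xi>))\<^sup>2 <= (1 + \<xi>\<^sup>2) powr (1 - b) * (M\<^sup>2 * (1 + \<xi>\<^sup>2) powr (- 1))"
      by (intro mult_left_mono) auto
    moreover have "(1 + \<xi>\<^sup>2) powr (1 - b) * (1 + \<xi>\<^sup>2) powr (- 1) = (1 + \<xi>\<^sup>2) powr (- b)"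
      unfolding powr_add[symmetric] by simp
    ultimately show ?thesis
      by (simp only: mult.left_commute)
  qed
  have int: "integrable lborel (\<lambda>\<xi>::real. M\<^sup>2 * (1 + \<xi>\<^sup>2) powr (- b))"
    using integrable_weight[OF b] by simp
  have int2: "integrable lborel (\<lambda>\<xi>. (1 + \<xi>\<^sup>2) powr (1 - b) * (norm (\<Phi> \<xi>))\<^sup>2)"
    by (rule Bochner_Integration.integrable_bound[OF int]) (use le in \<open>auto intro!: AE_I2\<close>)
  then show "\<Phi> \<in> Hs (1 - b)" by (simp add: Hs_def)
  have "(LINT \<xi>|lborel. (1 + \<xi>\<^sup>2) powr (1 - b) * (norm (\<Phi> \<xi>))\<^sup>2) <= (LINT \<xi>|lborel. M\<^sup>2 * (1 + \<xi>\<^sup>2) powr (- b))"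
    by (rule integral_mono) (use int int2 le in auto)
  then have "Hs_norm (1 - b) \<Phi> <= sqrt (M\<^sup>2 * ((LINT \<xi>|lborel. (1 + \<xi>\<^sup>2) powr (- b)) / (2 * pi)))"
    unfolding Hs_norm_def by (intro real_sqrt_le_mono) (simp add: divide_right_mono)
  then show "Hs_norm (1 - b) \<Phi> <= M * eval_norm b"
    using decays_nonneg[OF \<Phi>] unfolding eval_norm_def real_sqrt_mult by simp
qed

text \<open>With this exponent the right-hand side is integrable for \<open>\<Psi>\<close> in the dual of \<open>Hs (1 - b)\<close>, by
\<open>weighted_Cauchy_Schwarz\<close>: it dominates all pairings.\<close>

lemma decays_dominated:
  fixes \<Phi> \<Psi> :: "real => complex^'n::finite"
  assumes \<Phi>: "decays M \<Phi>"
  shows "\<bar>\<Phi> \<xi> \<bullet> \<Psi> \<xi>\<bar> <= M * ((1 + \<xi>\<^sup>2) powr ((- (1 - b) - b) / 2) * norm (\<Psi> \<xi>))"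
proof -
  have "\<bar>\<Phi> \<xi> \<bullet> \<Psi> \<xi>\<bar> <= norm (\<Phi> \<xi>) * norm (\<Psi> \<xi>)" by (rule Cauchy_Schwarz_ineq2)
  also have "\<dots> <= (M * (1 + \<xi>\<^sup>2) powr (- (1/2))) * norm (\<Psi> \<xi>)"
    by (intro mult_right_mono decaysD[OF \<Phi>]) auto
  finally show ?thesis by (simp add: mult.assoc)
qed

lemma decays_hpair:
  fixes \<Phi> \<Psi> :: "real => complex^'n::finite"
  assumes b: "1/2 < b" and [measurable]: "\<Phi> \<in> borel_measurable borel" and \<Phi>: "decays M \<Phi>"
    and \<Psi>: "\<Psi> \<in> Hs (- (1 - b))"
  shows "integrable lborel (\<lambda>\<xi>. \<Phi> \<xi> \<bullet> \<Psi> \<xi>)" and "\<bar>hpair \<Phi> \<Psi>\<bar> <= M * eval_norm b * Hs_norm (- (1 - b)) \<Psi>"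
proof -
  note [measurable] = HsD(1)[OF \<Psi>]
  note CS = weighted_Cauchy_Schwarz[OF b \<Psi>]
  have int: "integrable lborel (\<lambda>\<xi>. M * ((1 + \<xi>\<^sup>2) powr ((- (1 - b) - b) / 2) * norm (\<Psi> \<xi>)))"
    using CS(1) by (rule integrable_mult_right)
  show int2: "integrable lborel (\<lambda>\<xi>. \<Phi> \<xi> \<bullet> \<Psi> \<xi>)"
    by (rule Bochner_Integration.integrable_bound[OF int])
      (auto intro!: AE_I2 order.trans[OF decays_dominated[OF \<Phi>, of _ \<Psi> b]])
  have "\<bar>LINT \<xi>|lborel. \<Phi> \<xi> \<bullet> \<Psi> \<xi>\<bar> <= (LINT \<xi>|lborel. \<bar>\<Phi> \<xi> \<bullet> \<Psi> \<xi>\<bar>)"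
    by (rule integral_abs_bound)
  also have "\<dots> <= (LINT \<xi>|lborel. M * ((1 + \<xi>\<^sup>2) powr ((- (1 - b) - b) / 2) * norm (\<Psi> \<xi>)))"
    by (rule integral_mono) (use int int2 decays_dominated[OF \<Phi>, of _ \<Psi> b] in auto)
  also have "\<dots> = M * (LINT \<xi>|lborel. (1 + \<xi>\<^sup>2) powr ((- (1 - b) - b) / 2) * norm (\<Psi> \<xi>))"
    by (rule integral_mult_right_zero)
  finally have "\<bar>hpair \<Phi> \<Psi>\<bar> <= M * ((LINT \<xi>|lborel. (1 + \<xi>\<^sup>2) powr ((- (1 - b) - b) / 2) * norm (\<Psi> \<xi>)) / (2 * pi))"
    by (simp add: hpair_def divide_right_mono)
  also have "\<dots> <= M * (eval_norm b * Hs_norm (- (1 - b)) \<Psi>)"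
    by (rule mult_left_mono[OF CS(2) decays_nonneg[OF \<Phi>]])
  finally show "\<bar>hpair \<Phi> \<Psi>\<bar> <= M * eval_norm b * Hs_norm (- (1 - b)) \<Psi>" by simp
qed

lemma hpair_tendsto:
  fixes \<Phi> :: "nat => real => complex^'n::finite"
  assumes b: "1/2 < b" and [measurable]: "\<And>n. \<Phi> n \<in> borel_measurable borel" 
    and \<Phi>: "\<And>n. decays M (\<Phi> n)" and \<Psi>: "\<Psi> \<in> Hs (- (1 - b))"
    and lim: "\<And>\<xi>. (\<lambda>n. \<Phi> n \<xi>) \<longlonglongrightarrow> \<Phi>' \<xi>"
  shows "(\<lambda>n. hpair (\<Phi> n) \<Psi>) \<longlonglongrightarrow> hpair \<Phi>' \<Psi>"
proof -
  note [measurable] = HsD(1)[OF \<Psi>]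
  have [measurable]: "\<Phi>' \<in> borel_measurable borel"
    by (rule borel_measurable_LIMSEQ_metric[where f = \<Phi>]) (use lim in auto)
  have "(\<lambda>n. LINT \<xi>|lborel. \<Phi> n \<xi> \<bullet> \<Psi> \<xi>) \<longlonglongrightarrow> (LINT \<xi>|lborel. \<Phi>' \<xi> \<bullet> \<Psi> \<xi>)"
  proof (rule integral_dominated_convergence)
    show "integrable lborel (\<lambda>\<xi>. M * ((1 + \<xi>\<^sup>2) powr ((- (1 - b) - b) / 2) * norm (\<Psi> \<xi>)))"
      using weighted_Cauchy_Schwarz(1)[OF b \<Psi>] by (rule integrable_mult_right)
    show "AE \<xi> in lborel. norm (\<Phi> n \<xi> \<bullet> \<Psi> \<xi>) <= M * ((1 + \<xi>\<^sup>2) powr ((- (1 - b) - b) / 2) * norm (\<Psi> \<xi>))" for n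
      using decays_dominated[OF \<Phi>[of n], of _ \<Psi> b] by (auto intro!: AE_I2)
    show "AE \<xi> in lborel. (\<lambda>n. \<Phi> n \<xi> \<bullet> \<Psi> \<xi>) \<longlonglongrightarrow> \<Phi>' \<xi> \<bullet> \<Psi> \<xi>"
      by (intro AE_I2 tendsto_intros lim)
  qed measurable
  then show ?thesis
    unfolding hpair_def by (intro tendsto_intros) auto
qed

lemma decays_lim:
  fixes \<Phi> :: "nat => real => complex^'n::finite"
  assumes "\<And>n. decays M (\<Phi> n)" "\<And>\<xi>. (\<lambda>n. \<Phi> n \<xi>) \<longlonglongrightarrow> \<Phi>' \<xi>"
  shows "decays M \<Phi>'"
  unfolding decays_def
  by (intro allI LIMSEQ_le_const2[OF tendsto_norm[OF assms(2)]]) (use decaysD[OF assms(1)] in auto)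

lemma Dx_Hs:
  fixes \<Psi> :: "real => complex^'n::finite"
  assumes \<Psi>: "\<Psi> \<in> Hs b"
  shows "Dx \<Psi> \<in> Hs (- (1 - b))" and "Hs_norm (- (1 - b)) (Dx \<Psi>) <= Hs_norm b \<Psi>"
proof -
  note [measurable] = HsD(1)[OF \<Psi>]
  have n: "norm (Dx \<Psi> \<xi>) = \<bar>\<xi>\<bar> * norm (\<Psi> \<xi>)" for \<xi>
  proof -
    have "norm (Dx \<Psi> \<xi>) = L2_set (\<lambda>i. \<bar>\<xi>\<bar> * norm (\<Psi> \<xi> $ i)) UNIV"
      by (simp add: norm_vec_def Dx_def norm_mult)
    then show ?thesis by (simp add: norm_vec_def L2_set_right_distrib)
  qed
  have le: "(1 + \<xi>\<^sup>2) powr (- (1 - b)) * (norm (Dx \<Psi> \<xi>))\<^sup>2 <= (1 + \<xi>\<^sup>2) powr b * (norm (\<Psi> \<xi>))\<^sup>2" for \<xi>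
  proof -
    have "(1 + \<xi>\<^sup>2) powr b = (1 + \<xi>\<^sup>2) powr (- (1 - b)) * (1 + \<xi>\<^sup>2)"
      using pos_one_plus_sq[of \<xi>] powr_add[of "1 + \<xi>\<^sup>2" "- (1 - b)" 1] by simp
    moreover have "(norm (Dx \<Psi> \<xi>))\<^sup>2 <= (1 + \<xi>\<^sup>2) * (norm (\<Psi> \<xi>))\<^sup>2"
      by (simp add: n power_mult_distrib algebra_simps)
    ultimately show ?thesis
      using mult_left_mono[of "(norm (Dx \<Psi> \<xi>))\<^sup>2" "(1 + \<xi>\<^sup>2) * (norm (\<Psi> \<xi>))\<^sup>2" "(1 + \<xi>\<^sup>2) powr (- (1 - b))"]
      by (simp add: mult.assoc)
  qed
  have "Dx \<Psi> = (\<lambda>\<xi>. \<chi> i. (\<i> * complex_of_real \<xi>) * \<Psi> \<xi> $ i)"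
    by (auto simp: Dx_def vec_eq_iff)
  then have [measurable]: "Dx \<Psi> \<in> borel_measurable borel"
    by simp
  have int2: "integrable lborel (\<lambda>\<xi>. (1 + \<xi>\<^sup>2) powr (- (1 - b)) * (norm (Dx \<Psi> \<xi>))\<^sup>2)"
    by (rule Bochner_Integration.integrable_bound[OF HsD(2)[OF \<Psi>]]) (use le in \<open>auto intro!: AE_I2\<close>)
  then show "Dx \<Psi> \<in> Hs (- (1 - b))" by (simp add: Hs_def)
  show "Hs_norm (- (1 - b)) (Dx \<Psi>) <= Hs_norm b \<Psi>"
    unfolding Hs_norm_def
    by (intro real_sqrt_le_mono divide_right_mono integral_mono le int2 HsD(2)[OF \<Psi>]) auto
qed

section \<open>Step functions\<close>

lemma measurable_fourier_borel:
  fixes g :: "real => real^'n::finite"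
  assumes [measurable]: "g \<in> borel_measurable borel"
  shows "fourier g \<in> borel_measurable borel"
proof -
  have "g \<in> borel_measurable lborel" by simp
  from measurable_compose[OF measurable_snd this]
  have "(\<lambda>(_, x). g x) \<in> borel_measurable (borel \<Otimes>\<^sub>M lborel)"
    unfolding case_prod_beta' .
  then show ?thesis
    by (rule measurable_fourier[where X = "\<lambda>x. x"]) (rule measurable_ident_sets, rule refl)
qed

definition step_fn :: "'v::real_vector => (real \<times> 'v) list => real => 'v" where
  "step_fn g0 js x = g0 + (\<Sum>(y, v)\<leftarrow>js. heaviside (x - y) *\<^sub>R v)"

definition step_size :: "'v::real_normed_vector => (real \<times> 'v) list => real" where
  "step_size g0 js = norm g0 + (\<Sum>(y, v)\<leftarrow>js. norm v)"

lemma step_fn_Nil [simp]: "step_fn g0 [] x = g0"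
  by (simp add: step_fn_def)

lemma step_fn_Cons [simp]: "step_fn g0 ((y, v) # js) x = heaviside (x - y) *\<^sub>R v + step_fn g0 js x"
  by (simp add: step_fn_def)

lemma step_size_simps [simp]:
  "step_size g0 [] = norm g0" "step_size g0 ((y, v) # js) = norm v + step_size g0 js"
  by (simp_all add: step_size_def)

lemma step_size_nonneg: "0 <= step_size g0 js"
  by (induction js) auto

lemma measurable_heaviside [measurable]: "heaviside \<in> borel_measurable borel"
  unfolding heaviside_def[abs_def] by measurable

lemma heaviside_bounds: "0 <= heaviside x" "heaviside x <= 1"
  by (auto simp: heaviside_def)

lemma measurable_step_fn [measurable]:
  fixes g0 :: "'v::euclidean_space"
  shows "step_fn g0 js \<in> borel_measurable borel"
  by (induction js) (auto simp: step_fn_Nil[abs_def] step_fn_Cons[abs_def])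

lemma norm_step_fn: "norm (step_fn g0 js x) <= step_size g0 js"
proof (induction js)
  case (Cons j js)
  obtain y v where j: "j = (y, v)" by force
  have "norm (heaviside (x - y) *\<^sub>R v) <= 1 * norm v"
    unfolding norm_scaleR using heaviside_bounds[of "x - y"] by (intro mult_right_mono) auto
  with Cons show ?case
    by (auto simp: j intro: order.trans[OF norm_triangle_ineq])
qed auto

lemma cut_measurable [measurable (raw)]:
  fixes g :: "real => real^'n::finite"
  assumes [measurable]: "g \<in> borel_measurable borel"
  shows "cut l r g \<in> borel_measurable borel"
proof -
  have "cut l r g = (\<lambda>x. if x \<in> {l<..<r} then g x else 0)"
    by (auto simp: cut_def fun_eq_iff)
  then show ?thesis by simp
qed

lemma integrable_cut:
  fixes g :: "real => real^'n::finite"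
  assumes [measurable]: "g \<in> borel_measurable borel" and B: "\<And>x. norm (g x) <= B"
  shows "integrable lborel (cut l r g)"
    and "l <= r ==> (LINT x|lborel. norm (cut l r g x)) <= (r - l) * B"
proof -
  have B0: "0 <= B" using order.trans[OF norm_ge_zero B] by blast
  have i: "integrable lborel (\<lambda>x. indicator {l<..<r} x * B)"
    by (cases "l <= r") auto
  have le: "norm (cut l r g x) <= indicator {l<..<r} x * B" for x
    using B[of x] B0 by (simp add: cut_def)
  show c: "integrable lborel (cut l r g)"
    by (rule Bochner_Integration.integrable_bound[OF i]) (use le in \<open>auto intro!: AE_I2 intro: order.trans[OF _ abs_ge_self]\<close>)
  show "(LINT x|lborel. norm (cut l r g x)) <= (r - l) * B" if "l <= r"
  proof -
    have "(LINT x|lborel. norm (cut l r g x)) <= (LINT x|lborel. indicator {l<..<r} x * B)"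
      by (rule integral_mono[OF integrable_norm[OF c] i le])
    also have "\<dots> = (r - l) * B" using that by simp
    finally show ?thesis .
  qed
qed

text \<open>Minus a primitive in \<open>y\<close> of the kernel \<open>cis (- \<xi>y)\<close>.\<close>

definition kernel_prim :: "real => real => complex" where
  "kernel_prim \<xi> y = cis (- (\<xi> * y)) / (\<i> * complex_of_real \<xi>)"

lemma norm_kernel_prim: "\<xi> \<noteq> 0 ==> norm (kernel_prim \<xi> y) = 1 / \<bar>\<xi>\<bar>"
  by (simp add: kernel_prim_def norm_divide norm_mult)

lemma integral_kernel:
  fixes v :: "real^'n::finite"
  assumes ab: "a <= b" and \<xi>: "\<xi> \<noteq> 0"
  shows "(LINT x|lborel. indicator {a..b} x *\<^sub>R cscale (cis (- (\<xi> * x))) v)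
    = cscale (kernel_prim \<xi> a - kernel_prim \<xi> b) v"
proof -
  have "((\<lambda>y. kernel_prim \<xi> y) has_vector_derivative - cis (- (\<xi> * x))) (at x within S)" for x S
  proof -
    have e: "kernel_prim \<xi> = (\<lambda>y. exp (of_real y * (- \<i> * of_real \<xi>)) / (\<i> * of_real \<xi>))"
      by (auto simp: kernel_prim_def fun_eq_iff cis_conv_exp intro!: arg_cong[of _ _ exp])
    have "((\<lambda>z. exp (z * (- \<i> * of_real \<xi>)) / (\<i> * of_real \<xi>)) has_field_derivative
        - exp (of_real x * (- \<i> * of_real \<xi>))) (at (of_real x))"
      using \<xi> by (auto intro!: derivative_eq_intros simp: field_simps)
    then have "((\<lambda>y. exp (of_real y * (- \<i> * of_real \<xi>)) / (\<i> * of_real \<xi>)) has_vector_derivative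
        - exp (of_real x * (- \<i> * of_real \<xi>))) (at x within S)"
      by (intro has_vector_derivative_real_field) 
    moreover have "exp (of_real x * (- \<i> * of_real \<xi>)) = cis (- (\<xi> * x))"
      by (auto simp: cis_conv_exp intro!: arg_cong[of _ _ exp])
    ultimately show ?thesis unfolding e by simp
  qed
  then have "((\<lambda>y. cscale (kernel_prim \<xi> y) v) has_vector_derivative cscale (- cis (- (\<xi> * x))) v) (at x within S)" for x S
    by (rule bounded_linear.has_vector_derivative[OF cscale.bounded_linear_left])
  from has_vector_derivative_minus[OF this]
  have "((\<lambda>y. - cscale (kernel_prim \<xi> y) v) has_vector_derivative cscale (cis (- (\<xi> * x))) v) (at x within S)" for x S
    by (simp add: cscale.minus_left)
  then have "integral\<^sup>L lborel (\<lambda>x. indicator {a..b} x *\<^sub>R cscale (cis (- (\<xi> * x))) v)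
     = - cscale (kernel_prim \<xi> b) v - (- cscale (kernel_prim \<xi> a) v)"
    by (intro integral_FTC_Icc) (auto intro!: ab cscale.continuous_on continuous_intros)
  then show ?thesis by (simp add: cscale.diff_left)
qed

lemma fourier_indicator:
  fixes v :: "real^'n::finite"
  assumes g: "\<And>x. x \<notin> X ==> g x = indicator {a..b} x *\<^sub>R v" and X: "finite X" 
    and gm: "g \<in> borel_measurable lborel" and ab: "a <= b" and \<xi>: "\<xi> \<noteq> 0"
  shows "fourier g \<xi> = cscale (kernel_prim \<xi> a - kernel_prim \<xi> b) v"
proof -
  have "AE x in lborel. x \<notin> X"
    using X by (intro AE_not_in countable_imp_null_set_lborel countable_finite)
  then have ae: "AE x in lborel. g x = indicator {a..b} x *\<^sub>R v"
    by eventually_elim (rule g)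
  have int: "integrable lborel (\<lambda>x. indicator {a..b} x *\<^sub>R v)"
    using ab by simp
  have "fourier g \<xi> = fourier (\<lambda>x. indicator {a..b} x *\<^sub>R v) \<xi>"
    using fourier_cong_AE[OF gm _ ae] int by (metis borel_measurable_integrable)
  also have "\<dots> = (LINT x|lborel. indicator {a..b} x *\<^sub>R cscale (cis (- (\<xi> * x))) v)"
    unfolding fourier_eq(2)[OF int] by (simp add: cscale.scaleR_right)
  finally show ?thesis
    using integral_kernel[OF ab \<xi>, of v] by simp
qed

abbreviation clamp_to :: "real => real => real => real" where
  "clamp_to l r y \<equiv> max l (min y r)"

text \<open>A jump at \<open>y\<close> acts inside \<open>(l,r)\<close> as the indicator of the part of \<open>(l,r)\<close> to its right, whose left end is \<open>y\<close>
clamped to \<open>[l,r]\<close>.\<close>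

lemma fourier_cut_step:
  fixes g0 :: "real^'n::finite"
  assumes lr: "l < r" and \<xi>: "\<xi> \<noteq> 0"
  shows "fourier (cut l r (step_fn g0 js)) \<xi> = cscale (kernel_prim \<xi> l - kernel_prim \<xi> r) g0 +
    (\<Sum>(y, v)\<leftarrow>js. cscale (kernel_prim \<xi> (clamp_to l r y) - kernel_prim \<xi> r) v)"
proof (induction js)
  case Nil
  have "cut l r (\<lambda>_. g0) x = indicator {l..r} x *\<^sub>R g0" if "x \<notin> {l, r}" for x
    using that by (auto simp: cut_def indicator_def)
  then have "fourier (cut l r (\<lambda>_. g0)) \<xi> = cscale (kernel_prim \<xi> l - kernel_prim \<xi> r) g0"
    by (rule fourier_indicator[where X = "{l, r}"]) (use lr \<xi> in \<open>auto intro!: cut_measurable\<close>)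
  then show ?case by (simp add: step_fn_Nil[abs_def])
next
  case (Cons j js)
  obtain y v where j: "j = (y, v)" by force
  define h where "h = (\<lambda>x. heaviside (x - y) *\<^sub>R v)"
  have hm [measurable]: "h \<in> borel_measurable borel" unfolding h_def by measurable
  have hb: "norm (h x) <= norm v" for x
    using heaviside_bounds[of "x - y"] by (auto simp: h_def mult_left_le_one_le)
  have "cut l r h x = indicator {clamp_to l r y..r} x *\<^sub>R v" if "x \<notin> {l, r, y}" for x
    using that lr by (auto simp: cut_def indicator_def h_def heaviside_def max_def min_def split: if_splits)
  then have F: "fourier (cut l r h) \<xi> = cscale (kernel_prim \<xi> (clamp_to l r y) - kernel_prim \<xi> r) v"
    by (rule fourier_indicator[where X = "{l, r, y}"]) (use lr \<xi> in \<open>auto intro!: cut_measurable\<close>)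
  have "cut l r (step_fn g0 (j # js)) = (\<lambda>x. 1 *\<^sub>R cut l r h x + 1 *\<^sub>R cut l r (step_fn g0 js) x)"
    by (auto simp: cut_def h_def j fun_eq_iff)
  then have "fourier (cut l r (step_fn g0 (j # js))) \<xi> = fourier (cut l r h) \<xi> + fourier (cut l r (step_fn g0 js)) \<xi>"
    using fourier_lincomb[OF integrable_cut(1)[OF hm hb] integrable_cut(1)[OF measurable_step_fn norm_step_fn], where c = 1 and d = 1, of l r l r g0 js]
    by simp
  then show ?case using Cons F by (simp add: j add_ac del: step_fn_Cons)
qed

text \<open>For large \<open>\<xi>\<close> every jump, and each end of the interval, costs \<open>1/\<bar>\<xi>\<bar>\<close>; for small \<open>\<xi>\<close> the \<open>L\<^sup>1\<close> norm bounds the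
  transform. The number of jumps does not enter, only their total size.\<close>

lemma decays_cut_step:
  fixes g0 :: "real^'n::finite"
  assumes lr: "l < r"
  shows "decays ((2 + (r - l)) * step_size g0 js) (fourier (cut l r (step_fn g0 js)))"
  unfolding decays_def
proof
  fix \<xi> :: real
  let ?F = "norm (fourier (cut l r (step_fn g0 js)) \<xi>)"
  have 1: "?F <= (r - l) * step_size g0 js"
    using norm_fourier_le[OF integrable_cut(1)[OF measurable_step_fn norm_step_fn], of l r g0 js \<xi>]
      integrable_cut(2)[OF measurable_step_fn norm_step_fn, of l r g0 js] lr by linarith
  have 2: "\<bar>\<xi>\<bar> * ?F <= 2 * step_size g0 js"
  proof (cases "\<xi> = 0")
    case False
    have k: "norm (cscale (kernel_prim \<xi> a - kernel_prim \<xi> b) v) <= 2 / \<bar>\<xi>\<bar> * norm v" for a b and v :: "real^'n"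
      unfolding norm_cscale
      using norm_triangle_ineq4[of "kernel_prim \<xi> a" "kernel_prim \<xi> b"] False
      by (intro mult_right_mono) (auto simp: norm_kernel_prim)
    have "norm (\<Sum>(y, v)\<leftarrow>js. cscale (kernel_prim \<xi> (clamp_to l r y) - kernel_prim \<xi> r) v) <=
        2 / \<bar>\<xi>\<bar> * (\<Sum>(y, v)\<leftarrow>js. norm v)"
    proof (induction js)
      case (Cons j js)
      obtain y v where j: "j = (y, v)" by force
      show ?case using Cons k[of "clamp_to l r y" r v] 
        by (auto simp: j distrib_left intro!: order.trans[OF norm_triangle_ineq])
    qed simp
    then have "?F <= 2 / \<bar>\<xi>\<bar> * step_size g0 js"
      unfolding fourier_cut_step[OF lr False] step_size_def using k[of l r g0]
      by (auto simp: distrib_left intro!: order.trans[OF norm_triangle_ineq])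
    then show ?thesis using False by (simp add: field_simps)
  qed (use step_size_nonneg in simp)
  have "(1 + \<xi>\<^sup>2) powr (1/2) = sqrt (1 + \<xi>\<^sup>2)"
    using pos_one_plus_sq[of \<xi>] by (simp add: powr_half_sqrt)
  also have "\<dots> <= 1 + \<bar>\<xi>\<bar>"
    by (rule real_le_lsqrt) (auto simp: power2_sum)
  finally have "(1 + \<xi>\<^sup>2) powr (1/2) * ?F <= (1 + \<bar>\<xi>\<bar>) * ?F"
    by (intro mult_right_mono) auto
  also have "\<dots> <= (2 + (r - l)) * step_size g0 js"
    using 1 2 by (simp add: algebra_simps)
  finally show "?F <= (2 + (r - l)) * step_size g0 js * (1 + \<xi>\<^sup>2) powr (- (1/2))"
    using pos_one_plus_sq[of \<xi>] by (simp add: powr_minus field_simps)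
qed

text \<open>The explicit transform of a step function has the factor \<open>1/\<xi>\<close>, which cancels the one in \<open>Dx\<close>: what is left are
  inversion integrals at the jumps and at the ends of the interval, and the latter vanish.\<close>

lemma hpair_cut_step_Dx:
  fixes g0 :: "real^'n::finite"
  assumes lr: "l < r" and \<Psi>: "integrable lborel \<Psi>"
    and z: "\<And>x. x \<notin> {l<..<r} ==> inv_fourier \<Psi> x = 0"
  shows "hpair (fourier (cut l r (step_fn g0 js))) (Dx \<Psi>) = - (\<Sum>(y, v)\<leftarrow>js. v \<bullet> inv_fourier \<Psi> y)"
proof -
  let ?e = "\<lambda>\<xi> y v. v \<bullet> cscale_adj (cis (- (\<xi> * y))) (\<Psi> \<xi>)"
  have e: "cscale (kernel_prim \<xi> y) v \<bullet> Dx \<Psi> \<xi> = - ?e \<xi> y v" if "\<xi> \<noteq> 0" for \<xi> y v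
  proof -
    have "cnj (kernel_prim \<xi> y) * (\<i> * complex_of_real \<xi>) = - cnj (cis (- (\<xi> * y)))"
      using that by (simp add: kernel_prim_def)
    then have "cnj (kernel_prim \<xi> y) * (\<i> * complex_of_real \<xi> * w) = - (cnj (cis (- (\<xi> * y))) * w)" for w
      by (metis mult.assoc mult_minus_left)
    then have "cscale_adj (kernel_prim \<xi> y) (Dx \<Psi> \<xi>) = - cscale_adj (cis (- (\<xi> * y))) (\<Psi> \<xi>)"
      unfolding cscale_adj_def Dx_def vec_eq_iff by simp
    then show ?thesis by (simp add: cscale_inner)
  qed
  have i: "integrable lborel (\<lambda>\<xi>. ?e \<xi> y v)" 
    and I: "(LINT \<xi>|lborel. ?e \<xi> y v) = 2 * pi * (v \<bullet> inv_fourier \<Psi> y)" for y v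
    using integrable_cscale_adj[OF \<Psi>, of y] by (auto simp: inv_fourier_def)
  have d: "cscale (kernel_prim \<xi> a - kernel_prim \<xi> b) v \<bullet> Dx \<Psi> \<xi> = ?e \<xi> b v - ?e \<xi> a v" if "\<xi> \<noteq> 0" for \<xi> a b v
    using that by (simp add: cscale.diff_left inner_diff_left e)
  have ae: "AE \<xi> in lborel. \<xi> \<noteq> (0::real)"
    by (rule AE_lborel_singleton)
  define A where "A = (\<lambda>\<xi>. (?e \<xi> r g0 - ?e \<xi> l g0) + (\<Sum>(y, v)\<leftarrow>js. ?e \<xi> r v - ?e \<xi> (clamp_to l r y) v))"
  have cl: "inv_fourier \<Psi> (clamp_to l r y) = inv_fourier \<Psi> y" for y
  proof (cases "y \<in> {l<..<r}")
    case False
    then have "clamp_to l r y \<notin> {l<..<r}" using lr by auto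
    then show ?thesis using z False by simp
  qed auto
  have S: "integrable lborel (\<lambda>\<xi>. (\<Sum>(y, v)\<leftarrow>js. ?e \<xi> r v - ?e \<xi> (clamp_to l r y) v)) \<and>
     (LINT \<xi>|lborel. (\<Sum>(y, v)\<leftarrow>js. ?e \<xi> r v - ?e \<xi> (clamp_to l r y) v)) = - (2 * pi) * (\<Sum>(y, v)\<leftarrow>js. v \<bullet> inv_fourier \<Psi> y)"
  proof (induction js)
    case (Cons j js)
    obtain y v where j: "j = (y, v)" by force
    have "inv_fourier \<Psi> r = 0" by (rule z) simp
    then have "integrable lborel (\<lambda>\<xi>. ?e \<xi> r v - ?e \<xi> (clamp_to l r y) v)"
      "(LINT \<xi>|lborel. ?e \<xi> r v - ?e \<xi> (clamp_to l r y) v) = - (2 * pi) * (v \<bullet> inv_fourier \<Psi> y)"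
      using i I by (auto simp: cl)
    then show ?case
      unfolding j list.map sum_list.Cons prod.case
      using Cons by (auto simp: distrib_left)
  qed simp
  have "inv_fourier \<Psi> r = 0" "inv_fourier \<Psi> l = 0" by (rule z, simp)+
  then have LA: "integrable lborel A" "(LINT \<xi>|lborel. A \<xi>) = - (2 * pi) * (\<Sum>(y, v)\<leftarrow>js. v \<bullet> inv_fourier \<Psi> y)"
    unfolding A_def using S i I by auto
  have "fourier (cut l r (step_fn g0 js)) \<xi> \<bullet> Dx \<Psi> \<xi> = A \<xi>" if "\<xi> \<noteq> 0" for \<xi>
  proof -
    have "(\<Sum>(y, v)\<leftarrow>js. cscale (kernel_prim \<xi> (clamp_to l r y) - kernel_prim \<xi> r) v) \<bullet> Dx \<Psi> \<xi> =
        (\<Sum>(y, v)\<leftarrow>js. ?e \<xi> r v - ?e \<xi> (clamp_to l r y) v)"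
      by (induction js) (auto simp: inner_add_left d[OF that])
    then show ?thesis
      unfolding fourier_cut_step[OF lr that] A_def by (simp add: inner_add_left d[OF that])
  qed
  then have "AE \<xi> in lborel. fourier (cut l r (step_fn g0 js)) \<xi> \<bullet> Dx \<Psi> \<xi> = A \<xi>"
    using ae by (auto elim!: eventually_mono)
  moreover have "(\<lambda>\<xi>. fourier (cut l r (step_fn g0 js)) \<xi> \<bullet> Dx \<Psi> \<xi>) \<in> borel_measurable lborel"
  proof -
    have [measurable]: "\<Psi> \<in> borel_measurable borel" using \<Psi> by auto
    have "Dx \<Psi> = (\<lambda>\<xi>. \<chi> i. (\<i> * complex_of_real \<xi>) * \<Psi> \<xi> $ i)"
      by (auto simp: Dx_def vec_eq_iff)
    then have [measurable]: "Dx \<Psi> \<in> borel_measurable borel" by simp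
    show ?thesis
      using measurable_fourier_borel[OF cut_measurable[OF measurable_step_fn], of l r g0 js] by simp
  qed
  ultimately have "(LINT \<xi>|lborel. fourier (cut l r (step_fn g0 js)) \<xi> \<bullet> Dx \<Psi> \<xi>) = (LINT \<xi>|lborel. A \<xi>)"
    by (intro integral_cong_AE) (use LA in auto)
  then show ?thesis by (simp add: hpair_def LA)
qed

section \<open>Compactness in space and time\<close>

text \<open>Position, speed, left state, right state.\<close>

type_synonym 'n jump = "real \<times> real \<times> (real^'n) \<times> (real^'n)"

definition jumps_of :: "(real^'n::finite => real^'n) => 'n jump list => (real \<times> (real^'n)) list" where
  "jumps_of h = map (\<lambda>(x, s, a, b). (x, h b - h a))"

definition drift :: "real => 'n::finite jump list => 'n jump list" where
  "drift d = map (\<lambda>(x, s, a, b). (x + d * s, s, a, b))"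

text \<open>Front tracking approximations, reduced to what compactness needs: step functions with values in \<open>K\<close> off their jumps, of
bounded variation, Lipschitz in time with respect to \<open>L\<^sup>1\<close>. \<open>compose\<close> is stated for all functions \<open>h\<close> of the state at once,
since \<open>f(U)\<close> and \<open>q(U)\<close> are needed as step functions too.\<close>

locale tracking =
  fixes T xa xb \<sigma> V \<Lambda> :: real and K \<Omega> :: "(real^'n::finite) set"
    and U :: "nat => real => real => real^'n" and ul :: "nat => real^'n"
    and J :: "nat => real => 'n jump list" and uo :: "real => real^'n"
  assumes T: "0 < T" and xab: "xa <= xb" and K: "compact K" and \<Omega>: "open \<Omega>" "K \<subseteq> \<Omega>" and ulK: "\<And>n. ul n \<in> K"
    and jumps: "\<And>n t x s a b. t \<in> {0..T} ==> (x, s, a, b) \<in> set (J n t) ==>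
      x \<in> {xa..xb} \<and> \<bar>s\<bar> <= \<sigma> \<and> a \<in> K \<and> b \<in> K"
    and variation: "\<And>n t. t \<in> {0..T} ==> (\<Sum>(x, s, a, b)\<leftarrow>J n t. norm (b - a)) <= V"
    and in_K: "\<And>n t x. t \<in> {0..T} ==> x \<notin> fst ` set (J n t) ==> U n t x \<in> K"
    and compose: "\<And>n t x h. t \<in> {0..T} ==> x \<notin> fst ` set (J n t) ==>
      h (U n t x) = step_fn (h (ul n)) (jumps_of h (J n t)) x"
    and lipschitz_time: "\<And>n s t. s \<in> {0..T} ==> t \<in> {0..T} ==>
      integrable lborel (\<lambda>x. norm (U n t x - U n s x)) \<and> (LINT x|lborel. norm (U n t x - U n s x)) <= \<Lambda> * \<bar>t - s\<bar>"
    and uo_measurable: "uo \<in> borel_measurable borel" and uo_states: "\<And>x. uo x \<in> \<Omega>"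
    and initial: "\<And>n. integrable lborel (\<lambda>x. norm (U n 0 x - uo x))"
      "(\<lambda>n. LINT x|lborel. norm (U n 0 x - uo x)) \<longlonglongrightarrow> 0"
begin

lemma V_nonneg: "0 <= V"
proof -
  have "0 <= (\<Sum>(x, s, a, b)\<leftarrow>J 0 0. norm (b - a))"
    by (intro sum_list_nonneg) auto
  also have "\<dots> <= V" by (rule variation) (use T in auto)
  finally show ?thesis .
qed

lemma Lam_nonneg: "0 <= \<Lambda>"
proof -
  have "0 <= (LINT x|lborel. norm (U 0 T x - U 0 0 x))" by simp
  also have "\<dots> <= \<Lambda> * \<bar>T - 0\<bar>" using lipschitz_time[of 0 T 0] T by auto
  finally show ?thesis using T by (auto simp: zero_le_mult_iff)
qed

text \<open>Functions of the state whose compositions with the approximations have the same kind of bounds.\<close>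

definition lip_on_K :: "(real^'n => real^'n) => real => bool" where
  "lip_on_K h B \<longleftrightarrow> continuous_on \<Omega> h \<and> B-lipschitz_on K h \<and> (\<forall>u\<in>K. norm (h u) <= B)"

abbreviation hat_U :: "real => real => (real^'n => real^'n) => nat => real => real => complex^'n" where
  "hat_U l r h n t \<equiv> cut_hat l r (\<lambda>x. h (U n t x))"

definition total :: "real => real" where
  "total B = B + B * V"

lemma lip_on_K_nonneg: "lip_on_K h B ==> 0 <= B"
  by (auto simp: lip_on_K_def lipschitz_on_def)

lemma total_nonneg: "lip_on_K h B ==> 0 <= total B"
  using lip_on_K_nonneg[of h B] V_nonneg by (simp add: total_def)

lemma step_size_jumps:
  assumes h: "lip_on_K h B" and t: "t \<in> {0..T}"
  shows "step_size (h (ul n)) (jumps_of h (J n t)) <= total B"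
proof -
  have "(\<Sum>(y, v)\<leftarrow>jumps_of h (J n t). norm v) = (\<Sum>(x, s, a, b)\<leftarrow>J n t. norm (h b - h a))"
    by (induction "J n t") (auto simp: jumps_of_def comp_def split_def)
  also have "\<dots> <= (\<Sum>(x, s, a, b)\<leftarrow>J n t. B * norm (b - a))"
    using jumps[OF t] h by (intro sum_list_mono) (force simp: lip_on_K_def dist_norm dest: lipschitz_onD)
  also have "\<dots> = B * (\<Sum>(x, s, a, b)\<leftarrow>J n t. norm (b - a))"
    by (simp add: sum_list_const_mult split_def)
  also have "\<dots> <= B * V"
    by (intro mult_left_mono variation t lip_on_K_nonneg[OF h])
  finally show ?thesis
    using h ulK[of n] by (auto simp: step_size_def total_def lip_on_K_def intro!: add_mono)
qed

lemma lip_id: obtains B where "lip_on_K (\<lambda>x. x) B"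
proof -
  obtain B where B: "\<And>u. u \<in> K ==> norm u <= B"
    using compact_imp_bounded[OF K] by (auto simp: bounded_iff)
  have "lip_on_K (\<lambda>x. x) (max 1 B)"
    unfolding lip_on_K_def
  proof (intro conjI ballI lipschitz_onI)
    show "dist x y <= max 1 B * dist x y" for x y :: "real^'n"
      using mult_right_mono[of 1 "max 1 B" "dist x y"] by simp
    show "norm u <= max 1 B" if "u \<in> K" for u using B[OF that] by simp
  qed (auto intro: continuous_intros)
  then show ?thesis by (rule that)
qed

lemma finite_positions: "finite (fst ` set (J n t))"
  by simp

lemma AE_not_position: "AE x in lborel. x \<notin> fst ` set (J n t)"
  by (intro AE_not_in countable_imp_null_set_lborel countable_finite finite_positions)

lemma AE_values: "t \<in> {0..T} ==> AE x in lborel. U n t x \<in> K"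
  using AE_not_position[of n t] by eventually_elim (rule in_K)

lemma AE_compose:
  fixes h :: "real^'n => real^'n"
  shows "t \<in> {0..T} ==> AE x in lborel. h (U n t x) = step_fn (h (ul n)) (jumps_of h (J n t)) x"
  using AE_not_position[of n t] by eventually_elim (rule compose)

lemma measurable_hU:
  fixes h :: "real^'n => real^'n"
  assumes t: "t \<in> {0..T}"
  shows "(\<lambda>x. h (U n t x)) \<in> borel_measurable borel"
  by (rule measurable_discrete_difference[OF measurable_step_fn, of "fst ` set (J n t)"])
    (use compose[OF t, of _ n h] in \<open>auto simp: countable_finite\<close>)

lemma measurable_U: "t \<in> {0..T} ==> U n t \<in> borel_measurable borel"
  using measurable_hU[where h = "\<lambda>x. x"] by simp

lemma cut_hat_U_eq:
  fixes h :: "real^'n => real^'n"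
  assumes t: "t \<in> {0..T}"
  shows "hat_U l r h n t = fourier (cut l r (step_fn (h (ul n)) (jumps_of h (J n t))))"
  unfolding cut_hat_def
proof (rule fourier_cong_AE)
  show "AE x in lborel. cut l r (\<lambda>x. h (U n t x)) x = cut l r (step_fn (h (ul n)) (jumps_of h (J n t))) x"
    using AE_compose[OF t, of h n] by eventually_elim (simp add: cut_def)
qed (use measurable_hU[OF t] in \<open>auto intro!: cut_measurable\<close>)

lemma integrable_cut_U:
  fixes h :: "real^'n => real^'n"
  assumes t: "t \<in> {0..T}"
  shows "integrable lborel (cut l r (\<lambda>x. h (U n t x)))"
proof (subst integrable_cong_AE)
  show "AE x in lborel. cut l r (\<lambda>x. h (U n t x)) x = cut l r (step_fn (h (ul n)) (jumps_of h (J n t))) x"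
    using AE_compose[OF t, of h n] by eventually_elim (simp add: cut_def)
qed (use measurable_hU[OF t] integrable_cut(1)[OF measurable_step_fn norm_step_fn] in \<open>auto intro!: cut_measurable\<close>)

lemma decays_cut_hat_U:
  assumes h: "lip_on_K h B" and t: "t \<in> {0..T}" and lr: "l < r"
  shows "decays ((2 + (r - l)) * total B) (hat_U l r h n t)"
  unfolding decays_def
proof
  fix \<xi>
  have "norm (hat_U l r h n t \<xi>) <=
      (2 + (r - l)) * step_size (h (ul n)) (jumps_of h (J n t)) * (1 + \<xi>\<^sup>2) powr (- (1/2))"
    unfolding cut_hat_U_eq[OF t] by (rule decaysD[OF decays_cut_step[OF lr]])
  also have "\<dots> <= (2 + (r - l)) * total B * (1 + \<xi>\<^sup>2) powr (- (1/2))"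
    using step_size_jumps[OF h t] lr by (intro mult_right_mono mult_left_mono) auto
  finally show "norm (hat_U l r h n t \<xi>) <= (2 + (r - l)) * total B * (1 + \<xi>\<^sup>2) powr (- (1/2))" .
qed

lemma lipschitz_time_hU:
  assumes h: "lip_on_K h B" and st: "s \<in> {0..T}" "t \<in> {0..T}"
  shows "integrable lborel (\<lambda>x. norm (h (U n t x) - h (U n s x)))"
    and "(LINT x|lborel. norm (h (U n t x) - h (U n s x))) <= B * \<Lambda> * \<bar>t - s\<bar>"
proof -
  note [measurable] = measurable_hU[OF st(1)] measurable_hU[OF st(2)]
  have le: "AE x in lborel. norm (h (U n t x) - h (U n s x)) <= B * norm (U n t x - U n s x)"
    using AE_values[OF st(1), of n] AE_values[OF st(2), of n]
    by eventually_elim (use h in \<open>auto simp: lip_on_K_def dist_norm dest: lipschitz_onD\<close>)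
  have i: "integrable lborel (\<lambda>x. B * norm (U n t x - U n s x))"
    using lipschitz_time[OF st, of n] by simp
  show i2: "integrable lborel (\<lambda>x. norm (h (U n t x) - h (U n s x)))"
    by (rule Bochner_Integration.integrable_bound[OF i])
      (use le in \<open>auto elim!: eventually_mono intro: order.trans[OF _ abs_ge_self]\<close>)
  have "(LINT x|lborel. norm (h (U n t x) - h (U n s x))) <= (LINT x|lborel. B * norm (U n t x - U n s x))"
    by (rule integral_mono_AE[OF i2 i le])
  also have "\<dots> <= B * (\<Lambda> * \<bar>t - s\<bar>)"
    using lipschitz_time[OF st, of n] lip_on_K_nonneg[OF h] by (simp add: mult_left_mono)
  finally show "(LINT x|lborel. norm (h (U n t x) - h (U n s x))) <= B * \<Lambda> * \<bar>t - s\<bar>" by simp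
qed

lemma lipschitz_cut_hat_U:
  assumes h: "lip_on_K h B" and st: "s \<in> {0..T}" "t \<in> {0..T}"
  shows "norm (hat_U l r h n t \<xi> - hat_U l r h n s \<xi>) <= B * \<Lambda> * \<bar>t - s\<bar>"
proof -
  have i: "integrable lborel (\<lambda>x. cut l r (\<lambda>x. h (U n t x)) x - cut l r (\<lambda>x. h (U n s x)) x)"
    using integrable_cut_U[OF st(1)] integrable_cut_U[OF st(2)] by (rule Bochner_Integration.integrable_diff[rotated])
  have "norm (hat_U l r h n t \<xi> - hat_U l r h n s \<xi>) <=
    (LINT x|lborel. norm (cut l r (\<lambda>x. h (U n t x)) x - cut l r (\<lambda>x. h (U n s x)) x))"
    unfolding cut_hat_def fourier_diff[OF integrable_cut_U[OF st(2)] integrable_cut_U[OF st(1)], symmetric]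
    by (rule norm_fourier_le[OF i])
  also have "\<dots> <= (LINT x|lborel. norm (h (U n t x) - h (U n s x)))"
    by (rule integral_mono) (use i lipschitz_time_hU(1)[OF h st] in \<open>auto simp: cut_def\<close>)
  finally show ?thesis
    using lipschitz_time_hU(2)[OF h st, of n] by simp
qed

subsection \<open>Spatial averages\<close>

text \<open>The value of a step function differs from its average over \<open>[x,x + d]\<close> at most by the jumps inside this interval.\<close>

lemma step_fn_average:
  fixes g0 :: "real^'n"
  assumes d: "0 < d"
  shows "set_integrable lborel {x..x + d} (step_fn g0 js)"
    and "norm (step_fn g0 js x - (LINT z:{x..x + d}|lborel. step_fn g0 js z) /\<^sub>R d) <=
     (\<Sum>(y, v)\<leftarrow>js. indicator {y - d..y} x * norm v)"
proof -
  have ii: "integrable lborel (\<lambda>z. indicator {x..x + d} z * c)" for c :: real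
    using d by simp
  show i: "set_integrable lborel {x..x + d} (step_fn g0 js)" for js
    unfolding set_integrable_def
    by (rule Bochner_Integration.integrable_bound[OF ii[of "step_size g0 js"]])
      (use norm_step_fn[of g0 js] step_size_nonneg[of g0 js] d in \<open>auto split: split_indicator intro!: AE_I2\<close>)
  show "norm (step_fn g0 js x - (LINT z:{x..x + d}|lborel. step_fn g0 js z) /\<^sub>R d) <=
     (\<Sum>(y, v)\<leftarrow>js. indicator {y - d..y} x * norm v)"
  proof (induction js)
    case Nil
    show ?case using d by (simp add: set_lebesgue_integral_def step_fn_Nil[abs_def])
  next
    case (Cons j js)
    obtain y v where j: "j = (y, v)" by force
    define H where "H = (\<lambda>z. heaviside (z - y))"
    define I where "I = (LINT z:{x..x + d}|lborel. H z)"
    have [measurable]: "H \<in> borel_measurable borel" unfolding H_def by measurable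
    have iI: "integrable lborel (\<lambda>z. indicator {x..x + d} z :: real)"
      using d by simp
    have iH: "set_integrable lborel {x..x + d} H"
      unfolding set_integrable_def
      by (rule Bochner_Integration.integrable_bound[OF iI])
        (use heaviside_bounds d in \<open>auto simp: H_def split: split_indicator intro!: AE_I2\<close>)
    have I01: "0 <= I" "I <= d"
    proof -
      show "0 <= I" unfolding I_def set_lebesgue_integral_def
        by (rule Bochner_Integration.integral_nonneg) (use heaviside_bounds in \<open>auto simp: H_def\<close>)
      have "I <= (LINT z|lborel. indicator {x..x + d} z :: real)"
        unfolding I_def set_lebesgue_integral_def
        by (rule integral_mono) (use heaviside_bounds iH[unfolded set_integrable_def] iI in \<open>auto simp: H_def split: split_indicator\<close>)
      then show "I <= d" using d by simp
    qed
    have "\<bar>H x - I / d\<bar> <= indicator {y - d..y} x"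
    proof (cases "x \<in> {y - d..y}")
      case True
      have "0 <= I / d" "I / d <= 1" using I01 d by auto
      then show ?thesis using True heaviside_bounds[of "x - y"] by (auto simp: H_def abs_le_iff)
    next
      case False
      have "I = (LINT z|lborel. indicator {x..x + d} z * H x)"
        unfolding I_def set_lebesgue_integral_def
      proof (rule integral_cong_AE)
        have "AE z in lborel. z \<noteq> x + d \<and> z \<noteq> x"
          using AE_lborel_singleton[of "x + d"] AE_lborel_singleton[of x] by eventually_elim auto
        then show "AE z in lborel. indicator {x..x + d} z *\<^sub>R H z = indicator {x..x + d} z * H x"
          by eventually_elim (use False d in \<open>auto simp: H_def heaviside_def indicator_def\<close>)
      qed auto
      then have "I = d * H x" using d by simp
      then show ?thesis using d by simp
    qed
    then have 1: "norm ((H x - I / d) *\<^sub>R v) <= indicator {y - d..y} x * norm v"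
      unfolding norm_scaleR by (intro mult_right_mono) auto
    have "(LINT z:{x..x + d}|lborel. step_fn g0 (j # js) z) = I *\<^sub>R v + (LINT z:{x..x + d}|lborel. step_fn g0 js z)"
    proof -
      have "set_integrable lborel {x..x + d} (\<lambda>z. H z *\<^sub>R v)"
        using iH integrable_scaleR_left[of v lborel "\<lambda>z. indicator {x..x + d} z *\<^sub>R H z"] unfolding set_integrable_def by simp
      moreover have "(LINT z:{x..x + d}|lborel. H z *\<^sub>R v) = I *\<^sub>R v"
        using iH integral_scaleR_left[of v lborel "\<lambda>z. indicator {x..x + d} z *\<^sub>R H z"]
        unfolding set_integrable_def I_def set_lebesgue_integral_def by simp
      ultimately show ?thesis
        using set_integral_add(2)[OF _ i] unfolding j step_fn_Cons H_def by metis
    qed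
    then have "step_fn g0 (j # js) x - (LINT z:{x..x + d}|lborel. step_fn g0 (j # js) z) /\<^sub>R d =
       (H x - I / d) *\<^sub>R v + (step_fn g0 js x - (LINT z:{x..x + d}|lborel. step_fn g0 js z) /\<^sub>R d)"
      by (simp add: j H_def algebra_simps divide_inverse)
    then have "norm (step_fn g0 (j # js) x - (LINT z:{x..x + d}|lborel. step_fn g0 (j # js) z) /\<^sub>R d) <=
       norm ((H x - I / d) *\<^sub>R v) + norm (step_fn g0 js x - (LINT z:{x..x + d}|lborel. step_fn g0 js z) /\<^sub>R d)"
      using norm_triangle_ineq by metis
    then show ?case using 1 Cons by (simp add: j)
  qed
qed

lemma bound_K: obtains B where "0 <= B" "\<And>u. u \<in> K ==> norm u <= B"
proof -
  obtain B where "lip_on_K (\<lambda>x. x) B" by (rule lip_id)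
  then show ?thesis using that[of B] lip_on_K_nonneg unfolding lip_on_K_def by blast
qed

lemma set_integrable_U:
  assumes t: "t \<in> {0..T}"
  shows "set_integrable lborel {p..q} (U n t)"
proof -
  obtain B where B: "0 <= B" "\<And>u. u \<in> K ==> norm u <= B" using bound_K by blast
  have i: "integrable lborel (\<lambda>x. indicator {p..q} x * B)"
    by (cases "p <= q") auto
  show ?thesis
    unfolding set_integrable_def
    by (rule Bochner_Integration.integrable_bound[OF i])
      (use AE_values[OF t, of n] B measurable_U[OF t] in \<open>auto elim!: eventually_mono split: split_indicator\<close>)
qed

definition prim :: "nat => real => real => real^'n" where
  "prim n t x = (LINT z:{xa - 1..x}|lborel. U n t z)"

text \<open>The error made by averaging over intervals of length \<open>d\<close>. Its integral is \<open>d\<close> times the total size of the jumps.\<close>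

definition spread :: "nat => real => real => real => real" where
  "spread n t d x = (\<Sum>(y, v)\<leftarrow>jumps_of (\<lambda>u. u) (J n t). indicator {y - d..y} x * norm v)"

lemma prim_diff:
  assumes t: "t \<in> {0..T}" and x: "xa - 1 <= x" and d: "0 <= d"
  shows "prim n t (x + d) - prim n t x = (LINT z:{x..x + d}|lborel. U n t z)"
proof -
  have "(LINT z:{xa - 1..x + d}|lborel. U n t z) = (LINT z:{xa - 1..x} \<union> {x<..x + d}|lborel. U n t z)"
    using x d by (simp add: ivl_disj_un)
  also have "\<dots> = (LINT z:{xa - 1..x}|lborel. U n t z) + (LINT z:{x<..x + d}|lborel. U n t z)"
    by (rule set_integral_Un) (auto intro: set_integrable_U[OF t] set_integrable_subset[OF set_integrable_U[OF t, of x "x + d"]])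
  also have "(LINT z:{x<..x + d}|lborel. U n t z) = (LINT z:{x..x + d}|lborel. U n t z)"
  proof -
    have "AE z in lborel. z \<noteq> x" by (rule AE_lborel_singleton)
    then show ?thesis unfolding set_lebesgue_integral_def
      by (intro integral_cong_AE) (use measurable_U[OF t, of n] in \<open>auto elim!: eventually_mono split: split_indicator\<close>)
  qed
  finally show ?thesis by (simp add: prim_def)
qed

lemma AE_average_le_spread:
  assumes t: "t \<in> {0..T}" and d: "0 < d"
  shows "AE x in lborel. norm (U n t x - (LINT z:{x..x + d}|lborel. U n t z) /\<^sub>R d) <= spread n t d x"
proof -
  let ?S = "step_fn (ul n) (jumps_of (\<lambda>u. u) (J n t))"
  have e: "(LINT z:{x..x + d}|lborel. U n t z) = (LINT z:{x..x + d}|lborel. ?S z)" for x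
    unfolding set_lebesgue_integral_def
    by (intro integral_cong_AE)
      (use AE_compose[OF t, of "\<lambda>u. u" n] measurable_U[OF t, of n] in \<open>auto elim!: eventually_mono\<close>)
  show ?thesis
    using AE_compose[OF t, of "\<lambda>u. u" n]
    by eventually_elim (simp only: e spread_def step_fn_average(2)[OF d])
qed

lemma spread_integral:
  assumes t: "t \<in> {0..T}" and d: "0 < d"
  shows "integrable lborel (spread n t d)" "(LINT x|lborel. spread n t d x) <= d * V" "0 <= spread n t d x"
proof -
  have "integrable lborel (\<lambda>x. \<Sum>(y, v)\<leftarrow>js. indicator {y - d..y} x * norm v) \<and>
     (LINT x|lborel. (\<Sum>(y, v)\<leftarrow>js. indicator {y - d..y} x * norm v)) = d * (\<Sum>(y, v)\<leftarrow>js. norm v)" 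
    for js :: "(real \<times> (real^'n)) list"
  proof (induction js)
    case (Cons j js)
    obtain y v where j: "j = (y, v)" by force
    have "integrable lborel (\<lambda>x. indicator {y - d..y} x * norm v)"
       "(LINT x|lborel. indicator {y - d..y} x * norm v) = d * norm v"
      using d by auto
    then show ?case unfolding j list.map sum_list.Cons prod.case using Cons by (auto simp: distrib_left)
  qed simp
  moreover have "(\<Sum>(y, v)\<leftarrow>jumps_of (\<lambda>u. u) (J n t). norm v) = (\<Sum>(x, s, a, b)\<leftarrow>J n t. norm (b - a))"
    by (simp add: jumps_of_def comp_def split_def)
  then have "d * (\<Sum>(y, v)\<leftarrow>jumps_of (\<lambda>u. u) (J n t). norm v) <= d * V"
    using variation[OF t, of n] d by (simp add: mult_left_mono)
  ultimately show "integrable lborel (spread n t d)" "(LINT x|lborel. spread n t d x) <= d * V"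
    unfolding spread_def[abs_def] by auto
  show "0 <= spread n t d x"
    unfolding spread_def by (intro sum_list_nonneg) auto
qed

lemma prim_lipschitz:
  assumes B: "0 <= B" "\<And>u. u \<in> K ==> norm u <= B" and st: "s \<in> {0..T}" "t \<in> {0..T}"
    and xy: "xa - 1 <= x" "xa - 1 <= y"
  shows "norm (prim n s x - prim n t y) <= \<Lambda> * \<bar>s - t\<bar> + B * \<bar>x - y\<bar>"
proof -
  have sp: "norm (prim n t (x + d) - prim n t x) <= B * d" if t: "t \<in> {0..T}" and "xa - 1 <= x" "0 <= d" for t x d
  proof -
    have "norm (LINT z:{x..x + d}|lborel. U n t z) <= (LINT z:{x..x + d}|lborel. norm (U n t z))"
      using set_integral_norm_bound[OF set_integrable_U[OF t]] by blast
    also have "\<dots> <= (LINT z|lborel. indicator {x..x + d} z * B)"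
      unfolding set_lebesgue_integral_def
    proof (rule integral_mono_AE)
      show "integrable lborel (\<lambda>z. indicator {x..x + d} z *\<^sub>R norm (U n t z))"
        using set_integrable_norm[OF set_integrable_U[OF t]] by (simp add: set_integrable_def)
      show "AE z in lborel. indicator {x..x + d} z *\<^sub>R norm (U n t z) <= indicator {x..x + d} z * B"
        using AE_values[OF t, of n] by eventually_elim (use B in \<open>auto split: split_indicator\<close>)
    qed (use that in auto)
    also have "\<dots> = B * d" using that by simp
    finally show ?thesis using prim_diff[of t x d n] that by simp
  qed
  have 1: "norm (prim n t x - prim n t y) <= B * \<bar>x - y\<bar>"
  proof (cases "x <= y")
    case True
    then show ?thesis using sp[OF st(2) xy(1), of "y - x"] by (simp add: norm_minus_commute)
  next
    case False
    then show ?thesis using sp[OF st(2) xy(2), of "x - y"] by simp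
  qed
  have "norm (prim n s x - prim n t x) <= \<Lambda> * \<bar>s - t\<bar>"
  proof -
    have "prim n s x - prim n t x = (LINT z:{xa - 1..x}|lborel. U n s z - U n t z)"
      unfolding prim_def using set_integral_diff(2)[OF set_integrable_U[OF st(1)] set_integrable_U[OF st(2)]] by metis
    also have "norm \<dots> <= (LINT z|lborel. norm (U n s z - U n t z))"
      unfolding set_lebesgue_integral_def
    proof (rule order.trans[OF integral_norm_bound integral_mono'])
      show "integrable lborel (\<lambda>z. norm (U n s z - U n t z))" using lipschitz_time[OF st(2,1)] by simp
    qed (auto split: split_indicator)
    also have "\<dots> <= \<Lambda> * \<bar>s - t\<bar>" using lipschitz_time[OF st(2,1)] by simp
    finally show ?thesis .
  qed
  then show ?thesis
    using 1 norm_triangle_ineq[of "prim n s x - prim n t x" "prim n t x - prim n t y"] by simp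
qed

text \<open>Both functions are replaced by their averages, which are difference quotients of the primitives. The best choice of
\<open>d\<close> is small, with \<open>\<delta>\<close> much smaller.\<close>

lemma L1_dist_le:
  assumes t: "t \<in> {0..T}" and d: "0 < d" "d <= 1" 
    and \<delta>: "\<And>x. x \<in> {xa - 1..xb + 2} ==> norm (prim n t x - prim m t x) <= \<delta>"
  shows "(LINT x:{xa - 1..xb + 1}|lborel. norm (U n t x - U m t x)) <= 2 * d * V + (xb - xa + 2) * (2 * \<delta> / d)"
proof -
  let ?I = "{xa - 1..xb + 1}"
  have le: "AE x in lborel. indicator ?I x *\<^sub>R norm (U n t x - U m t x) <=
      spread n t d x + spread m t d x + indicator ?I x * (2 * \<delta> / d)"
    using AE_average_le_spread[OF t d(1), of n] AE_average_le_spread[OF t d(1), of m]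
  proof eventually_elim
    case (elim x)
    show ?case
    proof (cases "x \<in> ?I")
      case True
      let ?a = "\<lambda>n. (LINT z:{x..x + d}|lborel. U n t z)"
      have "?a n = prim n t (x + d) - prim n t x" "?a m = prim m t (x + d) - prim m t x"
        using prim_diff[OF t, of x d] True d by auto
      then have "?a n - ?a m = (prim n t (x + d) - prim m t (x + d)) - (prim n t x - prim m t x)"
        by simp
      also have "norm \<dots> <= \<delta> + \<delta>"
        using True d by (intro order.trans[OF norm_triangle_ineq4] add_mono \<delta>) auto
      finally have "norm (?a n - ?a m) / d <= 2 * \<delta> / d"
        using d by (simp add: divide_right_mono)
      then have "norm (?a n /\<^sub>R d - ?a m /\<^sub>R d) <= 2 * \<delta> / d"
        using d by (simp add: divide_inverse mult.commute flip: scaleR_diff_right)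
      moreover have "U n t x - U m t x = (U n t x - ?a n /\<^sub>R d) - (U m t x - ?a m /\<^sub>R d) + (?a n /\<^sub>R d - ?a m /\<^sub>R d)"
        by simp
      then have "norm (U n t x - U m t x) <= norm (U n t x - ?a n /\<^sub>R d) + norm (U m t x - ?a m /\<^sub>R d) + norm (?a n /\<^sub>R d - ?a m /\<^sub>R d)"
        by (smt (verit) norm_triangle_ineq norm_triangle_ineq4)
      ultimately show ?thesis using elim True by simp
    next
      case False
      then show ?thesis using spread_integral(3)[OF t d(1), of n x] spread_integral(3)[OF t d(1), of m x] by simp
    qed
  qed
  have iI: "integrable lborel (\<lambda>x. indicator ?I x * (2 * \<delta> / d))" using xab by simp
  have "(LINT x:?I|lborel. norm (U n t x - U m t x)) <=
    (LINT x|lborel. spread n t d x + spread m t d x + indicator ?I x * (2 * \<delta> / d))"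
    unfolding set_lebesgue_integral_def
  proof (rule integral_mono_AE[OF _ _ le])
    show "integrable lborel (\<lambda>x. indicator ?I x *\<^sub>R norm (U n t x - U m t x))"
      using set_integrable_norm[OF set_integral_diff(1)[OF set_integrable_U[OF t] set_integrable_U[OF t]]]
      by (simp add: set_integrable_def)
  qed (intro Bochner_Integration.integrable_add spread_integral t d iI)
  also have "\<dots> = (LINT x|lborel. spread n t d x) + (LINT x|lborel. spread m t d x) + (xb - xa + 2) * (2 * \<delta> / d)"
    using iI spread_integral(1)[OF t d(1)] xab by (subst Bochner_Integration.integral_add) auto
  also have "\<dots> <= d * V + d * V + (xb - xa + 2) * (2 * \<delta> / d)"
    by (intro add_mono spread_integral t d) auto
  finally show ?thesis by (simp add: algebra_simps)
qed

text \<open>Ascoli for the primitives gives convergence in \<open>L\<^sup>1\<close>, uniformly in time.\<close>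

lemma exists_Cauchy_subsequence:
  obtains k :: "nat => nat" where "strict_mono k"
    "\<And>j t. t \<in> {0..T} ==> (LINT x:{xa - 1..xb + 1}|lborel. norm (U (k (Suc j)) t x - U (k j) t x)) <= (1/2) ^ j"
proof -
  obtain B where B: "0 <= B" "\<And>u. u \<in> K ==> norm u <= B" using bound_K by blast
  define F where "F = (\<lambda>n (p :: real \<times> real). prim n (fst p) (snd p))"
  define D where "D = {0..T} \<times> {xa - 1..xb + 2}"
  have lip: "norm (F n p - F n p') <= (\<Lambda> + B) * norm (p - p')" if "p \<in> D" "p' \<in> D" for n p p'
  proof -
    have "norm (F n p - F n p') <= \<Lambda> * \<bar>fst p - fst p'\<bar> + B * \<bar>snd p - snd p'\<bar>"
      using that unfolding F_def D_def by (intro prim_lipschitz B) auto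
    also have "\<dots> <= \<Lambda> * norm (p - p') + B * norm (p - p')"
      using norm_fst_le[of "fst p - fst p'" "snd p - snd p'"] norm_snd_le[of "snd p - snd p'" "fst p - fst p'"] Lam_nonneg B(1)
      by (intro add_mono mult_left_mono) (auto simp: minus_prod_def)
    finally show ?thesis by (simp add: distrib_right)
  qed
  have bound: "norm (F n p) <= (\<Lambda> + B) * (T + (xb - xa + 3)) + B * 0" if p: "p \<in> D" for n p
  proof -
    have p0: "(0, xa - 1) \<in> D" using T xab by (auto simp: D_def)
    have "F n (0, xa - 1) = 0"
      unfolding F_def prim_def set_lebesgue_integral_def fst_conv snd_conv
    proof (rule integral_eq_zero_AE)
      have "AE x in lborel. x \<noteq> xa - 1" by (rule AE_lborel_singleton)
      then show "AE x in lborel. indicator {xa - 1..xa - 1} x *\<^sub>R U n 0 x = 0"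
        by eventually_elim simp
    qed
    then have "norm (F n p) <= (\<Lambda> + B) * norm (p - (0, xa - 1))"
      using lip[OF p p0, of n] by simp
    also have "norm (p - (0, xa - 1)) <= T + (xb - xa + 3)"
      using norm_Pair_le[of "fst p" "snd p - (xa - 1)"] p by (cases p) (auto simp: D_def)
    finally show ?thesis using Lam_nonneg B(1) by (simp add: mult_left_mono)
  qed
  obtain g and r :: "nat => nat" where r: "strict_mono r"
    and g: "\<And>e. 0 < e ==> \<exists>N. \<forall>n p. N <= n \<and> p \<in> D --> norm (F (r n) p - g p) < e"
  proof (rule Arzela_Ascoli[of D F "(\<Lambda> + B) * (T + (xb - xa + 3)) + B * 0"])
    show "compact D" unfolding D_def by (intro compact_Times) auto
    show "\<exists>d>0. \<forall>n p'. p' \<in> D \<and> norm (p - p') < d --> norm (F n p - F n p') < e" if "p \<in> D" "0 < e" for p e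
    proof (intro exI[of _ "e / (\<Lambda> + B + 1)"] conjI allI impI)
      show pos: "0 < e / (\<Lambda> + B + 1)" using that Lam_nonneg B(1) by simp
      fix n p' assume p': "p' \<in> D \<and> norm (p - p') < e / (\<Lambda> + B + 1)"
      have "norm (F n p - F n p') <= (\<Lambda> + B) * norm (p - p')" using lip that p' by auto
      also have "\<dots> <= (\<Lambda> + B) * (e / (\<Lambda> + B + 1))"
        using p' Lam_nonneg B(1) by (intro mult_left_mono) auto
      also have "\<dots> < e" using that Lam_nonneg B(1) by (simp add: field_simps)
      finally show "norm (F n p - F n p') < e" .
    qed
  qed (use bound in blast)+
  have cauchy: "\<exists>N. \<forall>n\<ge>N. \<forall>m\<ge>N. \<forall>t\<in>{0..T}. (LINT x:{xa - 1..xb + 1}|lborel. norm (U (r n) t x - U (r m) t x)) <= (1/2) ^ j" for j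
  proof -
    define e where "e = (1/2 :: real) ^ j"
    have e: "0 < e" "e <= 1" by (auto simp: e_def power_le_one)
    \<comment> \<open>\<open>d\<close> makes the averaging error at most \<open>e / 2\<close>, then \<open>\<delta>\<close> does the same for the difference quotients\<close>
    define d where "d = e / (4 * (V + 1))"
    have d: "0 < d" "d <= 1" "2 * d * V <= e / 2"
      using e V_nonneg by (auto simp: d_def field_simps)
    define L where "L = xb - xa + 2"
    have L: "0 < L" using xab by (simp add: L_def)
    define \<delta> where "\<delta> = d * e / (4 * L)"
    have \<delta>: "0 < \<delta>" "(xb - xa + 2) * (2 * \<delta> / d) <= e / 2"
      using d(1) e(1) L unfolding L_def[symmetric] by (auto simp: \<delta>_def field_simps)
    obtain N where N: "\<And>n p. N <= n ==> p \<in> D ==> norm (F (r n) p - g p) < \<delta> / 2"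
      using g[of "\<delta> / 2"] \<delta>(1) by auto
    have "(LINT x:{xa - 1..xb + 1}|lborel. norm (U (r n) t x - U (r m) t x)) <= e"
      if "N <= n" "N <= m" "t \<in> {0..T}" for n m t
    proof -
      have "norm (prim (r n) t x - prim (r m) t x) <= \<delta>" if x: "x \<in> {xa - 1..xb + 2}" for x
      proof -
        have "(t, x) \<in> D" using x \<open>t \<in> {0..T}\<close> by (auto simp: D_def)
        then have "norm (F (r n) (t, x) - g (t, x)) < \<delta> / 2" "norm (F (r m) (t, x) - g (t, x)) < \<delta> / 2"
          using N that \<open>N <= n\<close> \<open>N <= m\<close> by auto
        then show ?thesis
          using norm_triangle_ineq4[of "F (r n) (t, x) - g (t, x)" "F (r m) (t, x) - g (t, x)"]
          by (simp add: F_def)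
      qed
      from L1_dist_le[OF that(3) d(1,2) this] show ?thesis using d(3) \<delta>(2) by linarith
    qed
    then show ?thesis unfolding e_def by blast
  qed
  then obtain N where N: "\<And>j n m t. N j <= n ==> N j <= m ==> t \<in> {0..T} ==>
     (LINT x:{xa - 1..xb + 1}|lborel. norm (U (r n) t x - U (r m) t x)) <= (1/2) ^ j"
    by metis
  define q where "q = (\<lambda>j. (\<Sum>i\<le>j. N i) + j)"
  have q: "N j <= q j" "q j < q (Suc j)" for j
    by (auto simp: q_def intro: order.trans[OF member_le_sum[of j "{..j}" N]])
  have "strict_mono (\<lambda>j. r (q j))"
    using strict_monoD[OF r] q(2) by (simp add: strict_mono_Suc_iff)
  then show ?thesis
    by (rule that) (use N q in \<open>meson less_imp_le order.trans\<close>)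
qed

text \<open>Left of \<open>xa\<close> and right of \<open>xb\<close> every approximation is constant at a given time; a single point of convergence then settles
convergence on a whole half line.\<close>

lemma U_outside:
  assumes t: "t \<in> {0..T}" and xy: "x < xa \<and> y < xa \<or> xb < x \<and> xb < y"
  shows "U n t x = U n t y"
proof -
  have "x \<notin> fst ` set (J n t)" "y \<notin> fst ` set (J n t)"
    using jumps[OF t] xy by force+
  then have "U n t x = step_fn (ul n) (jumps_of (\<lambda>u. u) (J n t)) x" "U n t y = step_fn (ul n) (jumps_of (\<lambda>u. u) (J n t)) y"
    using compose[OF t, of _ n "\<lambda>u. u"] by auto
  moreover have "step_fn (ul n) (jumps_of (\<lambda>u. u) (J n t)) x = step_fn (ul n) (jumps_of (\<lambda>u. u) (J n t)) y"
    unfolding step_fn_def jumps_of_def map_map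
    using xy by (intro arg_cong2[of _ _ _ _ "(+)"] refl arg_cong[of _ _ sum_list] map_cong)
      (use jumps[OF t] in \<open>force simp: heaviside_def\<close>)
  ultimately show ?thesis by simp
qed

end

lemma AE_lborel_exists_between:
  assumes "AE x in lborel. P x" "a < (b::real)"
  obtains x where "a < x" "x < b" "P x"
proof (cases "\<exists>x. a < x \<and> x < b \<and> P x")
  case False
  then have "AE x in lborel. x \<notin> {a<..<b}"
    using assms(1) by (auto elim!: eventually_mono)
  then have "emeasure lborel {a<..<b} = 0"
    by (subst (asm) AE_iff_measurable[of "{a<..<b}"]) auto
  moreover have "emeasure lborel {a<..<b} = ennreal (b - a)" using assms(2) by simp
  ultimately show ?thesis using assms(2) by (simp only: ennreal_eq_0_iff)
qed (use that in blast)

lemma summable_increments_convergent: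
  fixes X :: "nat => 'a::banach"
  assumes "summable (\<lambda>j. norm (X (Suc j) - X j))"
  shows "convergent X"
proof -
  have "summable (\<lambda>j. X (Suc j) - X j)" using assms by (rule summable_norm_cancel)
  then have "(\<lambda>n. X 0 + (\<Sum>j<n. X (Suc j) - X j)) \<longlonglongrightarrow> X 0 + (\<Sum>j. X (Suc j) - X j)"
    by (intro tendsto_intros summable_LIMSEQ)
  then show ?thesis unfolding sum_lessThan_telescope convergent_def by auto
qed

context tracking
begin

text \<open>On the interval, the increments of the subsequence are summable in \<open>L\<^sup>1\<close>, hence almost everywhere. The limit is changed to a state
on the remaining null sets, and to the data at time \<open>0\<close>, so that it has values in \<open>\<Omega>\<close> everywhere.\<close>

lemma exists_limit:
  obtains k :: "nat => nat" and u :: "real => real => real^'n" where "strict_mono k"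
    "\<And>t. t \<in> {0..T} ==> AE x in lborel. (\<lambda>j. U (k j) t x) \<longlonglongrightarrow> u t x"
    "\<And>t. t \<in> {0..T} ==> AE x in lborel. u t x \<in> K"
    "\<And>t x. u t x \<in> \<Omega>" "u 0 = uo" "\<And>t. t \<in> {0..T} ==> u t \<in> borel_measurable borel"
proof -
  obtain k where k: "strict_mono k"
    "\<And>j t. t \<in> {0..T} ==> (LINT x:{xa - 1..xb + 1}|lborel. norm (U (k (Suc j)) t x - U (k j) t x)) <= (1/2) ^ j"
    using exists_Cauchy_subsequence by blast
  have conv: "AE x in lborel. convergent (\<lambda>j. U (k j) t x)" if t: "t \<in> {0..T}" for t
  proof -
    define G where "G = (\<lambda>j x. indicator {xa - 1..xb + 1} x * norm (U (k (Suc j)) t x - U (k j) t x))"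
    note [measurable] = measurable_U[OF t]
    have [measurable]: "G j \<in> borel_measurable borel" for j unfolding G_def by measurable
    have Gint: "integrable lborel (G j)" for j
      using set_integrable_norm[OF set_integral_diff(1)[OF set_integrable_U[OF t] set_integrable_U[OF t]], of "xa - 1" "xb + 1" "k (Suc j)" "k j"]
      by (simp add: set_integrable_def G_def)
    have "(\<integral>\<^sup>+x. (\<Sum>j. ennreal (G j x)) \<partial>lborel) = (\<Sum>j. (\<integral>\<^sup>+x. ennreal (G j x) \<partial>lborel))"
      by (rule nn_integral_suminf) measurable
    also have "\<dots> <= (\<Sum>j. ennreal ((1/2) ^ j))"
    proof (rule suminf_le)
      fix j
      have "(\<integral>\<^sup>+x. ennreal (G j x) \<partial>lborel) = ennreal (LINT x|lborel. G j x)"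
        by (rule nn_integral_eq_integral[OF Gint]) (simp add: G_def)
      also have "\<dots> <= ennreal ((1/2) ^ j)"
        using k(2)[OF t, of j] by (intro ennreal_leI) (simp add: G_def set_lebesgue_integral_def)
      finally show "(\<integral>\<^sup>+x. ennreal (G j x) \<partial>lborel) <= ennreal ((1/2) ^ j)" .
    qed auto
    also have "\<dots> = ennreal (\<Sum>j. (1/2) ^ j)"
      by (rule suminf_ennreal2) (auto intro: summable_geometric)
    finally have "(\<integral>\<^sup>+x. (\<Sum>j. ennreal (G j x)) \<partial>lborel) \<noteq> \<infinity>"
      by (auto simp: top_unique)
    then have "AE x in lborel. (\<Sum>j. ennreal (G j x)) \<noteq> \<infinity>"
      by (intro nn_integral_PInf_AE) auto
    then have c: "AE x in lborel. x \<in> {xa - 1..xb + 1} --> convergent (\<lambda>j. U (k j) t x)"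
    proof eventually_elim
      case (elim x)
      then have "summable (\<lambda>j. G j x)"
        by (intro summable_suminf_not_top) (auto simp: G_def)
      then show ?case
        by (auto simp: G_def intro!: summable_increments_convergent)
    qed
    obtain x0 where x0: "xa - 1 < x0" "x0 < xa" "convergent (\<lambda>j. U (k j) t x0)"
      using AE_lborel_exists_between[OF c, of "xa - 1" xa] xab by auto
    obtain x1 where x1: "xb < x1" "x1 < xb + 1" "convergent (\<lambda>j. U (k j) t x1)"
      using AE_lborel_exists_between[OF c, of xb "xb + 1"] xab by auto
    show ?thesis
      using c
    proof eventually_elim
      case (elim x)
      show ?case
      proof (cases "x < xa \<or> xb < x")
        case True
        then have "(\<forall>n. U n t x = U n t x0) \<or> (\<forall>n. U n t x = U n t x1)"
          using U_outside[OF t] x0(2) x1(1) by blast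
        then show ?thesis using x0(3) x1(3) by auto
      qed (use elim in auto)
    qed
  qed
  define w where "w = (\<lambda>t x. lim (\<lambda>j. U (k j) t x))"
  have w: "AE x in lborel. (\<lambda>j. U (k j) t x) \<longlonglongrightarrow> w t x" if t: "t \<in> {0..T}" for t
    using conv[OF t] by eventually_elim (simp add: w_def convergent_LIMSEQ_iff)
  have wK: "AE x in lborel. w t x \<in> K" if t: "t \<in> {0..T}" for t
  proof -
    have "AE x in lborel. \<forall>n. U n t x \<in> K"
      using AE_values[OF t] by (simp add: AE_all_countable)
    then show ?thesis
      using w[OF t]
      by eventually_elim (use compact_imp_closed[OF K] in \<open>auto intro: closed_sequentially\<close>)
  qed
  have wm: "w t \<in> borel_measurable borel" if t: "t \<in> {0..T}" for t
  proof -
    note [measurable] = measurable_U[OF t]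
    show ?thesis unfolding w_def by measurable
  qed
  have w0: "AE x in lborel. w 0 x = uo x"
  proof -
    have 0: "(0::real) \<in> {0..T}" using T by auto
    note [measurable] = measurable_U[OF 0] uo_measurable
    have ii: "integrable lborel (\<lambda>x. U (k j) 0 x - uo x)" for j
      by (rule integrable_norm_cancel[OF initial(1)]) auto
    have "(\<lambda>j. LINT x|lborel. norm (U (k j) 0 x - uo x)) \<longlonglongrightarrow> 0"
      using LIMSEQ_subseq_LIMSEQ[OF initial(2) k(1)] by (simp add: comp_def)
    then obtain r :: "nat => nat" where r: "strict_mono r" "AE x in lborel. (\<lambda>j. U (k (r j)) 0 x - uo x) \<longlonglongrightarrow> 0"
      using tendsto_L1_AE_subseq[of lborel "\<lambda>j x. U (k j) 0 x - uo x", OF ii] by auto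
    show ?thesis
      using r(2) w[OF 0]
    proof eventually_elim
      case (elim x)
      have "(\<lambda>j. U (k (r j)) 0 x - uo x + uo x) \<longlonglongrightarrow> 0 + uo x"
        using elim(1) by (intro tendsto_intros)
      moreover have "(\<lambda>j. U (k (r j)) 0 x) \<longlonglongrightarrow> w 0 x"
        using LIMSEQ_subseq_LIMSEQ[OF elim(2) r(1)] by (simp add: comp_def)
      ultimately show ?case using LIMSEQ_unique by auto
    qed
  qed
  define u where "u = (\<lambda>t x. if t = 0 then uo x else if w t x \<in> K then w t x else ul 0)"
  have uw: "AE x in lborel. u t x = w t x" if t: "t \<in> {0..T}" for t
  proof (cases "t = 0")
    case True
    then show ?thesis using w0 by (auto simp: u_def elim!: eventually_mono)
  next
    case False
    then show ?thesis using wK[OF t] by (auto simp: u_def elim!: eventually_mono)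
  qed
  show ?thesis
  proof (rule that[OF k(1)])
    fix t assume t: "t \<in> {0..T}"
    show "AE x in lborel. (\<lambda>j. U (k j) t x) \<longlonglongrightarrow> u t x"
      using w[OF t] uw[OF t] by eventually_elim simp
    show "AE x in lborel. u t x \<in> K"
      using wK[OF t] uw[OF t] by eventually_elim simp
    have [measurable]: "K \<in> sets borel" using compact_imp_closed[OF K] by auto
    note [measurable] = uo_measurable wm[OF t]
    show "u t \<in> borel_measurable borel"
      unfolding u_def by (cases "t = 0") auto
  next
    show "u t x \<in> \<Omega>" for t x
      using \<Omega>(2) ulK[of 0] uo_states by (auto simp: u_def)
    show "u 0 = uo" by (auto simp: u_def)
  qed
qed

end

section \<open>Integration by parts in time\<close>

lemma smooth_compactD:
  assumes "smooth_compact T \<eta>"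
  shows "(\<eta> has_vector_derivative deriv \<eta> t) (at t within S)" "continuous_on UNIV (deriv \<eta>)"
    "\<eta> 0 = 0" "\<eta> T = 0"
proof -
  have *: "(deriv ^^ n) \<eta> differentiable (at t)" for n t
    using assms by (simp add: smooth_compact_def)
  have d0: "\<eta> differentiable (at t)" and d1: "deriv \<eta> differentiable (at t)" for t
    using *[of 0 t] *[of 1 t] by simp_all
  show "(\<eta> has_vector_derivative deriv \<eta> t) (at t within S)"
    using d0[of t] by (metis DERIV_deriv_iff_real_differentiable has_field_derivative_at_within has_real_derivative_iff_has_vector_derivative)
  show "continuous_on UNIV (deriv \<eta>)"
    using d1 by (simp add: continuous_at_imp_continuous_on differentiable_imp_continuous_within)
  show "\<eta> 0 = 0" "\<eta> T = 0" using assms unfolding smooth_compact_def by fastforce+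
qed

lemma integral_derivative_Ioo:
  fixes \<eta> :: "real => real"
  assumes "smooth_compact T \<eta>" "s <= T"
  shows "(LINT t|lborel. indicator {s<..<T} t * deriv \<eta> t) = - \<eta> s"
proof -
  note \<eta> = smooth_compactD[OF assms(1)]
  have [measurable]: "deriv \<eta> \<in> borel_measurable borel"
    using \<eta>(2) by (rule borel_measurable_continuous_onI)
  have "(LINT t|lborel. indicator {s<..<T} t * deriv \<eta> t) = (LINT t|lborel. indicator {s..T} t *\<^sub>R deriv \<eta> t)"
  proof (rule integral_cong_AE)
    have "AE t in lborel. t \<noteq> s \<and> t \<noteq> T"
      using AE_lborel_singleton[of s] AE_lborel_singleton[of T] by eventually_elim auto
    then show "AE t in lborel. indicator {s<..<T} t * deriv \<eta> t = indicator {s..T} t *\<^sub>R deriv \<eta> t"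
      by eventually_elim (auto split: split_indicator)
  qed auto
  also have "\<dots> = \<eta> T - \<eta> s"
    by (rule integral_FTC_Icc[OF assms(2)])
      (use \<eta> in \<open>auto intro: continuous_on_subset has_vector_derivative_at_within\<close>)
  finally show ?thesis using \<eta> by simp
qed

text \<open>A bounded function \<open>e\<close> is the weak derivative of its primitive \<open>P\<close>. Fubini's theorem for the triangle \<open>\<tau> < t\<close> avoids any
regularity of \<open>e\<close>.\<close>

lemma integral_by_parts_primitive:
  fixes e P :: "real => real"
  assumes T: "0 < T" and em: "set_borel_measurable lborel {0<..<T} e" and eb: "\<And>t. t \<in> {0<..<T} ==> \<bar>e t\<bar> <= M"
    and P: "\<And>t. t \<in> {0<..<T} ==> P t = P0 + (LINT \<tau>:{0<..<t}|lborel. e \<tau>)"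
    and \<eta>: "smooth_compact T \<eta>"
  shows "(LINT t:{0<..<T}|lborel. deriv \<eta> t * P t) = - (LINT t:{0<..<T}|lborel. \<eta> t * e t)"
proof -
  note \<eta>' = smooth_compactD[OF \<eta>]
  have [measurable]: "deriv \<eta> \<in> borel_measurable borel"
    using \<eta>'(2) by (rule borel_measurable_continuous_onI)
  define e' where "e' = (\<lambda>t. indicator {0<..<T} t * e t)"
  have [measurable]: "e' \<in> borel_measurable borel"
    using em by (simp add: e'_def set_borel_measurable_def)
  have M: "0 <= M" using eb[of "T / 2"] T by auto
  have e'b: "\<bar>e' t\<bar> <= M" for t using eb[of t] M by (auto simp: e'_def split: split_indicator)
  have "bounded (deriv \<eta> ` {0..T})"
    using \<eta>'(2) by (intro compact_imp_bounded compact_continuous_image) (auto intro: continuous_on_subset)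
  then obtain D where D: "\<And>t. t \<in> {0..T} ==> \<bar>deriv \<eta> t\<bar> <= D"
    unfolding bounded_iff real_norm_def by blast
  have D0: "0 <= D" using D[of 0] T by auto
  define d where "d = (\<lambda>t. indicator {0<..<T} t * deriv \<eta> t)"
  have [measurable]: "d \<in> borel_measurable borel" unfolding d_def by measurable
  have db: "\<bar>d t\<bar> <= indicator {0..T} t * D" for t using D[of t] by (auto simp: d_def split: split_indicator)
  have iI: "integrable lborel (\<lambda>t. indicator {0..T} t * c)" for c :: real using T by simp
  have dint: "integrable lborel d"
    by (rule Bochner_Integration.integrable_bound[OF iI[of D]]) (use db D0 in \<open>auto intro!: AE_I2\<close>)
  define H where "H = (\<lambda>t \<tau>. d t * (indicator {0<..<t} \<tau> * e' \<tau>))"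
  have Hm: "case_prod H \<in> borel_measurable (lborel \<Otimes>\<^sub>M lborel)"
  proof -
    have "case_prod H = (\<lambda>p. d (fst p) * ((if 0 < snd p \<and> snd p < fst p then 1 else 0) * e' (snd p)))"
      by (auto simp: H_def fun_eq_iff indicator_def)
    then show ?thesis by simp
  qed
  have prod: "integrable (lborel \<Otimes>\<^sub>M lborel) (\<lambda>(t, \<tau>). (indicator {0..T} t * D) * (indicator {0..T} \<tau> * M))"
    by (rule lborel_pair.Fubini_integrable) (use iI[of D] iI[of M] in \<open>auto simp: abs_mult\<close>)
  have Hb: "\<bar>H t \<tau>\<bar> <= (indicator {0..T} t * D) * (indicator {0..T} \<tau> * M)" for t \<tau>
  proof -
    have "\<bar>indicator {0<..<t} \<tau> * e' \<tau>\<bar> <= indicator {0..T} \<tau> * M"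
      using e'b[of \<tau>] M by (auto simp: e'_def split: split_indicator)
    from mult_mono[OF db[of t] this] show ?thesis
      using D0 by (simp add: H_def abs_mult mult.assoc)
  qed
  have Hint: "integrable (lborel \<Otimes>\<^sub>M lborel) (case_prod H)"
    by (rule Bochner_Integration.integrable_bound[OF prod Hm])
      (use Hb in \<open>auto intro!: AE_I2 intro: order.trans[OF _ abs_ge_self]\<close>)
  have i2: "integrable lborel (\<lambda>t. LINT \<tau>|lborel. H t \<tau>)"
    using lborel_pair.integrable_fst'[OF Hint] by simp
  have "(LINT t:{0<..<T}|lborel. deriv \<eta> t * P t) = (LINT t|lborel. P0 * d t + (LINT \<tau>|lborel. H t \<tau>))"
    unfolding set_lebesgue_integral_def
  proof (intro Bochner_Integration.integral_cong refl)
    fix t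
    show "indicator {0<..<T} t *\<^sub>R (deriv \<eta> t * P t) = P0 * d t + (LINT \<tau>|lborel. H t \<tau>)"
    proof (cases "t \<in> {0<..<T}")
      case True
      have "(LINT \<tau>|lborel. H t \<tau>) = d t * (LINT \<tau>|lborel. indicator {0<..<t} \<tau> * e' \<tau>)"
        unfolding H_def by (rule integral_mult_right_zero)
      also have "(LINT \<tau>|lborel. indicator {0<..<t} \<tau> * e' \<tau>) = (LINT \<tau>:{0<..<t}|lborel. e \<tau>)"
        unfolding set_lebesgue_integral_def
        by (intro Bochner_Integration.integral_cong) (use True in \<open>auto simp: e'_def split: split_indicator\<close>)
      finally show ?thesis using True P[OF True] by (simp add: d_def algebra_simps)
    qed (simp add: H_def d_def)
  qed
  also have "\<dots> = P0 * (LINT t|lborel. d t) + (LINT t|lborel. LINT \<tau>|lborel. H t \<tau>)"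
    using dint i2 by simp
  also have "(LINT t|lborel. d t) = 0"
    unfolding d_def using integral_derivative_Ioo[OF \<eta>, of 0] T \<eta>' by simp
  also have "(LINT t|lborel. LINT \<tau>|lborel. H t \<tau>) = (LINT \<tau>|lborel. LINT t|lborel. H t \<tau>)"
    by (rule lborel_pair.Fubini_integral[symmetric]) (rule Hint)
  also have "\<dots> = (LINT \<tau>|lborel. - (indicator {0<..<T} \<tau> *\<^sub>R (\<eta> \<tau> * e \<tau>)))"
  proof (intro Bochner_Integration.integral_cong refl)
    fix \<tau>
    show "(LINT t|lborel. H t \<tau>) = - (indicator {0<..<T} \<tau> *\<^sub>R (\<eta> \<tau> * e \<tau>))"
    proof (cases "\<tau> \<in> {0<..<T}")
      case True
      then have "(LINT t|lborel. H t \<tau>) = (LINT t|lborel. (indicator {\<tau><..<T} t * deriv \<eta> t) * e \<tau>)"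
        by (intro Bochner_Integration.integral_cong) (auto simp: H_def d_def e'_def split: split_indicator)
      also have "\<dots> = - \<eta> \<tau> * e \<tau>"
        using integral_derivative_Ioo[OF \<eta>, of \<tau>] True by simp
      finally show ?thesis using True by simp
    qed (simp add: H_def e'_def)
  qed
  finally show ?thesis by (simp add: set_lebesgue_integral_def)
qed

section \<open>Pairings that depend on time\<close>

lemma continuous_fourier:
  fixes g :: "real => real^'n::finite"
  assumes g: "integrable lborel g"
  shows "continuous_on UNIV (fourier g)"
proof -
  have "isCont (\<lambda>\<xi>. LINT x|lborel. cscale (cis (- (\<xi> * x))) (g x)) \<xi>" for \<xi>
    unfolding continuous_at_sequentially comp_def
  proof (intro allI impI)
    fix X assume X: "X \<longlonglongrightarrow> \<xi>"
    show "(\<lambda>n. LINT x|lborel. cscale (cis (- (X n * x))) (g x)) \<longlonglongrightarrow> (LINT x|lborel. cscale (cis (- (\<xi> * x))) (g x))"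
    proof (rule integral_dominated_convergence[where w = "\<lambda>x. norm (g x)"])
      have "continuous_on UNIV (\<lambda>y. cscale (cis (- (y * x))) (g x))" for x
        by (intro cscale.continuous_on continuous_intros)
      then show "AE x in lborel. (\<lambda>n. cscale (cis (- (X n * x))) (g x)) \<longlonglongrightarrow> cscale (cis (- (\<xi> * x))) (g x)"
        using X by (auto simp: continuous_on_eq_continuous_at intro!: AE_I2 isCont_tendsto_compose[of \<xi>])
    qed (use g in \<open>auto simp: norm_cscale\<close>)
  qed
  then have "isCont (fourier g) \<xi>" for \<xi>
    by (simp add: fourier_eq(2)[OF g, abs_def])
  then show ?thesis
    by (simp add: continuous_on_eq_continuous_at)
qed

text \<open>\<open>\<Phi>\<close> is jointly continuous, being continuous in \<open>\<xi>\<close> and Lipschitz in time uniformly in \<open>\<xi>\<close>; so the integrand of the pairing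
is jointly measurable.\<close>

lemma measurable_hpair_time:
  fixes \<Phi> \<Psi> :: "real => real => complex^'n::finite"
  assumes T: "0 < T" and cont: "\<And>t. t \<in> {0..T} ==> continuous_on UNIV (\<Phi> t)"
    and lip: "\<And>s t \<xi>. s \<in> {0..T} ==> t \<in> {0..T} ==> norm (\<Phi> t \<xi> - \<Phi> s \<xi>) <= L * \<bar>t - s\<bar>"
    and [measurable]: "case_prod \<Psi> \<in> borel_measurable (lborel \<Otimes>\<^sub>M lborel)"
  shows "set_borel_measurable lborel {0<..<T} (\<lambda>t. hpair (\<Phi> t) (\<Psi> t))"
proof -
  \<comment> \<open>extends \<open>\<Phi>\<close> continuously to all times\<close>
  define c where "c = (\<lambda>t. max 0 (min T t))"
  have c: "c t \<in> {0..T}" "\<bar>c t - c s\<bar> <= \<bar>t - s\<bar>" for s t using T by (auto simp: c_def)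
  have L: "0 <= L"
    using order.trans[OF norm_ge_zero lip[of 0 T 0]] T by (simp add: zero_le_mult_iff)
  have "continuous_on UNIV (\<lambda>p. \<Phi> (c (fst p)) (snd p))"
    unfolding continuous_on_eq_continuous_at[OF open_UNIV] continuous_at_sequentially comp_def
  proof (intro ballI allI impI)
    fix p :: "real \<times> real" and X assume X: "X \<longlonglongrightarrow> p"
    have "norm (\<Phi> (c (fst (X n))) (snd (X n)) - \<Phi> (c (fst p)) (snd p)) <=
        L * \<bar>fst (X n) - fst p\<bar> + norm (\<Phi> (c (fst p)) (snd (X n)) - \<Phi> (c (fst p)) (snd p))" for n
      using lip[OF c(1) c(1), of "fst (X n)" "snd (X n)" "fst p"] mult_left_mono[OF c(2) L, of "fst (X n)" "fst p"]
        norm_triangle_ineq[of "\<Phi> (c (fst (X n))) (snd (X n)) - \<Phi> (c (fst p)) (snd (X n))" "\<Phi> (c (fst p)) (snd (X n)) - \<Phi> (c (fst p)) (snd p)"]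
      by simp
    moreover have "(\<lambda>n. L * \<bar>fst (X n) - fst p\<bar> + norm (\<Phi> (c (fst p)) (snd (X n)) - \<Phi> (c (fst p)) (snd p)))
       \<longlonglongrightarrow> L * \<bar>fst p - fst p\<bar> + norm (\<Phi> (c (fst p)) (snd p) - \<Phi> (c (fst p)) (snd p))"
    proof (intro tendsto_intros X)
      have "isCont (\<Phi> (c (fst p))) (snd p)"
        using cont[OF c(1)] by (simp add: continuous_on_eq_continuous_at)
      then show "(\<lambda>n. \<Phi> (c (fst p)) (snd (X n))) \<longlonglongrightarrow> \<Phi> (c (fst p)) (snd p)"
        by (rule isCont_tendsto_compose) (intro tendsto_intros X)
    qed
    ultimately have "(\<lambda>n. \<Phi> (c (fst (X n))) (snd (X n)) - \<Phi> (c (fst p)) (snd p)) \<longlonglongrightarrow> 0"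
      by (intro Lim_null_comparison[of "\<lambda>n. \<Phi> (c (fst (X n))) (snd (X n)) - \<Phi> (c (fst p)) (snd p)"]) (auto)
    then show "(\<lambda>n. \<Phi> (c (fst (X n))) (snd (X n))) \<longlonglongrightarrow> \<Phi> (c (fst p)) (snd p)"
      by (simp add: LIM_zero_iff)
  qed
  then have "(\<lambda>p. \<Phi> (c (fst p)) (snd p)) \<in> borel_measurable borel"
    by (rule borel_measurable_continuous_onI)
  then have [measurable]: "(\<lambda>(t, \<xi>). \<Phi> (c t) \<xi>) \<in> borel_measurable (lborel \<Otimes>\<^sub>M lborel)"
    by (simp add: lborel_prod case_prod_beta')
  have "(\<lambda>t. hpair (\<Phi> (c t)) (\<Psi> t)) \<in> borel_measurable lborel"
    unfolding hpair_def by measurable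
  then have "(\<lambda>t. indicator {0<..<T} t *\<^sub>R hpair (\<Phi> (c t)) (\<Psi> t)) \<in> borel_measurable lborel"
    by measurable
  also have "(\<lambda>t. indicator {0<..<T} t *\<^sub>R hpair (\<Phi> (c t)) (\<Psi> t)) = (\<lambda>t. indicator {0<..<T} t *\<^sub>R hpair (\<Phi> t) (\<Psi> t))"
    by (auto simp: c_def fun_eq_iff split: split_indicator)
  finally show ?thesis by (simp add: set_borel_measurable_def)
qed

text \<open>\<open>inv_fourier (fourier \<phi>)\<close> is the continuous representative of \<open>\<phi>\<close>. Its values at the jumps make sense, unlike those of
  \<open>\<phi>\<close>, which is only integrable.\<close>

lemma HtestD:
  fixes \<phi> :: "real => real^'n::finite"
  assumes b: "1/2 < b" and \<phi>: "\<phi> \<in> Htest b l r"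
  shows "fourier \<phi> \<in> Hs b" "integrable lborel (fourier \<phi>)" "integrable lborel \<phi>"
    "x \<notin> {l<..<r} ==> inv_fourier (fourier \<phi>) x = 0"
    "norm (inv_fourier (fourier \<phi>) x) <= eval_norm b * Hs_norm b (fourier \<phi>)"
    "continuous_on UNIV (inv_fourier (fourier \<phi>))"
proof -
  show 1: "fourier \<phi> \<in> Hs b" "integrable lborel \<phi>" using \<phi> by (auto simp: Htest_def)
  show 2: "integrable lborel (fourier \<phi>)" "norm (inv_fourier (fourier \<phi>) x) <= eval_norm b * Hs_norm b (fourier \<phi>)"
    using Hs_integrable[OF b 1(1)] by auto
  show "inv_fourier (fourier \<phi>) x = 0" if "x \<notin> {l<..<r}"
    by (rule inv_fourier_eq_0[OF 1(2) 2(1) _ that]) (use \<phi> in \<open>auto simp: Htest_def\<close>)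
  show "continuous_on UNIV (inv_fourier (fourier \<phi>))" by (rule continuous_inv_fourier[OF 2(1)])
qed

lemma inv_fourier_lincomb:
  fixes \<phi> \<psi> :: "real => real^'n::finite"
  assumes b: "1/2 < b" and \<phi>: "\<phi> \<in> Htest b l r" and \<psi>: "\<psi> \<in> Htest b l r"
  shows "inv_fourier (fourier (\<lambda>x. c *\<^sub>R \<phi> x + d *\<^sub>R \<psi> x)) x =
    c *\<^sub>R inv_fourier (fourier \<phi>) x + d *\<^sub>R inv_fourier (fourier \<psi>) x"
proof -
  note p = HtestD[OF b \<phi>] and s = HtestD[OF b \<psi>]
  have "fourier (\<lambda>x. c *\<^sub>R \<phi> x + d *\<^sub>R \<psi> x) = (\<lambda>\<xi>. c *\<^sub>R fourier \<phi> \<xi> + d *\<^sub>R fourier \<psi> \<xi>)"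
    using fourier_lincomb[OF p(3) s(3)] by auto
  moreover have "(LINT \<xi>|lborel. c *\<^sub>R cscale_adj (cis (- (\<xi> * x))) (fourier \<phi> \<xi>) + d *\<^sub>R cscale_adj (cis (- (\<xi> * x))) (fourier \<psi> \<xi>)) =
     c *\<^sub>R (LINT \<xi>|lborel. cscale_adj (cis (- (\<xi> * x))) (fourier \<phi> \<xi>)) + d *\<^sub>R (LINT \<xi>|lborel. cscale_adj (cis (- (\<xi> * x))) (fourier \<psi> \<xi>))"
    using integrable_cscale_adj[OF p(2), of x] integrable_cscale_adj[OF s(2), of x]
    by (subst Bochner_Integration.integral_add) auto
  ultimately show ?thesis
    by (simp add: inv_fourier_def cscale_adj.add_right cscale_adj.scaleR_right scaleR_add_right mult.commute)
qed

section \<open>Approximations of a conservation law\<close>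

text \<open>Adds the system: the jumps move with their speeds as long as the index \<open>idx\<close> of the current stage does not change, and the
jump conditions hold up to the residual \<open>\<eta>\<close>.\<close>

locale tracking_system = tracking T xa xb \<sigma> V \<Lambda> K \<Omega> U ul J uo
  for T xa xb \<sigma> V \<Lambda> :: real and K \<Omega> :: "(real^'n::finite) set"
    and U :: "nat => real => real => real^'n" and ul :: "nat => real^'n"
    and J :: "nat => real => 'n jump list" and uo :: "real => real^'n" +
  fixes f q :: "real^'n => real^'n" and B :: real and \<eta> :: "nat => real"
    and idx :: "nat => real => nat" and Jm :: "nat => nat => 'n jump list" and X :: "nat => real set" and b :: real
  assumes f: "lip_on_K f B" and q: "lip_on_K q B" and \<sigma>: "0 <= \<sigma>" and b: "1/2 < b"
    and motion: "\<And>n t. t \<in> {0..T} ==> J n t = drift t (Jm n (idx n t))"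
    and idx: "\<And>n. idx n \<in> lborel \<rightarrow>\<^sub>M count_space UNIV"
    and X: "\<And>n. finite (X n)" "\<And>n t. t \<in> {0<..<T} - X n ==> eventually (\<lambda>t'. idx n t' = idx n t) (nhds t)"
    and residual: "\<And>n t. t \<in> {0..T} ==> (\<Sum>(x, s, a, b)\<leftarrow>J n t. norm ((f b - f a) - s *\<^sub>R (q b - q a))) <= \<eta> n"
    and \<eta>: "\<eta> \<longlonglongrightarrow> 0"
begin

text \<open>The time derivative of \<open>q(U n)\<close> is a measure carried by the jumps.\<close>

definition rate :: "nat => real => (real => real^'n) => real" where
  "rate n t \<phi> = - (\<Sum>(x, s, a, b)\<leftarrow>J n t. (s *\<^sub>R (q b - q a)) \<bullet> inv_fourier (fourier \<phi>) x)"

lemma rate_bound: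
  assumes t: "t \<in> {0..T}" and \<phi>: "\<phi> \<in> Htest b l r"
  shows "\<bar>rate n t \<phi>\<bar> <= \<sigma> * (B * V) * eval_norm b * Hs_norm b (fourier \<phi>)"
proof -
  let ?N = "eval_norm b * Hs_norm b (fourier \<phi>)"
  have N: "0 <= ?N" by (simp add: eval_norm_nonneg Hs_norm_nonneg)
  have "\<bar>rate n t \<phi>\<bar> <= (\<Sum>(x, s, a, b)\<leftarrow>J n t. \<bar>(s *\<^sub>R (q b - q a)) \<bullet> inv_fourier (fourier \<phi>) x\<bar>)"
    unfolding rate_def abs_minus_cancel by (rule order.trans[OF sum_list_abs]) (simp add: comp_def split_def)
  also have "\<dots> <= (\<Sum>(x, s, a, b)\<leftarrow>J n t. \<sigma> * B * ?N * norm (b - a))"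
  proof (rule sum_list_mono, clarify)
    fix x s a b assume "(x, s, a, b) \<in> set (J n t)"
    note j = jumps[OF t this]
    have "norm (s *\<^sub>R (q b - q a)) <= \<sigma> * (B * norm (b - a))"
      unfolding norm_scaleR using j q \<sigma> by (intro mult_mono) (auto simp: lip_on_K_def dist_norm dest: lipschitz_onD)
    then have "norm (s *\<^sub>R (q b - q a)) * norm (inv_fourier (fourier \<phi>) x) <= \<sigma> * (B * norm (b - a)) * ?N"
      using HtestD(5)[OF local.b \<phi>] \<sigma> lip_on_K_nonneg[OF q] by (intro mult_mono) auto
    then show "\<bar>(s *\<^sub>R (q b - q a)) \<bullet> inv_fourier (fourier \<phi>) x\<bar> <= \<sigma> * B * ?N * norm (b - a)"
      using Cauchy_Schwarz_ineq2[of "s *\<^sub>R (q b - q a)" "inv_fourier (fourier \<phi>) x"] by (simp add: mult_ac)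
  qed
  also have "\<dots> = \<sigma> * B * ?N * (\<Sum>(x, s, a, b)\<leftarrow>J n t. norm (b - a))"
    by (simp add: sum_list_const_mult split_def)
  also have "\<dots> <= \<sigma> * B * ?N * V"
    by (intro mult_left_mono[OF variation[OF t]] mult_nonneg_nonneg[OF mult_nonneg_nonneg[OF \<sigma> lip_on_K_nonneg[OF q]] N])
  finally show ?thesis by (simp add: mult_ac)
qed

lemma hpair_flux:
  assumes t: "t \<in> {0..T}" and \<phi>: "\<phi> \<in> Htest b l r" and lr: "l < r"
  shows "hpair (hat_U l r f n t) (Dx (fourier \<phi>)) = - (\<Sum>(x, s, a, b)\<leftarrow>J n t. (f b - f a) \<bullet> inv_fourier (fourier \<phi>) x)"
proof -
  have "hpair (hat_U l r f n t) (Dx (fourier \<phi>)) = - (\<Sum>(y, v)\<leftarrow>jumps_of f (J n t). v \<bullet> inv_fourier (fourier \<phi>) y)"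
    unfolding cut_hat_U_eq[OF t] 
    by (rule hpair_cut_step_Dx[OF lr HtestD(2)[OF b \<phi>]]) (rule HtestD(4)[OF b \<phi>])
  then show ?thesis by (simp add: jumps_of_def comp_def split_def)
qed

text \<open>Time derivative and flux term are sums over the same jumps, so their difference is the residual, tested with the
continuous representative.\<close>

lemma rate_flux:
  assumes t: "t \<in> {0..T}" and \<phi>: "\<phi> \<in> Htest b l r" and lr: "l < r"
  shows "\<bar>rate n t \<phi> - hpair (hat_U l r f n t) (Dx (fourier \<phi>))\<bar> <= \<eta> n * (eval_norm b * Hs_norm b (fourier \<phi>))"
proof -
  let ?N = "eval_norm b * Hs_norm b (fourier \<phi>)"
  have N: "0 <= ?N" by (simp add: eval_norm_nonneg Hs_norm_nonneg)
  have "rate n t \<phi> - hpair (hat_U l r f n t) (Dx (fourier \<phi>)) =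
      (\<Sum>(x, s, a, b)\<leftarrow>J n t. ((f b - f a) - s *\<^sub>R (q b - q a)) \<bullet> inv_fourier (fourier \<phi>) x)"
    unfolding hpair_flux[OF t \<phi> lr] rate_def split_def
    by (simp add: inner_diff_left sum_list_subtractf)
  also have "\<bar>\<dots>\<bar> <= (\<Sum>(x, s, a, b)\<leftarrow>J n t. \<bar>((f b - f a) - s *\<^sub>R (q b - q a)) \<bullet> inv_fourier (fourier \<phi>) x\<bar>)"
    by (rule order.trans[OF sum_list_abs]) (simp add: comp_def split_def)
  also have "\<dots> <= (\<Sum>(x, s, a, b)\<leftarrow>J n t. ?N * norm ((f b - f a) - s *\<^sub>R (q b - q a)))"
  proof (rule sum_list_mono, clarify)
    fix x s a b
    let ?v = "(f b - f a) - s *\<^sub>R (q b - q a)"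
    have "\<bar>?v \<bullet> inv_fourier (fourier \<phi>) x\<bar> <= norm ?v * norm (inv_fourier (fourier \<phi>) x)" by (rule Cauchy_Schwarz_ineq2)
    also have "\<dots> <= norm ?v * ?N" by (intro mult_left_mono HtestD(5)[OF local.b \<phi>]) auto
    finally show "\<bar>?v \<bullet> inv_fourier (fourier \<phi>) x\<bar> <= ?N * norm ?v" by (simp add: mult_ac)
  qed
  also have "\<dots> = ?N * (\<Sum>(x, s, a, b)\<leftarrow>J n t. norm ((f b - f a) - s *\<^sub>R (q b - q a)))"
    by (simp add: sum_list_const_mult split_def)
  also have "\<dots> <= ?N * \<eta> n" by (intro mult_left_mono residual t N)
  finally show ?thesis by (simp add: mult_ac)
qed

lemma measurable_rate:
  assumes [measurable]: "case_prod \<phi> \<in> borel_measurable (lborel \<Otimes>\<^sub>M lborel)"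
  shows "set_borel_measurable lborel {0<..<T} (\<lambda>t. rate n t (\<phi> t))"
proof -
  have [measurable]: "case_prod (\<lambda>t. fourier (\<phi> t)) \<in> borel_measurable (lborel \<Otimes>\<^sub>M lborel)"
  proof -
    have "(\<lambda>p. fourier (\<phi> (fst p)) (snd p)) \<in> borel_measurable (lborel \<Otimes>\<^sub>M lborel)"
      by (rule measurable_fourier) measurable
    then show ?thesis by (simp add: case_prod_beta')
  qed
  define R where "R = (\<lambda>m t. - (\<Sum>(x, s, a, b)\<leftarrow>drift t (Jm n m). (s *\<^sub>R (q b - q a)) \<bullet> inv_fourier (fourier (\<phi> t)) x))"
  have "(\<lambda>t. \<Sum>(x, s, a, b)\<leftarrow>drift t js. (s *\<^sub>R (q b - q a)) \<bullet> inv_fourier (fourier (\<phi> t)) x) \<in> borel_measurable lborel" for js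
  proof (induction js)
    case (Cons j js)
    obtain x s a b where j: "j = (x, s, a, b)" by (cases j) auto
    have 1: "(\<lambda>t. inv_fourier (fourier (\<phi> t)) (x + t * s)) \<in> borel_measurable lborel"
      by (rule measurable_inv_fourier) measurable
    have "(\<lambda>t. (s *\<^sub>R (q b - q a)) \<bullet> inv_fourier (fourier (\<phi> t)) (x + t * s)) \<in> borel_measurable lborel"
      by (intro borel_measurable_inner 1 measurable_const) auto
    then show ?case using Cons by (simp add: j drift_def)
  qed (simp add: drift_def)
  then have Rm: "R m \<in> borel_measurable lborel" for m
    unfolding R_def by (intro borel_measurable_uminus)
  have "(\<lambda>t. R (idx n t) t) \<in> borel_measurable lborel"
    by (rule measurable_compose_countable[OF Rm idx])
  then have "(\<lambda>t. indicator {0<..<T} t *\<^sub>R R (idx n t) t) \<in> borel_measurable lborel"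
    by measurable
  also have "(\<lambda>t. indicator {0<..<T} t *\<^sub>R R (idx n t) t) = (\<lambda>t. indicator {0<..<T} t *\<^sub>R rate n t (\<phi> t))"
    by (auto simp: fun_eq_iff rate_def R_def motion split: split_indicator)
  finally show ?thesis by (simp add: set_borel_measurable_def)
qed

lemma hpair_density_eq:
  assumes t: "t \<in> {0..T}" and \<phi>: "\<phi> \<in> Htest b l r"
  shows "hpair (hat_U l r q n t) (fourier \<phi>) =
    (LINT x|lborel. cut l r (\<lambda>x. q (U n t x)) x \<bullet> inv_fourier (fourier \<phi>) x)"
  unfolding cut_hat_def
  by (rule hpair_fourier_eq_integral[OF integrable_cut_U[OF t] HtestD(2)[OF b \<phi>]])

text \<open>Integration of the representative turns the pairing into a sum over jumps of a primitive \<open>\<Theta>\<close> at their positions; the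
constant \<open>c\<close> belongs to the left end state. The primitive is taken from a point beyond all jumps and beyond \<open>(l,r)\<close>.\<close>

lemma hpair_density_jumps:
  assumes \<phi>: "\<phi> \<in> Htest b l r" and lr: "l < r"
  obtains c \<Theta> where "\<And>n t. t \<in> {0..T} ==> hpair (hat_U l r q n t) (fourier \<phi>) = q (ul n) \<bullet> c +
      (\<Sum>(x, s, a, b)\<leftarrow>J n t. (q b - q a) \<bullet> \<Theta> x)"
    "\<And>x. x \<in> {xa..xb} ==> (\<Theta> has_vector_derivative - inv_fourier (fourier \<phi>) x) (at x)"
proof -
  define \<psi> where "\<psi> = inv_fourier (fourier \<phi>)"
  have \<psi>: "continuous_on UNIV \<psi>" "\<And>x. x \<notin> {l<..<r} ==> \<psi> x = 0"
    using HtestD(4,6)[OF b \<phi>] by (auto simp: \<psi>_def)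
  have [measurable]: "\<psi> \<in> borel_measurable borel" using \<psi>(1) by (rule borel_measurable_continuous_onI)
  define p where "p = min l xa - 1"
  define z where "z = max r xb + 1"
  have pz: "p < l" "r < z" "p < xa" "xb < z" by (auto simp: p_def z_def)
  define \<Phi> where "\<Phi> = (\<lambda>y. integral {p..y} \<psi>)"
  define \<Theta> where "\<Theta> = (\<lambda>y. \<Phi> z - \<Phi> y)"
  have \<Phi>: "(\<Phi> has_vector_derivative \<psi> y) (at y within {p..z})" if "y \<in> {p..z}" for y
    unfolding \<Phi>_def by (rule integral_has_vector_derivative) (use \<psi>(1) that in \<open>auto intro: continuous_on_subset\<close>)
  have int\<psi>: "integrable lborel (\<lambda>x. indicator {y..z} x *\<^sub>R \<psi> x)" for y
    using borel_integrable_compact[of "{y..z}" \<psi>] \<psi>(1) by (auto intro: continuous_on_subset)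
  have I: "(LINT x|lborel. indicator {y..z} x *\<^sub>R \<psi> x) = \<Theta> y" if y: "y \<in> {p..z}" for y
    unfolding \<Theta>_def
  proof (rule integral_FTC_Icc)
    show "(\<Phi> has_vector_derivative \<psi> x) (at x within {y..z})" if "y <= x" "x <= z" for x
      by (rule has_vector_derivative_within_subset[OF \<Phi>]) (use y that in auto)
  qed (use y \<psi>(1) in \<open>auto intro: continuous_on_subset\<close>)
  show ?thesis
  proof (rule that)
    show "(\<Theta> has_vector_derivative - inv_fourier (fourier \<phi>) x) (at x)" if "x \<in> {xa..xb}" for x
    proof -
      have x: "x \<in> interior {p..z}" "x \<in> {p..z}" using that pz by auto
      have "(\<Phi> has_vector_derivative \<psi> x) (at x)" using \<Phi>[OF x(2)] at_within_interior[OF x(1)] by simp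
      then show ?thesis unfolding \<Theta>_def by (auto intro!: derivative_eq_intros simp: \<psi>_def)
    qed
    fix n t assume t: "t \<in> {0..T}"
    have step: "integrable lborel (\<lambda>x. indicator {p..z} x * (step_fn g0 js x \<bullet> \<psi> x)) \<and>
      (LINT x|lborel. indicator {p..z} x * (step_fn g0 js x \<bullet> \<psi> x)) = g0 \<bullet> \<Theta> p + (\<Sum>(y, v)\<leftarrow>js. v \<bullet> \<Theta> y)"
      if "\<And>y v. (y, v) \<in> set js ==> y \<in> {xa..xb}" for js g0
      using that
    proof (induction js)
      case Nil
      have "(LINT x|lborel. g0 \<bullet> (indicator {p..z} x *\<^sub>R \<psi> x)) = g0 \<bullet> \<Theta> p"
        using I[of p] pz lr by (subst integral_inner_right[OF int\<psi>]) auto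
      then show ?case using int\<psi>[of p] integrable_inner_right[of g0 lborel "\<lambda>x. indicator {p..z} x *\<^sub>R \<psi> x"] by simp
    next
      case (Cons j js)
      obtain y v where j: "j = (y, v)" by force
      have y: "y \<in> {p..z}" using Cons.prems[of y v] pz by (auto simp: j)
      have ae: "AE x in lborel. indicator {p..z} x * (heaviside (x - y) *\<^sub>R v \<bullet> \<psi> x) = v \<bullet> (indicator {y..z} x *\<^sub>R \<psi> x)"
        using AE_lborel_singleton[of y] by eventually_elim (use y in \<open>auto simp: heaviside_def split: split_indicator\<close>)
      have i1: "integrable lborel (\<lambda>x. v \<bullet> (indicator {y..z} x *\<^sub>R \<psi> x))"
        by (rule integrable_inner_right[OF int\<psi>])
      have i: "integrable lborel (\<lambda>x. indicator {p..z} x * (heaviside (x - y) *\<^sub>R v \<bullet> \<psi> x))"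
        by (subst integrable_cong_AE[OF _ _ ae]) (use i1 in auto)
      have "(LINT x|lborel. indicator {p..z} x * (heaviside (x - y) *\<^sub>R v \<bullet> \<psi> x)) = (LINT x|lborel. v \<bullet> (indicator {y..z} x *\<^sub>R \<psi> x))"
        by (rule integral_cong_AE[OF _ _ ae]) auto
      also have "\<dots> = v \<bullet> \<Theta> y" by (subst integral_inner_right[OF int\<psi>]) (simp only: I[OF y])
      finally have 2: "(LINT x|lborel. indicator {p..z} x * (heaviside (x - y) *\<^sub>R v \<bullet> \<psi> x)) = v \<bullet> \<Theta> y" .
      have "\<And>y v. (y, v) \<in> set js ==> y \<in> {xa..xb}" using Cons.prems by (meson list.set_intros(2))
      note IH = Cons.IH[OF this]
      show ?case using i 2 IH unfolding j step_fn_Cons inner_add_left distrib_left by simp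
    qed
    let ?js = "jumps_of q (J n t)"
    have "(LINT x|lborel. cut l r (\<lambda>x. q (U n t x)) x \<bullet> \<psi> x) = (LINT x|lborel. indicator {p..z} x * (step_fn (q (ul n)) ?js x \<bullet> \<psi> x))"
    proof (rule integral_cong_AE)
      show "AE x in lborel. cut l r (\<lambda>x. q (U n t x)) x \<bullet> \<psi> x = indicator {p..z} x * (step_fn (q (ul n)) ?js x \<bullet> \<psi> x)"
        using AE_compose[OF t, of q n] by eventually_elim (use \<psi>(2) pz in \<open>auto simp: cut_def split: split_indicator\<close>)
    qed (use measurable_hU[OF t, of q n] in \<open>auto intro!: cut_measurable borel_measurable_inner\<close>)
    also have "\<dots> = q (ul n) \<bullet> \<Theta> p + (\<Sum>(y, v)\<leftarrow>?js. v \<bullet> \<Theta> y)"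
      using step[of ?js "q (ul n)"] jumps[OF t] by (fastforce simp: jumps_of_def)
    finally show "hpair (hat_U l r q n t) (fourier \<phi>) = q (ul n) \<bullet> \<Theta> p + (\<Sum>(x, s, a, b)\<leftarrow>J n t. (q b - q a) \<bullet> \<Theta> x)"
      unfolding hpair_density_eq[OF t \<phi>] \<psi>_def[symmetric] by (simp add: jumps_of_def comp_def split_def)
  qed
qed

text \<open>The pairing is Lipschitz in time, and off the finitely many event times, where the jumps drift, it is differentiable with
derivative \<open>rate\<close> by \<open>hpair_density_jumps\<close>. The fundamental theorem of calculus tolerates finitely many exceptional points if the
function is continuous. In particular events do not contribute.\<close>

lemma conservation:
  assumes \<phi>: "\<phi> \<in> Htest b l r" and lr: "l < r" and t: "t \<in> {0..T}"
  shows "hpair (hat_U l r q n t) (fourier \<phi>) = hpair (hat_U l r q n 0) (fourier \<phi>) +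
    (LINT \<tau>:{0<..<t}|lborel. rate n \<tau> \<phi>)"
proof -
  define P where "P = (\<lambda>t. hpair (hat_U l r q n t) (fourier \<phi>))"
  obtain c \<Theta> where c: "\<And>n t. t \<in> {0..T} ==> hpair (hat_U l r q n t) (fourier \<phi>) = q (ul n) \<bullet> c +
      (\<Sum>(x, s, a, b)\<leftarrow>J n t. (q b - q a) \<bullet> \<Theta> x)"
    and \<Theta>: "\<And>x. x \<in> {xa..xb} ==> (\<Theta> has_vector_derivative - inv_fourier (fourier \<phi>) x) (at x)"
    using hpair_density_jumps[OF \<phi> lr] by blast
  let ?N = "eval_norm b * Hs_norm b (fourier \<phi>)"
  have Plip: "\<bar>P s - P s'\<bar> <= ?N * (B * \<Lambda>) * \<bar>s - s'\<bar>" if ss: "s \<in> {0..T}" "s' \<in> {0..T}" for s s'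
  proof -
    let ?\<psi> = "inv_fourier (fourier \<phi>)"
    have [measurable]: "?\<psi> \<in> borel_measurable borel" using HtestD(6)[OF b \<phi>] by (rule borel_measurable_continuous_onI)
    have i: "integrable lborel (\<lambda>x. cut l r (\<lambda>x. q (U n s x)) x \<bullet> ?\<psi> x)" if "s \<in> {0..T}" for s
    proof (rule Bochner_Integration.integrable_bound)
      show "integrable lborel (\<lambda>x. ?N * norm (cut l r (\<lambda>x. q (U n s x)) x))"
        using integrable_cut_U[OF that, of l r q n] by simp
      show "AE x in lborel. norm (cut l r (\<lambda>x. q (U n s x)) x \<bullet> ?\<psi> x) <= norm (?N * norm (cut l r (\<lambda>x. q (U n s x)) x))"
      proof (intro AE_I2)
        fix x
        have "\<bar>cut l r (\<lambda>x. q (U n s x)) x \<bullet> ?\<psi> x\<bar> <= norm (cut l r (\<lambda>x. q (U n s x)) x) * norm (?\<psi> x)"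
          by (rule Cauchy_Schwarz_ineq2)
        also have "\<dots> <= norm (cut l r (\<lambda>x. q (U n s x)) x) * ?N"
          by (intro mult_left_mono HtestD(5)[OF b \<phi>]) auto
        finally show "norm (cut l r (\<lambda>x. q (U n s x)) x \<bullet> ?\<psi> x) <= norm (?N * norm (cut l r (\<lambda>x. q (U n s x)) x))"
          by (simp add: mult.commute abs_mult eval_norm_nonneg Hs_norm_nonneg)
      qed
    qed (use measurable_hU[OF that, of q n] in \<open>auto intro!: cut_measurable borel_measurable_inner\<close>)
    have "P s - P s' = (LINT x|lborel. (cut l r (\<lambda>x. q (U n s x)) x - cut l r (\<lambda>x. q (U n s' x)) x) \<bullet> ?\<psi> x)"
      unfolding P_def hpair_density_eq[OF ss(1) \<phi>] hpair_density_eq[OF ss(2) \<phi>]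
      using i[OF ss(1)] i[OF ss(2)] by (simp add: inner_diff_left)
    also have "\<bar>\<dots>\<bar> <= (LINT x|lborel. ?N * norm (q (U n s x) - q (U n s' x)))"
      unfolding real_norm_def[symmetric]
    proof (rule order.trans[OF integral_norm_bound integral_mono'])
      show "integrable lborel (\<lambda>x. ?N * norm (q (U n s x) - q (U n s' x)))"
        using lipschitz_time_hU(1)[OF q ss(2,1), of n] by simp
      fix x
      let ?d = "cut l r (\<lambda>x. q (U n s x)) x - cut l r (\<lambda>x. q (U n s' x)) x"
      have "\<bar>?d \<bullet> ?\<psi> x\<bar> <= norm ?d * norm (?\<psi> x)" by (rule Cauchy_Schwarz_ineq2)
      also have "\<dots> <= norm (q (U n s x) - q (U n s' x)) * ?N"
        by (intro mult_mono HtestD(5)[OF b \<phi>]) (auto simp: cut_def)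
      finally show "norm (?d \<bullet> ?\<psi> x) <= ?N * norm (q (U n s x) - q (U n s' x))" by (simp add: mult.commute)
    qed (simp add: eval_norm_nonneg Hs_norm_nonneg)
    also have "\<dots> <= ?N * (B * \<Lambda> * \<bar>s - s'\<bar>)"
      using lipschitz_time_hU(2)[OF q ss(2,1), of n] by (simp add: mult_left_mono eval_norm_nonneg Hs_norm_nonneg)
    finally show ?thesis by (simp add: mult_ac)
  qed
  have Pcont: "continuous_on {0..t} P"
  proof (rule continuous_on_subset)
    show "continuous_on {0..T} P"
      using Plip Lam_nonneg lip_on_K_nonneg[OF q]
      by (intro lipschitz_on_continuous_on[of "?N * (B * \<Lambda>)"] lipschitz_onI) (auto simp: dist_real_def eval_norm_nonneg Hs_norm_nonneg)
  qed (use t in auto)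
  have deriv: "(P has_vector_derivative rate n s \<phi>) (at s)" if s: "s \<in> {0<..<T} - X n" for s
  proof -
    have s0: "s \<in> {0..T}" using s by auto
    define js where "js = Jm n (idx n s)"
    have ev: "eventually (\<lambda>t'. P t' = q (ul n) \<bullet> c + (\<Sum>(x, v, a, b)\<leftarrow>js. (q b - q a) \<bullet> \<Theta> (x + t' * v))) (nhds s)"
    proof -
      have "eventually (\<lambda>t'. t' \<in> {0<..<T}) (nhds s)"
        by (rule eventually_nhds_in_open) (use s in auto)
      with X(2)[OF s] show ?thesis
      proof eventually_elim
        case (elim t')
        then have "t' \<in> {0..T}" by auto
        then show ?case unfolding P_def c[OF \<open>t' \<in> {0..T}\<close>] motion[OF \<open>t' \<in> {0..T}\<close>] elim(1)
          by (simp add: js_def drift_def comp_def split_def)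
      qed
    qed
    have "x + s * v \<in> {xa..xb}" if "(x, v, a, b) \<in> set js" for x v a b
    proof -
      have "(x + s * v, v, a, b) \<in> set (J n s)"
        using that unfolding motion[OF s0] drift_def js_def[symmetric] by force
      then show ?thesis using jumps[OF s0] by blast
    qed
    then have "((\<lambda>t'. \<Sum>(x, v, a, b)\<leftarrow>js. (q b - q a) \<bullet> \<Theta> (x + t' * v)) has_vector_derivative
       - (\<Sum>(x, v, a, b)\<leftarrow>js. (v *\<^sub>R (q b - q a)) \<bullet> inv_fourier (fourier \<phi>) (x + s * v))) (at s)"
    proof (induction js)
      case (Cons j js)
      obtain x v a b where j: "j = (x, v, a, b)" by (cases j) auto
      have "x + s * v \<in> {xa..xb}" using Cons.prems[of x v a b] by (simp add: j)
      note \<Theta>' = \<Theta>[OF this]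
      have "((\<lambda>t'. \<Theta> (x + t' * v)) has_vector_derivative v *\<^sub>R (- inv_fourier (fourier \<phi>) (x + s * v))) (at s)"
      proof -
        have "((\<lambda>t'. x + t' * v) has_vector_derivative v) (at s)"
          by (auto simp: has_real_derivative_iff_has_vector_derivative[symmetric] intro!: derivative_eq_intros)
        from vector_diff_chain_at[OF this \<Theta>'] show ?thesis by (simp add: comp_def)
      qed
      from bounded_linear.has_vector_derivative[OF bounded_linear_inner_right this, of "q b - q a"]
      have "((\<lambda>t'. (q b - q a) \<bullet> \<Theta> (x + t' * v)) has_vector_derivative - ((v *\<^sub>R (q b - q a)) \<bullet> inv_fourier (fourier \<phi>) (x + s * v))) (at s)"
        by simp
      moreover have "\<And>x v a b. (x, v, a, b) \<in> set js ==> x + s * v \<in> {xa..xb}" 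
        using Cons.prems by (meson list.set_intros(2))
      from has_vector_derivative_add[OF calculation Cons.IH[OF this]] show ?case by (simp add: j)
    qed simp
    then have "((\<lambda>t'. q (ul n) \<bullet> c + (\<Sum>(x, v, a, b)\<leftarrow>js. (q b - q a) \<bullet> \<Theta> (x + t' * v))) has_vector_derivative rate n s \<phi>) (at s)"
      using has_vector_derivative_add[OF has_vector_derivative_const] 
      unfolding rate_def motion[OF s0] js_def[symmetric] drift_def by (fastforce simp: comp_def split_def)
    moreover have "P s = q (ul n) \<bullet> c + (\<Sum>(x, v, a, b)\<leftarrow>js. (q b - q a) \<bullet> \<Theta> (x + s * v))"
      using ev by (rule eventually_nhds_x_imp_x)
    ultimately show ?thesis
      by (subst has_vector_derivative_cong_ev[where g = "\<lambda>t'. q (ul n) \<bullet> c + (\<Sum>(x, v, a, b)\<leftarrow>js. (q b - q a) \<bullet> \<Theta> (x + t' * v))"])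
        (use ev in \<open>auto elim!: eventually_mono\<close>)
  qed
  have hk: "((\<lambda>s. rate n s \<phi>) has_integral (P t - P 0)) {0..t}"
    by (rule fundamental_theorem_of_calculus_interior_strong[OF X(1)[of n] _ _ Pcont]) (use t deriv in auto)
  have bm: "set_borel_measurable lborel {0<..<T} (\<lambda>s. rate n s \<phi>)"
  proof (rule measurable_rate)
    have "\<phi> \<in> borel_measurable lborel" using HtestD(3)[OF b \<phi>] by auto
    from measurable_compose[OF measurable_snd this]
    show "(\<lambda>(t, y). \<phi> y) \<in> borel_measurable (lborel \<Otimes>\<^sub>M lborel)" unfolding case_prod_beta' .
  qed
  have si: "set_integrable lborel {0<..<t} (\<lambda>s. rate n s \<phi>)"
    unfolding set_integrable_def
  proof (rule Bochner_Integration.integrable_bound)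
    show "integrable lborel (\<lambda>s. indicator {0<..<t} s * (\<sigma> * (B * V) * ?N))"
      using t by simp
    have "set_borel_measurable lborel {0<..<t} (\<lambda>s. rate n s \<phi>)"
      by (rule set_borel_measurable_subset[OF bm]) (use t in auto)
    then show "(\<lambda>s. indicator {0<..<t} s *\<^sub>R rate n s \<phi>) \<in> borel_measurable lborel"
      by (simp add: set_borel_measurable_def)
    show "AE s in lborel. norm (indicator {0<..<t} s *\<^sub>R rate n s \<phi>) <= norm (indicator {0<..<t} s * (\<sigma> * (B * V) * ?N))"
      using rate_bound[OF _ \<phi>, of _ n] t by (auto intro!: AE_I2 intro: order.trans[OF _ abs_ge_self] simp: mult.assoc split: split_indicator)
  qed
  from hk have "integral {0<..<t} (\<lambda>s. rate n s \<phi>) = P t - P 0"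
    unfolding has_integral_Icc_iff_Ioo by (rule integral_unique)
  then show ?thesis
    using set_borel_integral_eq_integral(2)[OF si] by (simp add: P_def)
qed

lemma measurable_const_pair: "\<Psi> \<in> borel_measurable lborel ==> case_prod (\<lambda>_. \<Psi>) \<in> borel_measurable (lborel \<Otimes>\<^sub>M lborel)"
  unfolding case_prod_beta' by (rule measurable_compose[OF measurable_snd])

lemma cut_hat_U_continuous:
  fixes h :: "real^'n => real^'n"
  shows "t \<in> {0..T} ==> continuous_on UNIV (hat_U l r h n t)"
  unfolding cut_hat_def by (rule continuous_fourier[OF integrable_cut_U])

lemma measurable_hpair_U:
  assumes "lip_on_K h B'" "case_prod \<Psi> \<in> borel_measurable (lborel \<Otimes>\<^sub>M lborel)"
  shows "set_borel_measurable lborel {0<..<T} (\<lambda>t. hpair (hat_U l r h n t) (\<Psi> t))"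
  by (rule measurable_hpair_time[OF T cut_hat_U_continuous lipschitz_cut_hat_U[OF assms(1)] assms(2)])

lemma Linf_H_U:
  assumes h: "lip_on_K h B'" and lr: "l < r"
  shows "Linf_H T (1 - b) l r (\<lambda>t x. h (U n t x))"
  unfolding Linf_H_def
proof (intro conjI exI[of _ "(2 + (r - l)) * total B' * eval_norm b"] ballI)
  fix t assume "t \<in> {0<..<T}"
  then have t: "t \<in> {0..T}" by auto
  show "integrable lborel (cut l r (\<lambda>x. h (U n t x)))" by (rule integrable_cut_U[OF t])
  have m: "hat_U l r h n t \<in> borel_measurable borel"
    by (rule borel_measurable_continuous_onI[OF cut_hat_U_continuous[OF t]])
  show "hat_U l r h n t \<in> Hs (1 - b)"
    "Hs_norm (1 - b) (hat_U l r h n t) <= (2 + (r - l)) * total B' * eval_norm b"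
    using decays_Hs[OF b m decays_cut_hat_U[OF h t lr]] by auto
next
  fix \<Psi> :: "real => complex^'n" assume "\<Psi> \<in> Hs (- (1 - b))"
  then have "\<Psi> \<in> borel_measurable lborel" using HsD(1) by auto
  from measurable_hpair_U[OF h measurable_const_pair[OF this]]
  show "set_borel_measurable lborel {0<..<T} (\<lambda>t. hpair (hat_U l r h n t) \<Psi>)" .
qed

lemma rate_linear:
  assumes "\<phi> \<in> Htest b l r" "\<psi> \<in> Htest b l r"
  shows "rate n t (\<lambda>x. c *\<^sub>R \<phi> x + d *\<^sub>R \<psi> x) = c * rate n t \<phi> + d * rate n t \<psi>"
proof -
  have "(\<Sum>p\<leftarrow>js. F p \<bullet> (c *\<^sub>R x p + d *\<^sub>R y p)) = c * (\<Sum>p\<leftarrow>js. F p \<bullet> x p) + d * (\<Sum>p\<leftarrow>js. F p \<bullet> y p)"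
    for js :: "'n jump list" and F x y :: "_ => real^'n"
    by (induction js) (auto simp: inner_add_right algebra_simps)
  note lin = this
  show ?thesis
    unfolding rate_def split_def inv_fourier_lincomb[OF b assms]
    by (simp only: lin minus_add_distrib mult_minus_right)
qed

lemma Htest_measurable: "\<phi> \<in> Htest b l r ==> \<phi> \<in> borel_measurable lborel"
  by (rule borel_measurable_integrable[OF HtestD(3)[OF b]])

lemma measurable_rate_const: "\<phi> \<in> Htest b l r ==> set_borel_measurable lborel {0<..<T} (\<lambda>t. rate n t \<phi>)"
  by (rule measurable_rate[OF measurable_const_pair[OF Htest_measurable]])

lemma W1inf_U:
  assumes lr: "l < r"
  shows "W1inf T b l r (\<lambda>t x. q (U n t x)) (rate n)"
  unfolding W1inf_def
proof (intro conjI)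
  show "Linf_H T (1 - b) l r (\<lambda>t x. q (U n t x))" by (rule Linf_H_U[OF q lr])
  show "Linf_dual T b l r (rate n)"
    unfolding Linf_dual_def
  proof (intro conjI ballI allI exI[of _ "\<sigma> * (B * V) * eval_norm b"])
    show "rate n t (\<lambda>x. c *\<^sub>R \<phi> x + d *\<^sub>R \<psi> x) = c * rate n t \<phi> + d * rate n t \<psi>"
      if "\<phi> \<in> Htest b l r" "\<psi> \<in> Htest b l r" for t \<phi> \<psi> c d
      by (rule rate_linear[OF that])
    show "\<bar>rate n t \<phi>\<bar> <= \<sigma> * (B * V) * eval_norm b * Hs_norm b (fourier \<phi>)" if "t \<in> {0<..<T}" "\<phi> \<in> Htest b l r" for t \<phi>
      using rate_bound[OF _ that(2), of t n] that(1) by auto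
    show "set_borel_measurable lborel {0<..<T} (\<lambda>t. rate n t \<phi>)" if "\<phi> \<in> Htest b l r" for \<phi>
      by (rule measurable_rate_const[OF that])
  qed
  show "gelfand_derivative T b l r (\<lambda>t x. q (U n t x)) (rate n)"
    unfolding gelfand_derivative_def
  proof (intro allI impI ballI)
    fix \<eta> and \<phi> :: "real => real^'n" assume \<eta>: "smooth_compact T \<eta>" and \<phi>: "\<phi> \<in> Htest b l r"
    show "(LINT t:{0<..<T}|lborel. deriv \<eta> t * hpair (hat_U l r q n t) (fourier \<phi>)) =
      - (LINT t:{0<..<T}|lborel. \<eta> t * rate n t \<phi>)"
    proof (rule integral_by_parts_primitive[OF T measurable_rate_const[OF \<phi>] _ _ \<eta>])
      show "\<bar>rate n t \<phi>\<bar> <= \<sigma> * (B * V) * eval_norm b * Hs_norm b (fourier \<phi>)" if "t \<in> {0<..<T}" for t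
        by (rule rate_bound[OF _ \<phi>]) (use that in auto)
      show "hpair (hat_U l r q n t) (fourier \<phi>) = hpair (hat_U l r q n 0) (fourier \<phi>) +
          (LINT \<tau>:{0<..<t}|lborel. rate n \<tau> \<phi>)" if "t \<in> {0<..<T}" for t
        by (rule conservation[OF \<phi> lr]) (use that in auto)
    qed
  qed
qed

end

section \<open>Passage to the limit\<close>

text \<open>\<open>k\<close> and \<open>u\<close> are as provided by \<open>exists_limit\<close>.\<close>

locale tracking_limit = tracking_system T xa xb \<sigma> V \<Lambda> K \<Omega> U ul J uo f q B \<eta> idx Jm X b
  for T xa xb \<sigma> V \<Lambda> :: real and K \<Omega> :: "(real^'n::finite) set"
    and U :: "nat => real => real => real^'n" and ul :: "nat => real^'n"
    and J :: "nat => real => 'n jump list" and uo :: "real => real^'n"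
    and f q :: "real^'n => real^'n" and B :: real and \<eta> :: "nat => real"
    and idx :: "nat => real => nat" and Jm :: "nat => nat => 'n jump list" and X :: "nat => real set" and b :: real +
  fixes k :: "nat => nat" and u :: "real => real => real^'n"
  assumes k: "strict_mono k"
    and lim: "\<And>t. t \<in> {0..T} ==> AE x in lborel. (\<lambda>j. U (k j) t x) \<longlonglongrightarrow> u t x"
    and u_K: "\<And>t. t \<in> {0..T} ==> AE x in lborel. u t x \<in> K"
    and u_\<Omega>: "\<And>t x. u t x \<in> \<Omega>" and u_0: "u 0 = uo" and u_m: "\<And>t. t \<in> {0..T} ==> u t \<in> borel_measurable borel"
begin

abbreviation hat_u :: "real => real => (real^'n => real^'n) => real => real => complex^'n" where
  "hat_u l r h t \<equiv> cut_hat l r (\<lambda>x. h (u t x))"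

lemma measurable_hu:
  assumes h: "lip_on_K h B'" and t: "t \<in> {0..T}"
  shows "(\<lambda>x. h (u t x)) \<in> borel_measurable borel"
proof -
  have "(\<lambda>v. indicator \<Omega> v *\<^sub>R h v) \<in> borel_measurable borel"
    using \<Omega> h by (intro borel_measurable_continuous_on_indicator) (auto simp: lip_on_K_def)
  from measurable_compose[OF u_m[OF t] this] show ?thesis using u_\<Omega> by simp
qed

lemma integrable_cut_u:
  assumes h: "lip_on_K h B'" and t: "t \<in> {0..T}"
  shows "integrable lborel (cut l r (\<lambda>x. h (u t x)))"
proof (rule Bochner_Integration.integrable_bound)
  show "integrable lborel (\<lambda>x. indicator {l<..<r} x * B')" by (cases "l <= r") auto
  show "AE x in lborel. norm (cut l r (\<lambda>x. h (u t x)) x) <= norm (indicator {l<..<r} x * B')"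
    using u_K[OF t] by eventually_elim (use h in \<open>auto simp: cut_def lip_on_K_def split: split_indicator intro: order.trans[OF _ abs_ge_self]\<close>)
qed (use measurable_hu[OF h t] in \<open>auto intro!: cut_measurable\<close>)

lemma cut_hat_tendsto:
  assumes h: "lip_on_K h B'" and t: "t \<in> {0..T}"
  shows "(\<lambda>j. hat_U l r h (k j) t \<xi>) \<longlonglongrightarrow> hat_u l r h t \<xi>"
  unfolding cut_hat_def fourier_eq(2)[OF integrable_cut_U[OF t]] fourier_eq(2)[OF integrable_cut_u[OF h t]]
proof (rule integral_dominated_convergence)
  have aeK: "AE x in lborel. \<forall>n. U n t x \<in> K"
    using AE_values[OF t] by (simp add: AE_all_countable)
  show "integrable lborel (\<lambda>x. indicator {l<..<r} x * B')" by (cases "l <= r") auto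
  show "AE x in lborel. (\<lambda>j. cscale (cis (- (\<xi> * x))) (cut l r (\<lambda>x. h (U (k j) t x)) x)) \<longlonglongrightarrow>
      cscale (cis (- (\<xi> * x))) (cut l r (\<lambda>x. h (u t x)) x)"
    using lim[OF t]
  proof eventually_elim
    case (elim x)
    have "isCont h (u t x)"
      using h u_\<Omega> \<Omega>(1) by (auto simp: lip_on_K_def continuous_on_eq_continuous_at)
    then have "(\<lambda>j. h (U (k j) t x)) \<longlonglongrightarrow> h (u t x)" using elim by (rule isCont_tendsto_compose)
    then have "(\<lambda>j. cut l r (\<lambda>x. h (U (k j) t x)) x) \<longlonglongrightarrow> cut l r (\<lambda>x. h (u t x)) x"
      by (auto simp: cut_def)
    then show ?case by (rule cscale.tendsto[OF tendsto_const])
  qed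
  show "AE x in lborel. norm (cscale (cis (- (\<xi> * x))) (cut l r (\<lambda>x. h (U (k j) t x)) x)) <= indicator {l<..<r} x * B'" for j
    using aeK by eventually_elim (use h in \<open>auto simp: norm_cscale cut_def lip_on_K_def\<close>)
  show "(\<lambda>x. cscale (cis (- (\<xi> * x))) (cut l r (\<lambda>x. h (u t x)) x)) \<in> borel_measurable lborel"
    using measurable_hu[OF h t] by (intro measurable_cscale) (auto intro!: cut_measurable)
  show "(\<lambda>x. cscale (cis (- (\<xi> * x))) (cut l r (\<lambda>x. h (U (k j) t x)) x)) \<in> borel_measurable lborel" for j
    using measurable_hU[OF t] by (intro measurable_cscale) (auto intro!: cut_measurable)
qed

lemma decays_cut_hat_u:
  "lip_on_K h B' ==> t \<in> {0..T} ==> l < r ==> decays ((2 + (r - l)) * total B') (hat_u l r h t)"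
  by (rule decays_lim[OF decays_cut_hat_U cut_hat_tendsto])

lemma lipschitz_cut_hat_u:
  assumes h: "lip_on_K h B'" and st: "s \<in> {0..T}" "t \<in> {0..T}"
  shows "norm (hat_u l r h t \<xi> - hat_u l r h s \<xi>) <= B' * \<Lambda> * \<bar>t - s\<bar>"
  by (rule LIMSEQ_le_const2[OF tendsto_norm[OF tendsto_diff[OF cut_hat_tendsto[OF h st(2)] cut_hat_tendsto[OF h st(1)]]]])
    (use lipschitz_cut_hat_U[OF h st] in auto)

lemma cut_hat_u_continuous: "lip_on_K h B' ==> t \<in> {0..T} ==> continuous_on UNIV (hat_u l r h t)"
  unfolding cut_hat_def by (rule continuous_fourier[OF integrable_cut_u])

lemma measurable_hpair_u:
  assumes "lip_on_K h B'" "case_prod \<Psi> \<in> borel_measurable (lborel \<Otimes>\<^sub>M lborel)"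
  shows "set_borel_measurable lborel {0<..<T} (\<lambda>t. hpair (hat_u l r h t) (\<Psi> t))"
  by (rule measurable_hpair_time[OF T cut_hat_u_continuous[OF assms(1)] lipschitz_cut_hat_u[OF assms(1)] assms(2)])

lemma Linf_H_u:
  assumes h: "lip_on_K h B'" and lr: "l < r"
  shows "Linf_H T (1 - b) l r (\<lambda>t x. h (u t x))"
  unfolding Linf_H_def
proof (intro conjI exI[of _ "(2 + (r - l)) * total B' * eval_norm b"] ballI)
  fix t assume "t \<in> {0<..<T}"
  then have t: "t \<in> {0..T}" by auto
  show "integrable lborel (cut l r (\<lambda>x. h (u t x)))" by (rule integrable_cut_u[OF h t])
  have m: "hat_u l r h t \<in> borel_measurable borel"
    by (rule borel_measurable_continuous_onI[OF cut_hat_u_continuous[OF h t]])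
  show "hat_u l r h t \<in> Hs (1 - b)"
    "Hs_norm (1 - b) (hat_u l r h t) <= (2 + (r - l)) * total B' * eval_norm b"
    using decays_Hs[OF b m decays_cut_hat_u[OF h t lr]] by auto
next
  fix \<Psi> :: "real => complex^'n" assume "\<Psi> \<in> Hs (- (1 - b))"
  then have "\<Psi> \<in> borel_measurable lborel" using HsD(1) by auto
  from measurable_hpair_u[OF h measurable_const_pair[OF this]]
  show "set_borel_measurable lborel {0<..<T} (\<lambda>t. hpair (hat_u l r h t) \<Psi>)" .
qed

lemma hpair_U_tendsto:
  assumes h: "lip_on_K h B'" and t: "t \<in> {0..T}" and lr: "l < r" and \<Psi>: "\<Psi> \<in> Hs (- (1 - b))"
  shows "(\<lambda>j. hpair (hat_U l r h (k j) t) \<Psi>) \<longlonglongrightarrow> hpair (hat_u l r h t) \<Psi>"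
  by (rule hpair_tendsto[OF b borel_measurable_continuous_onI[OF cut_hat_U_continuous[OF t]] decays_cut_hat_U[OF h t lr] \<Psi> cut_hat_tendsto[OF h t]])

lemma hpair_U_bound:
  assumes h: "lip_on_K h B'" and t: "t \<in> {0..T}" and lr: "l < r" and \<Psi>: "\<Psi> \<in> Hs (- (1 - b))"
  shows "\<bar>hpair (hat_U l r h n t) \<Psi>\<bar> <= (2 + (r - l)) * total B' * eval_norm b * Hs_norm (- (1 - b)) \<Psi>"
  by (rule decays_hpair(2)[OF b borel_measurable_continuous_onI[OF cut_hat_U_continuous[OF t]] decays_cut_hat_U[OF h t lr] \<Psi>])

lemma hpair_u_bound:
  assumes h: "lip_on_K h B'" and t: "t \<in> {0..T}" and lr: "l < r" and \<Psi>: "\<Psi> \<in> Hs (- (1 - b))"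
  shows "\<bar>hpair (hat_u l r h t) \<Psi>\<bar> <= (2 + (r - l)) * total B' * eval_norm b * Hs_norm (- (1 - b)) \<Psi>"
  by (rule decays_hpair(2)[OF b borel_measurable_continuous_onI[OF cut_hat_u_continuous[OF h t]] decays_cut_hat_u[OF h t lr] \<Psi>])

lemma set_integral_dominated_convergence:
  fixes s :: "nat => real => real"
  assumes "set_integrable lborel A w" "\<And>j. set_borel_measurable lborel A (s j)" "set_borel_measurable lborel A g"
    and "\<And>t. t \<in> A ==> (\<lambda>j. s j t) \<longlonglongrightarrow> g t" "\<And>j t. t \<in> A ==> \<bar>s j t\<bar> <= w t"
  shows "(\<lambda>j. LINT t:A|lborel. s j t) \<longlonglongrightarrow> (LINT t:A|lborel. g t)"
  unfolding set_lebesgue_integral_def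
proof (rule integral_dominated_convergence)
  show "integrable lborel (\<lambda>t. indicator A t *\<^sub>R w t)" using assms(1) by (simp add: set_integrable_def)
  show "AE t in lborel. (\<lambda>j. indicator A t *\<^sub>R s j t) \<longlonglongrightarrow> indicator A t *\<^sub>R g t"
    using assms(4) by (intro AE_I2) (auto split: split_indicator)
  show "AE t in lborel. norm (indicator A t *\<^sub>R s j t) <= indicator A t *\<^sub>R w t" for j
    using assms(5) by (intro AE_I2) (auto split: split_indicator)
qed (use assms(2,3) in \<open>auto simp: set_borel_measurable_def\<close>)

lemma weakstar_lim_H_U:
  assumes h: "lip_on_K h B'" and lr: "l < r"
  shows "weakstar_lim_H T (1 - b) l r (\<lambda>j t x. h (U (k j) t x)) (\<lambda>t x. h (u t x))"
  unfolding weakstar_lim_H_def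
proof (intro conjI allI impI)
  show "Linf_H T (1 - b) l r (\<lambda>t x. h (U (k j) t x))" for j by (rule Linf_H_U[OF h lr])
  show "Linf_H T (1 - b) l r (\<lambda>t x. h (u t x))" by (rule Linf_H_u[OF h lr])
  fix \<Psi> :: "real => real => complex^'n" assume a: "case_prod \<Psi> \<in> borel_measurable (lborel \<Otimes>\<^sub>M lborel) \<and> (\<forall>t\<in>{0<..<T}. \<Psi> t \<in> Hs (- (1 - b))) \<and>
    set_integrable lborel {0<..<T} (\<lambda>t. Hs_norm (- (1 - b)) (\<Psi> t))"
  show "(\<lambda>j. LINT t:{0<..<T}|lborel. hpair (hat_U l r h (k j) t) (\<Psi> t)) \<longlonglongrightarrow>
      (LINT t:{0<..<T}|lborel. hpair (hat_u l r h t) (\<Psi> t))"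
  proof (rule set_integral_dominated_convergence)
    show "set_integrable lborel {0<..<T} (\<lambda>t. (2 + (r - l)) * total B' * eval_norm b * Hs_norm (- (1 - b)) (\<Psi> t))"
      using a by simp
    show "\<bar>hpair (hat_U l r h (k j) t) (\<Psi> t)\<bar> <= (2 + (r - l)) * total B' * eval_norm b * Hs_norm (- (1 - b)) (\<Psi> t)"
      if "t \<in> {0<..<T}" for j t
      by (rule hpair_U_bound[OF h _ lr]) (use a that in auto)
    show "(\<lambda>j. hpair (hat_U l r h (k j) t) (\<Psi> t)) \<longlonglongrightarrow> hpair (hat_u l r h t) (\<Psi> t)"
      if "t \<in> {0<..<T}" for t
      by (rule hpair_U_tendsto[OF h _ lr]) (use a that in auto)
  qed (use a in \<open>auto intro!: measurable_hpair_U[OF h] measurable_hpair_u[OF h]\<close>)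
qed

text \<open>The flux terms converge, and the rates differ from them by the residual.\<close>

lemma rate_limit:
  assumes t: "t \<in> {0..T}" and \<phi>: "\<phi> \<in> Htest b l r" and lr: "l < r"
  shows "(\<lambda>j. rate (k j) t \<phi>) \<longlonglongrightarrow> hpair (hat_u l r f t) (Dx (fourier \<phi>))"
proof -
  let ?h = "\<lambda>j. hpair (hat_U l r f (k j) t) (Dx (fourier \<phi>))"
  have "(\<lambda>j. \<eta> (k j) * (eval_norm b * Hs_norm b (fourier \<phi>))) \<longlonglongrightarrow> 0 * (eval_norm b * Hs_norm b (fourier \<phi>))"
    using LIMSEQ_subseq_LIMSEQ[OF \<eta> k] by (intro tendsto_intros) (simp add: comp_def)
  then have "(\<lambda>j. \<eta> (k j) * (eval_norm b * Hs_norm b (fourier \<phi>))) \<longlonglongrightarrow> 0" by simp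
  then have "(\<lambda>j. rate (k j) t \<phi> - ?h j) \<longlonglongrightarrow> 0"
    by (rule Lim_null_comparison[rotated]) (use rate_flux[OF t \<phi> lr] in auto)
  moreover have "?h \<longlonglongrightarrow> hpair (hat_u l r f t) (Dx (fourier \<phi>))"
    by (rule hpair_U_tendsto[OF f t lr Dx_Hs(1)[OF HtestD(1)[OF b \<phi>]]])
  ultimately have "(\<lambda>j. (rate (k j) t \<phi> - ?h j) + ?h j) \<longlonglongrightarrow> 0 + hpair (hat_u l r f t) (Dx (fourier \<phi>))"
    by (rule tendsto_add)
  then show ?thesis by simp
qed

definition limit_rate :: "real => real => real => (real => real^'n) => real" where
  "limit_rate l r t \<phi> = hpair (hat_u l r f t) (Dx (fourier \<phi>))"

lemma measurable_limit_rate: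
  assumes [measurable]: "case_prod \<phi> \<in> borel_measurable (lborel \<Otimes>\<^sub>M lborel)"
  shows "set_borel_measurable lborel {0<..<T} (\<lambda>t. limit_rate l r t (\<phi> t))"
  unfolding limit_rate_def
proof (rule measurable_hpair_u[OF f])
  have [measurable]: "(\<lambda>p. fourier (\<phi> (fst p)) (snd p)) \<in> borel_measurable (lborel \<Otimes>\<^sub>M lborel)"
    by (rule measurable_fourier) measurable
  have "case_prod (\<lambda>t. Dx (fourier (\<phi> t))) = (\<lambda>p. \<chi> i. (\<i> * complex_of_real (snd p)) * fourier (\<phi> (fst p)) (snd p) $ i)"
    by (auto simp: Dx_def fun_eq_iff vec_eq_iff)
  then show "case_prod (\<lambda>t. Dx (fourier (\<phi> t))) \<in> borel_measurable (lborel \<Otimes>\<^sub>M lborel)"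
    by simp
qed

text \<open>Dominated convergence in \<open>conservation\<close>; the rates are bounded by the total size of the jumps times the norm of the test
function.\<close>

lemma limit_conservation:
  assumes \<phi>: "\<phi> \<in> Htest b l r" and lr: "l < r" and t: "t \<in> {0..T}"
  shows "hpair (hat_u l r q t) (fourier \<phi>) = hpair (hat_u l r q 0) (fourier \<phi>) +
    (LINT \<tau>:{0<..<t}|lborel. limit_rate l r \<tau> \<phi>)"
proof (rule LIMSEQ_unique)
  let ?P = "\<lambda>j t. hpair (hat_U l r q (k j) t) (fourier \<phi>)"
  have Hs: "fourier \<phi> \<in> Hs (- (1 - b))"
  proof -
    note H = HsD[OF HtestD(1)[OF b \<phi>]]
    have "integrable lborel (\<lambda>\<xi>. (1 + \<xi>\<^sup>2) powr (- (1 - b)) * (norm (fourier \<phi> \<xi>))\<^sup>2)"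
    proof (rule Bochner_Integration.integrable_bound[OF H(2)])
      show "AE \<xi> in lborel. norm ((1 + \<xi>\<^sup>2) powr (- (1 - b)) * (norm (fourier \<phi> \<xi>))\<^sup>2) <= norm ((1 + \<xi>\<^sup>2) powr b * (norm (fourier \<phi> \<xi>))\<^sup>2)"
        by (intro AE_I2) (auto simp: abs_mult intro!: mult_right_mono powr_mono)
    qed (use H(1) in measurable)
    then show ?thesis using H(1) by (simp add: Hs_def)
  qed
  show "(\<lambda>j. ?P j t) \<longlonglongrightarrow> hpair (hat_u l r q t) (fourier \<phi>)"
    by (rule hpair_U_tendsto[OF q t lr Hs])
  have "(\<lambda>j. LINT \<tau>:{0<..<t}|lborel. rate (k j) \<tau> \<phi>) \<longlonglongrightarrow> (LINT \<tau>:{0<..<t}|lborel. limit_rate l r \<tau> \<phi>)"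
  proof (rule set_integral_dominated_convergence)
    show "set_integrable lborel {0<..<t} (\<lambda>\<tau>. \<sigma> * (B * V) * eval_norm b * Hs_norm b (fourier \<phi>))"
      using t by (simp add: set_integrable_def)
    show "set_borel_measurable lborel {0<..<t} (\<lambda>\<tau>. rate (k j) \<tau> \<phi>)" for j
      by (rule set_borel_measurable_subset[OF measurable_rate_const[OF \<phi>]]) (use t in auto)
    show "set_borel_measurable lborel {0<..<t} (\<lambda>\<tau>. limit_rate l r \<tau> \<phi>)"
      by (rule set_borel_measurable_subset[OF measurable_limit_rate[OF measurable_const_pair[OF Htest_measurable[OF \<phi>]]]]) (use t in auto)
    show "(\<lambda>j. rate (k j) \<tau> \<phi>) \<longlonglongrightarrow> limit_rate l r \<tau> \<phi>" if "\<tau> \<in> {0<..<t}" for \<tau>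
      unfolding limit_rate_def by (rule rate_limit[OF _ \<phi> lr]) (use that t in auto)
    show "\<bar>rate (k j) \<tau> \<phi>\<bar> <= \<sigma> * (B * V) * eval_norm b * Hs_norm b (fourier \<phi>)" if "\<tau> \<in> {0<..<t}" for j \<tau>
      by (rule rate_bound[OF _ \<phi>]) (use that t in auto)
  qed
  moreover have "(\<lambda>j. ?P j 0) \<longlonglongrightarrow> hpair (hat_u l r q 0) (fourier \<phi>)"
    by (rule hpair_U_tendsto[OF q _ lr Hs]) (use T in auto)
  ultimately have "(\<lambda>j. ?P j 0 + (LINT \<tau>:{0<..<t}|lborel. rate (k j) \<tau> \<phi>)) \<longlonglongrightarrow>
      hpair (hat_u l r q 0) (fourier \<phi>) + (LINT \<tau>:{0<..<t}|lborel. limit_rate l r \<tau> \<phi>)"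
    by (intro tendsto_add)
  then show "(\<lambda>j. ?P j t) \<longlonglongrightarrow> hpair (hat_u l r q 0) (fourier \<phi>) + (LINT \<tau>:{0<..<t}|lborel. limit_rate l r \<tau> \<phi>)"
    using conservation[OF \<phi> lr t] by simp
qed

lemma limit_rate_bound:
  assumes t: "t \<in> {0..T}" and \<phi>: "\<phi> \<in> Htest b l r" and lr: "l < r"
  shows "\<bar>limit_rate l r t \<phi>\<bar> <= (2 + (r - l)) * total B * eval_norm b * Hs_norm b (fourier \<phi>)"
proof -
  note Hb = HtestD(1)[OF b \<phi>]
  have "\<bar>limit_rate l r t \<phi>\<bar> <= (2 + (r - l)) * total B * eval_norm b * Hs_norm (- (1 - b)) (Dx (fourier \<phi>))"
    unfolding limit_rate_def by (rule hpair_u_bound[OF f t lr Dx_Hs(1)[OF Hb]])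
  also have "\<dots> <= (2 + (r - l)) * total B * eval_norm b * Hs_norm b (fourier \<phi>)"
    using lr total_nonneg[OF f] by (intro mult_left_mono[OF Dx_Hs(2)[OF Hb]] mult_nonneg_nonneg eval_norm_nonneg) auto
  finally show ?thesis .
qed

lemma W1inf_u:
  assumes lr: "l < r"
  shows "W1inf T b l r (\<lambda>t x. q (u t x)) (limit_rate l r)"
  unfolding W1inf_def
proof (intro conjI)
  show "Linf_H T (1 - b) l r (\<lambda>t x. q (u t x))" by (rule Linf_H_u[OF q lr])
  have m: "set_borel_measurable lborel {0<..<T} (\<lambda>t. limit_rate l r t \<phi>)" if "\<phi> \<in> Htest b l r" for \<phi>
    by (rule measurable_limit_rate[OF measurable_const_pair[OF Htest_measurable[OF that]]])
  show "Linf_dual T b l r (limit_rate l r)"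
    unfolding Linf_dual_def
  proof (intro conjI ballI allI exI[of _ "(2 + (r - l)) * total B * eval_norm b"])
    fix t c d and \<phi> \<psi> :: "real => real^'n" assume t: "t \<in> {0<..<T}" and p: "\<phi> \<in> Htest b l r" "\<psi> \<in> Htest b l r"
    then have t': "t \<in> {0..T}" by auto
    note P = HtestD[OF b p(1)] and S = HtestD[OF b p(2)]
    let ?\<Phi> = "hat_u l r f t"
    have m: "?\<Phi> \<in> borel_measurable borel"
      by (rule borel_measurable_continuous_onI[OF cut_hat_u_continuous[OF f t']])
    note I = decays_hpair(1)[OF b m decays_cut_hat_u[OF f t' lr] Dx_Hs(1)]
    have "Dx (fourier (\<lambda>x. c *\<^sub>R \<phi> x + d *\<^sub>R \<psi> x)) \<xi> = c *\<^sub>R Dx (fourier \<phi>) \<xi> + d *\<^sub>R Dx (fourier \<psi>) \<xi>" for \<xi>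
      unfolding Dx_def fourier_lincomb[OF P(3) S(3)] by (simp add: vec_eq_iff distrib_left)
    then have "(LINT \<xi>|lborel. ?\<Phi> \<xi> \<bullet> Dx (fourier (\<lambda>x. c *\<^sub>R \<phi> x + d *\<^sub>R \<psi> x)) \<xi>) =
       c * (LINT \<xi>|lborel. ?\<Phi> \<xi> \<bullet> Dx (fourier \<phi>) \<xi>) + d * (LINT \<xi>|lborel. ?\<Phi> \<xi> \<bullet> Dx (fourier \<psi>) \<xi>)"
      using I[OF P(1)] I[OF S(1)] by (simp add: inner_add_right)
    then show "limit_rate l r t (\<lambda>x. c *\<^sub>R \<phi> x + d *\<^sub>R \<psi> x) = c * limit_rate l r t \<phi> + d * limit_rate l r t \<psi>"
      by (simp add: limit_rate_def hpair_def add_divide_distrib)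
  next
    show "\<bar>limit_rate l r t \<phi>\<bar> <= (2 + (r - l)) * total B * eval_norm b * Hs_norm b (fourier \<phi>)" if "t \<in> {0<..<T}" "\<phi> \<in> Htest b l r" for t \<phi>
      using limit_rate_bound[OF _ that(2) lr, of t] that(1) by auto
  qed (rule m)
  show "gelfand_derivative T b l r (\<lambda>t x. q (u t x)) (limit_rate l r)"
    unfolding gelfand_derivative_def
  proof (intro allI impI ballI)
    fix \<eta> and \<phi> :: "real => real^'n" assume \<eta>: "smooth_compact T \<eta>" and \<phi>: "\<phi> \<in> Htest b l r"
    show "(LINT t:{0<..<T}|lborel. deriv \<eta> t * hpair (hat_u l r q t) (fourier \<phi>)) =
      - (LINT t:{0<..<T}|lborel. \<eta> t * limit_rate l r t \<phi>)"
    proof (rule integral_by_parts_primitive[OF T m[OF \<phi>] _ _ \<eta>])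
      show "\<bar>limit_rate l r t \<phi>\<bar> <= (2 + (r - l)) * total B * eval_norm b * Hs_norm b (fourier \<phi>)" if "t \<in> {0<..<T}" for t
        by (rule limit_rate_bound[OF _ \<phi> lr]) (use that in auto)
      show "hpair (hat_u l r q t) (fourier \<phi>) = hpair (hat_u l r q 0) (fourier \<phi>) +
          (LINT \<tau>:{0<..<t}|lborel. limit_rate l r \<tau> \<phi>)" if "t \<in> {0<..<T}" for t
        by (rule limit_conservation[OF \<phi> lr]) (use that in auto)
    qed
  qed
qed

lemma weakstar_lim_dual_rate:
  assumes lr: "l < r"
  shows "weakstar_lim_dual T b l r (\<lambda>j. rate (k j)) (limit_rate l r)"
  unfolding weakstar_lim_dual_def
proof (intro allI impI)
  fix \<phi> :: "real => real => real^'n" assume a: "case_prod \<phi> \<in> borel_measurable (lborel \<Otimes>\<^sub>M lborel) \<and> (\<forall>t\<in>{0<..<T}. \<phi> t \<in> Htest b l r) \<and>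
    set_integrable lborel {0<..<T} (\<lambda>t. Hs_norm b (fourier (\<phi> t)))"
  show "(\<lambda>j. LINT t:{0<..<T}|lborel. rate (k j) t (\<phi> t)) \<longlonglongrightarrow> (LINT t:{0<..<T}|lborel. limit_rate l r t (\<phi> t))"
  proof (rule set_integral_dominated_convergence)
    show "set_integrable lborel {0<..<T} (\<lambda>t. \<sigma> * (B * V) * eval_norm b * Hs_norm b (fourier (\<phi> t)))"
      using a by simp
    show "set_borel_measurable lborel {0<..<T} (\<lambda>t. rate (k j) t (\<phi> t))" for j
      using a by (intro measurable_rate) auto
    show "set_borel_measurable lborel {0<..<T} (\<lambda>t. limit_rate l r t (\<phi> t))"
      using a by (intro measurable_limit_rate) auto
    show "(\<lambda>j. rate (k j) t (\<phi> t)) \<longlonglongrightarrow> limit_rate l r t (\<phi> t)" if "t \<in> {0<..<T}" for t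
      unfolding limit_rate_def using a that by (intro rate_limit lr) auto
    show "\<bar>rate (k j) t (\<phi> t)\<bar> <= \<sigma> * (B * V) * eval_norm b * Hs_norm b (fourier (\<phi> t))" if "t \<in> {0<..<T}" for j t
      using a that by (intro rate_bound[of t "\<phi> t" l r]) auto
  qed
qed

end

section \<open>Regularity on compact sets of states\<close>

lemma C1_onD:
  assumes "C1_on X g"
  obtains g' where "\<And>x. x \<in> X ==> (g has_derivative blinfun_apply (g' x)) (at x)" "continuous_on X g'"
  using assms unfolding C1_on_def by blast

lemma C2_on_imp_C1_on: "C2_on X g ==> C1_on X g"
proof -
  assume "C2_on X g"
  then obtain g' where g': "\<forall>x\<in>X. (g has_derivative blinfun_apply (g' x)) (at x)" "C1_on X g'"
    unfolding C2_on_def by blast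
  then have "continuous_on X g'"
    unfolding C1_on_def by (meson continuous_at_imp_continuous_on has_derivative_continuous)
  with g'(1) show ?thesis unfolding C1_on_def by blast
qed

lemma C1_on_continuous: "C1_on X g ==> continuous_on X g"
  unfolding C1_on_def by (meson continuous_at_imp_continuous_on has_derivative_continuous)

text \<open>\<open>K\<close> need not be convex, so the mean value inequality is used on small balls only.\<close>

lemma C1_on_lipschitz:
  fixes g :: "'a::euclidean_space => 'b::real_normed_vector"
  assumes g: "C1_on X g" and X: "open X" and K: "compact K" "K \<subseteq> X"
  obtains L where "L-lipschitz_on K g"
proof -
  obtain g' where g': "\<And>x. x \<in> X ==> (g has_derivative blinfun_apply (g' x)) (at x)" "continuous_on X g'"
    using C1_onD[OF g] by blast
  have "local_lipschitz {0::real} K (\<lambda>_. g)"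
  proof (rule local_lipschitzI)
    fix t :: real and x assume "x \<in> K"
    then have "x \<in> X" using K by auto
    then obtain d where d: "0 < d" "cball x d \<subseteq> X" using X by (meson open_contains_cball)
    have "bounded (g' ` cball x d)"
      using g'(2) d(2) by (intro compact_imp_bounded compact_continuous_image) (auto intro: continuous_on_subset)
    then obtain L where L: "\<And>y. y \<in> cball x d ==> norm (g' y) <= L"
      unfolding bounded_iff by blast
    have "dist (g y) (g z) <= L * dist y z" if "y \<in> cball x d" "z \<in> cball x d" for y z
      unfolding dist_norm
    proof (rule differentiable_bound[OF convex_cball _ _ that])
      show "(g has_derivative blinfun_apply (g' w)) (at w within cball x d)" if "w \<in> cball x d" for w
        by (rule has_derivative_at_withinI[OF g'(1)]) (use d(2) that in auto)
      show "onorm (blinfun_apply (g' w)) <= L" if "w \<in> cball x d" for w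
        using L[OF that] by (simp add: norm_blinfun.rep_eq)
    qed
    moreover have "0 <= L" using order.trans[OF norm_ge_zero L[of x]] d by simp
    ultimately have "L-lipschitz_on (cball x d \<inter> K) g"
      by (intro lipschitz_onI) auto
    then show "\<exists>u>0. \<exists>L. \<forall>t\<in>cball t u \<inter> {0}. L-lipschitz_on (cball x u \<inter> K) g"
      using d(1) by blast
  qed
  then obtain L where "\<And>t. t \<in> {0::real} ==> L-lipschitz_on K g"
    by (rule local_lipschitz_compact_implies_lipschitz) (use K in auto)
  then show ?thesis using that by blast
qed

section \<open>Integral curves\<close>

locale hyperbolic =
  fixes S :: "'n::finite hsys"
  assumes hyp: "hyperbolic_system S"
begin

lemma strict: "strictly_hyperbolic S" and gnlld: "gnl_or_ld S" and curves: "wave_curves S" and solvable: "gRP_solvable S"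
  using hyp by (auto simp: hyperbolic_system_def)

lemma open_states: "open (states S)"
  using strict by (simp add: strictly_hyperbolic_def)

lemma C1_rvec: "k \<in> families S ==> C1_on (states S) (rvec S k)"
  and C1_lam: "k \<in> families S ==> C1_on (states S) (lam S k)"
  and C1_q: "C1_on (states S) (qfun S)" and C1_f: "C1_on (states S) (ffun S)"
  using strict by (auto simp: strictly_hyperbolic_def intro: C2_on_imp_C1_on)

definition icurve :: "nat => (real => real^'n) => real set => bool" where
  "icurve k c I \<longleftrightarrow> (\<forall>z\<in>I. c z \<in> states S \<and> (c has_vector_derivative rvec S k (c z)) (at z within I))"

lemma W_curve_icurve: "W_curve S k u \<zeta> u' \<longleftrightarrow> (\<exists>c. c 0 = u \<and> c \<zeta> = u' \<and> icurve k c (closed_segment 0 \<zeta>))"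
  by (simp add: W_curve_def icurve_def)

lemma icurve_subset: "icurve k c I ==> I' \<subseteq> I ==> icurve k c I'"
  unfolding icurve_def by (meson has_vector_derivative_within_subset subsetD)

lemma icurve_shift:
  assumes "icurve k c I"
  shows "icurve k (\<lambda>z. c (a + z)) ((\<lambda>z. z - a) ` I)"
  unfolding icurve_def
proof
  fix z assume "z \<in> (\<lambda>z. z - a) ` I"
  then have z: "a + z \<in> I" by auto
  have im: "(\<lambda>z. a + z) ` ((\<lambda>z. z - a) ` I) = I" by (auto simp: image_image)
  have "((\<lambda>z. a + z) has_vector_derivative 1) (at z within (\<lambda>z. z - a) ` I)"
    by (auto simp: has_real_derivative_iff_has_vector_derivative[symmetric] intro!: derivative_eq_intros)
  from vector_diff_chain_within[OF this, of c "rvec S k (c (a + z))"]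
  have "((c \<circ> (\<lambda>z. a + z)) has_vector_derivative rvec S k (c (a + z))) (at z within (\<lambda>z. z - a) ` I)"
    using assms z unfolding im icurve_def by simp
  then show "c (a + z) \<in> states S \<and> ((\<lambda>z. c (a + z)) has_vector_derivative rvec S k (c (a + z))) (at z within (\<lambda>z. z - a) ` I)"
    using assms z by (simp add: icurve_def comp_def)
qed

lemma icurve_W_curve:
  assumes c: "icurve k c {p..q}" and xy: "x \<in> {p..q}" "y \<in> {p..q}"
  shows "W_curve S k (c x) (y - x) (c y)"
  unfolding W_curve_icurve
proof (intro exI[of _ "\<lambda>z. c (x + z)"] conjI)
  have "icurve k c (closed_segment x y)"
    by (rule icurve_subset[OF c]) (use xy in \<open>auto simp: closed_segment_eq_real_ivl split: if_splits\<close>)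
  moreover have "(\<lambda>z. z - x) ` closed_segment x y = closed_segment 0 (y - x)"
    using closed_segment_translation[of "- x" x y] by (simp add: add.commute)
  ultimately show "icurve k (\<lambda>z. c (x + z)) (closed_segment 0 (y - x))"
    using icurve_shift[of k c "closed_segment x y" x] by simp
qed auto

lemma W_curve_nonneg_icurve:
  assumes "0 <= \<zeta>"
  shows "W_curve S k u \<zeta> u' \<longleftrightarrow> (\<exists>c. c 0 = u \<and> c \<zeta> = u' \<and> icurve k c {0..\<zeta>})"
  using assms by (simp add: W_curve_icurve closed_segment_eq_real_ivl)

lemma W_curve_reverse: "W_curve S k u \<zeta> u' ==> W_curve S k u' (- \<zeta>) u"
proof -
  assume "W_curve S k u \<zeta> u'"
  then obtain c where c: "c 0 = u" "c \<zeta> = u'" "icurve k c (closed_segment 0 \<zeta>)"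
    unfolding W_curve_icurve by blast
  have "icurve k c {min 0 \<zeta>..max 0 \<zeta>}"
    using c(3) by (auto simp: closed_segment_eq_real_ivl min_def max_def split: if_splits)
  from icurve_W_curve[OF this, of \<zeta> 0] show ?thesis using c by simp
qed

lemma W_curve_states: "W_curve S k u \<zeta> u' ==> u \<in> states S \<and> u' \<in> states S"
  unfolding W_curve_icurve icurve_def by (metis ends_in_segment)

lemma E_eq_W:
  assumes "k \<in> families S" "u \<in> states S" "0 <= \<zeta> \<or> k \<notin> gnl S"
  shows "E_curve S k u \<zeta> u' \<longleftrightarrow> W_curve S k u \<zeta> u'"
  using curves assms unfolding wave_curves_def by blast

lemma edom_states: "k \<in> families S ==> (u, \<zeta>) \<in> edom S k ==> u \<in> states S"
  using curves unfolding wave_curves_def by blast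

lemma open_edom: "k \<in> families S ==> open (edom S k)"
  using curves unfolding wave_curves_def by blast

lemma ecv_local_lipschitz:
  "k \<in> families S ==> p \<in> edom S k ==> \<exists>\<delta>>0. \<exists>L. L-lipschitz_on (ball p \<delta> \<inter> edom S k) (\<lambda>(u, \<zeta>). ecv S k u \<zeta>)"
  using curves unfolding wave_curves_def by blast

lemma W_curve_0: "u \<in> states S ==> W_curve S k u 0 u' \<longleftrightarrow> u' = u"
proof
  assume u: "u \<in> states S" and "u' = u"
  then show "W_curve S k u 0 u'"
    unfolding W_curve_def
    by (intro exI[of _ "\<lambda>z. u + z *\<^sub>R rvec S k u"]) (auto intro!: derivative_eq_intros)
qed (auto simp: W_curve_def)

lemma E_curve_0: "k \<in> families S ==> u \<in> states S ==> E_curve S k u 0 u' \<longleftrightarrow> u' = u"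
  using E_eq_W[of k u 0] W_curve_0 by simp

lemma edom_0: "k \<in> families S ==> u \<in> states S ==> (u, 0) \<in> edom S k" "k \<in> families S ==> u \<in> states S ==> ecv S k u 0 = u"
  using E_curve_0[of k u u] by (auto simp: E_curve_def)

lemma continuous_ecv: "k \<in> families S ==> continuous_on (edom S k) (\<lambda>(u, \<zeta>). ecv S k u \<zeta>)"
proof (subst continuous_on_eq_continuous_at[OF open_edom], assumption, intro ballI)
  fix p assume k: "k \<in> families S" and p: "p \<in> edom S k"
  obtain \<delta> L where d: "0 < \<delta>" "L-lipschitz_on (ball p \<delta> \<inter> edom S k) (\<lambda>(u, \<zeta>). ecv S k u \<zeta>)"
    using ecv_local_lipschitz[OF k p] by blast
  have "continuous_on (ball p \<delta> \<inter> edom S k) (\<lambda>(u, \<zeta>). ecv S k u \<zeta>)"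
    by (rule lipschitz_on_continuous_on[OF d(2)])
  moreover have "open (ball p \<delta> \<inter> edom S k)" using open_edom[OF k] by auto
  ultimately show "isCont (\<lambda>(u, \<zeta>). ecv S k u \<zeta>) p"
    using d(1) p by (simp add: continuous_on_eq_continuous_at)
qed

lemma W_curve_forward:
  assumes "k \<in> families S" "0 <= \<zeta>"
  shows "W_curve S k u \<zeta> u' \<longleftrightarrow> (u, \<zeta>) \<in> edom S k \<and> u' = ecv S k u \<zeta>"
  using E_eq_W[OF assms(1), of u \<zeta> u'] W_curve_states[of k u \<zeta> u'] edom_states[OF assms(1), of u \<zeta>] assms(2)
  unfolding E_curve_def by blast

text \<open>Two curves that reach the same state \<open>w\<close> agree before: with the Lipschitz constant \<open>L\<close> of \<open>r\<^sub>k\<close>, the squared distance times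
  \<open>exp (2Lt)\<close> is increasing, and it ends at zero.\<close>

lemma backward_unique:
  assumes k: "k \<in> families S" and z: "0 <= \<zeta>" and 1: "W_curve S k u \<zeta> w" and 2: "W_curve S k v \<zeta> w"
  shows "u = v"
proof -
  obtain c where c: "c 0 = u" "c \<zeta> = w" "icurve k c {0..\<zeta>}" using 1 z by (auto simp: W_curve_nonneg_icurve)
  obtain d where d: "d 0 = v" "d \<zeta> = w" "icurve k d {0..\<zeta>}" using 2 z by (auto simp: W_curve_nonneg_icurve)
  have cont: "continuous_on {0..\<zeta>} c" "continuous_on {0..\<zeta>} d"
    using c(3) d(3) unfolding icurve_def by (meson continuous_on_eq_continuous_within has_vector_derivative_continuous)+
  define C where "C = c ` {0..\<zeta>} \<union> d ` {0..\<zeta>}"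
  have C: "compact C" "C \<subseteq> states S"
    using cont c(3) d(3) by (auto simp: C_def icurve_def intro!: compact_Un compact_continuous_image)
  obtain L where L: "L-lipschitz_on C (rvec S k)"
    by (rule C1_on_lipschitz[OF C1_rvec[OF k] open_states C])
  define h where "h = (\<lambda>t. exp (2 * L * t) * ((c t - d t) \<bullet> (c t - d t)))"
  have hcont: "continuous_on {0..\<zeta>} h" unfolding h_def by (intro continuous_intros cont)
  have "h 0 <= h \<zeta>"
  proof (rule DERIV_nonneg_imp_increasing_open[OF z _ hcont])
    fix t assume t: "0 < t" "t < \<zeta>"
    have at: "at t within {0..\<zeta>} = at t" by (rule at_within_interior) (use t in auto)
    have dc: "(c has_vector_derivative rvec S k (c t)) (at t)" "(d has_vector_derivative rvec S k (d t)) (at t)"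
      using c(3) d(3) t at unfolding icurve_def by (metis atLeastAtMost_iff less_imp_le)+
    define e where "e = c t - d t"
    define e' where "e' = rvec S k (c t) - rvec S k (d t)"
    have de: "((\<lambda>t. c t - d t) has_derivative (\<lambda>x. x *\<^sub>R e')) (at t)"
      using has_vector_derivative_diff[OF dc] by (simp add: has_vector_derivative_def e'_def)
    have "((\<lambda>t. (c t - d t) \<bullet> (c t - d t)) has_derivative (\<lambda>x. e \<bullet> (x *\<^sub>R e') + (x *\<^sub>R e') \<bullet> e)) (at t)"
      unfolding e_def by (rule has_derivative_inner[OF de de])
    then have "((\<lambda>t. (c t - d t) \<bullet> (c t - d t)) has_real_derivative 2 * (e \<bullet> e')) (at t)"
      unfolding has_field_derivative_def by (rule has_derivative_eq_rhs) (auto simp: inner_commute)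
    moreover have "((\<lambda>t. exp (2 * L * t)) has_real_derivative exp (2 * L * t) * (2 * L)) (at t)"
      by (auto intro!: derivative_eq_intros)
    ultimately have "(h has_real_derivative exp (2 * L * t) * (2 * L) * (e \<bullet> e) + 2 * (e \<bullet> e') * exp (2 * L * t)) (at t)"
      unfolding h_def e_def using DERIV_mult by blast
    moreover have "\<bar>e \<bullet> e'\<bar> <= L * (e \<bullet> e)"
    proof -
      have "norm e' <= L * norm e"
        using lipschitz_onD[OF L, of "c t" "d t"] t by (auto simp: C_def e_def e'_def dist_norm)
      then have "norm e * norm e' <= norm e * (L * norm e)" by (intro mult_left_mono) auto
      then show ?thesis using Cauchy_Schwarz_ineq2[of e e'] by (simp add: dot_square_norm power2_eq_square mult_ac)
    qed
    then have "0 <= exp (2 * L * t) * (2 * (L * (e \<bullet> e)) + 2 * (e \<bullet> e'))" by simp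
    then have "0 <= exp (2 * L * t) * (2 * L) * (e \<bullet> e) + 2 * (e \<bullet> e') * exp (2 * L * t)" by (simp add: algebra_simps)
    ultimately show "\<exists>y. (h has_real_derivative y) (at t) \<and> 0 <= y" by blast
  qed
  moreover have "h \<zeta> = 0" using c(2) d(2) by (simp add: h_def)
  moreover have "0 <= h 0" by (simp add: h_def)
  ultimately have "h 0 = 0" by simp
  then show "u = v" using c(1) d(1) by (simp add: h_def)
qed

text \<open>Forwards, the curve is \<open>E\<close>, a function; backwards, it is \<open>backward_unique\<close>.\<close>

lemma W_curve_unique:
  assumes k: "k \<in> families S" and "W_curve S k u \<zeta> v" "W_curve S k u \<zeta> w"
  shows "v = w"
proof (cases "0 <= \<zeta>")
  case True
  then show ?thesis using assms by (auto simp: W_curve_forward)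
next
  case False
  then show ?thesis using backward_unique[OF k, of "- \<zeta>" v u w] W_curve_reverse[OF assms(2)] W_curve_reverse[OF assms(3)] by auto
qed

definition wdom :: "nat => ((real^'n) \<times> real) set" where
  "wdom k = {(u, \<zeta>). \<exists>u'. W_curve S k u \<zeta> u'}"

definition wcv :: "nat => real^'n => real => real^'n" where
  "wcv k u \<zeta> = (THE u'. W_curve S k u \<zeta> u')"

lemma W_curve_wcv:
  assumes k: "k \<in> families S"
  shows "W_curve S k u \<zeta> u' \<longleftrightarrow> (u, \<zeta>) \<in> wdom k \<and> u' = wcv k u \<zeta>"
proof -
  have "W_curve S k u \<zeta> (wcv k u \<zeta>)" if "W_curve S k u \<zeta> w" for w
    unfolding wcv_def by (rule theI[of _ w]) (use that W_curve_unique[OF k] in auto)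
  then show ?thesis using W_curve_unique[OF k] by (auto simp: wdom_def)
qed

text \<open>For negative parameters the flow inverts the curves \<open>E\<^sub>k\<close>, and invariance of domain applies.\<close>

lemma wcv_negative:
  assumes k: "k \<in> families S"
  shows "open (wdom k \<inter> UNIV \<times> {..<0})" "continuous_on (wdom k \<inter> UNIV \<times> {..<0}) (\<lambda>(u, \<zeta>). wcv k u \<zeta>)"
proof -
  define D where "D = edom S k \<inter> UNIV \<times> {0<..}"
  define \<Xi> where "\<Xi> = (\<lambda>(v, s). (ecv S k v s, - s))"
  have D: "open D" unfolding D_def by (intro open_Int open_edom k open_Times) auto
  have cont: "continuous_on D \<Xi>"
    unfolding \<Xi>_def case_prod_beta'
    by (intro continuous_on_Pair continuous_intros continuous_on_subset[OF continuous_ecv[OF k, unfolded case_prod_beta']])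
      (auto simp: D_def)
  have WD: "(v, s) \<in> D \<longleftrightarrow> 0 < s \<and> (v, s) \<in> edom S k" for v s by (auto simp: D_def)
  have Wr: "(v, s) \<in> D \<and> u = ecv S k v s \<longleftrightarrow> 0 < s \<and> W_curve S k u (- s) v" for u v s
    using W_curve_forward[OF k, of s v u] W_curve_reverse[of k v s u] W_curve_reverse[of k u "- s" v] unfolding WD by auto
  have inj: "inj_on \<Xi> D"
  proof (rule inj_onI, clarify)
    fix v s v' s' assume "(v, s) \<in> D" "(v', s') \<in> D" "\<Xi> (v, s) = \<Xi> (v', s')"
    then have "s = s'" "W_curve S k (ecv S k v s) (- s) v" "W_curve S k (ecv S k v s) (- s) v'"
      using Wr[of v s "ecv S k v s"] Wr[of v' s' "ecv S k v' s'"] by (auto simp: \<Xi>_def)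
    then show "v = v' \<and> s = s'" using W_curve_unique[OF k] by blast
  qed
  have im: "\<Xi> ` D = wdom k \<inter> UNIV \<times> {..<0}"
  proof (intro equalityI subsetI)
    fix p assume "p \<in> \<Xi> ` D"
    then obtain v s where "(v, s) \<in> D" "p = (ecv S k v s, - s)" by (auto simp: \<Xi>_def)
    then show "p \<in> wdom k \<inter> UNIV \<times> {..<0}" using Wr[of v s "ecv S k v s"] by (auto simp: wdom_def)
  next
    fix p assume p: "p \<in> wdom k \<inter> UNIV \<times> {..<0}"
    then obtain u s v where "p = (u, - s)" "0 < s" "W_curve S k u (- s) v"
      by (auto simp: wdom_def) (metis neg_0_less_iff_less minus_minus)
    then show "p \<in> \<Xi> ` D" using Wr[of v s u] by (force simp: \<Xi>_def)
  qed
  show "open (wdom k \<inter> UNIV \<times> {..<0})"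
    unfolding im[symmetric] by (rule invariance_of_domain[OF cont D inj])
  obtain g where g: "homeomorphism D (\<Xi> ` D) \<Xi> g"
    by (rule invariance_of_domain_homeomorphism[OF D cont order_refl inj])
  have "wcv k u \<zeta> = fst (g (u, \<zeta>))" if "(u, \<zeta>) \<in> \<Xi> ` D" for u \<zeta>
  proof -
    obtain r where "r \<in> D" "(u, \<zeta>) = \<Xi> r" using \<open>(u, \<zeta>) \<in> \<Xi> ` D\<close> by blast
    then obtain v s where vs: "(v, s) \<in> D" "(u, \<zeta>) = \<Xi> (v, s)" by (metis surj_pair)
    then have vs: "(v, s) \<in> D" "(u, \<zeta>) = (ecv S k v s, - s)" by (auto simp: \<Xi>_def)
    then have "g (u, \<zeta>) = (v, s)" using homeomorphism_apply1[OF g vs(1)] by (simp add: \<Xi>_def)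
    moreover have "wcv k u \<zeta> = v" using Wr[of v s u] vs W_curve_wcv[OF k, of u \<zeta> v] by auto
    ultimately show ?thesis by simp
  qed
  moreover have "continuous_on (\<Xi> ` D) (\<lambda>p. fst (g p))"
    using homeomorphism_cont2[OF g] by (intro continuous_intros)
  ultimately show "continuous_on (wdom k \<inter> UNIV \<times> {..<0}) (\<lambda>(u, \<zeta>). wcv k u \<zeta>)"
    unfolding im[symmetric] by (subst continuous_on_cong[OF refl]) auto
qed

text \<open>Backward existence: for small \<open>\<tau>\<close> the map \<open>E\<^sub>k(\<cdot>,\<tau>)\<close> is close to the identity, so by Brouwer's
  theorem it takes the value \<open>p\<close>.\<close>

lemma backward_exists:
  assumes k: "k \<in> families S" and p: "p \<in> states S"
  obtains v \<tau> where "0 < \<tau>" "W_curve S k v \<tau> p"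
proof -
  obtain \<delta> L where dL: "0 < \<delta>" "L-lipschitz_on (ball (p, 0) \<delta> \<inter> edom S k) (\<lambda>(u, \<zeta>). ecv S k u \<zeta>)"
    using ecv_local_lipschitz[OF k edom_0(1)[OF k p]] by blast
  have "open (ball (p, 0::real) \<delta> \<inter> edom S k)" "(p, 0) \<in> ball (p, 0) \<delta> \<inter> edom S k"
    using open_edom[OF k] dL(1) edom_0(1)[OF k p] by auto
  then obtain A B where AB: "open A" "open B" "p \<in> A" "0 \<in> B" "A \<times> B \<subseteq> ball (p, 0) \<delta> \<inter> edom S k"
    by (metis mem_Sigma_iff open_prod_elim)
  obtain \<rho> where \<rho>: "0 < \<rho>" "cball p \<rho> \<subseteq> A" using AB open_contains_cball by metis
  obtain \<beta> where \<beta>: "0 < \<beta>" "cball 0 \<beta> \<subseteq> B" using AB open_contains_cball by metis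
  have L0: "0 <= L" by (rule lipschitz_on_nonneg[OF dL(2)])
  define \<tau> where "\<tau> = min \<beta> (\<rho> / (L + 1))"
  have \<tau>: "0 < \<tau>" "\<tau> <= \<beta>" "L * \<tau> <= \<rho>"
  proof -
    show "0 < \<tau>" "\<tau> <= \<beta>" using \<rho> \<beta> L0 by (auto simp: \<tau>_def)
    have "L * \<tau> <= L * (\<rho> / (L + 1))" using L0 by (intro mult_left_mono) (auto simp: \<tau>_def)
    also have "\<dots> <= \<rho>" using L0 \<rho> by (simp add: field_simps)
    finally show "L * \<tau> <= \<rho>" .
  qed
  have dom: "(v, t) \<in> ball (p, 0) \<delta> \<inter> edom S k" if "v \<in> cball p \<rho>" "t \<in> {0..\<tau>}" for v t
  proof -
    have "v \<in> A" "t \<in> B" using \<rho>(2) \<beta>(2) \<tau>(2) that by auto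
    then show ?thesis using AB(5) by blast
  qed
  define F where "F = (\<lambda>v. p + v - ecv S k v \<tau>)"
  have "continuous_on (cball p \<rho>) (\<lambda>v. (\<lambda>(u, \<zeta>). ecv S k u \<zeta>) (v, \<tau>))"
    using \<tau> dom by (intro continuous_on_compose2[OF continuous_ecv[OF k]] continuous_intros) auto
  then have "continuous_on (cball p \<rho>) F" unfolding F_def by (intro continuous_intros) auto
  moreover have "F \<in> cball p \<rho> \<rightarrow> cball p \<rho>"
  proof
    fix v assume v: "v \<in> cball p \<rho>"
    have st: "v \<in> states S" using dom[OF v, of 0] \<tau> edom_states[OF k] by auto
    have "dist (ecv S k v \<tau>) (ecv S k v 0) <= L * dist (v, \<tau>) (v, 0)"
      using lipschitz_onD[OF dL(2) dom[OF v, of \<tau>] dom[OF v, of 0]] \<tau> by simp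
    then have "norm (ecv S k v \<tau> - v) <= \<rho>"
      using edom_0(2)[OF k st] \<tau> by (simp add: dist_norm dist_Pair_Pair)
    then show "F v \<in> cball p \<rho>" by (simp add: F_def dist_norm norm_minus_commute)
  qed
  ultimately obtain v where v: "v \<in> cball p \<rho>" "F v = v"
    using brouwer[of "cball p \<rho>" F] \<rho>(1) by auto
  then have "p = ecv S k v \<tau>" by (simp add: F_def)
  then have "W_curve S k v \<tau> p"
    using W_curve_forward[OF k, of \<tau> v p] dom[OF v(1), of \<tau>] \<tau> by auto
  with \<tau>(1) show ?thesis by (rule that)
qed

text \<open>Around parameter zero, the curve is first followed back by a fixed \<open>\<tau>\<close>, to \<open>\<beta>(u)\<close>, and then forward by \<open>\<tau> + \<zeta> > 0\<close>, where it is
\<open>E\<close>. Both maps are known to be continuous.\<close>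

lemma wcv_at_0:
  assumes k: "k \<in> families S" and p: "p \<in> states S"
  obtains A where "open A" "(p, 0) \<in> A" "A \<subseteq> wdom k" "continuous_on A (\<lambda>(u, \<zeta>). wcv k u \<zeta>)"
proof -
  obtain v0 \<tau> where v0: "0 < \<tau>" "W_curve S k v0 \<tau> p" using backward_exists[OF k p] by blast
  define N where "N = wdom k \<inter> UNIV \<times> {..<0}"
  have N: "open N" "continuous_on N (\<lambda>(u, \<zeta>). wcv k u \<zeta>)" using wcv_negative[OF k] by (auto simp: N_def)
  define N' where "N' = (\<lambda>p :: (real^'n) \<times> real. (fst p, - \<tau>)) -` N"
  have N': "open N'" unfolding N'_def by (rule open_vimage[OF N(1)]) (intro continuous_intros)
  define \<beta> where "\<beta> = (\<lambda>p :: (real^'n) \<times> real. wcv k (fst p) (- \<tau>))"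
  have \<beta>: "continuous_on N' \<beta>"
  proof -
    have "continuous_on N' (\<lambda>p. (\<lambda>(u, \<zeta>). wcv k u \<zeta>) (fst p, - \<tau>))"
      by (rule continuous_on_compose2[OF N(2)]) (auto simp: N'_def intro!: continuous_intros)
    then show ?thesis by (simp add: \<beta>_def)
  qed
  define M where "M = (\<lambda>p. (\<beta> p, \<tau> + snd p))"
  have M: "continuous_on N' M" unfolding M_def by (intro continuous_intros \<beta>)
  define A where "A = (N' \<inter> M -` edom S k) \<inter> UNIV \<times> {- \<tau><..}"
  have W: "W_curve S k u \<zeta> (ecv S k (\<beta> (u, \<zeta>)) (\<tau> + \<zeta>))" if a: "(u, \<zeta>) \<in> A" for u \<zeta>
  proof -
    let ?b = "\<beta> (u, \<zeta>)" and ?w = "ecv S k (\<beta> (u, \<zeta>)) (\<tau> + \<zeta>)"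
    have z: "0 < \<tau> + \<zeta>" using a by (auto simp: A_def)
    have "(u, - \<tau>) \<in> wdom k" using a by (auto simp: A_def N'_def N_def)
    then have "W_curve S k u (- \<tau>) ?b" using W_curve_wcv[OF k] by (simp add: \<beta>_def)
    then have bu: "W_curve S k ?b \<tau> u" using W_curve_reverse by fastforce
    have bw: "W_curve S k ?b (\<tau> + \<zeta>) ?w"
      using a z W_curve_forward[OF k, of "\<tau> + \<zeta>" ?b ?w] by (auto simp: A_def M_def)
    show ?thesis
    proof (cases "0 <= \<zeta>")
      case True
      obtain c where c: "c 0 = ?b" "c (\<tau> + \<zeta>) = ?w" "icurve k c {0..\<tau> + \<zeta>}"
        using bw z by (auto simp: W_curve_nonneg_icurve)
      have "W_curve S k ?b \<tau> (c \<tau>)" using icurve_W_curve[OF c(3), of 0 \<tau>] c(1) True v0(1) by simp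
      then have "c \<tau> = u" using W_curve_unique[OF k] bu by blast
      then show ?thesis using icurve_W_curve[OF c(3), of \<tau> "\<tau> + \<zeta>"] c(2) True v0(1) by simp
    next
      case False
      obtain c where c: "c 0 = ?b" "c \<tau> = u" "icurve k c {0..\<tau>}"
        using bu v0(1) by (auto simp: W_curve_nonneg_icurve)
      have "W_curve S k ?b (\<tau> + \<zeta>) (c (\<tau> + \<zeta>))" using icurve_W_curve[OF c(3), of 0 "\<tau> + \<zeta>"] c(1) False z by simp
      then have "c (\<tau> + \<zeta>) = ?w" using W_curve_unique[OF k] bw by blast
      then show ?thesis using icurve_W_curve[OF c(3), of \<tau> "\<tau> + \<zeta>"] c(2) False z v0(1) by simp
    qed
  qed
  show ?thesis
  proof (rule that)
    show "open A" unfolding A_def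
      by (intro open_Int continuous_open_preimage[OF M N' open_edom[OF k]] open_Times) auto
    have b0: "W_curve S k p (- \<tau>) v0" by (rule W_curve_reverse[OF v0(2)])
    then have "(p, - \<tau>) \<in> wdom k" "\<beta> (p, 0) = v0" using W_curve_wcv[OF k, of p "- \<tau>" v0] by (auto simp: \<beta>_def)
    moreover have "(v0, \<tau>) \<in> edom S k" using W_curve_forward[OF k, of \<tau> v0 p] v0 by auto
    ultimately show "(p, 0) \<in> A" using v0(1) by (auto simp: A_def N'_def N_def M_def)
    show "A \<subseteq> wdom k" using W unfolding wdom_def by blast
    have "wcv k u \<zeta> = (\<lambda>(u, \<zeta>). ecv S k u \<zeta>) (M (u, \<zeta>))" if "(u, \<zeta>) \<in> A" for u \<zeta>
      using W[OF that] W_curve_wcv[OF k, of u \<zeta>] by (simp add: M_def)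
    moreover have "continuous_on A (\<lambda>p. (\<lambda>(u, \<zeta>). ecv S k u \<zeta>) (M p))"
      by (rule continuous_on_compose2[OF continuous_ecv[OF k] continuous_on_subset[OF M]]) (auto simp: A_def)
    ultimately show "continuous_on A (\<lambda>(u, \<zeta>). wcv k u \<zeta>)"
      by (subst continuous_on_cong[OF refl]) auto
  qed
qed

lemma wcv_open_continuous:
  assumes k: "k \<in> families S"
  shows "open (wdom k)" "continuous_on (wdom k) (\<lambda>(u, \<zeta>). wcv k u \<zeta>)"
proof -
  have nb: "\<exists>A. open A \<and> p \<in> A \<and> A \<subseteq> wdom k \<and> continuous_on A (\<lambda>(u, \<zeta>). wcv k u \<zeta>)" if p: "p \<in> wdom k" for p
  proof -
    obtain u \<zeta> where uz: "p = (u, \<zeta>)" by force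
    have us: "u \<in> states S" using p W_curve_states by (auto simp: uz wdom_def)
    consider "\<zeta> < 0" | "\<zeta> = 0" | "0 < \<zeta>" by linarith
    then show ?thesis
    proof cases
      case 1
      then show ?thesis using wcv_negative[OF k] p by (intro exI[of _ "wdom k \<inter> UNIV \<times> {..<0}"]) (auto simp: uz)
    next
      case 2
      then show ?thesis using wcv_at_0[OF k us] unfolding uz by metis
    next
      case 3
      define D where "D = edom S k \<inter> UNIV \<times> {0<..}"
      have W: "W_curve S k u \<zeta> (ecv S k u \<zeta>)" if "(u, \<zeta>) \<in> D" for u \<zeta>
        using that W_curve_forward[OF k, of \<zeta> u] by (auto simp: D_def)
      have "wcv k u \<zeta> = ecv S k u \<zeta>" if "(u, \<zeta>) \<in> D" for u \<zeta>
        using W[OF that] W_curve_wcv[OF k] by metis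
      moreover have "continuous_on D (\<lambda>(u, \<zeta>). ecv S k u \<zeta>)"
        by (rule continuous_on_subset[OF continuous_ecv[OF k]]) (auto simp: D_def)
      ultimately have "continuous_on D (\<lambda>(u, \<zeta>). wcv k u \<zeta>)"
        by (subst continuous_on_cong[OF refl, of _ _ "\<lambda>(u, \<zeta>). ecv S k u \<zeta>"]) auto
      moreover have "open D" unfolding D_def by (intro open_Int open_edom k open_Times) auto
      moreover have "p \<in> D" using p 3 W_curve_forward[OF k, of \<zeta> u] by (auto simp: uz D_def wdom_def)
      moreover have "D \<subseteq> wdom k" using W unfolding wdom_def by auto
      ultimately show ?thesis by blast
    qed
  qed
  show o: "open (wdom k)"
    by (subst open_subopen) (use nb in blast)
  show "continuous_on (wdom k) (\<lambda>(u, \<zeta>). wcv k u \<zeta>)"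
    unfolding continuous_on_eq_continuous_at[OF o]
    using nb continuous_on_eq_continuous_at by blast
qed

section \<open>Continuity of the generalized Riemann problem\<close>

text \<open>A width pattern \<open>A\<close> is the set of families of positive width.\<close>

definition cdom :: "nat set => nat => ((real^'n) \<times> real) set" where
  "cdom A k = (if k \<in> A then wdom k else edom S k)"

definition ccv :: "nat set => nat => real^'n => real => real^'n" where
  "ccv A k u \<zeta> = (if k \<in> A then wcv k u \<zeta> else ecv S k u \<zeta>)"

lemma cdom: "k \<in> families S ==> open (cdom A k)" "k \<in> families S ==> continuous_on (cdom A k) (\<lambda>(u, \<zeta>). ccv A k u \<zeta>)"
  using open_edom continuous_ecv wcv_open_continuous by (auto simp: cdom_def ccv_def)

lemma gRP_ccv:
  "gRP S uL uR w z v \<longleftrightarrow> v 0 = uL \<and> v (CARD('n)) = uR \<and>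
     (\<forall>k\<in>families S. (v (k - 1), z k) \<in> cdom {k. w k \<noteq> 0} k \<and> v k = ccv {k. w k \<noteq> 0} k (v (k - 1)) (z k))"
  unfolding gRP_def cdom_def ccv_def using W_curve_wcv by (auto simp: E_curve_def)

lemma E_curve_states:
  assumes k: "k \<in> families S" and E: "E_curve S k u \<zeta> u'"
  shows "u \<in> states S \<and> u' \<in> states S"
proof -
  have u: "u \<in> states S" using E edom_states[OF k] by (auto simp: E_curve_def)
  show ?thesis
  proof (cases "0 <= \<zeta> \<or> k \<notin> gnl S")
    case True
    then show ?thesis using E_eq_W[OF k u] E W_curve_states by blast
  next
    case False
    then have "\<exists>s. kshock S k u (ecv S k u \<zeta>) s"
      using curves E k unfolding wave_curves_def E_curve_def by (meson not_le)
    then show ?thesis using E by (auto simp: kshock_def E_curve_def)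
  qed
qed

lemma ccv_states: "k \<in> families S ==> (u, \<zeta>) \<in> cdom A k ==> u \<in> states S \<and> ccv A k u \<zeta> \<in> states S"
  using E_curve_states[of k u \<zeta> "ecv S k u \<zeta>"] W_curve_wcv[of k u \<zeta> "wcv k u \<zeta>"] W_curve_states
  by (auto simp: cdom_def ccv_def E_curve_def split: if_splits)

text \<open>The chain map sends a left state and strengths to the two outer states. Its domain is open, and uniqueness of the
generalized Riemann problem makes it injective. The dimensions agree, so invariance of domain applies; by existence the
inverse is defined on all pairs of states.\<close>

lemma gRP_strength_continuous:
  assumes w: "\<forall>k\<in>families S. 0 <= w k \<and> (k \<notin> gnl S --> w k = 0)"
  obtains G :: "nat => (real^'n) \<times> (real^'n) => real" where
    "\<And>k. k \<in> families S ==> continuous_on (states S \<times> states S) (G k)"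
    "\<And>uL uR z v k. uL \<in> states S ==> uR \<in> states S ==> gRP S uL uR w z v ==> k \<in> families S ==> z k = G k (uL, uR)"
proof -
  define N where "N = CARD('n)"
  \<comment> \<open>strengths as a vector, so that domain and range are the same Euclidean space\<close>
  obtain e :: "nat => 'n" where e: "bij_betw e {1..N} UNIV"
    using ex_bij_betw_nat_finite_1[of "UNIV :: 'n set"] by (auto simp: N_def)
  define A where "A = {k. w k \<noteq> 0}"
  define chain :: "nat => (real^'n) \<times> (real^'n) => real^'n" where
    "chain = rec_nat fst (\<lambda>j c p. ccv A (Suc j) (c p) (snd p $ e (Suc j)))"
  have chain [simp]: "chain 0 p = fst p" "chain (Suc j) p = ccv A (Suc j) (chain j p) (snd p $ e (Suc j))" for j p
    by (simp_all add: chain_def)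
  define D where "D = (\<lambda>j. {p. fst p \<in> states S \<and> (\<forall>i<j. (chain i p, snd p $ e (Suc i)) \<in> cdom A (Suc i))})"
  have Suc_fam: "Suc j \<in> families S" if "j < N" for j using that by (auto simp: families_def N_def)
  have D: "open (D j) \<and> continuous_on (D j) (chain j)" if "j <= N" for j
    using that
  proof (induction j)
    case 0
    have "D 0 = states S \<times> UNIV" by (auto simp: D_def)
    then show ?case using open_states by (auto simp: open_Times chain_def intro!: continuous_intros)
  next
    case (Suc j)
    then have IH: "open (D j)" "continuous_on (D j) (chain j)" and k: "Suc j \<in> families S" using Suc_fam by auto
    define M where "M = (\<lambda>p. (chain j p, snd p $ e (Suc j)))"
    have M: "continuous_on (D j) M" unfolding M_def by (intro continuous_intros IH(2))
    have DS: "D (Suc j) = D j \<inter> M -` cdom A (Suc j)" by (auto simp: D_def M_def less_Suc_eq)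
    have o: "open (D (Suc j))" unfolding DS by (rule continuous_open_preimage[OF M IH(1) cdom(1)[OF k]])
    have "continuous_on (D (Suc j)) (\<lambda>p. (\<lambda>(u, \<zeta>). ccv A (Suc j) u \<zeta>) (M p))"
      by (rule continuous_on_compose2[OF cdom(2)[OF k, of A] continuous_on_subset[OF M]]) (auto simp: DS)
    then have "continuous_on (D (Suc j)) (chain (Suc j))"
      by (rule continuous_on_eq) (auto simp: M_def)
    with o show ?case by simp
  qed
  define \<Theta> where "\<Theta> = (\<lambda>p. (fst p, chain N p))"
  have \<Theta>: "continuous_on (D N) \<Theta>" unfolding \<Theta>_def using D[of N] by (intro continuous_intros) auto
  have sol: "gRP S (fst p) (chain N p) w (\<lambda>k. snd p $ e k) (\<lambda>j. chain j p)" if "p \<in> D N" for p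
    unfolding gRP_ccv A_def[symmetric]
  proof (intro conjI ballI)
    fix k assume "k \<in> families S"
    then obtain j where j: "k = Suc j" "j < N" by (cases k) (auto simp: families_def N_def)
    show "(chain (k - 1) p, snd p $ e k) \<in> cdom A k" "chain k p = ccv A k (chain (k - 1) p) (snd p $ e k)"
      using that j by (auto simp: D_def)
  qed (auto simp: N_def)
  have N1: "0 < N" by (simp add: N_def)
  have st: "fst p \<in> states S \<and> chain N p \<in> states S" if p: "p \<in> D N" for p
  proof -
    obtain j where j: "N = Suc j" using N1 by (cases N) auto
    then have "(chain j p, snd p $ e (Suc j)) \<in> cdom A (Suc j)" using p by (auto simp: D_def)
    then have "chain (Suc j) p \<in> states S" using ccv_states[OF Suc_fam[of j]] j by auto
    then show ?thesis using p j by (auto simp: D_def)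
  qed
  have inj: "inj_on \<Theta> (D N)"
  proof (rule inj_onI)
    fix p p' assume p: "p \<in> D N" "p' \<in> D N" and eq: "\<Theta> p = \<Theta> p'"
    have "gRP S (fst p) (chain N p) w (\<lambda>k. snd p' $ e k) (\<lambda>j. chain j p')"
      using sol[OF p(2)] eq by (simp add: \<Theta>_def)
    then have z: "\<forall>k\<in>families S. snd p $ e k = snd p' $ e k"
      using solvable w sol[OF p(1)] st[OF p(1)] unfolding gRP_solvable_def by blast
    have "snd p $ i = snd p' $ i" for i
    proof -
      obtain k where "k \<in> {1..N}" "i = e k" using e by (metis UNIV_I bij_betw_def imageE)
      then show ?thesis using z by (auto simp: families_def N_def)
    qed
    then have "snd p = snd p'" by (simp add: vec_eq_iff)
    then show "p = p'" using eq by (simp add: \<Theta>_def prod_eq_iff)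
  qed
  have surj: "\<exists>p\<in>D N. \<Theta> p = (uL, uR) \<and> (\<forall>k\<in>families S. snd p $ e k = z k)"
    if g: "gRP S uL uR w z v" and uL: "uL \<in> states S" for uL uR z v
  proof -
    define p where "p = (uL, \<chi> i. z (inv_into {1..N} e i))"
    have pz: "snd p $ e k = z k" if "k \<in> {1..N}" for k
      using that bij_betw_inv_into_left[OF e] by (simp add: p_def)
    note g' = g[unfolded gRP_ccv A_def[symmetric]]
    have ch: "chain j p = v j \<and> p \<in> D j" if "j <= N" for j
      using that
    proof (induction j)
      case 0
      then show ?case using g' uL by (simp add: p_def D_def)
    next
      case (Suc j)
      then have k: "Suc j \<in> families S" and IH: "chain j p = v j" "p \<in> D j" using Suc_fam by auto
      have "(v j, z (Suc j)) \<in> cdom A (Suc j)" "v (Suc j) = ccv A (Suc j) (v j) (z (Suc j))"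
        using g' k by force+
      moreover have "snd p $ e (Suc j) = z (Suc j)" using pz Suc.prems by simp
      ultimately show ?case using IH by (auto simp: D_def less_Suc_eq)
    qed
    have "\<Theta> p = (uL, uR)" using ch[of N] g' by (simp add: \<Theta>_def p_def N_def)
    then show ?thesis using ch[of N] pz by (intro bexI[of _ p]) (auto simp: families_def N_def)
  qed
  have im: "\<Theta> ` D N = states S \<times> states S"
  proof (intro equalityI subsetI)
    fix x assume "x \<in> states S \<times> states S"
    then obtain z v where "gRP S (fst x) (snd x) w z v" "fst x \<in> states S"
      using solvable w unfolding gRP_solvable_def by (metis mem_Times_iff)
    from surj[OF this] show "x \<in> \<Theta> ` D N" by force
  qed (use st in \<open>auto simp: \<Theta>_def\<close>)
  obtain g where g: "homeomorphism (D N) (\<Theta> ` D N) \<Theta> g"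
    using invariance_of_domain_homeomorphism[OF _ \<Theta> order_refl inj] D[of N] by auto
  show ?thesis
  proof (rule that[of "\<lambda>k x. snd (g x) $ e k"])
    show "continuous_on (states S \<times> states S) (\<lambda>x. snd (g x) $ e k)" for k
      using homeomorphism_cont2[OF g] unfolding im by (intro continuous_intros)
    fix uL uR z v k assume "uL \<in> states S" "gRP S uL uR w z v" "k \<in> families S"
    then obtain p where "p \<in> D N" "\<Theta> p = (uL, uR)" "snd p $ e k = z k" using surj by blast
    then show "z k = snd (g (uL, uR)) $ e k" using homeomorphism_apply1[OF g] by metis
  qed
qed

lemma gRP_cong_widths: "(\<And>k. k \<in> families S ==> w k = 0 \<longleftrightarrow> w' k = 0) ==> gRP S uL uR w z v \<longleftrightarrow> gRP S uL uR w' z v"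
  by (auto simp: gRP_def)

text \<open>Closeness of strengths for close outer states, for the same widths in both problems.\<close>

definition gRP_close :: "(real^'n) set => real => real => bool" where
  "gRP_close K \<delta> \<eta> \<longleftrightarrow> (\<forall>w uL uR uL' uR' z v z' v'. (\<forall>k\<in>families S. 0 <= w k \<and> (k \<notin> gnl S --> w k = 0)) -->
     uL \<in> K \<and> uR \<in> K \<and> uL' \<in> K \<and> uR' \<in> K --> norm (uL - uL') + norm (uR - uR') < \<delta> -->
     gRP S uL uR w z v --> gRP S uL' uR' w z' v' --> (\<forall>k\<in>families S. \<bar>z k - z' k\<bar> < \<eta>))"

lemma gRP_closeD:
  assumes "gRP_close K \<delta> \<eta>" "\<forall>k\<in>families S. 0 <= w k \<and> (k \<notin> gnl S --> w k = 0)" "uL \<in> K" "uR \<in> K" "uL' \<in> K" "uR' \<in> K"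
    "norm (uL - uL') + norm (uR - uR') < \<delta>" "gRP S uL uR w z v" "gRP S uL' uR' w z' v'" "k \<in> families S"
  shows "\<bar>z k - z' k\<bar> < \<eta>"
  using assms(1)[unfolded gRP_close_def, rule_format, OF bspec[OF assms(2)]] assms(3-) by blast

text \<open>Only the pattern of widths matters, and there are finitely many patterns; for each one uniform continuity on \<open>K \<times> K\<close> applies.\<close>

lemma gRP_strength_uniform:
  assumes K: "compact K" "K \<subseteq> states S" and \<eta>: "0 < \<eta>"
  obtains \<delta> where "0 < \<delta>" "gRP_close K \<delta> \<eta>"
proof -
  define pat where "pat = (\<lambda>A (k::nat). if k \<in> A then 1 else 0 :: real)"
  have one: "\<exists>\<delta>>0. \<forall>uL\<in>K. \<forall>uR\<in>K. \<forall>uL'\<in>K. \<forall>uR'\<in>K. \<forall>z v z' v'. norm (uL - uL') + norm (uR - uR') < \<delta> -->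
      gRP S uL uR (pat A) z v --> gRP S uL' uR' (pat A) z' v' --> \<bar>z k - z' k\<bar> < \<eta>"
    if A: "A \<subseteq> families S \<inter> gnl S" and k: "k \<in> families S" for A k
  proof -
    have w: "\<forall>k\<in>families S. 0 <= pat A k \<and> (k \<notin> gnl S --> pat A k = 0)" using A by (auto simp: pat_def)
    obtain G where G: "continuous_on (states S \<times> states S) (G k)"
      "\<And>uL uR z v. uL \<in> states S ==> uR \<in> states S ==> gRP S uL uR (pat A) z v ==> z k = G k (uL, uR)"
      using gRP_strength_continuous[OF w] k by metis
    have "uniformly_continuous_on (K \<times> K) (G k)"
      by (rule compact_uniformly_continuous[OF continuous_on_subset[OF G(1)]]) (use K in \<open>auto intro: compact_Times\<close>)
    then obtain \<delta> where \<delta>: "0 < \<delta>" "\<And>x y. x \<in> K \<times> K ==> y \<in> K \<times> K ==> dist y x < \<delta> ==> dist (G k y) (G k x) < \<eta>"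
      unfolding uniformly_continuous_on_def using \<eta> by metis
    show ?thesis
    proof (intro exI[of _ \<delta>] conjI ballI allI impI \<delta>(1))
      fix uL uR uL' uR' z v z' v'
      assume K': "uL \<in> K" "uR \<in> K" "uL' \<in> K" "uR' \<in> K" and d: "norm (uL - uL') + norm (uR - uR') < \<delta>"
        and g: "gRP S uL uR (pat A) z v" "gRP S uL' uR' (pat A) z' v'"
      have "dist (uL, uR) (uL', uR') <= norm (uL - uL') + norm (uR - uR')"
        using norm_Pair_le[of "uL - uL'" "uR - uR'"] by (simp add: dist_norm)
      then have "dist (G k (uL, uR)) (G k (uL', uR')) < \<eta>" using d K' by (intro \<delta>(2)) auto
      moreover have "z k = G k (uL, uR)" "z' k = G k (uL', uR')" using G(2) g K' K(2) by blast+
      ultimately show "\<bar>z k - z' k\<bar> < \<eta>" by (simp add: dist_real_def)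
    qed
  qed
  define P where "P = (\<lambda>\<delta> A k. \<forall>uL\<in>K. \<forall>uR\<in>K. \<forall>uL'\<in>K. \<forall>uR'\<in>K. \<forall>z v z' v'. norm (uL - uL') + norm (uR - uR') < \<delta> -->
      gRP S uL uR (pat A) z v --> gRP S uL' uR' (pat A) z' v' --> \<bar>z k - z' k\<bar> < \<eta>)"
  define I where "I = Pow (families S \<inter> gnl S) \<times> families S"
  have "\<forall>i\<in>I. \<exists>\<delta>>0. P \<delta> (fst i) (snd i)"
    unfolding P_def I_def using one by auto
  then obtain d where d: "\<And>i. i \<in> I ==> 0 < d i \<and> P (d i) (fst i) (snd i)" by metis
  have I: "finite I" "I \<noteq> {}" by (auto simp: I_def families_def)
  define \<delta> where "\<delta> = Min (d ` I)"
  have \<delta>: "0 < \<delta>" "\<And>i. i \<in> I ==> \<delta> <= d i" using I d by (auto simp: \<delta>_def)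
  show ?thesis
  proof (rule that[OF \<delta>(1)], unfold gRP_close_def, intro allI impI ballI, elim conjE)
    fix w uL uR uL' uR' z v z' v' k
    assume w: "\<forall>k\<in>families S. 0 <= w k \<and> (k \<notin> gnl S --> w k = 0)" and K': "uL \<in> K" "uR \<in> K" "uL' \<in> K" "uR' \<in> K"
      and n: "norm (uL - uL') + norm (uR - uR') < \<delta>" and g: "gRP S uL uR w z v" "gRP S uL' uR' w z' v'" and k: "k \<in> families S"
    define A where "A = {k \<in> families S. w k \<noteq> 0}"
    have i: "(A, k) \<in> I" using w k by (auto simp: I_def A_def)
    have "gRP S uL uR (pat A) z v" "gRP S uL' uR' (pat A) z' v'"
      using g gRP_cong_widths[of w "pat A"] by (auto simp: A_def pat_def)
    moreover have "norm (uL - uL') + norm (uR - uR') < d (A, k)" using n \<delta>(2)[OF i] by simp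
    ultimately show "\<bar>z k - z' k\<bar> < \<eta>" using d[OF i] K' unfolding P_def fst_conv snd_conv by blast
  qed
qed

end

section \<open>Wave estimates on a compact set of states\<close>

definition fjump :: "'n::finite hsys => 'n wave => real^'n" where
  "fjump S \<gamma> = ffun S (rst \<gamma>) - ffun S (lst \<gamma>)"

definition qjump :: "'n::finite hsys => 'n wave => real^'n" where
  "qjump S \<gamma> = qfun S (rst \<gamma>) - qfun S (lst \<gamma>)"

lemma compact_cball_enlargement:
  fixes K :: "'a::euclidean_space set"
  assumes "compact K" "open X" "K \<subseteq> X"
  obtains \<rho> K' where "0 < \<rho>" "compact K'" "K' \<subseteq> X" "\<And>x y. x \<in> K ==> dist x y <= \<rho> ==> y \<in> K'"
proof -
  obtain e where e: "0 < e" "(\<Union>x\<in>K. cball x e) \<subseteq> X"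
    using compact_subset_open_imp_cball_epsilon_subset[OF assms] by blast
  have "(\<Union>x\<in>K. cball x e) = {x + y |x y. x \<in> K \<and> y \<in> cball 0 e}"
  proof (intro equalityI subsetI)
    fix z assume "z \<in> (\<Union>x\<in>K. cball x e)"
    then obtain x where "x \<in> K" "dist x z <= e" by auto
    then show "z \<in> {x + y |x y. x \<in> K \<and> y \<in> cball 0 e}"
      by (intro CollectI exI[of _ x] exI[of _ "z - x"]) (auto simp: dist_norm norm_minus_commute)
  qed (force simp: dist_norm)
  then have "compact (\<Union>x\<in>K. cball x e)"
    using compact_sums[OF assms(1) compact_cball[of 0 e]] by simp
  then show ?thesis using e by (intro that[of e "\<Union>x\<in>K. cball x e"]) auto
qed

lemma finite_uniform_bound:
  fixes P :: "'i => real => bool"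
  assumes "finite I" "\<And>i. i \<in> I ==> \<exists>M. P i M" "\<And>i M M'. P i M ==> M <= M' ==> P i M'"
  shows "\<exists>M\<ge>M0. \<forall>i\<in>I. P i M"
proof -
  obtain m where m: "\<And>i. i \<in> I ==> P i (m i)" using assms(2) by metis
  show ?thesis
  proof (intro exI[of _ "Max (insert M0 (m ` I))"] conjI ballI)
    show "M0 <= Max (insert M0 (m ` I))" using assms(1) by simp
    show "P i (Max (insert M0 (m ` I)))" if "i \<in> I" for i
      by (rule assms(3)[OF m[OF that]]) (use assms(1) that in simp)
  qed
qed

locale hyperbolic_compact = hyperbolic S for S :: "'n::finite hsys" +
  fixes K :: "(real^'n) set"
  assumes K: "compact K" "K \<subseteq> states S"
begin

lemma finite_families: "finite (families S)"
  by (simp add: families_def)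

lemma bounded_on_compact:
  fixes g :: "real^'n => 'b::real_normed_vector"
  assumes "compact K'" "K' \<subseteq> states S" "continuous_on (states S) g"
  obtains M where "\<And>u. u \<in> K' ==> norm (g u) <= M"
proof -
  have "bounded (g ` K')"
    using assms by (intro compact_imp_bounded compact_continuous_image) (auto intro: continuous_on_subset)
  then show ?thesis using that unfolding bounded_iff by blast
qed

lemma families_bounded_on_compact:
  fixes g :: "nat => real^'n => 'b::real_normed_vector"
  assumes "compact K'" "K' \<subseteq> states S" "\<And>k. k \<in> families S ==> continuous_on (states S) (g k)"
  obtains M where "0 < M" "\<And>k u. k \<in> families S ==> u \<in> K' ==> norm (g k u) <= M"
proof -
  have "\<exists>M. \<forall>u\<in>K'. norm (g k u) <= M" if "k \<in> families S" for k
    using bounded_on_compact[OF assms(1,2) assms(3)[OF that]] by metis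
  moreover have "\<forall>u\<in>K'. norm (g k u) <= M'" if "\<forall>u\<in>K'. norm (g k u) <= M" "M <= M'" for k M M'
    using that by force
  ultimately have "\<exists>M\<ge>1. \<forall>k\<in>families S. \<forall>u\<in>K'. norm (g k u) <= M"
    by (intro finite_uniform_bound finite_families) auto
  then obtain M where "1 <= M" "\<forall>k\<in>families S. \<forall>u\<in>K'. norm (g k u) <= M" by blast
  then show ?thesis by (intro that[of M]) auto
qed

text \<open>A curve needs a parameter length of at least \<open>\<rho> / M\<close> to leave the \<open>\<rho>\<close>-neighbourhood \<open>K'\<close> of \<open>K\<close>, where \<open>M\<close> bounds \<open>r\<^sub>k\<close>.\<close>

lemma short_icurves:
  obtains K' M \<tau> where "compact K'" "K \<subseteq> K'" "K' \<subseteq> states S" "0 < M" "0 < \<tau>"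
    "\<And>k c \<zeta> z. [|k \<in> families S; icurve k c (closed_segment 0 \<zeta>); c 0 \<in> K; \<bar>\<zeta>\<bar> <= \<tau>; z \<in> closed_segment 0 \<zeta>|] ==>
      c z \<in> K' \<and> norm (c z - c 0) <= M * \<bar>\<zeta>\<bar>"
proof -
  obtain \<rho> K' where K': "0 < \<rho>" "compact K'" "K' \<subseteq> states S" "\<And>x y. x \<in> K ==> dist x y <= \<rho> ==> y \<in> K'"
    using compact_cball_enlargement[OF K(1) open_states K(2)] by metis
  obtain M where M: "0 < M" "\<And>k u. k \<in> families S ==> u \<in> K' ==> norm (rvec S k u) <= M"
    using families_bounded_on_compact[OF K'(2,3), of "rvec S"] C1_on_continuous[OF C1_rvec] by blast
  define \<tau> where "\<tau> = \<rho> / (2 * M)"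
  have \<tau>: "0 < \<tau>" "M * \<tau> < \<rho>" using K'(1) M(1) by (auto simp: \<tau>_def)
  show ?thesis
  proof (rule that[OF K'(2) _ K'(3) M(1) \<tau>(1)])
    show "K \<subseteq> K'" using K'(1,4) by force
    fix k c \<zeta> z
    assume k: "k \<in> families S" and c: "icurve k c (closed_segment 0 \<zeta>)" and c0: "c 0 \<in> K" and \<zeta>: "\<bar>\<zeta>\<bar> <= \<tau>" and z: "z \<in> closed_segment 0 \<zeta>"
    define d where "d = (\<lambda>s. c (s * \<zeta>))"
    have seg: "(\<lambda>s. s * \<zeta>) ` {0..1} = closed_segment 0 \<zeta>"
      by (auto simp: closed_segment_def image_def)
    have dd: "(d has_derivative (\<lambda>x. x *\<^sub>R (\<zeta> *\<^sub>R rvec S k (d s)))) (at s within {0..1})" if s: "s \<in> {0..1}" for s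
    proof -
      have "((\<lambda>s. s * \<zeta>) has_vector_derivative \<zeta>) (at s within {0..1})"
        by (auto simp: has_real_derivative_iff_has_vector_derivative[symmetric] intro!: derivative_eq_intros)
      moreover have "(c has_vector_derivative rvec S k (c (s * \<zeta>))) (at (s * \<zeta>) within (\<lambda>s. s * \<zeta>) ` {0..1})"
        using c s unfolding seg icurve_def by (auto simp: seg[symmetric])
      ultimately show ?thesis
        unfolding d_def using vector_diff_chain_within[of "\<lambda>s. s * \<zeta>" \<zeta> s "{0..1}" c] by (simp add: has_vector_derivative_def comp_def)
    qed
    then have dcont: "continuous_on {0..1} d"
      by (meson continuous_on_eq_continuous_within has_derivative_continuous)
    have bound: "norm (d s - d 0) <= M * \<bar>\<zeta>\<bar>" if s: "s \<in> {0..1}" and in': "\<And>t. t \<in> {0..s} ==> d t \<in> K'" for s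
    proof -
      have "norm (d s - d 0) <= (\<bar>\<zeta>\<bar> * M) * norm (s - 0)"
      proof (rule differentiable_bound[of "{0..s}" d])
        fix t assume t: "t \<in> {0..s}"
        show "(d has_derivative (\<lambda>x. x *\<^sub>R (\<zeta> *\<^sub>R rvec S k (d t)))) (at t within {0..s})"
          by (rule has_derivative_subset[OF dd]) (use t s in auto)
        have "norm (\<zeta> *\<^sub>R rvec S k (d t)) <= \<bar>\<zeta>\<bar> * M"
          using M(2)[OF k in'[OF t]] by (simp add: mult_left_mono)
        then have "norm (x *\<^sub>R (\<zeta> *\<^sub>R rvec S k (d t))) <= (\<bar>\<zeta>\<bar> * M) * norm x" for x
          using mult_left_mono[OF _ abs_ge_zero[of x]] by (metis mult.commute norm_scaleR real_norm_def)
        then show "onorm (\<lambda>x. x *\<^sub>R (\<zeta> *\<^sub>R rvec S k (d t))) <= \<bar>\<zeta>\<bar> * M"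
          by (intro onorm_bound) (use M(1) in auto)
      qed (use s in auto)
      also have "\<dots> <= (\<bar>\<zeta>\<bar> * M) * 1" using s M(1) by (intro mult_left_mono) auto
      finally show ?thesis by (simp add: mult.commute)
    qed
    have near: "norm (d s - d 0) < \<rho>" if s: "s \<in> {0..1}" for s
    proof (rule ccontr)
      assume n: "\<not> norm (d s - d 0) < \<rho>"
      have gc: "continuous_on {0..s} (\<lambda>t. norm (d t - d 0))"
        using s by (intro continuous_intros continuous_on_subset[OF dcont]) auto
      define A where "A = {t \<in> {0..s}. \<rho> <= norm (d t - d 0)}"
      have "closed A" unfolding A_def
        using continuous_closed_preimage[OF gc closed_atLeastAtMost closed_atLeast[of \<rho>]] by (simp add: vimage_def Int_def conj_commute)
      moreover have "s \<in> A" using n s by (auto simp: A_def)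
      moreover have "bdd_below A" by (rule bdd_belowI[of _ 0]) (auto simp: A_def)
      ultimately have i: "Inf A \<in> A" "\<And>t. t \<in> A ==> Inf A <= t" using closed_contains_Inf[of A] cInf_lower[of _ A] by auto
      define s0 where "s0 = Inf A"
      have s0: "s0 \<in> {0..s}" "\<rho> <= norm (d s0 - d 0)" using i(1) by (auto simp: A_def s0_def)
      have less: "norm (d t - d 0) < \<rho>" if "0 <= t" "t < s0" for t
        using i(2)[of t] that s0(1) by (force simp: A_def s0_def)
      have "norm (d t - d 0) <= \<rho>" if "t \<in> {0..s0}" for t
      proof (cases "t < s0")
        case False
        then have ts: "t = s0" using that by auto
        show ?thesis
        proof (cases "s0 = 0")
          case True then show ?thesis using ts K'(1) by simp
        next
          case False
          then have "0 < s0" using s0 by auto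
          then have "closure {0..<s0} = {0..s0}" by simp
          moreover have "continuous_on {0..s0} (\<lambda>t. norm (d t - d 0))" using gc s0 by (auto intro: continuous_on_subset)
          ultimately show ?thesis
            using continuous_le_on_closure[of "{0..<s0}" "\<lambda>t. norm (d t - d 0)" s0 \<rho>] less ts \<open>0 < s0\<close> by (force intro: less_imp_le)
        qed
      qed (use less that in \<open>auto intro: less_imp_le\<close>)
      then have "d t \<in> K'" if "t \<in> {0..s0}" for t
        using K'(4)[OF c0, of "d t"] that by (auto simp: d_def dist_norm norm_minus_commute)
      then have "norm (d s0 - d 0) <= M * \<bar>\<zeta>\<bar>" using s0 s by (intro bound) auto
      also have "\<dots> <= M * \<tau>" using \<zeta> M(1) by simp
      finally show False using \<tau>(2) s0(2) by simp
    qed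
    obtain s where s: "s \<in> {0..1}" "z = s * \<zeta>" using z unfolding seg[symmetric] by auto
    have in': "d t \<in> K'" if "t \<in> {0..1}" for t
      using K'(4)[OF c0, of "d t"] near[OF that] by (auto simp: d_def dist_norm norm_minus_commute)
    have "norm (d s - d 0) <= M * \<bar>\<zeta>\<bar>" using s in' by (intro bound) auto
    then show "c z \<in> K' \<and> norm (c z - c 0) <= M * \<bar>\<zeta>\<bar>" using in'[OF s(1)] s(2) by (simp add: d_def)
  qed
qed

text \<open>Strengths control jumps: near strength \<open>0\<close> by the Lipschitz bounds, elsewhere because \<open>K\<close> is bounded.\<close>

lemma jump_le_strength:
  obtains \<Lambda> where "0 < \<Lambda>" "\<And>\<gamma>. valid_wave S \<gamma> ==> lst \<gamma> \<in> K ==> rst \<gamma> \<in> K ==> norm (rst \<gamma> - lst \<gamma>) <= \<Lambda> * \<bar>str \<gamma>\<bar>"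
proof -
  obtain B where B: "\<And>u. u \<in> K ==> norm u <= B"
    using compact_imp_bounded[OF K(1)] unfolding bounded_iff by blast
  obtain K' M \<tau> where sh: "0 < M" "0 < \<tau>"
    "\<And>k c \<zeta> z. [|k \<in> families S; icurve k c (closed_segment 0 \<zeta>); c 0 \<in> K; \<bar>\<zeta>\<bar> <= \<tau>; z \<in> closed_segment 0 \<zeta>|] ==>
      c z \<in> K' \<and> norm (c z - c 0) <= M * \<bar>\<zeta>\<bar>"
    using short_icurves by metis
  have large: "norm (rst \<gamma> - lst \<gamma>) <= (2 * B / t) * \<bar>str \<gamma>\<bar>" if "lst \<gamma> \<in> K" "rst \<gamma> \<in> K" "0 < t" "t <= \<bar>str \<gamma>\<bar>" for \<gamma> :: "'n wave" and t
  proof -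
    have n: "norm (rst \<gamma> - lst \<gamma>) <= 2 * B" using norm_triangle_ineq4[of "rst \<gamma>" "lst \<gamma>"] B[OF that(1)] B[OF that(2)] by linarith
    then have "0 <= 2 * B" using norm_ge_zero order.trans by blast
    then have "2 * B * t <= 2 * B * \<bar>str \<gamma>\<bar>" using that by (intro mult_left_mono) auto
    then have "2 * B <= (2 * B / t) * \<bar>str \<gamma>\<bar>" using that(3) by (simp add: field_simps)
    with n show ?thesis by linarith
  qed
  have E: "\<exists>\<Lambda>. \<forall>\<gamma>. valid_wave S \<gamma> \<and> fam \<gamma> = k \<and> \<not> smooth \<gamma> \<and> lst \<gamma> \<in> K \<and> rst \<gamma> \<in> K --> norm (rst \<gamma> - lst \<gamma>) <= \<Lambda> * \<bar>str \<gamma>\<bar>"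
    if k: "k \<in> families S" for k
  proof -
    have "compact (K \<times> {0::real})" "K \<times> {0} \<subseteq> edom S k"
      using K edom_0(1)[OF k] by (auto intro: compact_Times)
    then obtain e C where eC: "0 < e" "compact C" "C \<subseteq> edom S k" "\<And>x y. x \<in> K \<times> {0} ==> dist x y <= e ==> y \<in> C"
      using compact_cball_enlargement[OF _ open_edom[OF k], of "K \<times> {0}"] by metis
    have "local_lipschitz {0::real} C (\<lambda>_. \<lambda>(u, \<zeta>). ecv S k u \<zeta>)"
    proof (rule local_lipschitzI)
      fix t :: real and x assume "x \<in> C"
      then obtain \<delta> L where dL: "0 < \<delta>" "L-lipschitz_on (ball x \<delta> \<inter> edom S k) (\<lambda>(u, \<zeta>). ecv S k u \<zeta>)"
        using ecv_local_lipschitz[OF k] eC(3) by blast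
      have "L-lipschitz_on (cball x (\<delta> / 2) \<inter> C) (\<lambda>(u, \<zeta>). ecv S k u \<zeta>)"
        by (rule lipschitz_on_subset[OF dL(2)]) (use eC(3) dL(1) in auto)
      then show "\<exists>u>0. \<exists>L. \<forall>t\<in>cball t u \<inter> {0}. L-lipschitz_on (cball x u \<inter> C) (\<lambda>(u, \<zeta>). ecv S k u \<zeta>)"
        using dL(1) by (intro exI[of _ "\<delta> / 2"]) auto
    qed
    then obtain L where L: "\<And>t. t \<in> {0::real} ==> L-lipschitz_on C (\<lambda>(u, \<zeta>). ecv S k u \<zeta>)"
      by (rule local_lipschitz_compact_implies_lipschitz) (use eC in auto)
    have "norm (rst \<gamma> - lst \<gamma>) <= max L (2 * B / e) * \<bar>str \<gamma>\<bar>"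
      if g: "valid_wave S \<gamma>" "fam \<gamma> = k" "\<not> smooth \<gamma>" "lst \<gamma> \<in> K" "rst \<gamma> \<in> K" for \<gamma>
    proof (cases "\<bar>str \<gamma>\<bar> <= e")
      case True
      have r: "rst \<gamma> = ecv S k (lst \<gamma>) (str \<gamma>)" using g by (auto simp: valid_wave_def E_curve_def)
      have "(lst \<gamma>, str \<gamma>) \<in> C" "(lst \<gamma>, 0) \<in> C"
        using eC(1) g(4) True by (auto intro!: eC(4)[of "(lst \<gamma>, 0)"] simp: dist_Pair_Pair)
      from lipschitz_onD[OF L this] have "norm (rst \<gamma> - lst \<gamma>) <= L * \<bar>str \<gamma>\<bar>"
        using edom_0(2)[OF k, of "lst \<gamma>"] g(4) K by (auto simp: r dist_norm dist_Pair_Pair)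
      also have "\<dots> <= max L (2 * B / e) * \<bar>str \<gamma>\<bar>" by (intro mult_right_mono) auto
      finally show ?thesis .
    next
      case False
      have "norm (rst \<gamma> - lst \<gamma>) <= (2 * B / e) * \<bar>str \<gamma>\<bar>" using g False eC(1) by (intro large) auto
      also have "\<dots> <= max L (2 * B / e) * \<bar>str \<gamma>\<bar>" by (intro mult_right_mono) auto
      finally show ?thesis .
    qed
    then show ?thesis by blast
  qed
  define P where "P = (\<lambda>k \<Lambda>. \<forall>\<gamma>. valid_wave S \<gamma> \<and> fam \<gamma> = k \<and> \<not> smooth \<gamma> \<and> lst \<gamma> \<in> K \<and> rst \<gamma> \<in> K --> norm (rst \<gamma> - lst \<gamma>) <= \<Lambda> * \<bar>str \<gamma>\<bar>)"
  have "P k M'" if "P k M" "M <= M'" for k M M'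
    unfolding P_def
  proof (intro allI impI)
    fix \<gamma> :: "'n wave" assume "valid_wave S \<gamma> \<and> fam \<gamma> = k \<and> \<not> smooth \<gamma> \<and> lst \<gamma> \<in> K \<and> rst \<gamma> \<in> K"
    then have "norm (rst \<gamma> - lst \<gamma>) <= M * \<bar>str \<gamma>\<bar>" using that(1) unfolding P_def by blast
    also have "\<dots> <= M' * \<bar>str \<gamma>\<bar>" using that(2) by (intro mult_right_mono) auto
    finally show "norm (rst \<gamma> - lst \<gamma>) <= M' * \<bar>str \<gamma>\<bar>" .
  qed
  then obtain \<Lambda>1 where \<Lambda>1: "1 <= \<Lambda>1" "\<And>k. k \<in> families S ==> P k \<Lambda>1"
    using finite_uniform_bound[OF finite_families, of P 1] E unfolding P_def by blast
  note \<Lambda>1 = \<Lambda>1[unfolded P_def]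
  define \<Lambda> where "\<Lambda> = max \<Lambda>1 (max M (2 * B / \<tau>))"
  show ?thesis
  proof (rule that[of \<Lambda>])
    show "0 < \<Lambda>" using \<Lambda>1(1) by (auto simp: \<Lambda>_def)
    fix \<gamma> :: "'n wave" assume g: "valid_wave S \<gamma>" "lst \<gamma> \<in> K" "rst \<gamma> \<in> K"
    have k: "fam \<gamma> \<in> families S" using g by (simp add: valid_wave_def)
    have "norm (rst \<gamma> - lst \<gamma>) <= \<Lambda>1 * \<bar>str \<gamma>\<bar> \<or> norm (rst \<gamma> - lst \<gamma>) <= M * \<bar>str \<gamma>\<bar> \<or> norm (rst \<gamma> - lst \<gamma>) <= (2 * B / \<tau>) * \<bar>str \<gamma>\<bar>"
    proof (cases "smooth \<gamma>")
      case True
      show ?thesis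
      proof (cases "\<bar>str \<gamma>\<bar> <= \<tau>")
        case le: True
        obtain c where c: "c 0 = lst \<gamma>" "c (str \<gamma>) = rst \<gamma>" "icurve (fam \<gamma>) c (closed_segment 0 (str \<gamma>))"
          using g True by (auto simp: valid_wave_def W_curve_icurve)
        show ?thesis using sh(3)[OF k c(3) _ le, of "str \<gamma>"] c g by auto
      next
        case False
        then show ?thesis using large[OF g(2,3) sh(2)] by auto
      qed
    qed (use \<Lambda>1(2)[OF k] g in blast)
    moreover have "\<Lambda>1 * \<bar>str \<gamma>\<bar> <= \<Lambda> * \<bar>str \<gamma>\<bar>" "M * \<bar>str \<gamma>\<bar> <= \<Lambda> * \<bar>str \<gamma>\<bar>" "(2 * B / \<tau>) * \<bar>str \<gamma>\<bar> <= \<Lambda> * \<bar>str \<gamma>\<bar>"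
      by (intro mult_right_mono; simp add: \<Lambda>_def)+
    ultimately show "norm (rst \<gamma> - lst \<gamma>) <= \<Lambda> * \<bar>str \<gamma>\<bar>" by linarith
  qed
qed

text \<open>Along the \<open>k\<close>-th integral curve, \<open>f\<close> and \<open>q\<close> are differentiated by the chain rule and the eigenvalue equation.\<close>

definition qdir :: "nat => real^'n => real^'n" where
  "qdir k u = frechet_derivative (qfun S) (at u) (rvec S k u)"

lemma derivative_along_curve:
  assumes k: "k \<in> families S" and c: "icurve k c I" and z: "z \<in> I"
  shows "((\<lambda>z. qfun S (c z)) has_vector_derivative qdir k (c z)) (at z within I)"
    "((\<lambda>z. ffun S (c z)) has_vector_derivative lam S k (c z) *\<^sub>R qdir k (c z)) (at z within I)"
    "((\<lambda>z. lam S k (c z)) has_vector_derivative frechet_derivative (lam S k) (at (c z)) (rvec S k (c z))) (at z within I)"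
proof -
  have cz: "c z \<in> states S" "(c has_vector_derivative rvec S k (c z)) (at z within I)"
    using c z by (auto simp: icurve_def)
  have chain: "((\<lambda>z. g (c z)) has_vector_derivative frechet_derivative g (at (c z)) (rvec S k (c z))) (at z within I)"
    if g: "C1_on (states S) g" for g :: "real^'n => 'b::real_normed_vector"
  proof -
    obtain g' where "(g has_derivative g') (at (c z))" using g cz(1) unfolding C1_on_def by blast
    then have "(g has_derivative frechet_derivative g (at (c z))) (at (c z))"
      using frechet_derivative_at by metis
    then have gd: "(g has_derivative frechet_derivative g (at (c z))) (at (c z) within c ` I)"
      by (rule has_derivative_at_withinI)
    have "((g \<circ> c) has_derivative frechet_derivative g (at (c z)) \<circ> (\<lambda>x. x *\<^sub>R rvec S k (c z))) (at z within I)"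
      by (rule diff_chain_within[OF cz(2)[unfolded has_vector_derivative_def] gd])
    moreover have "frechet_derivative g (at (c z)) \<circ> (\<lambda>x. x *\<^sub>R rvec S k (c z)) = (\<lambda>x. x *\<^sub>R frechet_derivative g (at (c z)) (rvec S k (c z)))"
      using linear_cmul[OF has_derivative_linear[OF gd]] by (auto simp: fun_eq_iff)
    ultimately show ?thesis by (simp add: has_vector_derivative_def comp_def)
  qed
  show "((\<lambda>z. qfun S (c z)) has_vector_derivative qdir k (c z)) (at z within I)"
    unfolding qdir_def by (rule chain[OF C1_q])
  show "((\<lambda>z. lam S k (c z)) has_vector_derivative frechet_derivative (lam S k) (at (c z)) (rvec S k (c z))) (at z within I)"
    by (rule chain[OF C1_lam[OF k]])
  have "frechet_derivative (ffun S) (at (c z)) (rvec S k (c z)) = lam S k (c z) *\<^sub>R qdir k (c z)"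
    using strict k cz(1) unfolding strictly_hyperbolic_def qdir_def by blast
  then show "((\<lambda>z. ffun S (c z)) has_vector_derivative lam S k (c z) *\<^sub>R qdir k (c z)) (at z within I)"
    using chain[OF C1_f] by simp
qed

lemma qdir_continuous: "k \<in> families S ==> continuous_on (states S) (qdir k)"
proof -
  assume k: "k \<in> families S"
  obtain q' where q': "\<And>x. x \<in> states S ==> (qfun S has_derivative blinfun_apply (q' x)) (at x)" "continuous_on (states S) q'"
    using C1_onD[OF C1_q] by blast
  have "qdir k u = blinfun_apply (q' u) (rvec S k u)" if "u \<in> states S" for u
    unfolding qdir_def using frechet_derivative_at[OF q'(1)[OF that]] by simp
  moreover have "continuous_on (states S) (\<lambda>u. blinfun_apply (q' u) (rvec S k u))"
    by (intro continuous_intros q'(2) C1_on_continuous C1_rvec k)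
  ultimately show ?thesis by (subst continuous_on_cong[OF refl]) auto
qed

lemma qdir_nonzero: "k \<in> families S ==> u \<in> states S ==> qdir k u \<noteq> 0"
proof
  assume k: "k \<in> families S" and u: "u \<in> states S" and "qdir k u = 0"
  obtain q' where q': "(qfun S has_derivative q') (at u)"
    using C1_q u unfolding C1_on_def by blast
  have lin: "linear (frechet_derivative (qfun S) (at u))"
    using has_derivative_linear[OF q'] frechet_derivative_at[OF q'] by simp
  have "inj (frechet_derivative (qfun S) (at u))" "rvec S k u \<noteq> 0"
    using strict k u unfolding strictly_hyperbolic_def bij_def by blast+
  then show False using \<open>qdir k u = 0\<close> linear_0[OF lin] unfolding qdir_def by (metis injD)
qed

lemma closed_segment_curve_bound:
  fixes F :: "real => real^'n"
  assumes "\<And>z. z \<in> closed_segment 0 \<zeta> ==> (F has_vector_derivative F' z) (at z within closed_segment 0 \<zeta>)"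
    and "\<And>z. z \<in> closed_segment 0 \<zeta> ==> norm (F' z) <= B"
  shows "norm (F \<zeta> - F 0) <= B * \<bar>\<zeta>\<bar>"
proof -
  have B: "0 <= B" using order.trans[OF norm_ge_zero assms(2)[of 0]] by simp
  have "norm (F \<zeta> - F 0) <= B * norm (\<zeta> - 0)"
  proof (rule differentiable_bound[of "closed_segment 0 \<zeta>" F])
    show "(F has_derivative (\<lambda>x. x *\<^sub>R F' z)) (at z within closed_segment 0 \<zeta>)" if "z \<in> closed_segment 0 \<zeta>" for z
      using assms(1)[OF that] by (simp add: has_vector_derivative_def)
    show "onorm (\<lambda>x. x *\<^sub>R F' z) <= B" if "z \<in> closed_segment 0 \<zeta>" for z
      by (intro onorm_bound B) (use mult_right_mono[OF assms(2)[OF that] abs_ge_zero] in \<open>simp add: mult.commute\<close>)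
  qed auto
  then show ?thesis by simp
qed

text \<open>A short simple wave almost satisfies the jump conditions with its characteristic speed: the derivative of \<open>f - \<lambda> q\<close> along the curve is
\<open>O(\<zeta>)\<close>, as it vanishes at the start. The lower bound for \<open>[q]\<close> follows from invertibility of \<open>Dq\<close>, since \<open>r\<^sub>k \<noteq> 0\<close>.\<close>

lemma simple_wave_estimates:
  obtains \<Lambda> m \<tau> where "0 < \<Lambda>" "0 < m" "0 < \<tau>"
    "\<And>k u \<zeta> u'. [|k \<in> families S; u \<in> K; W_curve S k u \<zeta> u'; \<bar>\<zeta>\<bar> <= \<tau>|] ==>
      norm ((ffun S u' - ffun S u) - lam S k u *\<^sub>R (qfun S u' - qfun S u)) <= \<Lambda> * \<zeta>\<^sup>2 \<and> m * \<bar>\<zeta>\<bar> <= norm (qfun S u' - qfun S u)"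
    "\<And>k u \<zeta> u'. [|k \<in> families S; u \<in> K; W_curve S k u \<zeta> u'; \<bar>\<zeta>\<bar> <= \<tau>|] ==> \<bar>lam S k u'\<bar> <= \<Lambda>"
    "\<And>k u. k \<in> families S ==> u \<in> K ==> \<bar>lam S k u\<bar> <= \<Lambda>"
proof -
  obtain K' M \<tau>0 where sh: "compact K'" "K \<subseteq> K'" "K' \<subseteq> states S" "0 < M" "0 < \<tau>0"
    "\<And>k c \<zeta> z. [|k \<in> families S; icurve k c (closed_segment 0 \<zeta>); c 0 \<in> K; \<bar>\<zeta>\<bar> <= \<tau>0; z \<in> closed_segment 0 \<zeta>|] ==>
      c z \<in> K' \<and> norm (c z - c 0) <= M * \<bar>\<zeta>\<bar>"
    using short_icurves by metis
  obtain D where D: "0 < D" "\<And>k u. k \<in> families S ==> u \<in> K' ==> norm (qdir k u) <= D"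
    using families_bounded_on_compact[OF sh(1,3), of qdir] qdir_continuous by blast
  obtain Lb where Lb: "0 < Lb" "\<And>k u. k \<in> families S ==> u \<in> K' ==> norm (lam S k u) <= Lb"
    using families_bounded_on_compact[OF sh(1,3), of "lam S"] C1_on_continuous[OF C1_lam] by blast
  have "\<exists>L. L-lipschitz_on K' (lam S k)" if "k \<in> families S" for k
    using C1_on_lipschitz[OF C1_lam[OF that] open_states sh(1,3)] by metis
  moreover have "M'-lipschitz_on K' (lam S k)" if "M-lipschitz_on K' (lam S k)" "M <= M'" for k M M'
    using lipschitz_on_mono[OF that(1) order_refl that(2)] .
  ultimately obtain L where L: "1 <= L" "\<And>k. k \<in> families S ==> L-lipschitz_on K' (lam S k)"
    using finite_uniform_bound[OF finite_families, of "\<lambda>k L. L-lipschitz_on K' (lam S k)" 1] by blast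
  have "\<exists>M. \<forall>u\<in>K. 1 <= M * norm (qdir k u) \<and> 0 < M" if k: "k \<in> families S" for k
  proof -
    have "continuous_on (states S) (\<lambda>u. inverse (norm (qdir k u)))"
      using qdir_nonzero[OF k] by (intro continuous_intros qdir_continuous k) auto
    then obtain M where M: "\<And>u. u \<in> K ==> norm (inverse (norm (qdir k u))) <= M"
      using bounded_on_compact[OF K] by metis
    have "1 <= max 1 M * norm (qdir k u)" if u: "u \<in> K" for u
    proof -
      have "0 < norm (qdir k u)" using qdir_nonzero[OF k] u K by auto
      moreover have "inverse (norm (qdir k u)) <= max 1 M" using M[OF u] by simp
      ultimately show ?thesis by (simp add: field_simps)
    qed
    then show ?thesis by (intro exI[of _ "max 1 M"]) auto
  qed
  moreover have "\<forall>u\<in>K. 1 <= M' * norm (qdir k u) \<and> 0 < M'" if "\<forall>u\<in>K. 1 <= M * norm (qdir k u) \<and> 0 < M" "M <= M'" for k M M'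
  proof (intro ballI conjI)
    fix u assume u: "u \<in> K"
    have "1 <= M * norm (qdir k u)" using that(1) u by blast
    also have "\<dots> <= M' * norm (qdir k u)" using that(2) by (intro mult_right_mono) auto
    finally show "1 <= M' * norm (qdir k u)" .
    show "0 < M'" using that u by force
  qed
  ultimately obtain M1 where M1: "1 <= M1" "\<And>k. k \<in> families S ==> \<forall>u\<in>K. 1 <= M1 * norm (qdir k u) \<and> 0 < M1"
    using finite_uniform_bound[OF finite_families, of "\<lambda>k M. \<forall>u\<in>K. 1 <= M * norm (qdir k u) \<and> 0 < M" 1] by blast
  define m where "m = 1 / (2 * M1)"
  have m: "0 < m" "\<And>k u. k \<in> families S ==> u \<in> K ==> 2 * m <= norm (qdir k u)"
    using M1 by (auto simp: m_def field_simps)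
  have "\<exists>\<delta>>0. \<forall>x\<in>K'. \<forall>y\<in>K'. dist y x < \<delta> --> dist (qdir k y) (qdir k x) < m" if k: "k \<in> families S" for k
  proof -
    have "uniformly_continuous_on K' (qdir k)"
      using compact_uniformly_continuous[OF continuous_on_subset[OF qdir_continuous[OF k] sh(3)] sh(1)] .
    then show ?thesis using m(1) unfolding uniformly_continuous_on_def by blast
  qed
  then obtain \<delta> where \<delta>: "\<And>k. k \<in> families S ==> 0 < \<delta> k \<and> (\<forall>x\<in>K'. \<forall>y\<in>K'. dist y x < \<delta> k --> dist (qdir k y) (qdir k x) < m)"
    by metis
  define \<delta>0 where "\<delta>0 = Min (insert 1 (\<delta> ` families S))"
  have \<delta>0: "0 < \<delta>0" "\<And>k. k \<in> families S ==> \<delta>0 <= \<delta> k"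
    using \<delta> finite_families by (auto simp: \<delta>0_def)
  define \<tau> where "\<tau> = min \<tau>0 (\<delta>0 / (2 * M))"
  have \<tau>: "0 < \<tau>" "\<tau> <= \<tau>0" "M * \<tau> < \<delta>0"
  proof -
    show "0 < \<tau>" "\<tau> <= \<tau>0" using sh(4,5) \<delta>0(1) by (auto simp: \<tau>_def)
    have "M * \<tau> <= M * (\<delta>0 / (2 * M))" using sh(4) by (intro mult_left_mono) (auto simp: \<tau>_def)
    then show "M * \<tau> < \<delta>0" using sh(4) \<delta>0(1) by simp
  qed
  define \<Lambda> where "\<Lambda> = max Lb (L * M * D)"
  show ?thesis
  proof (rule that[of \<Lambda> m \<tau>])
    show "0 < \<Lambda>" "0 < m" "0 < \<tau>" using Lb m \<tau> by (auto simp: \<Lambda>_def)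
    show "\<bar>lam S k u\<bar> <= \<Lambda>" if "k \<in> families S" "u \<in> K" for k u
      using Lb(2)[OF that(1), of u] that(2) sh(2) by (auto simp: \<Lambda>_def)
    fix k u \<zeta> u' assume k: "k \<in> families S" and u: "u \<in> K" and W: "W_curve S k u \<zeta> u'" and \<zeta>: "\<bar>\<zeta>\<bar> <= \<tau>"
    obtain c where c: "c 0 = u" "c \<zeta> = u'" "icurve k c (closed_segment 0 \<zeta>)"
      using W by (auto simp: W_curve_icurve)
    have cz: "c z \<in> K'" "norm (c z - u) <= M * \<bar>\<zeta>\<bar>" if "z \<in> closed_segment 0 \<zeta>" for z
      using sh(6)[OF k c(3) _ _ that] c(1) u \<zeta> \<tau>(2) by auto
    show "\<bar>lam S k u'\<bar> <= \<Lambda>"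
      using Lb(2)[OF k cz(1)[of \<zeta>]] c(2) by (auto simp: \<Lambda>_def)
    note der = derivative_along_curve[OF k c(3)]
    have uK': "u \<in> K'" using u sh(2) by auto
    have 1: "norm ((ffun S (c \<zeta>) - lam S k u *\<^sub>R qfun S (c \<zeta>)) - (ffun S (c 0) - lam S k u *\<^sub>R qfun S (c 0))) <= (L * M * D * \<bar>\<zeta>\<bar>) * \<bar>\<zeta>\<bar>"
    proof (rule closed_segment_curve_bound[where F' = "\<lambda>z. (lam S k (c z) - lam S k u) *\<^sub>R qdir k (c z)"])
      fix z assume z: "z \<in> closed_segment 0 \<zeta>"
      show "((\<lambda>z. ffun S (c z) - lam S k u *\<^sub>R qfun S (c z)) has_vector_derivative (lam S k (c z) - lam S k u) *\<^sub>R qdir k (c z)) (at z within closed_segment 0 \<zeta>)"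
        using has_vector_derivative_diff[OF der(2)[OF z] bounded_linear.has_vector_derivative[OF bounded_linear_scaleR_right der(1)[OF z], of "lam S k u"]]
        by (simp add: scaleR_diff_left)
      have "\<bar>lam S k (c z) - lam S k u\<bar> <= L * norm (c z - u)"
        using lipschitz_onD[OF L(2)[OF k] cz(1)[OF z] uK'] by (simp add: dist_norm)
      also have "\<dots> <= L * (M * \<bar>\<zeta>\<bar>)" using cz(2)[OF z] L(1) by (intro mult_left_mono) auto
      finally have "\<bar>lam S k (c z) - lam S k u\<bar> * norm (qdir k (c z)) <= L * (M * \<bar>\<zeta>\<bar>) * D"
        using D(2)[OF k cz(1)[OF z]] L(1) sh(4) by (intro mult_mono) auto
      then show "norm ((lam S k (c z) - lam S k u) *\<^sub>R qdir k (c z)) <= L * M * D * \<bar>\<zeta>\<bar>" by (simp add: mult_ac)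
    qed
    have "norm ((ffun S u' - ffun S u) - lam S k u *\<^sub>R (qfun S u' - qfun S u)) <= L * M * D * \<zeta>\<^sup>2"
      using 1 unfolding c(1,2) by (simp add: algebra_simps power2_eq_square)
    also have "\<dots> <= \<Lambda> * \<zeta>\<^sup>2" by (intro mult_right_mono) (auto simp: \<Lambda>_def)
    finally have f: "norm ((ffun S u' - ffun S u) - lam S k u *\<^sub>R (qfun S u' - qfun S u)) <= \<Lambda> * \<zeta>\<^sup>2" .
    have 2: "norm ((qfun S (c \<zeta>) - \<zeta> *\<^sub>R qdir k u) - (qfun S (c 0) - 0 *\<^sub>R qdir k u)) <= m * \<bar>\<zeta>\<bar>"
    proof (rule closed_segment_curve_bound[where F' = "\<lambda>z. qdir k (c z) - qdir k u"])
      fix z assume z: "z \<in> closed_segment 0 \<zeta>"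
      have "((\<lambda>z. z *\<^sub>R qdir k u) has_vector_derivative qdir k u) (at z within closed_segment 0 \<zeta>)"
        by (auto intro!: derivative_eq_intros)
      from has_vector_derivative_diff[OF der(1)[OF z] this]
      show "((\<lambda>z. qfun S (c z) - z *\<^sub>R qdir k u) has_vector_derivative qdir k (c z) - qdir k u) (at z within closed_segment 0 \<zeta>)" .
      have "norm (c z - u) <= M * \<tau>" using cz(2)[OF z] \<zeta> sh(4) by (meson less_imp_le mult_left_mono order.trans)
      then have "dist (c z) u < \<delta> k" using \<tau>(3) \<delta>0(2)[OF k] by (simp add: dist_norm)
      then show "norm (qdir k (c z) - qdir k u) <= m"
        using \<delta>[OF k] cz(1)[OF z] uK' by (auto simp: dist_norm intro: less_imp_le)
    qed
    have "norm (\<zeta> *\<^sub>R qdir k u) <= norm (qfun S u' - qfun S u) + m * \<bar>\<zeta>\<bar>"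
      using 2 norm_triangle_ineq4[of "qfun S u' - qfun S u" "(qfun S u' - qfun S u) - \<zeta> *\<^sub>R qdir k u"] unfolding c(1,2) by (simp add: algebra_simps)
    moreover have "\<bar>\<zeta>\<bar> * (2 * m) <= norm (\<zeta> *\<^sub>R qdir k u)" using m(2)[OF k u] by (simp add: mult_left_mono)
    ultimately have "m * \<bar>\<zeta>\<bar> <= norm (qfun S u' - qfun S u)" by (simp add: algebra_simps)
    with f show "norm ((ffun S u' - ffun S u) - lam S k u *\<^sub>R (qfun S u' - qfun S u)) <= \<Lambda> * \<zeta>\<^sup>2 \<and> m * \<bar>\<zeta>\<bar> <= norm (qfun S u' - qfun S u)" ..
  qed
qed

lemma lam_increases:
  assumes k: "k \<in> families S" "k \<in> gnl S" and \<zeta>: "0 < \<zeta>" and W: "W_curve S k u \<zeta> u'"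
  shows "lam S k u < lam S k u'"
proof -
  obtain c where c: "c 0 = u" "c \<zeta> = u'" "icurve k c {0..\<zeta>}" using W \<zeta> by (auto simp: W_curve_nonneg_icurve)
  note der = derivative_along_curve(3)[OF k(1) c(3)]
  have "lam S k (c 0) < lam S k (c \<zeta>)"
  proof (rule DERIV_pos_imp_increasing_open[OF \<zeta>])
    fix z assume z: "0 < z" "z < \<zeta>"
    have "at z within {0..\<zeta>} = at z" by (rule at_within_interior) (use z in auto)
    then have "((\<lambda>z. lam S k (c z)) has_real_derivative frechet_derivative (lam S k) (at (c z)) (rvec S k (c z))) (at z)"
      using der[of z] z by (simp add: has_real_derivative_iff_has_vector_derivative)
    moreover have "0 < frechet_derivative (lam S k) (at (c z)) (rvec S k (c z))"
      using gnlld k c(3) z unfolding gnl_or_ld_def icurve_def by auto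
    ultimately show "\<exists>y. ((\<lambda>z. lam S k (c z)) has_real_derivative y) (at z) \<and> 0 < y" by blast
  next
    show "continuous_on {0..\<zeta>} (\<lambda>z. lam S k (c z))"
      using der by (meson continuous_on_eq_continuous_within has_vector_derivative_continuous)
  qed
  then show ?thesis using c by simp
qed

text \<open>The characteristic speed is constant along the curve of a linearly degenerate family.\<close>

lemma contact_exact:
  assumes k: "k \<in> families S" "k \<notin> gnl S" and W: "W_curve S k u \<zeta> u'"
  shows "ffun S u' - ffun S u = lam S k u *\<^sub>R (qfun S u' - qfun S u)"
proof -
  obtain c where c: "c 0 = u" "c \<zeta> = u'" "icurve k c (closed_segment 0 \<zeta>)" using W by (auto simp: W_curve_icurve)
  note der = derivative_along_curve[OF k(1) c(3)]
  have "((\<lambda>z. lam S k (c z)) has_vector_derivative 0) (at z within closed_segment 0 \<zeta>)" if z: "z \<in> closed_segment 0 \<zeta>" for z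
    using der(3)[OF z] gnlld k c(3) z unfolding gnl_or_ld_def icurve_def by force
  then obtain l where "\<And>z. z \<in> closed_segment 0 \<zeta> ==> lam S k (c z) = l"
    using has_vector_derivative_zero_constant[OF convex_closed_segment] by blast
  then have l0: "lam S k (c z) = lam S k (c 0)" if "z \<in> closed_segment 0 \<zeta>" for z
    using that by (metis ends_in_segment(1))
  have "((\<lambda>z. ffun S (c z) - lam S k u *\<^sub>R qfun S (c z)) has_vector_derivative 0) (at z within closed_segment 0 \<zeta>)"
    if z: "z \<in> closed_segment 0 \<zeta>" for z
    using has_vector_derivative_diff[OF der(2)[OF z] bounded_linear.has_vector_derivative[OF bounded_linear_scaleR_right der(1)[OF z], of "lam S k u"]] l0[OF z] c(1)
    by simp
  from closed_segment_curve_bound[OF this, of 0]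
  show ?thesis unfolding c(1,2) by (simp add: algebra_simps)
qed

end

section \<open>Residuals of waves and fronts\<close>

lemma joined_append: "joined u (xs @ ys) w \<longleftrightarrow> (\<exists>v. joined u xs v \<and> joined v ys w)"
  by (induction xs arbitrary: u) auto

lemma joined_sum:
  fixes g :: "real^'n::finite => 'b::ab_group_add"
  shows "joined u ws w ==> (\<Sum>\<gamma>\<leftarrow>ws. g (rst \<gamma>) - g (lst \<gamma>)) = g w - g u"
  by (induction ws arbitrary: u) (auto simp: algebra_simps)

lemma joined_hd: "joined u ws w ==> ws \<noteq> [] ==> lst (hd ws) = u \<and> rst (last ws) = w"
  by (induction ws arbitrary: u) (auto split: if_splits)

lemma sum_list_split_nth:
  fixes g :: "'a => 'b::comm_monoid_add"
  assumes "c < length xs"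
  shows "(\<Sum>x\<leftarrow>xs. g x) = g (xs ! c) + (\<Sum>i\<in>{..<length xs} - {c}. g (xs ! i))"
  using assms by (simp add: sum_list_sum_nth atLeast0LessThan sum.remove[of _ c])

lemma onorm_matrix: "norm (A *v x) <= onorm ((*v) A) * norm (x :: real^'n::finite)" for A :: "real^'n^'n"
  by (rule onorm[OF matrix_vector_mul_bounded_linear])

lemma norm_le_inverse_matrix:
  fixes A :: "real^'n::finite^'n"
  assumes "invertible A"
  shows "norm x <= onorm ((*v) (matrix_inv A)) * norm (A *v x)"
proof -
  have "matrix_inv A ** A = mat 1"
    using assms unfolding invertible_def matrix_inv_def by (rule someI2_ex) simp
  then have "x = matrix_inv A *v (A *v x)"
    by (simp add: matrix_vector_mul_assoc)
  then show ?thesis using onorm_matrix[of "matrix_inv A" "A *v x"] by simp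
qed

context hyperbolic_compact
begin

text \<open>The uniform bounds on the waves of a run, with one bound \<open>\<theta>\<close> for the strengths of all simple waves.\<close>

definition tame :: "real => real => 'n wave => bool" where
  "tame C \<theta> \<gamma> \<longleftrightarrow> valid_wave S \<gamma> \<and> lst \<gamma> \<in> K \<and> rst \<gamma> \<in> K \<and> invertible (pre \<gamma>) \<and>
     onorm ((*v) (pre \<gamma>)) <= C \<and> onorm ((*v) (matrix_inv (pre \<gamma>))) <= C \<and> (is_simple S \<gamma> --> \<bar>str \<gamma>\<bar> <= \<theta>)"

lemma valid_simple: "valid_wave S \<gamma> ==> lst \<gamma> \<in> states S ==> is_simple S \<gamma> \<or> fam \<gamma> \<notin> gnl S ==> W_curve S (fam \<gamma>) (lst \<gamma>) (str \<gamma>) (rst \<gamma>)"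
  unfolding valid_wave_def is_simple_def is_shock_def using E_eq_W[of "fam \<gamma>" "lst \<gamma>" "str \<gamma>" "rst \<gamma>"]
  by (auto split: if_splits)

lemma valid_not_simple:
  assumes "valid_wave S \<gamma>" "lst \<gamma> \<in> states S" "\<not> is_simple S \<gamma>"
  shows "E_curve S (fam \<gamma>) (lst \<gamma>) (str \<gamma>) (rst \<gamma>)"
  using assms valid_simple[OF assms(1,2)] E_eq_W[of "fam \<gamma>" "lst \<gamma>" "str \<gamma>" "rst \<gamma>"]
  unfolding valid_wave_def is_simple_def is_shock_def by (auto split: if_splits)

lemma shock_speed_exists:
  assumes "valid_wave S \<gamma>" "is_shock S \<gamma>"
  obtains s where "kshock S (fam \<gamma>) (lst \<gamma>) (rst \<gamma>) s"
  using assms curves unfolding valid_wave_def is_shock_def wave_curves_def E_curve_def by metis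

text \<open>For a simple wave the minimality of the speed \<open>s\<close> is tested with the characteristic speed. The factor \<open>C * C\<close> is the price for
removing the preconditioner. The lower bound for \<open>[q]\<close> turns the two residual bounds into a bound for \<open>s\<close>.\<close>

lemma wave_estimates:
  obtains \<Lambda> \<tau> where "1 <= \<Lambda>" "0 < \<tau>"
    "\<And>\<gamma> \<theta> s. [|tame C \<theta> \<gamma>; 0 <= \<theta>; \<theta> <= \<tau>; wave_speed S \<gamma> s|] ==> \<bar>s\<bar> <= \<Lambda> \<and> norm (fjump S \<gamma> - s *\<^sub>R qjump S \<gamma>) <= \<Lambda> * \<theta> * \<bar>str \<gamma>\<bar>"
    "\<And>\<gamma> \<theta>. [|tame C \<theta> \<gamma>; 0 <= \<theta>; \<theta> <= \<tau>|] ==> \<exists>s. \<bar>s\<bar> <= \<Lambda> \<and> norm (fjump S \<gamma> - s *\<^sub>R qjump S \<gamma>) <= \<Lambda> * \<theta> * \<bar>str \<gamma>\<bar>"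
    "\<And>\<gamma> \<theta>. tame C \<theta> \<gamma> ==> norm (fjump S \<gamma>) <= \<Lambda> * \<bar>str \<gamma>\<bar> \<and> norm (qjump S \<gamma>) <= \<Lambda> * \<bar>str \<gamma>\<bar> \<and> norm (rst \<gamma> - lst \<gamma>) <= \<Lambda> * \<bar>str \<gamma>\<bar>"
    "\<And>k u \<zeta> u'. [|k \<in> families S; u \<in> K; W_curve S k u \<zeta> u'; \<bar>\<zeta>\<bar> <= \<tau>|] ==> \<bar>lam S k u'\<bar> <= \<Lambda>"
proof -
  obtain J where J: "0 < J" "\<And>\<gamma>. valid_wave S \<gamma> ==> lst \<gamma> \<in> K ==> rst \<gamma> \<in> K ==> norm (rst \<gamma> - lst \<gamma>) <= J * \<bar>str \<gamma>\<bar>"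
    using jump_le_strength by blast
  obtain \<Lambda>1 m \<tau> where E: "0 < \<Lambda>1" "0 < m" "0 < \<tau>"
    "\<And>k u \<zeta> u'. [|k \<in> families S; u \<in> K; W_curve S k u \<zeta> u'; \<bar>\<zeta>\<bar> <= \<tau>|] ==>
      norm ((ffun S u' - ffun S u) - lam S k u *\<^sub>R (qfun S u' - qfun S u)) <= \<Lambda>1 * \<zeta>\<^sup>2 \<and> m * \<bar>\<zeta>\<bar> <= norm (qfun S u' - qfun S u)"
    "\<And>k u \<zeta> u'. [|k \<in> families S; u \<in> K; W_curve S k u \<zeta> u'; \<bar>\<zeta>\<bar> <= \<tau>|] ==> \<bar>lam S k u'\<bar> <= \<Lambda>1"
    "\<And>k u. k \<in> families S ==> u \<in> K ==> \<bar>lam S k u\<bar> <= \<Lambda>1"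
    by (rule simple_wave_estimates) blast
  obtain Lf where Lf: "Lf-lipschitz_on K (ffun S)" by (rule C1_on_lipschitz[OF C1_f open_states K])
  obtain Lq where Lq: "Lq-lipschitz_on K (qfun S)" by (rule C1_on_lipschitz[OF C1_q open_states K])
  have L0: "0 <= Lf" "0 <= Lq" using Lf Lq lipschitz_on_nonneg by auto
  define \<Lambda> where "\<Lambda> = 1 + J + Lf * J + Lq * J + (1 + C * C) * \<Lambda>1 + (\<Lambda>1 + (1 + C * C) * \<Lambda>1 * \<tau> / m)"
  have pos: "0 <= Lf * J" "0 <= Lq * J" "0 <= (1 + C * C) * \<Lambda>1" "0 <= (1 + C * C) * \<Lambda>1 * \<tau> / m" "0 <= J" "0 <= \<Lambda>1"
    using L0 J(1) E(1-3) by (auto intro!: mult_nonneg_nonneg add_nonneg_nonneg)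
  have \<Lambda>: "1 <= \<Lambda>" "\<Lambda>1 <= \<Lambda>" "(1 + C * C) * \<Lambda>1 <= \<Lambda>" "\<Lambda>1 + (1 + C * C) * \<Lambda>1 * \<tau> / m <= \<Lambda>" "J <= \<Lambda>" "Lf * J <= \<Lambda>" "Lq * J <= \<Lambda>"
    unfolding \<Lambda>_def using pos by linarith+
  have nn: "0 <= \<Lambda> * \<theta> * \<bar>str \<gamma>\<bar>" if "0 <= \<theta>" for \<theta> and \<gamma> :: "'n wave" using \<Lambda>(1) that by simp
  have sq: "X * (str \<gamma>)\<^sup>2 <= \<Lambda> * \<theta> * \<bar>str \<gamma>\<bar>" if "X <= \<Lambda>" "0 <= X" "\<bar>str \<gamma>\<bar> <= \<theta>" for X \<theta> and \<gamma> :: "'n wave"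
  proof -
    have "X * (str \<gamma>)\<^sup>2 = X * \<bar>str \<gamma>\<bar> * \<bar>str \<gamma>\<bar>" by (simp add: power2_eq_square)
    also have "\<dots> <= \<Lambda> * \<theta> * \<bar>str \<gamma>\<bar>" using that \<Lambda>(1) by (intro mult_right_mono mult_mono) auto
    finally show ?thesis .
  qed
  have shock: "\<bar>s\<bar> <= \<Lambda> \<and> norm (fjump S \<gamma> - s *\<^sub>R qjump S \<gamma>) <= \<Lambda> * \<theta> * \<bar>str \<gamma>\<bar>"
    if g: "tame C \<theta> \<gamma>" "0 <= \<theta>" "kshock S (fam \<gamma>) (lst \<gamma>) (rst \<gamma>) s" for \<gamma> \<theta> s
  proof -
    have "fam \<gamma> \<in> families S" using g by (auto simp: tame_def valid_wave_def)
    then have "\<bar>lam S (fam \<gamma>) (lst \<gamma>)\<bar> <= \<Lambda>1" "\<bar>lam S (fam \<gamma>) (rst \<gamma>)\<bar> <= \<Lambda>1" using E(6) g by (auto simp: tame_def)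
    then have "\<bar>s\<bar> <= \<Lambda>" using g(3) \<Lambda>(2) by (auto simp: kshock_def)
    moreover have "fjump S \<gamma> - s *\<^sub>R qjump S \<gamma> = 0" using g(3) by (simp add: kshock_def fjump_def qjump_def)
    ultimately show ?thesis using nn[OF g(2), of \<gamma>] by simp
  qed
  have contact: "\<bar>lam S (fam \<gamma>) (lst \<gamma>)\<bar> <= \<Lambda> \<and> norm (fjump S \<gamma> - lam S (fam \<gamma>) (lst \<gamma>) *\<^sub>R qjump S \<gamma>) <= \<Lambda> * \<theta> * \<bar>str \<gamma>\<bar>"
    if g: "tame C \<theta> \<gamma>" "0 <= \<theta>" "fam \<gamma> \<notin> gnl S" for \<gamma> \<theta>
  proof -
    have k: "fam \<gamma> \<in> families S" "lst \<gamma> \<in> K" using g by (auto simp: tame_def valid_wave_def)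
    have "W_curve S (fam \<gamma>) (lst \<gamma>) (str \<gamma>) (rst \<gamma>)" using valid_simple[of \<gamma>] g K by (auto simp: tame_def)
    from contact_exact[OF k(1) g(3) this] show ?thesis
      using E(6)[OF k] \<Lambda>(2) nn[OF g(2), of \<gamma>] by (simp add: fjump_def qjump_def)
  qed
  have simple: "norm (fjump S \<gamma> - lam S (fam \<gamma>) (lst \<gamma>) *\<^sub>R qjump S \<gamma>) <= \<Lambda>1 * (str \<gamma>)\<^sup>2 \<and> m * \<bar>str \<gamma>\<bar> <= norm (qjump S \<gamma>) \<and> \<bar>lam S (fam \<gamma>) (lst \<gamma>)\<bar> <= \<Lambda>1"
    if g: "tame C \<theta> \<gamma>" "\<theta> <= \<tau>" "is_simple S \<gamma>" for \<gamma> \<theta>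
  proof -
    have k: "fam \<gamma> \<in> families S" "lst \<gamma> \<in> K" using g by (auto simp: tame_def valid_wave_def)
    have W: "W_curve S (fam \<gamma>) (lst \<gamma>) (str \<gamma>) (rst \<gamma>)" using valid_simple[of \<gamma>] g K by (auto simp: tame_def)
    have "\<bar>str \<gamma>\<bar> <= \<tau>" using g by (auto simp: tame_def)
    from E(4)[OF k W this] E(6)[OF k] show ?thesis by (simp add: fjump_def qjump_def)
  qed
  show ?thesis
  proof (rule that[OF \<Lambda>(1) E(3)])
    fix \<gamma> \<theta> s assume g: "tame C \<theta> \<gamma>" "0 <= \<theta>" "\<theta> <= \<tau>" and s: "wave_speed S \<gamma> s"
    consider "is_shock S \<gamma>" | "is_simple S \<gamma>" "\<not> is_shock S \<gamma>" | "\<not> is_shock S \<gamma>" "\<not> is_simple S \<gamma>" by blast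
    then show "\<bar>s\<bar> <= \<Lambda> \<and> norm (fjump S \<gamma> - s *\<^sub>R qjump S \<gamma>) <= \<Lambda> * \<theta> * \<bar>str \<gamma>\<bar>"
    proof cases
      case 1
      then show ?thesis using shock[OF g(1,2)] s by (simp add: wave_speed_def)
    next
      case 3
      then have "fam \<gamma> \<notin> gnl S" by (simp add: is_simple_def)
      then show ?thesis using contact[OF g(1,2)] s 3 by (simp add: wave_speed_def)
    next
      case 2
      let ?l = "lam S (fam \<gamma>) (lst \<gamma>)"
      note sm = simple[OF g(1,3) 2(1)]
      have "\<not> norm (wave_residual S \<gamma> ?l) < norm (wave_residual S \<gamma> s)"
        using s 2 unfolding wave_speed_def is_arg_min_def by auto
      then have min: "norm (pre \<gamma> *v (fjump S \<gamma> - s *\<^sub>R qjump S \<gamma>)) <= norm (pre \<gamma> *v (fjump S \<gamma> - ?l *\<^sub>R qjump S \<gamma>))"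
        by (simp add: wave_residual_def fjump_def qjump_def)
      have C: "onorm ((*v) (pre \<gamma>)) <= C" "onorm ((*v) (matrix_inv (pre \<gamma>))) <= C" "invertible (pre \<gamma>)"
        using g by (auto simp: tame_def)
      have C0: "0 <= C" using C(1) onorm_pos_le[OF matrix_vector_mul_bounded_linear[of "pre \<gamma>"]] by linarith
      have "norm (fjump S \<gamma> - s *\<^sub>R qjump S \<gamma>) <= onorm ((*v) (matrix_inv (pre \<gamma>))) * norm (pre \<gamma> *v (fjump S \<gamma> - s *\<^sub>R qjump S \<gamma>))"
        by (rule norm_le_inverse_matrix[OF C(3)])
      also have "\<dots> <= C * norm (pre \<gamma> *v (fjump S \<gamma> - ?l *\<^sub>R qjump S \<gamma>))"
        using C(2) min C0 by (intro mult_mono) auto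
      also have "norm (pre \<gamma> *v (fjump S \<gamma> - ?l *\<^sub>R qjump S \<gamma>)) <= C * norm (fjump S \<gamma> - ?l *\<^sub>R qjump S \<gamma>)"
        by (rule order.trans[OF onorm_matrix]) (use C(1) in \<open>intro mult_right_mono, auto\<close>)
      also have "C * (C * norm (fjump S \<gamma> - ?l *\<^sub>R qjump S \<gamma>)) <= C * (C * (\<Lambda>1 * (str \<gamma>)\<^sup>2))"
        using sm C0 by (intro mult_left_mono) auto
      finally have r: "norm (fjump S \<gamma> - s *\<^sub>R qjump S \<gamma>) <= C * C * \<Lambda>1 * (str \<gamma>)\<^sup>2"
        using C0 by (simp add: mult_left_mono mult.assoc)
      have st: "\<bar>str \<gamma>\<bar> <= \<theta>" "str \<gamma> \<noteq> 0" using g 2 by (auto simp: tame_def valid_wave_def)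
      have "\<bar>s - ?l\<bar> * (m * \<bar>str \<gamma>\<bar>) <= \<bar>s - ?l\<bar> * norm (qjump S \<gamma>)" using sm by (intro mult_left_mono) auto
      also have "\<dots> = norm ((fjump S \<gamma> - ?l *\<^sub>R qjump S \<gamma>) - (fjump S \<gamma> - s *\<^sub>R qjump S \<gamma>))"
        by (simp add: norm_scaleR[symmetric] scaleR_diff_left del: norm_scaleR)
      also have "\<dots> <= \<Lambda>1 * (str \<gamma>)\<^sup>2 + C * C * \<Lambda>1 * (str \<gamma>)\<^sup>2"
        using norm_triangle_ineq4 sm r by (meson add_mono order.trans)
      finally have "\<bar>s - ?l\<bar> * m * \<bar>str \<gamma>\<bar> <= (1 + C * C) * \<Lambda>1 * \<bar>str \<gamma>\<bar> * \<bar>str \<gamma>\<bar>"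
        by (simp add: power2_eq_square algebra_simps)
      then have "\<bar>s - ?l\<bar> * m <= (1 + C * C) * \<Lambda>1 * \<bar>str \<gamma>\<bar>" using st by simp
      also have "\<dots> <= (1 + C * C) * \<Lambda>1 * \<tau>" using st g pos by (intro mult_left_mono) auto
      finally have "\<bar>s - ?l\<bar> <= (1 + C * C) * \<Lambda>1 * \<tau> / m" using E(2) by (simp add: field_simps)
      then have "\<bar>s\<bar> <= \<Lambda>" using sm \<Lambda>(4) by linarith
      moreover have "C * C * \<Lambda>1 <= \<Lambda>" "0 <= C * C * \<Lambda>1" using \<Lambda>(3) pos C0 by (auto simp: algebra_simps)
      then have "norm (fjump S \<gamma> - s *\<^sub>R qjump S \<gamma>) <= \<Lambda> * \<theta> * \<bar>str \<gamma>\<bar>" using r sq[of "C * C * \<Lambda>1" \<gamma> \<theta>] st by linarith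
      ultimately show ?thesis ..
    qed
  next
    fix \<gamma> \<theta> assume g: "tame C \<theta> \<gamma>" "0 <= \<theta>" "\<theta> <= \<tau>"
    consider "is_shock S \<gamma>" | "is_simple S \<gamma>" | "fam \<gamma> \<notin> gnl S" by (auto simp: is_simple_def)
    then show "\<exists>s. \<bar>s\<bar> <= \<Lambda> \<and> norm (fjump S \<gamma> - s *\<^sub>R qjump S \<gamma>) <= \<Lambda> * \<theta> * \<bar>str \<gamma>\<bar>"
    proof cases
      case 1
      then show ?thesis using shock[OF g(1,2)] shock_speed_exists[of \<gamma>] g(1) unfolding tame_def by metis
    next
      case 2
      have "\<bar>str \<gamma>\<bar> <= \<theta>" using g 2 by (auto simp: tame_def)
      then show ?thesis using simple[OF g(1,3) 2] sq[of \<Lambda>1 \<gamma> \<theta>] \<Lambda>(2) pos(6) by (intro exI[of _ "lam S (fam \<gamma>) (lst \<gamma>)"]) auto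
    next
      case 3
      then show ?thesis using contact[OF g(1,2)] by blast
    qed
  next
    fix \<gamma> \<theta> assume g: "tame C \<theta> \<gamma>"
    then have j: "norm (rst \<gamma> - lst \<gamma>) <= J * \<bar>str \<gamma>\<bar>" using J(2) by (auto simp: tame_def)
    have "norm (fjump S \<gamma>) <= Lf * norm (rst \<gamma> - lst \<gamma>)" "norm (qjump S \<gamma>) <= Lq * norm (rst \<gamma> - lst \<gamma>)"
      using lipschitz_onD[OF Lf, of "rst \<gamma>" "lst \<gamma>"] lipschitz_onD[OF Lq, of "rst \<gamma>" "lst \<gamma>"] g
      by (auto simp: tame_def fjump_def qjump_def dist_norm)
    moreover have "Lf * norm (rst \<gamma> - lst \<gamma>) <= Lf * J * \<bar>str \<gamma>\<bar>" "Lq * norm (rst \<gamma> - lst \<gamma>) <= Lq * J * \<bar>str \<gamma>\<bar>"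
      using mult_left_mono[OF j L0(1)] mult_left_mono[OF j L0(2)] by (simp_all add: mult.assoc)
    moreover have "Lf * J * \<bar>str \<gamma>\<bar> <= \<Lambda> * \<bar>str \<gamma>\<bar>" "Lq * J * \<bar>str \<gamma>\<bar> <= \<Lambda> * \<bar>str \<gamma>\<bar>" "J * \<bar>str \<gamma>\<bar> <= \<Lambda> * \<bar>str \<gamma>\<bar>"
      by (intro mult_right_mono \<Lambda> abs_ge_zero)+
    ultimately show "norm (fjump S \<gamma>) <= \<Lambda> * \<bar>str \<gamma>\<bar> \<and> norm (qjump S \<gamma>) <= \<Lambda> * \<bar>str \<gamma>\<bar> \<and> norm (rst \<gamma> - lst \<gamma>) <= \<Lambda> * \<bar>str \<gamma>\<bar>"
      using j by linarith
  next
    show "\<bar>lam S k u'\<bar> <= \<Lambda>" if "k \<in> families S" "u \<in> K" "W_curve S k u \<zeta> u'" "\<bar>\<zeta>\<bar> <= \<tau>" for k u \<zeta> u'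
      using E(5)[OF that] \<Lambda>(2) by linarith
  qed
qed

text \<open>The summand of the weight that belongs to this front.\<close>

definition heavy_size :: "mft_params => real => 'n front => real" where
  "heavy_size P \<epsilon> F = (if heavy P \<epsilon> F = {} then 0 else sqrt (\<Sum>h\<in>heavy P \<epsilon> F. (str (comps F ! h))\<^sup>2))"

definition front_size :: "'n front => real" where
  "front_size F = (\<Sum>\<gamma>\<leftarrow>comps F. \<bar>str \<gamma>\<bar>)"

lemma passengers_size:
  assumes car: "car F < length (comps F)" and len: "length (comps F) <= Suc (CARD('n))" and Q: "0 <= Qlight P \<epsilon>"
  shows "(\<Sum>i\<in>{..<length (comps F)} - {car F}. \<bar>str (comps F ! i)\<bar>) <=
    CARD('n) * (Qlight P \<epsilon> * \<bar>str (carrier F)\<bar> + heavy_size P \<epsilon> F)"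
proof -
  let ?I = "{..<length (comps F)} - {car F}"
  have hs: "0 <= heavy_size P \<epsilon> F" by (auto simp: heavy_size_def intro!: sum_nonneg)
  have "\<bar>str (comps F ! i)\<bar> <= Qlight P \<epsilon> * \<bar>str (carrier F)\<bar> + heavy_size P \<epsilon> F" if i: "i \<in> ?I" for i
  proof (cases "i \<in> heavy P \<epsilon> F")
    case True
    have fin: "finite (heavy P \<epsilon> F)" by (rule finite_subset[of _ "{..<length (comps F)}"]) (auto simp: heavy_def)
    have "(str (comps F ! i))\<^sup>2 <= (\<Sum>h\<in>heavy P \<epsilon> F. (str (comps F ! h))\<^sup>2)"
      by (rule member_le_sum[OF True _ fin]) auto
    then have "\<bar>str (comps F ! i)\<bar> <= sqrt (\<Sum>h\<in>heavy P \<epsilon> F. (str (comps F ! h))\<^sup>2)"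
      by (metis real_sqrt_abs real_sqrt_le_mono)
    then have "\<bar>str (comps F ! i)\<bar> <= heavy_size P \<epsilon> F" using True by (auto simp: heavy_size_def)
    moreover have "0 <= Qlight P \<epsilon> * \<bar>str (carrier F)\<bar>" using Q by simp
    ultimately show ?thesis by linarith
  next
    case False
    then show ?thesis using i hs by (auto simp: heavy_def)
  qed
  then have "(\<Sum>i\<in>?I. \<bar>str (comps F ! i)\<bar>) <= of_nat (card ?I) * (Qlight P \<epsilon> * \<bar>str (carrier F)\<bar> + heavy_size P \<epsilon> F)"
    by (rule sum_bounded_above)
  also have "\<dots> <= CARD('n) * (Qlight P \<epsilon> * \<bar>str (carrier F)\<bar> + heavy_size P \<epsilon> F)"
    using car len Q hs by (intro mult_right_mono) auto
  finally show ?thesis .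
qed

definition front_bounds :: "real => real => real => bool" where
  "front_bounds C \<Lambda> \<tau> \<longleftrightarrow> 1 <= \<Lambda> \<and> 0 < \<tau> \<and>
     (\<forall>F P \<epsilon> \<theta> s. (\<forall>\<gamma>\<in>set (comps F). tame C \<theta> \<gamma>) \<and> 0 <= \<theta> \<and> \<theta> <= \<tau> \<and> car F < length (comps F) \<and>
        length (comps F) <= Suc (CARD('n)) \<and> 0 <= Qlight P \<epsilon> \<and> regular_speed S P C \<epsilon> F s -->
        \<bar>s\<bar> <= \<Lambda> \<and> norm (\<Sum>\<gamma>\<leftarrow>comps F. fjump S \<gamma> - s *\<^sub>R qjump S \<gamma>) <= \<Lambda> * ((\<theta> + Qlight P \<epsilon>) * front_size F + heavy_size P \<epsilon> F)) \<and>
     (\<forall>\<gamma> \<theta>. tame C \<theta> \<gamma> --> norm (qjump S \<gamma>) <= \<Lambda> * \<bar>str \<gamma>\<bar> \<and> norm (rst \<gamma> - lst \<gamma>) <= \<Lambda> * \<bar>str \<gamma>\<bar>) \<and>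
     (\<forall>k u \<zeta> u'. k \<in> families S \<and> u \<in> K \<and> W_curve S k u \<zeta> u' \<and> \<bar>\<zeta>\<bar> <= \<tau> --> \<bar>lam S k u'\<bar> <= \<Lambda>)"

text \<open>Without heavy passengers the speed is that of the carrier, and the passengers are small compared with it. Otherwise the speed is
a minimizer of the preconditioned residual of the whole front and is tested with a good speed \<open>sb\<close> for the carrier; passengers
are estimated by their size for both speeds, which leaves an estimate for the residual of the carrier.\<close>

lemma front_estimates: obtains \<Lambda> \<tau> where "front_bounds C \<Lambda> \<tau>"
proof -
  obtain L \<tau> where L: "1 <= L" "0 < \<tau>"
    "\<And>\<gamma> \<theta> s. [|tame C \<theta> \<gamma>; 0 <= \<theta>; \<theta> <= \<tau>; wave_speed S \<gamma> s|] ==> \<bar>s\<bar> <= L \<and> norm (fjump S \<gamma> - s *\<^sub>R qjump S \<gamma>) <= L * \<theta> * \<bar>str \<gamma>\<bar>"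
    "\<And>\<gamma> \<theta>. [|tame C \<theta> \<gamma>; 0 <= \<theta>; \<theta> <= \<tau>|] ==> \<exists>s. \<bar>s\<bar> <= L \<and> norm (fjump S \<gamma> - s *\<^sub>R qjump S \<gamma>) <= L * \<theta> * \<bar>str \<gamma>\<bar>"
    "\<And>\<gamma> \<theta>. tame C \<theta> \<gamma> ==> norm (fjump S \<gamma>) <= L * \<bar>str \<gamma>\<bar> \<and> norm (qjump S \<gamma>) <= L * \<bar>str \<gamma>\<bar> \<and> norm (rst \<gamma> - lst \<gamma>) <= L * \<bar>str \<gamma>\<bar>"
    "\<And>k u \<zeta> u'. [|k \<in> families S; u \<in> K; W_curve S k u \<zeta> u'; \<bar>\<zeta>\<bar> <= \<tau>|] ==> \<bar>lam S k u'\<bar> <= L"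
    by (rule wave_estimates[of C]) blast
  define C1 where "C1 = max C 1"
  define s1 where "s1 = max L C1"
  define G where "G = L + s1 * L"
  have G: "0 < G" "1 <= s1" "L <= s1" using L(1) by (auto simp: G_def s1_def C1_def intro!: add_pos_nonneg)
  have C1: "1 <= C1" "C <= C1" by (auto simp: C1_def)
  define N where "N = real (CARD('n))"
  have N: "1 <= N" by (simp add: N_def Suc_leI)
  have any: "norm (fjump S \<gamma> - s *\<^sub>R qjump S \<gamma>) <= G * \<bar>str \<gamma>\<bar>" if "tame C \<theta> \<gamma>" "\<bar>s\<bar> <= s1" for \<gamma> \<theta> s
  proof -
    note l = L(5)[OF that(1)]
    have "norm (fjump S \<gamma> - s *\<^sub>R qjump S \<gamma>) <= norm (fjump S \<gamma>) + \<bar>s\<bar> * norm (qjump S \<gamma>)"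
      using norm_triangle_ineq4[of "fjump S \<gamma>" "s *\<^sub>R qjump S \<gamma>"] by simp
    also have "\<dots> <= L * \<bar>str \<gamma>\<bar> + s1 * (L * \<bar>str \<gamma>\<bar>)"
      using l that(2) G(2) by (intro add_mono mult_mono) auto
    finally show ?thesis by (simp add: G_def algebra_simps)
  qed
  define H where "H = C1 * C1 * (L + G * N + G * N) + G * N"
  define \<Lambda> where "\<Lambda> = s1 + H + L + G * N"
  have H0: "0 <= C1 * C1 * (L + G * N + G * N)" "0 <= G * N" using C1 L(1) G(1) N by (auto intro!: mult_nonneg_nonneg add_nonneg_nonneg)
  have \<Lambda>: "1 <= \<Lambda>" "s1 <= \<Lambda>" "H <= \<Lambda>" "L + G * N <= \<Lambda>" "L <= \<Lambda>"
    unfolding \<Lambda>_def H_def using H0 G L(1) by linarith+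
  show ?thesis
  proof (rule that, unfold front_bounds_def, rule conjI[OF \<Lambda>(1) conjI[OF L(2) conjI[OF _ conjI]]]; intro allI impI; (elim conjE)?)
    show "norm (qjump S \<gamma>) <= \<Lambda> * \<bar>str \<gamma>\<bar> \<and> norm (rst \<gamma> - lst \<gamma>) <= \<Lambda> * \<bar>str \<gamma>\<bar>" if "tame C \<theta> \<gamma>" for \<gamma> \<theta>
      using L(5)[OF that] mult_right_mono[OF \<Lambda>(5) abs_ge_zero, of "str \<gamma>"] by linarith
    show "\<bar>lam S k u'\<bar> <= \<Lambda>" if "k \<in> families S" "u \<in> K" "W_curve S k u \<zeta> u'" "\<bar>\<zeta>\<bar> <= \<tau>" for k u \<zeta> u'
      using L(6)[OF that] \<Lambda>(5) by linarith
    fix F :: "'n front" and P \<epsilon> \<theta> s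
    assume t: "\<forall>\<gamma>\<in>set (comps F). tame C \<theta> \<gamma>" and \<theta>: "0 <= \<theta>" "\<theta> <= \<tau>" and car: "car F < length (comps F)" and len: "length (comps F) <= Suc (CARD('n))"
      and Q: "0 <= Qlight P \<epsilon>" and s: "regular_speed S P C \<epsilon> F s"
    let ?I = "{..<length (comps F)} - {car F}"
    let ?p = "\<Sum>i\<in>?I. \<bar>str (comps F ! i)\<bar>"
    let ?h = "heavy_size P \<epsilon> F"
    let ?r = "\<lambda>s \<gamma>. fjump S \<gamma> - s *\<^sub>R qjump S \<gamma>"
    have ti: "tame C \<theta> (comps F ! i)" if "i < length (comps F)" for i using t that by simp
    have tc: "tame C \<theta> (carrier F)" using ti[OF car] by (simp add: carrier_def)
    have h0: "0 <= ?h" by (auto simp: heavy_size_def intro!: sum_nonneg)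
    have fs: "front_size F = \<bar>str (carrier F)\<bar> + ?p"
      unfolding front_size_def carrier_def by (rule sum_list_split_nth[OF car])
    have p0: "0 <= ?p" by (intro sum_nonneg) auto
    have pp: "?p <= N * (Qlight P \<epsilon> * front_size F + ?h)"
    proof -
      have "?p <= N * (Qlight P \<epsilon> * \<bar>str (carrier F)\<bar> + ?h)"
        using passengers_size[OF car len Q] by (simp add: N_def)
      also have "\<dots> <= N * (Qlight P \<epsilon> * front_size F + ?h)"
        using N Q p0 fs by (intro mult_left_mono add_right_mono) auto
      finally show ?thesis .
    qed
    have psum: "norm (\<Sum>i\<in>?I. ?r s' (comps F ! i)) <= G * ?p" if "\<bar>s'\<bar> <= s1" for s'
    proof -
      have "norm (\<Sum>i\<in>?I. ?r s' (comps F ! i)) <= (\<Sum>i\<in>?I. G * \<bar>str (comps F ! i)\<bar>)"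
        by (rule sum_norm_le) (use any ti that in auto)
      then show ?thesis by (simp add: sum_distrib_left)
    qed
    have split: "(\<Sum>\<gamma>\<leftarrow>comps F. ?r s' \<gamma>) = ?r s' (carrier F) + (\<Sum>i\<in>?I. ?r s' (comps F ! i))" for s'
      unfolding carrier_def by (rule sum_list_split_nth[OF car])
    have cf: "L * \<theta> * \<bar>str (carrier F)\<bar> <= L * (\<theta> * front_size F)"
      using fs p0 L(1) \<theta> by (simp add: mult.assoc mult_left_mono)
    define Z where "Z = (\<theta> + Qlight P \<epsilon>) * front_size F + ?h"
    have f0: "0 <= front_size F" using fs p0 by simp
    have Z: "\<theta> * front_size F <= Z" "Qlight P \<epsilon> * front_size F + ?h <= Z" "0 <= Z"
      using h0 \<theta> Q f0 by (auto simp: Z_def algebra_simps)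
    have pZ: "G * ?p <= G * N * Z"
    proof -
      have "?p <= N * Z" using pp mult_left_mono[OF Z(2), of N] N by linarith
      then have "G * ?p <= G * (N * Z)" using G(1) by (intro mult_left_mono) auto
      then show ?thesis by (simp only: mult.assoc)
    qed
    have cZ: "L * \<theta> * \<bar>str (carrier F)\<bar> <= L * Z" using cf mult_left_mono[OF Z(1), of L] L(1) by linarith
    show "\<bar>s\<bar> <= \<Lambda> \<and> norm (\<Sum>\<gamma>\<leftarrow>comps F. ?r s \<gamma>) <= \<Lambda> * ((\<theta> + Qlight P \<epsilon>) * front_size F + ?h)"
      unfolding Z_def[symmetric]
    proof (cases "heavy P \<epsilon> F = {}")
      case True
      then have "wave_speed S (carrier F) s" using s by (simp add: regular_speed_def)
      note l = L(3)[OF tc \<theta> this]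
      have "norm (\<Sum>\<gamma>\<leftarrow>comps F. ?r s \<gamma>) <= norm (?r s (carrier F)) + norm (\<Sum>i\<in>?I. ?r s (comps F ! i))"
        unfolding split by (rule norm_triangle_ineq)
      also have "\<dots> <= L * Z + G * N * Z" using l psum[of s] G(3) cZ pZ by linarith
      also have "\<dots> <= \<Lambda> * Z" using mult_right_mono[OF \<Lambda>(4) Z(3)] by (simp add: distrib_right)
      finally show "\<bar>s\<bar> <= \<Lambda> \<and> norm (\<Sum>\<gamma>\<leftarrow>comps F. ?r s \<gamma>) <= \<Lambda> * Z" using l \<Lambda>(5) by linarith
    next
      case False
      then have arg: "is_arg_min (\<lambda>\<sigma>. norm (\<Sum>\<gamma>\<leftarrow>comps F. wave_residual S \<gamma> \<sigma>)) (\<lambda>_. True) s" and sC: "\<bar>s\<bar> <= C"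
        using s by (auto simp: regular_speed_def)
      have ss1: "\<bar>s\<bar> <= s1" using sC by (simp add: s1_def C1_def)
      obtain sb where sb: "\<bar>sb\<bar> <= L" "norm (?r sb (carrier F)) <= L * \<theta> * \<bar>str (carrier F)\<bar>" using L(4)[OF tc \<theta>] by blast
      let ?A = "\<lambda>s \<gamma>. pre \<gamma> *v ?r s \<gamma>"
      have wr: "wave_residual S \<gamma> s' = ?A s' \<gamma>" for \<gamma> s' by (simp add: wave_residual_def fjump_def qjump_def)
      have Ab: "norm (pre \<gamma> *v v) <= C1 * norm v" if "tame C \<theta> \<gamma>" for \<gamma> v
        by (rule order.trans[OF onorm_matrix mult_right_mono]) (use that C1 in \<open>auto simp: tame_def\<close>)
      have splitA: "(\<Sum>\<gamma>\<leftarrow>comps F. ?A s' \<gamma>) = ?A s' (carrier F) + (\<Sum>i\<in>?I. ?A s' (comps F ! i))" for s'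
        unfolding carrier_def by (rule sum_list_split_nth[OF car])
      have psumA: "norm (\<Sum>i\<in>?I. ?A s' (comps F ! i)) <= C1 * (G * ?p)" if "\<bar>s'\<bar> <= s1" for s'
      proof -
        have "norm (?A s' (comps F ! i)) <= C1 * (G * \<bar>str (comps F ! i)\<bar>)" if "i \<in> ?I" for i
        proof -
          have "tame C \<theta> (comps F ! i)" using ti that by simp
          from order.trans[OF Ab[OF this] mult_left_mono[OF any[OF this \<open>\<bar>s'\<bar> <= s1\<close>]]] show ?thesis using C1(1) by simp
        qed
        then have "norm (\<Sum>i\<in>?I. ?A s' (comps F ! i)) <= (\<Sum>i\<in>?I. C1 * (G * \<bar>str (comps F ! i)\<bar>))" by (rule sum_norm_le)
        then show ?thesis by (simp add: sum_distrib_left)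
      qed
      have "\<not> norm (\<Sum>\<gamma>\<leftarrow>comps F. ?A sb \<gamma>) < norm (\<Sum>\<gamma>\<leftarrow>comps F. ?A s \<gamma>)"
        using arg unfolding is_arg_min_def wr by auto
      then have "norm (\<Sum>\<gamma>\<leftarrow>comps F. ?A s \<gamma>) <= norm (?A sb (carrier F)) + norm (\<Sum>i\<in>?I. ?A sb (comps F ! i))"
        unfolding splitA[of sb] using norm_triangle_ineq[of "?A sb (carrier F)" "\<Sum>i\<in>?I. ?A sb (comps F ! i)"] by linarith
      also have "\<dots> <= C1 * (L * Z) + C1 * (G * N * Z)"
      proof (rule add_mono)
        show "norm (?A sb (carrier F)) <= C1 * (L * Z)"
          by (rule order.trans[OF Ab[OF tc] mult_left_mono]) (use sb cZ C1 in auto)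
        show "norm (\<Sum>i\<in>?I. ?A sb (comps F ! i)) <= C1 * (G * N * Z)"
          by (rule order.trans[OF psumA mult_left_mono[OF pZ]]) (use sb G C1 in auto)
      qed
      finally have tot: "norm (\<Sum>\<gamma>\<leftarrow>comps F. ?A s \<gamma>) <= C1 * (L * Z) + C1 * (G * N * Z)" .
      have "?A s (carrier F) = (\<Sum>\<gamma>\<leftarrow>comps F. ?A s \<gamma>) - (\<Sum>i\<in>?I. ?A s (comps F ! i))" using splitA[of s] by simp
      then have "norm (?A s (carrier F)) <= norm (\<Sum>\<gamma>\<leftarrow>comps F. ?A s \<gamma>) + norm (\<Sum>i\<in>?I. ?A s (comps F ! i))"
        by (simp only: norm_triangle_ineq4)
      also have "\<dots> <= (C1 * (L * Z) + C1 * (G * N * Z)) + C1 * (G * N * Z)"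
        using order.trans[OF psumA[OF ss1] mult_left_mono[OF pZ, of C1]] tot C1 by (intro add_mono) simp_all
      finally have c: "norm (?A s (carrier F)) <= C1 * ((L + G * N + G * N) * Z)" by (simp only: distrib_left distrib_right)
      have "norm (?r s (carrier F)) <= onorm ((*v) (matrix_inv (pre (carrier F)))) * norm (?A s (carrier F))"
        using tc by (intro norm_le_inverse_matrix) (simp add: tame_def)
      also have "\<dots> <= C1 * (C1 * ((L + G * N + G * N) * Z))"
        using tc C1 c by (intro mult_mono) (auto simp: tame_def)
      finally have cr: "norm (?r s (carrier F)) <= C1 * C1 * (L + G * N + G * N) * Z" by (simp add: mult.assoc)
      have "norm (\<Sum>\<gamma>\<leftarrow>comps F. ?r s \<gamma>) <= norm (?r s (carrier F)) + norm (\<Sum>i\<in>?I. ?r s (comps F ! i))"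
        unfolding split by (rule norm_triangle_ineq)
      also have "\<dots> <= C1 * C1 * (L + G * N + G * N) * Z + G * N * Z" using cr psum[OF ss1] pZ by linarith
      also have "\<dots> <= \<Lambda> * Z" using mult_right_mono[OF \<Lambda>(3) Z(3)] by (simp add: H_def distrib_right)
      finally show "\<bar>s\<bar> <= \<Lambda> \<and> norm (\<Sum>\<gamma>\<leftarrow>comps F. ?r s \<gamma>) <= \<Lambda> * Z" using ss1 \<Lambda>(2) by linarith
    qed
  qed
qed

end

section \<open>Invariants of runs\<close>

context hyperbolic_compact
begin

text \<open>The invariant of a run. Passengers are weaker than base waves, and the speed is regular up to the error \<open>\<eta>\<close> that is admitted
  for temporary speeds.\<close>

definition good_front :: "mft_params => real => real => real => 'n front => bool" where
  "good_front P C \<epsilon> \<eta> F \<longleftrightarrow> car F < length (comps F) \<and> length (comps F) <= Suc (CARD('n)) \<and>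
     (\<forall>i<length (comps F). i \<noteq> car F --> \<bar>str (comps F ! i)\<bar> < \<epsilon> powr ep P) \<and>
     regular_speed S P C \<epsilon> F (regspd F) \<and> \<bar>spd F - regspd F\<bar> <= \<eta>"

definition good_list :: "mft_params => real => real => real => real^'n => 'n front list => bool" where
  "good_list P C \<epsilon> \<eta> u0 L \<longleftrightarrow> sorted (map pos L) \<and> (\<exists>w. joined u0 (concat (map comps L)) w) \<and>
     (\<forall>F\<in>set L. good_front P C \<epsilon> \<eta> F)"

subsection \<open>Grouping into composite waves\<close>

abbreviation weak :: "mft_params => real => 'n wave => bool" where
  "weak P \<epsilon> \<gamma> \<equiv> \<bar>str \<gamma>\<bar> < \<epsilon> powr ep P"

text \<open>In both cases of the definition every component but the carrier is weak, so the number of components is bounded by the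
number of weak waves.\<close>

lemma composites_bounds:
  assumes c: "composites P \<epsilon> ws Fs" and n: "length (filter (weak P \<epsilon>) ws) <= N" and F: "F \<in> set Fs"
  shows "car F < length (comps F)" "length (comps F) <= Suc N"
    "\<And>i. i < length (comps F) ==> i \<noteq> car F ==> weak P \<epsilon> (comps F ! i)"
proof -
  have ws: "concat (map comps Fs) = ws" and car: "car F < length (comps F)" using c F unfolding composites_def by blast+
  show "car F < length (comps F)" by (rule car)
  show pass: "weak P \<epsilon> (comps F ! i)" if i: "i < length (comps F)" "i \<noteq> car F" for i
  proof (cases "\<exists>\<gamma>\<in>set ws. \<epsilon> powr ep P <= \<bar>str \<gamma>\<bar>")
    case True
    then have "\<forall>F\<in>set Fs. \<forall>i<length (comps F). \<epsilon> powr ep P <= \<bar>str (comps F ! i)\<bar> \<longleftrightarrow> i = car F"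
      using c unfolding composites_def if_P[OF True] by blast
    then have "\<not> \<epsilon> powr ep P <= \<bar>str (comps F ! i)\<bar>" using F i by blast
    then show ?thesis by linarith
  next
    case False
    have "comps F ! i \<in> set (concat (map comps Fs))" using nth_mem[OF i(1)] F by auto
    then show ?thesis using False unfolding ws by (meson not_le)
  qed
  have "{..<length (comps F)} - {car F} \<subseteq> {i. i < length (comps F) \<and> weak P \<epsilon> (comps F ! i)}" using pass by auto
  then have "card ({..<length (comps F)} - {car F}) <= length (filter (weak P \<epsilon>) (comps F))"
    unfolding length_filter_conv_card by (intro card_mono) auto
  also have "\<dots> <= length (filter (weak P \<epsilon>) ws)"
  proof -
    have "length (filter (weak P \<epsilon>) ws) = sum_list (map (\<lambda>F. length (filter (weak P \<epsilon>) (comps F))) Fs)"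
      unfolding ws[symmetric] filter_concat length_concat by (simp add: comp_def)
    then show ?thesis using F by (metis (mono_tags, lifting) elem_le_sum_list in_set_conv_nth length_map nth_map)
  qed
  finally show "length (comps F) <= Suc N" using n car by simp
qed

lemma length_filter_in_order:
  assumes "\<And>k. k \<in> families S ==> length (filter p (pcs k)) <= 1"
  shows "length (filter p (in_order S pcs)) <= CARD('n)"
proof -
  have "length (filter p (concat (map pcs ks))) <= length ks" if "set ks \<subseteq> families S" for ks
    using that by (induction ks) (use assms in \<open>force+\<close>)
  moreover have "set [1..<CARD('n) + 1] \<subseteq> families S" by (auto simp: families_def)
  ultimately have "length (filter p (in_order S pcs)) <= length [1..<CARD('n) + 1]" unfolding in_order_def by blast
  then show ?thesis by (simp del: upt_Suc)
qed

lemma in_order_joined: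
  assumes g: "gRP S uL uR w z v" and j: "\<And>k. k \<in> families S ==> joined (v (k - 1)) (pcs k) (v k)"
  shows "joined uL (in_order S pcs) uR"
proof -
  have "joined (v 0) (concat (map pcs [1..<n + 1])) (v n)" if "n <= CARD('n)" for n
    using that
  proof (induction n)
    case (Suc n)
    have "joined (v n) (pcs (Suc n)) (v (Suc n))" using j[of "Suc n"] Suc.prems by (simp add: families_def)
    then show ?case using Suc by (auto simp: joined_append)
  qed simp
  from this[of "CARD('n)"] show ?thesis using g by (simp add: in_order_def gRP_def)
qed

lemma gRP_zero_strength:
  assumes "gRP S uL uR w z v" "k \<in> families S" "z k = 0"
  shows "v (k - 1) = v k"
  using assms E_curve_0[of k "v (k - 1)" "v k"] W_curve_0[of "v (k - 1)" k "v k"] E_curve_states[of k] W_curve_states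
  unfolding gRP_def by metis

lemma unsplit_joined: "unsplit k u z u' sm ps ==> (z = 0 ==> u = u') ==> joined u ps u'"
  by (auto simp: unsplit_def split: if_splits)

text \<open>A split wave consists of base waves, as its pieces have strength at least \<open>\<kappa>\<close> times the maximal one, which exceeds the
strength of a passenger. So each family has at most one weak wave.\<close>

lemma outgoing_pieces_props:
  assumes g: "gRP S uL uR w z v" and k: "k \<in> families S" and v: "valid_params P \<epsilon>"
    and o: "outgoing_pieces S P \<epsilon> k (v (k - 1)) (z k) (v k) sm ps"
  shows "joined (v (k - 1)) ps (v k)" "length (filter (weak P \<epsilon>) ps) <= 1"
proof -
  show "joined (v (k - 1)) ps (v k)"
  proof (cases "too_strong S P \<epsilon> k (z k)")
    case True
    then show ?thesis using o unfolding outgoing_pieces_def split_rarefaction_def by meson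
  next
    case False
    then have "unsplit k (v (k - 1)) (z k) (v k) sm ps" using o unfolding outgoing_pieces_def by meson
    from unsplit_joined[OF this gRP_zero_strength[OF g k]] show ?thesis .
  qed
  show "length (filter (weak P \<epsilon>) ps) <= 1"
  proof (cases "too_strong S P \<epsilon> k (z k)")
    case True
    have "\<not> weak P \<epsilon> \<gamma>" if "\<gamma> \<in> set ps" for \<gamma>
      using o True that v unfolding outgoing_pieces_def valid_params_def by (force simp: not_less)
    then show ?thesis by (simp add: filter_False)
  next
    case False
    then show ?thesis using o by (auto simp: outgoing_pieces_def unsplit_def split: if_splits)
  qed
qed

lemma singles_props: "singles ws Fs ==> concat (map comps Fs) = ws" "singles ws Fs ==> F \<in> set Fs ==> car F = 0 \<and> length (comps F) = 1"
proof -
  assume "singles ws Fs"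
  then have m: "map comps Fs = map (\<lambda>\<gamma>. [\<gamma>]) ws" "\<forall>F\<in>set Fs. car F = 0" by (auto simp: singles_def)
  show "concat (map comps Fs) = ws" unfolding m(1) by (induction ws) auto
  assume F: "F \<in> set Fs"
  then have "comps F \<in> set (map (\<lambda>\<gamma>. [\<gamma>]) ws)" unfolding m(1)[symmetric] by simp
  then show "car F = 0 \<and> length (comps F) = 1" using m(2) F by auto
qed

subsection \<open>Initialization\<close>

lemma initial_riemann_good:
  assumes r: "initial_riemann S P C \<epsilon> x uL uR Fs" and v: "valid_params P \<epsilon>" and \<eta>: "0 <= \<eta>"
  shows "joined uL (concat (map comps Fs)) uR" "\<And>F. F \<in> set Fs ==> good_front P C \<epsilon> \<eta> F \<and> pos F = x"
proof -
  obtain z v pcs where g: "gRP S uL uR (\<lambda>_. 0) z v"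
    and ip: "\<And>k. k \<in> families S ==> initial_pieces S P \<epsilon> k (v (k - 1)) (z k) (v k) (pcs k)"
    and sc: "singles (in_order S pcs) Fs \<or> composites P \<epsilon> (in_order S pcs) Fs \<and>
           (\<forall>k\<in>families S. 1 < length (pcs k) --> (\<forall>\<gamma>\<in>set (pcs k). \<epsilon> powr ep P <= str \<gamma>))"
    and Fs: "\<And>F. F \<in> set Fs ==> pos F = x \<and> spd F = regspd F \<and> regular_speed S P C \<epsilon> F (regspd F)"
    using r unfolding initial_riemann_def by blast
  have "joined (v (k - 1)) (pcs k) (v k)" if "k \<in> families S" for k
  proof (cases "k \<in> gnl S \<and> 0 < z k")
    case True
    then show ?thesis using ip[OF that] unfolding initial_pieces_def split_rarefaction_def by meson
  next
    case False
    then have "unsplit k (v (k - 1)) (z k) (v k) False (pcs k)" using ip[OF that] unfolding initial_pieces_def by meson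
    from unsplit_joined[OF this gRP_zero_strength[OF g that]] show ?thesis .
  qed
  then have j: "joined uL (in_order S pcs) uR" by (rule in_order_joined[OF g])
  have cc: "concat (map comps Fs) = in_order S pcs" using sc singles_props(1) by (auto simp: composites_def)
  show "joined uL (concat (map comps Fs)) uR" using j cc by simp
  fix F assume F: "F \<in> set Fs"
  show "good_front P C \<epsilon> \<eta> F \<and> pos F = x"
  proof (cases "singles (in_order S pcs) Fs")
    case True
    then show ?thesis using singles_props(2)[OF True F] Fs[OF F] \<eta> by (auto simp: good_front_def)
  next
    case False
    then have c: "composites P \<epsilon> (in_order S pcs) Fs" "\<And>k. k \<in> families S ==> 1 < length (pcs k) ==> \<forall>\<gamma>\<in>set (pcs k). \<epsilon> powr ep P <= str \<gamma>"
      using sc by auto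
    have "length (filter (weak P \<epsilon>) (pcs k)) <= 1" if k: "k \<in> families S" for k
    proof (cases "1 < length (pcs k)")
      case True
      then have "\<not> weak P \<epsilon> \<gamma>" if "\<gamma> \<in> set (pcs k)" for \<gamma> using c(2)[OF k True] that by force
      then show ?thesis by (simp add: filter_False)
    qed (use length_filter_le[of "weak P \<epsilon>" "pcs k"] in linarith)
    from composites_bounds[OF c(1) length_filter_in_order[OF this] F] show ?thesis
      using Fs[OF F] \<eta> by (auto simp: good_front_def)
  qed
qed

lemma initial_cell_good:
  assumes r: "initial_cell S P C \<epsilon> x x' uL uR Fs" and \<eta>: "0 <= \<eta>"
  shows "joined uL (concat (map comps Fs)) uR" "\<And>F. F \<in> set Fs ==> good_front P C \<epsilon> \<eta> F \<and> x <= pos F \<and> pos F <= x'"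
    "sorted (map pos Fs)"
proof -
  obtain w z v pcs where g: "gRP S uL uR w z v"
    and ip: "\<And>k. k \<in> families S ==> unsplit k (v (k - 1)) (z k) (v k) (0 < w k) (pcs k)"
    and s: "singles (in_order S pcs) Fs"
    and Fs: "\<And>F. F \<in> set Fs ==> spd F = regspd F \<and> regular_speed S P C \<epsilon> F (regspd F) \<and>
           x <= left_edge S 0 F \<and> left_edge S 0 F <= pos F \<and> pos F <= right_edge S 0 F \<and> right_edge S 0 F <= x'"
    and o: "\<And>j. Suc j < length Fs ==> right_edge S 0 (Fs ! j) <= left_edge S 0 (Fs ! Suc j)"
    using r unfolding initial_cell_def by blast
  have "joined (v (k - 1)) (pcs k) (v k)" if "k \<in> families S" for k
    by (rule unsplit_joined[OF ip[OF that] gRP_zero_strength[OF g that]])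
  then show "joined uL (concat (map comps Fs)) uR" using in_order_joined[OF g] singles_props(1)[OF s] by simp
  show "good_front P C \<epsilon> \<eta> F \<and> x <= pos F \<and> pos F <= x'" if F: "F \<in> set Fs" for F
    using singles_props(2)[OF s F] Fs[OF F] \<eta> by (auto simp: good_front_def)
  have "pos (Fs ! j) <= pos (Fs ! Suc j)" if "Suc j < length Fs" for j
    using Fs[of "Fs ! j"] Fs[of "Fs ! Suc j"] o[OF that] that by (auto intro: order.trans)
  then show "sorted (map pos Fs)" by (auto simp: sorted_iff_nth_Suc)
qed

text \<open>The Riemann solutions and cells are appended from left to right; each list starts in the state in which the previous one
ends, and the last division point needs no right end.\<close>

lemma initialized_good:
  assumes i: "initialized S P C \<epsilon> uo u0 L" and v: "valid_params P \<epsilon>" and \<eta>: "0 <= \<eta>"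
  shows "good_list P C \<epsilon> \<eta> u0 L"
proof -
  obtain xs rp cell where xs: "xs \<noteq> []" "sorted_wrt (<) xs" "u0 = llim uo (hd xs)"
    and rp: "\<And>j. j < length xs ==> if xs ! j \<in> big_jumps P \<epsilon> uo
           then initial_riemann S P C \<epsilon> (xs ! j) (llim uo (xs ! j)) (rlim uo (xs ! j)) (rp j)
           else llim uo (xs ! j) = rlim uo (xs ! j) \<and> rp j = []"
    and cell: "\<And>j. j < length xs ==> if Suc j < length xs
           then initial_cell S P C \<epsilon> (xs ! j) (xs ! Suc j) (rlim uo (xs ! j)) (llim uo (xs ! Suc j)) (cell j)
           else cell j = []"
    and L: "L = concat (map (\<lambda>j. rp j @ cell j) [0..<length xs])"
    using i unfolding initialized_def by blast
  have rj: "joined (llim uo (xs ! j)) (concat (map comps (rp j))) (rlim uo (xs ! j)) \<and> (\<forall>F\<in>set (rp j). good_front P C \<epsilon> \<eta> F \<and> pos F = xs ! j) \<and> sorted (map pos (rp j))"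
    if "j < length xs" for j
  proof (cases "xs ! j \<in> big_jumps P \<epsilon> uo")
    case True
    then have r: "initial_riemann S P C \<epsilon> (xs ! j) (llim uo (xs ! j)) (rlim uo (xs ! j)) (rp j)" using rp[OF that] by simp
    note irg = initial_riemann_good[OF r v \<eta>]
    have "map pos (rp j) = replicate (length (rp j)) (xs ! j)" using irg(2) by (auto intro!: nth_equalityI)
    then show ?thesis using irg by simp
  qed (use rp[OF that] in auto)
  have step: "(\<exists>w. joined (llim uo (xs ! 0)) (concat (map comps (concat (map (\<lambda>j. rp j @ cell j) [0..<m])))) w \<and> (m < length xs --> w = llim uo (xs ! m))) \<and>
     (\<forall>F\<in>set (concat (map (\<lambda>j. rp j @ cell j) [0..<m])). good_front P C \<epsilon> \<eta> F \<and> (m < length xs --> pos F <= xs ! m)) \<and>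
     sorted (map pos (concat (map (\<lambda>j. rp j @ cell j) [0..<m])))" if "m <= length xs" for m
    using that
  proof (induction m)
    case (Suc m)
    then have m: "m < length xs" by simp
    let ?L = "concat (map (\<lambda>j. rp j @ cell j) [0..<m])"
    have IH: "joined (llim uo (xs ! 0)) (concat (map comps ?L)) (llim uo (xs ! m))"
      "\<And>F. F \<in> set ?L ==> good_front P C \<epsilon> \<eta> F \<and> pos F <= xs ! m" "sorted (map pos ?L)"
      using Suc m by auto
    note rjm = rj[OF m]
    have LS: "concat (map (\<lambda>j. rp j @ cell j) [0..<Suc m]) = ?L @ rp m @ cell m" by simp
    show ?case
    proof (cases "Suc m < length xs")
      case True
      then have "initial_cell S P C \<epsilon> (xs ! m) (xs ! Suc m) (rlim uo (xs ! m)) (llim uo (xs ! Suc m)) (cell m)" using cell[OF m] by simp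
      note ic = initial_cell_good[OF this \<eta>]
      have lt: "xs ! m < xs ! Suc m" using xs(2) True by (simp add: sorted_wrt_nth_less)
      have "joined (llim uo (xs ! 0)) (concat (map comps (?L @ rp m @ cell m))) (llim uo (xs ! Suc m))"
        using IH(1) rjm ic(1) by (auto simp: joined_append)
      moreover have "sorted (map pos (?L @ rp m @ cell m))"
        using IH(2,3) rjm ic(2,3) by (fastforce simp: sorted_append)
      moreover have "\<forall>F\<in>set (?L @ rp m @ cell m). good_front P C \<epsilon> \<eta> F \<and> pos F <= xs ! Suc m"
        using IH(2) rjm ic(2) lt by fastforce
      ultimately show ?thesis unfolding LS using True by blast
    next
      case False
      then have c: "cell m = []" using cell[OF m] by simp
      have "joined (llim uo (xs ! 0)) (concat (map comps (?L @ rp m @ cell m))) (rlim uo (xs ! m))"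
        using IH(1) rjm by (auto simp: joined_append c)
      moreover have "sorted (map pos (?L @ rp m @ cell m))"
        using IH(2,3) rjm by (fastforce simp: sorted_append c)
      moreover have "\<forall>F\<in>set (?L @ rp m @ cell m). good_front P C \<epsilon> \<eta> F"
        using IH(2) rjm by (auto simp: c)
      ultimately show ?thesis unfolding LS using False by blast
    qed
  qed auto
  from step[of "length xs"] show ?thesis
    unfolding good_list_def L using xs(1,3) by (auto simp: hd_conv_nth)
qed

subsection \<open>Removal of overlaps\<close>

text \<open>Removing overlaps changes virtual centers only.\<close>

definition same_front :: "'n front => 'n front => bool" where
  "same_front F F' \<longleftrightarrow> (\<exists>x t. F' = F\<lparr>xc := x, tc := t\<rparr>)"

lemma same_front_refl: "same_front F F"
  unfolding same_front_def by (intro exI[of _ "xc F"] exI[of _ "tc F"]) simp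

lemma overlap_removed_same:
  assumes "overlap_removed S t i n L L'"
  shows "list_all2 same_front L L'"
  unfolding list_all2_conv_all_nth
  using assms same_front_refl unfolding overlap_removed_def narrowed_def same_front_def Let_def by metis

lemma same_frontD:
  assumes "same_front F F'"
  shows "comps F' = comps F" "car F' = car F" "pos F' = pos F" "spd F' = spd F" "regspd F' = regspd F" "good_front P C \<epsilon> \<eta> F' \<longleftrightarrow> good_front P C \<epsilon> \<eta> F"
proof -
  obtain x t where F': "F' = F\<lparr>xc := x, tc := t\<rparr>" using assms by (auto simp: same_front_def)
  show e: "comps F' = comps F" "car F' = car F" "pos F' = pos F" "spd F' = spd F" "regspd F' = regspd F" by (simp_all add: F')
  have "heavy P \<epsilon> F' = heavy P \<epsilon> F" "carrier F' = carrier F" by (simp_all add: heavy_def carrier_def e)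
  then show "good_front P C \<epsilon> \<eta> F' \<longleftrightarrow> good_front P C \<epsilon> \<eta> F" by (simp add: good_front_def regular_speed_def e)
qed

lemma same_list_maps:
  assumes "list_all2 same_front L L'"
  shows "map comps L' = map comps L" "map pos L' = map pos L" "(\<forall>F\<in>set L. good_front P C \<epsilon> \<eta> F) \<longleftrightarrow> (\<forall>F\<in>set L'. good_front P C \<epsilon> \<eta> F)"
  using assms by (induction rule: list_all2_induct) (auto simp: same_frontD)

lemma good_list_same: "list_all2 same_front L L' ==> good_list P C \<epsilon> \<eta> u0 L \<longleftrightarrow> good_list P C \<epsilon> \<eta> u0 L'"
  using same_list_maps[of L L'] by (simp add: good_list_def)

lemma front_function_same:
  assumes "list_all2 same_front L L'"
  shows "front_function u0 L x = front_function u0 L' x"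
  unfolding front_function_def using assms by (induction rule: list_all2_induct) (auto simp: same_frontD)

end

section \<open>From runs to tracked step functions\<close>

subsection \<open>Travelling jumps in L1\<close>

lemma heaviside_shift_L1:
  "integrable lborel (\<lambda>x. \<bar>heaviside (x - p) - heaviside (x - p')\<bar>)"
  "(LINT x|lborel. \<bar>heaviside (x - p) - heaviside (x - p')\<bar>) <= \<bar>p - p'\<bar>"
proof -
  let ?I = "{min p p'..max p p'}"
  have b: "\<bar>heaviside (x - p) - heaviside (x - p')\<bar> <= indicator ?I x" for x
    by (auto simp: heaviside_def indicator_def min_def max_def)
  have iI: "integrable lborel (indicator ?I :: real => real)" by simp
  show i: "integrable lborel (\<lambda>x. \<bar>heaviside (x - p) - heaviside (x - p')\<bar>)"
    by (rule Bochner_Integration.integrable_bound[OF iI]) (use b in \<open>auto intro!: AE_I2 simp: abs_le_iff\<close>)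
  have "(LINT x|lborel. \<bar>heaviside (x - p) - heaviside (x - p')\<bar>) <= (LINT x|lborel. indicator ?I x)"
    by (rule integral_mono[OF i iI b])
  also have "\<dots> = \<bar>p - p'\<bar>" by (auto simp: min_def max_def)
  finally show "(LINT x|lborel. \<bar>heaviside (x - p) - heaviside (x - p')\<bar>) <= \<bar>p - p'\<bar>" .
qed

text \<open>Measurability is included so that the relation is transitive.\<close>

definition L1_close :: "(real => 'a::euclidean_space) => (real => 'a) => real => bool" where
  "L1_close g h c \<longleftrightarrow> g \<in> borel_measurable borel \<and> h \<in> borel_measurable borel \<and>
     integrable lborel (\<lambda>x. norm (g x - h x)) \<and> (LINT x|lborel. norm (g x - h x)) <= c"

lemma L1_close_refl: "g \<in> borel_measurable borel ==> 0 <= c ==> L1_close g g c"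
  by (simp add: L1_close_def)

lemma L1_close_sym: "L1_close g h c ==> L1_close h g c"
  by (simp add: L1_close_def norm_minus_commute)

lemma L1_close_trans:
  assumes "L1_close f g c" "L1_close g h d"
  shows "L1_close f h (c + d)"
proof -
  have [measurable]: "f \<in> borel_measurable borel" "g \<in> borel_measurable borel" "h \<in> borel_measurable borel"
    and i: "integrable lborel (\<lambda>x. norm (f x - g x))" "integrable lborel (\<lambda>x. norm (g x - h x))"
    and b: "(LINT x|lborel. norm (f x - g x)) <= c" "(LINT x|lborel. norm (g x - h x)) <= d"
    using assms by (auto simp: L1_close_def)
  have t: "norm (f x - h x) <= norm (f x - g x) + norm (g x - h x)" for x
    using norm_triangle_ineq[of "f x - g x" "g x - h x"] by simp
  have isum: "integrable lborel (\<lambda>x. norm (f x - g x) + norm (g x - h x))" using i by simp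
  have ifh: "integrable lborel (\<lambda>x. norm (f x - h x))"
    by (rule Bochner_Integration.integrable_bound[OF isum]) (use t in \<open>auto intro!: AE_I2\<close>)
  have "(LINT x|lborel. norm (f x - h x)) <= (LINT x|lborel. norm (f x - g x) + norm (g x - h x))"
    by (rule integral_mono[OF ifh isum t])
  also have "\<dots> = (LINT x|lborel. norm (f x - g x)) + (LINT x|lborel. norm (g x - h x))"
    by (rule Bochner_Integration.integral_add[OF i])
  finally show ?thesis using ifh b by (simp add: L1_close_def)
qed

lemma L1_close_add_jump:
  assumes "L1_close g h c"
  shows "L1_close (\<lambda>x. heaviside (x - p) *\<^sub>R v + g x) (\<lambda>x. heaviside (x - p') *\<^sub>R v + h x) (\<bar>p - p'\<bar> * norm v + c)"
proof -
  have [measurable]: "g \<in> borel_measurable borel" "h \<in> borel_measurable borel" using assms by (auto simp: L1_close_def)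
  have 1: "L1_close (\<lambda>x. heaviside (x - p) *\<^sub>R v + g x) (\<lambda>x. heaviside (x - p') *\<^sub>R v + g x) (\<bar>p - p'\<bar> * norm v)"
  proof -
    have e: "norm ((heaviside (x - p) *\<^sub>R v + g x) - (heaviside (x - p') *\<^sub>R v + g x)) = \<bar>heaviside (x - p) - heaviside (x - p')\<bar> * norm v" for x
      by (simp add: scaleR_diff_left[symmetric])
    show ?thesis
      unfolding L1_close_def e using heaviside_shift_L1[of p p'] by (simp add: mult_right_mono)
  qed
  have 2: "L1_close (\<lambda>x. heaviside (x - p') *\<^sub>R v + g x) (\<lambda>x. heaviside (x - p') *\<^sub>R v + h x) c"
    using assms by (simp add: L1_close_def)
  show ?thesis by (rule L1_close_trans[OF 1 2])
qed

subsection \<open>Front functions as step functions\<close>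

definition jump_of :: "'n::finite front => 'n jump" where
  "jump_of F = (pos F, spd F, left_state F, right_state F)"

lemma joined_scaled: "joined u ws w ==> (\<Sum>\<gamma>\<leftarrow>ws. c *\<^sub>R (rst \<gamma> - lst \<gamma>)) = c *\<^sub>R (w - u)"
  using joined_sum[of u ws w "\<lambda>v. c *\<^sub>R v"] by (simp add: scaleR_diff_right)

lemma front_function_Nil [simp]: "front_function u0 [] x = u0"
  by (simp add: front_function_def)

lemma front_function_Cons:
  assumes "joined u0 (comps F) v"
  shows "front_function u0 (F # L) x = heaviside (x - pos F) *\<^sub>R (v - u0) + front_function u0 L x"
  using joined_scaled[OF assms, of "heaviside (x - pos F)"] by (simp add: front_function_def)

lemma front_function_shift: "front_function u0 L x - u0 = front_function v L x - v"
  by (simp add: front_function_def)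

lemma front_function_left:
  assumes "\<forall>F\<in>set L. x < pos F"
  shows "front_function u0 L x = u0"
  using assms by (induction L) (auto simp: front_function_def heaviside_def)

lemma step_fn_left:
  assumes "\<forall>(y, v)\<in>set js. x < y"
  shows "step_fn g0 js x = g0"
  using assms by (induction js) (auto simp: heaviside_def)

lemma step_fn_shift: "step_fn g0 js x - g0 = step_fn g1 js x - g1"
  by (simp add: step_fn_def)

text \<open>Right of the first front the function is the one that starts from the right state of this front, left of it everything is
constant. Induction then gives, off the jumps, one of the intermediate states.\<close>

lemma front_function_states:
  assumes "joined u0 (concat (map comps L)) w" "sorted (map pos L)" "x \<notin> pos ` set L" "u0 \<in> K"
    and "\<forall>F\<in>set L. comps F \<noteq> [] \<and> (\<forall>\<gamma>\<in>set (comps F). rst \<gamma> \<in> K)"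
  shows "front_function u0 L x \<in> K \<and> h (front_function u0 L x) = step_fn (h u0) (jumps_of h (map jump_of L)) x"
  using assms
proof (induction L arbitrary: u0)
  case (Cons F L)
  obtain v where v: "joined u0 (comps F) v" "joined v (concat (map comps L)) w"
    using Cons.prems(1) by (auto simp: joined_append)
  have ne: "comps F \<noteq> []" using Cons.prems by simp
  have st: "left_state F = u0" "right_state F = v" using joined_hd[OF v(1) ne] by (auto simp: left_state_def right_state_def)
  have vK: "v \<in> K" using Cons.prems(5) joined_hd[OF v(1) ne] last_in_set[OF ne] by auto
  have IH: "front_function v L x \<in> K \<and> h (front_function v L x) = step_fn (h v) (jumps_of h (map jump_of L)) x"
    using Cons.prems vK by (intro Cons.IH[OF v(2)]) auto
  have js: "jumps_of h (map jump_of (F # L)) = (pos F, h v - h u0) # jumps_of h (map jump_of L)"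
    by (simp add: jumps_of_def jump_of_def st)
  consider "x < pos F" | "pos F < x" using Cons.prems(3) by force
  then show ?case
  proof cases
    case 1
    then have "\<forall>F'\<in>set (F # L). x < pos F'" using Cons.prems(2) by force
    then have "front_function u0 (F # L) x = u0" by (rule front_function_left)
    moreover have "step_fn (h u0) (jumps_of h (map jump_of (F # L))) x = h u0"
      using \<open>\<forall>F'\<in>set (F # L). x < pos F'\<close> by (intro step_fn_left) (auto simp: jumps_of_def jump_of_def)
    ultimately show ?thesis using Cons.prems(4) by simp
  next
    case 2
    have "front_function u0 (F # L) x = front_function v L x"
      unfolding front_function_Cons[OF v(1)] using front_function_shift[of u0 L x v] 2 by (simp add: heaviside_def algebra_simps)
    moreover have "step_fn (h u0) (jumps_of h (map jump_of (F # L))) x = step_fn (h v) (jumps_of h (map jump_of L)) x"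
      unfolding js step_fn_Cons using step_fn_shift[of "h u0" "jumps_of h (map jump_of L)" x "h v"] 2
      by (simp add: heaviside_def algebra_simps)
    ultimately show ?thesis using IH by simp
  qed
qed (simp add: jumps_of_def)

lemma measurable_front_function [measurable]: "front_function u0 L \<in> borel_measurable borel"
proof -
  have "(\<lambda>x. \<Sum>\<gamma>\<leftarrow>ws. heaviside (x - p) *\<^sub>R (rst \<gamma> - lst \<gamma>)) \<in> borel_measurable borel" for p and ws :: "'a wave list"
    by (induction ws) auto
  then have "(\<lambda>x. \<Sum>F\<leftarrow>L. \<Sum>\<gamma>\<leftarrow>comps F. heaviside (x - pos F) *\<^sub>R (rst \<gamma> - lst \<gamma>)) \<in> borel_measurable borel"
    by (induction L) auto
  then show ?thesis unfolding front_function_def[abs_def] by simp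
qed

lemma advance_simps [simp]:
  "comps (advance d F) = comps F" "car (advance d F) = car F" "spd (advance d F) = spd F" "regspd (advance d F) = regspd F"
  "trev (advance d F) = trev F" "pos (advance d F) = pos F + d * spd F" "carrier (advance d F) = carrier F"
  "left_state (advance d F) = left_state F" "right_state (advance d F) = right_state F" "heavy P \<epsilon> (advance d F) = heavy P \<epsilon> F"
  by (simp_all add: advance_def carrier_def left_state_def right_state_def heavy_def)

text \<open>Positions are affine in time.\<close>

lemma sorted_between:
  assumes "sorted (map pos L)" "sorted (map (\<lambda>F. pos (advance d1 F)) L)" "0 <= d" "d <= d1"
  shows "sorted (map (\<lambda>F. pos (advance d F)) L)"
proof (cases "d1 = 0")
  case True
  then show ?thesis using assms by simp
next
  case False
  then have d1: "0 < d1" using assms by simp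
  have "pos (L ! i) + d * spd (L ! i) <= pos (L ! j) + d * spd (L ! j)" if ij: "i <= j" "j < length L" for i j
  proof -
    have 0: "pos (L ! i) <= pos (L ! j)" using assms(1) ij by (auto simp: sorted_iff_nth_mono)
    have 1: "pos (L ! i) + d1 * spd (L ! i) <= pos (L ! j) + d1 * spd (L ! j)" using assms(2) ij by (auto simp: sorted_iff_nth_mono)
    have c: "pos F + d * spd F = (1 - d / d1) * pos F + d / d1 * (pos F + d1 * spd F)" for F :: "'a front"
      using d1 by (simp add: field_simps)
    have "0 <= 1 - d / d1" "0 <= d / d1" using assms(3,4) d1 by auto
    from add_mono[OF mult_left_mono[OF 0 this(1)] mult_left_mono[OF 1 this(2)]] show ?thesis unfolding c[symmetric] .
  qed
  then show ?thesis by (auto simp: sorted_iff_nth_mono)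
qed

text \<open>Each jump contributes its size times the distance by which it moves.\<close>

lemma front_function_advance_L1:
  fixes L :: "'n::finite front list"
  assumes "joined u0 (concat (map comps L)) w" "\<forall>F\<in>set L. comps F \<noteq> [] \<and> \<bar>spd F\<bar> <= \<sigma>"
  shows "L1_close (front_function u (map (advance d) L)) (front_function u (map (advance d') L))
    (\<sigma> * \<bar>d - d'\<bar> * (\<Sum>F\<leftarrow>L. norm (right_state F - left_state F)))"
  using assms
proof (induction L arbitrary: u0)
  case Nil
  show ?case using L1_close_refl[of "\<lambda>_. u" 0] by (simp add: front_function_Nil[abs_def])
next
  case (Cons F L)
  obtain v where v: "joined u0 (comps F) v" "joined v (concat (map comps L)) w"
    using Cons.prems(1) by (auto simp: joined_append)
  have ne: "comps F \<noteq> []" using Cons.prems by simp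
  have st: "left_state F = u0" "right_state F = v" using joined_hd[OF v(1) ne] by (auto simp: left_state_def right_state_def)
  have e: "front_function u (map (advance d) (F # L)) x =
      heaviside (x - (pos F + d * spd F)) *\<^sub>R (v - u0) + front_function u (map (advance d) L) x" for d x
    using joined_scaled[OF v(1), of "heaviside (x - (pos F + d * spd F))"] by (simp add: front_function_def)
  note L1_close_add_jump[OF Cons.IH[OF v(2)], of "pos F + d * spd F" "v - u0" "pos F + d' * spd F"]
  moreover have "\<bar>(pos F + d * spd F) - (pos F + d' * spd F)\<bar> <= \<sigma> * \<bar>d - d'\<bar>"
  proof -
    have "(pos F + d * spd F) - (pos F + d' * spd F) = spd F * (d - d')" by (simp add: algebra_simps)
    then show ?thesis using Cons.prems(2) by (simp add: abs_mult mult_right_mono)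
  qed
  then have "\<bar>(pos F + d * spd F) - (pos F + d' * spd F)\<bar> * norm (v - u0) <= \<sigma> * \<bar>d - d'\<bar> * norm (v - u0)"
    by (rule mult_right_mono) simp
  ultimately show ?case
    unfolding e[abs_def] using Cons.prems(2) by (auto simp: L1_close_def st distrib_left)
qed

section \<open>Events\<close>

text \<open>The smallness conditions under which the invariant \<open>good_list\<close> survives an event. Outer states that are closer than \<open>\<delta>\<close>
  give strengths closer than \<open>\<eta>'\<close>; the condition on \<open>\<delta>\<close> allows for the passengers and one simple carrier of each of two colliding
  fronts, and the one on \<open>\<eta>\<close> converts \<open>\<eta>'\<close> into a bound for temporary speeds.\<close>

locale fine_scheme = hyperbolic_compact S K for S :: "'n::finite hsys" and K +
  fixes P :: mft_params and C \<epsilon> \<eta> \<eta>' \<theta> \<Lambda> \<tau> \<delta> :: real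
  assumes params: "valid_params P \<epsilon>" and \<theta>: "0 <= \<theta>" "\<theta> <= \<tau>" and bounds: "front_bounds C \<Lambda> \<tau>"
    and \<delta>: "4 * (CARD('n) * \<Lambda> * \<epsilon> powr ep P) + 2 * (\<Lambda> * \<theta>) < \<delta>" and close: "gRP_close K \<delta> \<eta>'"
    and \<eta>': "\<eta>' <= \<tau>" "0 <= \<eta>'" and \<eta>: "\<Lambda> * \<bar>C\<bar> * \<eta>' / kap P <= \<eta>" "0 <= \<eta>"
begin

abbreviation good :: "'n front => bool" where "good \<equiv> good_front P C \<epsilon> \<eta>"

lemma \<Lambda>: "1 <= \<Lambda>" and \<Lambda>0: "0 <= \<Lambda>"
  using bounds by (auto simp: front_bounds_def)

lemma front_bound:
  assumes "\<forall>\<gamma>\<in>set (comps F). tame C \<theta> \<gamma>" "car F < length (comps F)" "length (comps F) <= Suc (CARD('n))" "regular_speed S P C \<epsilon> F s"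
  shows "\<bar>s\<bar> <= \<Lambda>" "norm (\<Sum>\<gamma>\<leftarrow>comps F. fjump S \<gamma> - s *\<^sub>R qjump S \<gamma>) <= \<Lambda> * ((\<theta> + Qlight P \<epsilon>) * front_size F + heavy_size P \<epsilon> F)"
  using bounds assms \<theta> params unfolding front_bounds_def valid_params_def by (meson less_imp_le)+

lemma jump_bound: "tame C \<theta> \<gamma> ==> norm (qjump S \<gamma>) <= \<Lambda> * \<bar>str \<gamma>\<bar>" "tame C \<theta> \<gamma> ==> norm (rst \<gamma> - lst \<gamma>) <= \<Lambda> * \<bar>str \<gamma>\<bar>"
  using bounds unfolding front_bounds_def by blast+

lemma lam_bound: "k \<in> families S ==> u \<in> K ==> W_curve S k u \<zeta> u' ==> \<bar>\<zeta>\<bar> <= \<tau> ==> \<bar>lam S k u'\<bar> <= \<Lambda>"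
  using bounds unfolding front_bounds_def by blast

definition tame_list :: "'n front list => bool" where
  "tame_list L \<longleftrightarrow> (\<forall>F\<in>set L. \<forall>\<gamma>\<in>set (comps F). tame C \<theta> \<gamma>)"

subsection \<open>Outgoing fronts\<close>

lemma split_sum_ge:
  assumes "\<forall>\<gamma>\<in>set ps. a <= str \<gamma>"
  shows "real (length ps) * a <= (\<Sum>\<gamma>\<leftarrow>ps. str \<gamma>)"
  using assms by (induction ps) (auto simp: distrib_right)

text \<open>The definition of the temporary speed gives \<open>\<bar>spd - regspd\<bar> = \<bar>regspd - \<lambda>\<bar> (t - Tc) / (th - t)\<close>, and the last quotient is at most
\<open>C m \<epsilon> powr er\<close>. The \<open>2m + 1\<close> pieces have strength at least \<open>\<kappa> \<epsilon> powr er\<close> each, so \<open>m \<epsilon> powr er\<close> is bounded by the strength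
of the whole rarefaction divided by \<open>2\<kappa>\<close>.\<close>

lemma outgoing_good:
  assumes o: "outgoing S P C \<epsilon> x t uL uR w Fs" and tFs: "tame_list Fs" and w: "\<forall>k\<in>families S. 0 <= w k"
    and small: "\<forall>z v. gRP S uL uR w z v --> (\<forall>k\<in>families S. 0 < w k --> \<bar>z k\<bar> <= \<eta>')"
  shows "joined uL (concat (map comps Fs)) uR" "\<And>F. F \<in> set Fs ==> good F \<and> pos F = x"
proof -
  obtain z v pcs X Tc th mid where
    g: "gRP S uL uR w z v" and
    op0: "\<forall>k\<in>families S. outgoing_pieces S P \<epsilon> k (v (k - 1)) (z k) (v k) (0 < w k) (pcs k)" and
    Tc0: "\<forall>k\<in>families S \<inter> gnl S.
           Tc k = t - w k / (lam S k (v k) - lam S k (v (k - 1))) \<and>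
           X k + lam S k (v (k - 1)) * (t - Tc k) <= x \<and> x <= X k + lam S k (v k) * (t - Tc k)" and
    multi0: "\<forall>k\<in>families S. too_strong S P \<epsilon> k (z k) \<and> 0 < w k -->
           W_curve S k (v (k - 1)) (z k / 2) (mid k) \<and> t < th k \<and>
           (\<forall>m. length (pcs k) = 2 * m + 1 --> t - Tc k <= C * real m * \<epsilon> powr er P * (th k - t))" and
    c: "composites P \<epsilon> (in_order S pcs) Fs" and
    Fs0: "\<forall>F\<in>set Fs. let k = fam (carrier F) in
           pos F = x \<and> regular_speed S P C \<epsilon> F (regspd F) \<and>
           (is_simple S (carrier F) --> xc F = X k \<and> tc F = Tc k) \<and>
           (if too_strong S P \<epsilon> k (z k) \<and> 0 < w k \<and> heavy P \<epsilon> F = {}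
            then trev F = Some (th k) \<and>
                 (spd F - regspd F) * (th k - t) = (regspd F - lam S k (mid k)) * (t - Tc k)
            else trev F = None \<and> spd F = regspd F)"
    using o unfolding outgoing_def by (elim exE conjE) (rule that, assumption+)
  note op = bspec[OF op0] and Tc = bspec[OF Tc0, THEN conjunct1] and multi = bspec[OF multi0, THEN mp]
    and Fs = bspec[OF Fs0]
  note v = params
  have uK: "\<forall>\<gamma>\<in>set (comps F). tame C \<theta> \<gamma>" if "F \<in> set Fs" for F using tFs that by (simp add: tame_list_def)
  note props = outgoing_pieces_props[OF g _ v op]
  have cc: "concat (map comps Fs) = in_order S pcs" using c by (simp add: composites_def)
  show "joined uL (concat (map comps Fs)) uR" unfolding cc by (rule in_order_joined[OF g props(1)])
  fix F assume F: "F \<in> set Fs"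
  note cb = composites_bounds[OF c length_filter_in_order[OF props(2)] F]
  let ?k = "fam (carrier F)"
  have cF: "carrier F \<in> set (comps F)" using cb(1) by (simp add: carrier_def)
  have k: "?k \<in> families S" using uK[OF F] cF by (auto simp: tame_def valid_wave_def)
  have rs: "regular_speed S P C \<epsilon> F (regspd F)" and px: "pos F = x" using Fs[OF F] by (auto simp: Let_def)
  have "\<bar>spd F - regspd F\<bar> <= \<eta>"
  proof (cases "too_strong S P \<epsilon> ?k (z ?k) \<and> 0 < w ?k \<and> heavy P \<epsilon> F = {}")
    case False
    then show ?thesis using Fs[OF F] \<eta>(2) by (auto simp: Let_def)
  next
    case True
    then have ts: "too_strong S P \<epsilon> ?k (z ?k)" "0 < w ?k" by auto
    have eq: "(spd F - regspd F) * (th ?k - t) = (regspd F - lam S ?k (mid ?k)) * (t - Tc ?k)"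
      using Fs[OF F] True by (auto simp: Let_def)
    note mu = multi[OF k conjI[OF ts]]
    have gn: "?k \<in> gnl S" and "\<epsilon> powr er P < z ?k" using ts(1) by (auto simp: too_strong_def)
    then have z0: "0 < z ?k" using powr_ge_zero[of \<epsilon> "er P"] by linarith
    have zs: "z ?k <= \<eta>'" using small g k ts(2) by fastforce
    have oo: "split_rarefaction S ?k (v (?k - 1)) (z ?k) (v ?k) True (pcs ?k)"
      "\<forall>\<gamma>\<in>set (pcs ?k). kap P * \<epsilon> powr er P <= str \<gamma>" "\<exists>m\<ge>1. length (pcs ?k) = 2 * m + 1"
      using op[OF k] ts by (auto simp: outgoing_pieces_def)
    obtain m where m: "length (pcs ?k) = 2 * m + 1" using oo(3) by blast
    have nonempty: "pcs ?k \<noteq> []" using m by auto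
    have vK: "v (?k - 1) \<in> K"
    proof -
      have "joined (v (?k - 1)) (pcs ?k) (v ?k)" using oo(1) by (simp add: split_rarefaction_def)
      then have l: "lst (hd (pcs ?k)) = v (?k - 1)" using joined_hd nonempty by blast
      have "?k \<in> set [1..<CARD('n) + 1]" using k by (auto simp: families_def)
      then have "set (pcs ?k) \<subseteq> set (in_order S pcs)" unfolding in_order_def set_concat set_map by blast
      then have "hd (pcs ?k) \<in> set (in_order S pcs)" using hd_in_set[OF nonempty] by blast
      then obtain G where "G \<in> set Fs" "hd (pcs ?k) \<in> set (comps G)" unfolding cc[symmetric] by auto
      then show ?thesis using uK l by (metis tame_def)
    qed
    have Wz: "W_curve S ?k (v (?k - 1)) (z ?k) (v ?k)" using g k ts(2) by (auto simp: gRP_def)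
    \<comment> \<open>a rarefaction of positive width has its center in the past\<close>
    have "lam S ?k (v (?k - 1)) < lam S ?k (v ?k)" by (rule lam_increases[OF k gn z0 Wz])
    then have tT: "0 <= t - Tc ?k" using Tc[of ?k] k gn ts(2) by simp
    have mz: "real m * (\<epsilon> powr er P) <= \<eta>' / (2 * kap P)"
    proof -
      have kp: "0 < kap P" using v by (simp add: valid_params_def)
      have "real (2 * m + 1) * (kap P * \<epsilon> powr er P) <= z ?k"
        using split_sum_ge[OF oo(2)] oo(1) m by (simp add: split_rarefaction_def)
      moreover have "real (2 * m) * (kap P * \<epsilon> powr er P) <= real (2 * m + 1) * (kap P * \<epsilon> powr er P)"
        using kp by (intro mult_right_mono) auto
      ultimately have "2 * kap P * (real m * \<epsilon> powr er P) <= \<eta>'" using zs by (simp add: mult_ac)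
      then show ?thesis using kp by (simp add: field_simps)
    qed
    have d: "0 < th ?k - t" using mu by simp
    have "t - Tc ?k <= C * real m * \<epsilon> powr er P * (th ?k - t)" using mu m by blast
    also have "\<dots> <= \<bar>C\<bar> * (\<eta>' / (2 * kap P)) * (th ?k - t)"
    proof (rule mult_right_mono)
      have "C * real m * \<epsilon> powr er P <= \<bar>C\<bar> * (real m * \<epsilon> powr er P)"
        unfolding mult.assoc by (intro mult_right_mono) auto
      also have "\<dots> <= \<bar>C\<bar> * (\<eta>' / (2 * kap P))" by (intro mult_left_mono mz) auto
      finally show "C * real m * \<epsilon> powr er P <= \<bar>C\<bar> * (\<eta>' / (2 * kap P))" .
    qed (use d in simp)
    finally have tb: "t - Tc ?k <= \<bar>C\<bar> * (\<eta>' / (2 * kap P)) * (th ?k - t)" .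
    have "\<bar>regspd F\<bar> <= \<Lambda>" by (rule front_bound(1)[OF uK[OF F] cb(1,2) rs])
    moreover have "\<bar>lam S ?k (mid ?k)\<bar> <= \<Lambda>"
      using mu z0 zs \<eta>' by (intro lam_bound[OF k vK, of "z ?k / 2"]) auto
    ultimately have "\<bar>regspd F - lam S ?k (mid ?k)\<bar> <= 2 * \<Lambda>" by linarith
    then have "\<bar>regspd F - lam S ?k (mid ?k)\<bar> * (t - Tc ?k) <= 2 * \<Lambda> * (\<bar>C\<bar> * (\<eta>' / (2 * kap P)) * (th ?k - t))"
      using tb tT by (intro mult_mono) auto
    moreover have "\<bar>spd F - regspd F\<bar> * (th ?k - t) = \<bar>regspd F - lam S ?k (mid ?k)\<bar> * (t - Tc ?k)"
      using arg_cong[OF eq, of abs] d tT by (simp add: abs_mult)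
    moreover have "2 * \<Lambda> * (\<bar>C\<bar> * (\<eta>' / (2 * kap P)) * D) = (\<Lambda> * \<bar>C\<bar> * \<eta>' / kap P) * D" for D :: real by simp
    ultimately have "\<bar>spd F - regspd F\<bar> * (th ?k - t) <= (\<Lambda> * \<bar>C\<bar> * \<eta>' / kap P) * (th ?k - t)" by metis
    then have "\<bar>spd F - regspd F\<bar> <= \<Lambda> * \<bar>C\<bar> * \<eta>' / kap P" using d by (rule mult_right_le_imp_le)
    then show ?thesis using \<eta>(1) by linarith
  qed
  then show "good F \<and> pos F = x" using cb rs px by (auto simp: good_front_def)
qed

subsection \<open>Strengths at interactions\<close>

text \<open>All components other than the carrier are weak and there are at most \<open>CARD('n)\<close> of them.\<close>

lemma passengers_near_carrier:
  assumes gf: "good F" and tm: "\<forall>\<gamma>\<in>set (comps F). tame C \<theta> \<gamma>" and j: "joined a (comps F) b"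
  shows "norm (a - lst (carrier F)) <= CARD('n) * \<Lambda> * \<epsilon> powr ep P" "norm (b - rst (carrier F)) <= CARD('n) * \<Lambda> * \<epsilon> powr ep P"
proof -
  define c where "c = car F"
  have c: "c < length (comps F)" "length (comps F) <= Suc (CARD('n))" using gf by (auto simp: good_front_def c_def)
  have "comps F = take c (comps F) @ comps F ! c # drop (Suc c) (comps F)" using c(1) by (rule id_take_nth_drop)
  then have js: "joined a (take c (comps F)) (lst (carrier F))" "joined (rst (carrier F)) (drop (Suc c) (comps F)) b"
    using j joined_append[of a "take c (comps F)" "comps F ! c # drop (Suc c) (comps F)" b] by (auto simp: carrier_def c_def)
  have small: "norm (w' - w) <= real (length ws) * (\<Lambda> * \<epsilon> powr ep P)"
    if "joined w ws w'" "\<forall>\<gamma>\<in>set ws. tame C \<theta> \<gamma> \<and> \<bar>str \<gamma>\<bar> < \<epsilon> powr ep P" for w ws w'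
    using that
  proof (induction ws arbitrary: w)
    case (Cons \<gamma> ws)
    have "norm (w' - rst \<gamma>) <= real (length ws) * (\<Lambda> * \<epsilon> powr ep P)" using Cons by auto
    moreover have "norm (rst \<gamma> - lst \<gamma>) <= \<Lambda> * \<epsilon> powr ep P"
      using Cons.prems(2) by (intro order.trans[OF jump_bound(2) mult_left_mono] \<Lambda>0) auto
    moreover have "norm (w' - w) <= norm (w' - rst \<gamma>) + norm (rst \<gamma> - lst \<gamma>)"
      using norm_triangle_ineq[of "w' - rst \<gamma>" "rst \<gamma> - lst \<gamma>"] Cons.prems(1) by simp
    ultimately show ?case by (simp add: distrib_right)
  qed simp
  have le: "real n * (\<Lambda> * \<epsilon> powr ep P) <= CARD('n) * \<Lambda> * \<epsilon> powr ep P" if "n <= CARD('n)" for n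
    unfolding mult.assoc using that \<Lambda>0 by (intro mult_right_mono) auto
  have w: "\<bar>str (comps F ! i)\<bar> < \<epsilon> powr ep P" if "i < length (comps F)" "i \<noteq> c" for i using gf that by (auto simp: good_front_def c_def)
  have 1: "\<forall>\<gamma>\<in>set (take c (comps F)). tame C \<theta> \<gamma> \<and> \<bar>str \<gamma>\<bar> < \<epsilon> powr ep P"
  proof
    fix \<gamma> assume g: "\<gamma> \<in> set (take c (comps F))"
    then have "\<gamma> \<in> set (comps F)" by (rule in_set_takeD)
    moreover obtain i where "i < c" "\<gamma> = comps F ! i" using g c by (auto simp: in_set_conv_nth)
    ultimately show "tame C \<theta> \<gamma> \<and> \<bar>str \<gamma>\<bar> < \<epsilon> powr ep P" using tm w[of i] c by auto
  qed
  have 2: "\<forall>\<gamma>\<in>set (drop (Suc c) (comps F)). tame C \<theta> \<gamma> \<and> \<bar>str \<gamma>\<bar> < \<epsilon> powr ep P"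
  proof
    fix \<gamma> assume g: "\<gamma> \<in> set (drop (Suc c) (comps F))"
    then have "\<gamma> \<in> set (comps F)" by (rule in_set_dropD)
    moreover obtain i where "i < length (comps F) - Suc c" "\<gamma> = comps F ! (Suc c + i)" using g c by (auto simp: in_set_conv_nth)
    ultimately show "tame C \<theta> \<gamma> \<and> \<bar>str \<gamma>\<bar> < \<epsilon> powr ep P" using tm w[of "Suc c + i"] by auto
  qed
  show "norm (a - lst (carrier F)) <= CARD('n) * \<Lambda> * \<epsilon> powr ep P"
    using order.trans[OF small[OF js(1) 1] le] c by (simp add: norm_minus_commute)
  show "norm (b - rst (carrier F)) <= CARD('n) * \<Lambda> * \<epsilon> powr ep P"
    using order.trans[OF small[OF js(2) 2] le] c by simp
qed

lemma resets_widths: "resets S P \<epsilon> uL uR w w' ==> w' k = w k \<or> w' k = 0"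
  by (induction rule: resets.induct) (auto split: if_splits)

lemma vwidth_not_simple: "\<not> is_simple S (carrier F) ==> vwidth S t F = 0"
  by (simp add: vwidth_def right_edge_def left_edge_def)

lemma gRP_trivial: "u \<in> states S ==> gRP S u u w (\<lambda>_. 0) (\<lambda>_. u)"
  unfolding gRP_def using E_curve_0 W_curve_0 by auto

text \<open>Valid for every width of the other families: a wave of strength zero solves both curves.\<close>

lemma gRP_single:
  assumes k: "k \<in> families S" and E: "E_curve S k a \<zeta> b" and w: "w k = 0"
  shows "gRP S a b w (\<lambda>j. if j = k then \<zeta> else 0) (\<lambda>j. if j < k then a else b)"
proof -
  have ab: "a \<in> states S" "b \<in> states S" using E_curve_states[OF k E] by auto
  have kk: "1 <= k" "k <= CARD('n)" using k by (auto simp: families_def)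
  show ?thesis
    unfolding gRP_def
  proof (intro conjI ballI)
    fix j assume j: "j \<in> families S"
    then have j1: "1 <= j" by (simp add: families_def)
    consider "j < k" | "j = k" | "k < j" by linarith
    then show "if w j = 0 then E_curve S j (if j - 1 < k then a else b) (if j = k then \<zeta> else 0) (if j < k then a else b)
         else W_curve S j (if j - 1 < k then a else b) (if j = k then \<zeta> else 0) (if j < k then a else b)"
      by cases (use ab E w j1 E_curve_0[OF j] W_curve_0 kk in auto)
  qed (use kk in auto)
qed

text \<open>If a wave of positive width emerges, one of the colliding carriers is simple, hence weak. If both are, the outer states are
  close to equal ones. If the other one is not, its family has width zero, and alone it solves the problem with its own states.
  In either comparison problem the family \<open>k\<close> has strength zero.\<close>

lemma meeting_strengths:
  assumes gF: "good F" "\<forall>\<gamma>\<in>set (comps F). tame C \<theta> \<gamma>" "joined a (comps F) b"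
    and gG: "good G" "\<forall>\<gamma>\<in>set (comps G). tame C \<theta> \<gamma>" "joined b (comps G) c"
    and wr: "width_rule S (fam (carrier F)) (vwidth S t F) (fam (carrier G)) (vwidth S t G) w0"
    and w: "\<And>k. w k = w0 k \<or> w k = 0"
    and g: "gRP S a c w z v" and k: "k \<in> families S" and wk: "0 < w k"
  shows "\<bar>z k\<bar> <= \<eta>'"
proof -
  let ?F = "carrier F" and ?G = "carrier G"
  define D where "D = CARD('n) * \<Lambda> * \<epsilon> powr ep P"
  have tF: "tame C \<theta> ?F" and tG: "tame C \<theta> ?G" using gF(1,2) gG(1,2) by (auto simp: good_front_def carrier_def)
  have neF: "comps F \<noteq> []" and neG: "comps G \<noteq> []" using gF(1) gG(1) by (auto simp: good_front_def)
  have aK: "a \<in> K" using joined_hd[OF gF(3) neF] gF(2) neF by (metis hd_in_set tame_def)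
  have cK: "c \<in> K" using joined_hd[OF gG(3) neG] gG(2) neG by (metis last_in_set tame_def)
  have valid: "\<forall>k\<in>families S. 0 <= w k \<and> (k \<notin> gnl S --> w k = 0)"
    using wr w unfolding width_rule_def by (metis order_refl)
  have fF: "fam ?F \<in> families S" "valid_wave S ?F" "lst ?F \<in> K" "rst ?F \<in> K" using tF by (auto simp: tame_def valid_wave_def)
  have fG: "fam ?G \<in> families S" "valid_wave S ?G" "lst ?G \<in> K" "rst ?G \<in> K" using tG by (auto simp: tame_def valid_wave_def)
  have zero: "w k' = 0" if "w0 k' <= 0" "k' \<in> families S" for k'
    using that w[of k'] valid by force
  note nF = passengers_near_carrier[OF gF, folded D_def] and nG = passengers_near_carrier[OF gG, folded D_def]
  have D0: "0 <= D" using order.trans[OF norm_ge_zero nF(1)] .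
  have sF: "norm (rst ?F - lst ?F) <= \<Lambda> * \<theta>" if "is_simple S ?F"
    using that tF by (intro order.trans[OF jump_bound(2)[OF tF] mult_left_mono[OF _ \<Lambda>0]]) (auto simp: tame_def)
  have sG: "norm (rst ?G - lst ?G) <= \<Lambda> * \<theta>" if "is_simple S ?G"
    using that tG by (intro order.trans[OF jump_bound(2)[OF tG] mult_left_mono[OF _ \<Lambda>0]]) (auto simp: tame_def)
  have ab: "norm (a - b) <= 2 * D + \<Lambda> * \<theta>" if "is_simple S ?F"
  proof -
    have "a - b = (a - lst ?F) - (rst ?F - lst ?F) - (b - rst ?F)" by simp
    then have "norm (a - b) <= norm (a - lst ?F) + norm (rst ?F - lst ?F) + norm (b - rst ?F)"
      by (smt (verit) norm_triangle_ineq4)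
    then show ?thesis using nF sF[OF that] by linarith
  qed
  have bc: "norm (b - c) <= 2 * D + \<Lambda> * \<theta>" if "is_simple S ?G"
  proof -
    have "b - c = (b - lst ?G) - (rst ?G - lst ?G) - (c - rst ?G)" by simp
    then have "norm (b - c) <= norm (b - lst ?G) + norm (rst ?G - lst ?G) + norm (c - rst ?G)"
      by (smt (verit) norm_triangle_ineq4)
    then show ?thesis using nG sG[OF that] by linarith
  qed
  have \<delta>': "4 * D + 2 * (\<Lambda> * \<theta>) < \<delta>" using \<delta> by (simp add: D_def)
  consider (both) "is_simple S ?F" "is_simple S ?G" | (left) "is_simple S ?F" "\<not> is_simple S ?G"
    | (right) "\<not> is_simple S ?F" "is_simple S ?G" | (none) "\<not> is_simple S ?F" "\<not> is_simple S ?G" by blast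
  then show ?thesis
  proof cases
    case both
    have "norm (c - a) <= norm (a - b) + norm (b - c)"
      using norm_triangle_ineq[of "a - b" "b - c"] by (simp add: norm_minus_commute)
    then have "norm (a - a) + norm (c - a) < \<delta>" using ab[OF both(1)] bc[OF both(2)] \<delta>' by simp
    from gRP_closeD[OF close valid aK cK aK aK this g gRP_trivial k] show ?thesis using aK K by auto
  next
    case left
    have w2: "w (fam ?G) = 0"
      using wr vwidth_not_simple[OF left(2), of t] fG(1) by (intro zero) (auto simp: width_rule_def split: if_splits)
    have E: "E_curve S (fam ?G) (lst ?G) (str ?G) (rst ?G)" using valid_not_simple[OF fG(2)] left(2) fG(3) K by blast
    have "norm (a - lst ?G) <= norm (a - b) + norm (b - lst ?G)"
      using norm_triangle_ineq[of "a - b" "b - lst ?G"] by simp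
    then have n: "norm (a - lst ?G) + norm (c - rst ?G) < \<delta>"
      using ab[OF left(1)] nG \<delta>' D0 by (smt (verit) mult_nonneg_nonneg norm_ge_zero order.trans sF left(1))
    have "k \<noteq> fam ?G" using w2 wk by auto
    then show ?thesis using gRP_closeD[OF close valid aK cK fG(3,4) n g gRP_single[where w = w, OF fG(1) E w2] k] by simp
  next
    case right
    have w1: "w (fam ?F) = 0"
      using wr vwidth_not_simple[OF right(1), of t] fF(1) by (intro zero) (auto simp: width_rule_def split: if_splits)
    have E: "E_curve S (fam ?F) (lst ?F) (str ?F) (rst ?F)" using valid_not_simple[OF fF(2)] right(1) fF(3) K by blast
    have "norm (c - rst ?F) <= norm (b - c) + norm (b - rst ?F)"
      using norm_triangle_ineq4[of "b - rst ?F" "b - c"] by (simp add: norm_minus_commute)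
    then have n: "norm (a - lst ?F) + norm (c - rst ?F) < \<delta>"
      using bc[OF right(2)] nF \<delta>' D0 by (smt (verit) mult_nonneg_nonneg norm_ge_zero order.trans sG right(2))
    have "k \<noteq> fam ?F" using w1 wk by auto
    then show ?thesis using gRP_closeD[OF close valid aK cK fF(3,4) n g gRP_single[where w = w, OF fF(1) E w1] k] by simp
  next
    case none
    have "w0 k <= 0"
      using wr k vwidth_not_simple[OF none(1), of t] vwidth_not_simple[OF none(2), of t]
      unfolding width_rule_def by (auto split: if_splits)
    then show ?thesis using zero[OF _ k] wk by simp
  qed
qed

lemma good_front_advance [simp]: "good (advance d F) = good F"
  by (simp add: good_front_def regular_speed_def)

lemma good_list_advance:
  assumes "good_list P C \<epsilon> \<eta> u0 L" "sorted (map (\<lambda>F. pos (advance d F)) L)"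
  shows "good_list P C \<epsilon> \<eta> u0 (map (advance d) L)"
  using assms by (simp add: good_list_def comp_def)

lemma tame_list_advance [simp]: "tame_list (map (advance d) L) = tame_list L"
  by (simp add: tame_list_def)

lemma jumps_at_one_point:
  assumes "joined a (concat (map comps M)) b" "\<forall>F\<in>set M. pos F = x"
  shows "(\<Sum>F\<leftarrow>M. \<Sum>\<gamma>\<leftarrow>comps F. heaviside (y - pos F) *\<^sub>R (rst \<gamma> - lst \<gamma>)) = heaviside (y - x) *\<^sub>R (b - a)"
  using assms
proof (induction M arbitrary: a)
  case (Cons F M)
  then obtain v where v: "joined a (comps F) v" "joined v (concat (map comps M)) b" by (auto simp: joined_append)
  have "(\<Sum>F\<leftarrow>M. \<Sum>\<gamma>\<leftarrow>comps F. heaviside (y - pos F) *\<^sub>R (rst \<gamma> - lst \<gamma>)) = heaviside (y - x) *\<^sub>R (b - v)"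
    using Cons.IH[OF v(2)] Cons.prems(2) by simp
  moreover have "heaviside (y - x) *\<^sub>R (b - a) = heaviside (y - x) *\<^sub>R (v - a) + heaviside (y - x) *\<^sub>R (b - v)"
    by (simp add: scaleR_right_distrib[symmetric])
  ultimately show ?case using joined_scaled[OF v(1), of "heaviside (y - x)"] Cons.prems(2) by simp
qed simp

text \<open>An interaction at a point keeps the total jump there.\<close>

lemma replace_good:
  assumes good: "good_list P C \<epsilon> \<eta> u0 (L1 @ M @ L2)" and M: "M \<noteq> []" "\<forall>F\<in>set M. pos F = x"
    and j: "\<And>a b. joined a (concat (map comps M)) b ==> joined a (concat (map comps Fs)) b"
    and Fs: "\<And>F. F \<in> set Fs ==> good F \<and> pos F = x"
  shows "good_list P C \<epsilon> \<eta> u0 (L1 @ Fs @ L2)" "front_function u0 (L1 @ M @ L2) y = front_function u0 (L1 @ Fs @ L2) y"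
proof -
  obtain w where "joined u0 (concat (map comps (L1 @ M @ L2))) w" using good by (auto simp: good_list_def)
  then obtain a b where ab: "joined u0 (concat (map comps L1)) a" "joined a (concat (map comps M)) b" "joined b (concat (map comps L2)) w"
    by (auto simp: joined_append)
  have 1: "joined u0 (concat (map comps (L1 @ Fs @ L2))) w" using ab j[OF ab(2)] by (auto simp: joined_append)
  have s: "sorted (map pos (L1 @ M @ L2))" using good by (simp add: good_list_def)
  obtain F0 M' where F0: "M = F0 # M'" using M(1) by (cases M) auto
  have "\<forall>F\<in>set L1. pos F <= x" "\<forall>F\<in>set L2. x <= pos F" using s M(2) by (auto simp: sorted_append F0)
  moreover have "sorted (map pos L1)" "sorted (map pos L2)" using s by (auto simp: sorted_append)
  moreover have "map pos Fs = replicate (length Fs) x" using Fs by (auto intro!: nth_equalityI)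
  then have "sorted (map pos Fs)" by simp
  ultimately have "sorted (map pos (L1 @ Fs @ L2))" using Fs by (fastforce simp: sorted_append)
  then show "good_list P C \<epsilon> \<eta> u0 (L1 @ Fs @ L2)" using good Fs 1 unfolding good_list_def by auto
  have "\<forall>F\<in>set Fs. pos F = x" using Fs by blast
  from jumps_at_one_point[OF ab(2) M(2), of y] jumps_at_one_point[OF j[OF ab(2)] this, of y]
  show "front_function u0 (L1 @ M @ L2) y = front_function u0 (L1 @ Fs @ L2) y"
    by (simp add: front_function_def)
qed

text \<open>At a collapse all widths are zero, so there are no temporary speeds. A reversion restores the regular speeds.\<close>

lemma event_good:
  assumes e: "mft_event S P C \<epsilon> t L L'" and L: "good_list P C \<epsilon> \<eta> u0 L" "tame_list L" and L': "tame_list L'"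
  shows "good_list P C \<epsilon> \<eta> u0 L' \<and> front_function u0 L y = front_function u0 L' y"
  using e
proof cases
  case (meeting F G w0 w Fs L1 L2)
  have gF: "good F" "\<forall>\<gamma>\<in>set (comps F). tame C \<theta> \<gamma>" and gG: "good G" "\<forall>\<gamma>\<in>set (comps G). tame C \<theta> \<gamma>"
    using L unfolding meeting(1) good_list_def tame_list_def by auto
  have ne: "comps F \<noteq> []" "comps G \<noteq> []" using gF(1) gG(1) by (auto simp: good_front_def)
  note same = overlap_removed_same[OF meeting(7)]
  have tFs: "tame_list Fs"
  proof -
    have "set (concat (map comps L')) = set (concat (map comps (L1 @ Fs @ L2)))" using same_list_maps(1)[OF same] by simp
    then have "set (concat (map comps Fs)) \<subseteq> set (concat (map comps L'))" by auto
    then show ?thesis using L' by (fastforce simp: tame_list_def)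
  qed
  obtain w1 where "joined u0 (concat (map comps (L1 @ [F, G] @ L2))) w1" using L(1) unfolding meeting(1) good_list_def by blast
  then obtain a b c where abc: "joined a (comps F) b" "joined b (comps G) c" by (auto simp: joined_append)
  have ac: "left_state F = a" "right_state G = c"
    using joined_hd[OF abc(1) ne(1)] joined_hd[OF abc(2) ne(2)] by (auto simp: left_state_def right_state_def)
  have w: "w k = w0 k \<or> w k = 0" for k by (rule resets_widths[OF meeting(5)])
  have w_nonneg: "0 <= w k" if "k \<in> families S" for k
    using meeting(4) w[of k] that unfolding width_rule_def by auto
  have "\<forall>z v. gRP S (left_state F) (right_state G) w z v --> (\<forall>k\<in>families S. 0 < w k --> \<bar>z k\<bar> <= \<eta>')"
    using meeting_strengths[OF gF abc(1) gG abc(2) meeting(4) w] unfolding ac by blast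
  note og = outgoing_good[OF meeting(6) tFs _ this]
  note og = og(1)[OF ballI[OF w_nonneg]] og(2)[OF ballI[OF w_nonneg]]
  have jFs: "joined a' (concat (map comps Fs)) b'" if "joined a' (concat (map comps [F, G])) b'" for a' b'
  proof -
    have "joined a' (comps F @ comps G) b'" using that by simp
    then obtain v where "joined a' (comps F) v" "joined v (comps G) b'" unfolding joined_append by blast
    then have "a' = left_state F" "b' = right_state G" using joined_hd ne by (auto simp: left_state_def right_state_def)
    then show ?thesis using og(1) by simp
  qed
  have pp: "[F, G] \<noteq> []" "\<forall>H\<in>set [F, G]. pos H = pos F" using meeting(2) by auto
  note rg = replace_good[OF L(1)[unfolded meeting(1)] pp jFs og(2)]
  show ?thesis
    using rg good_list_same[OF same] front_function_same[OF same] unfolding meeting(1) by simp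
next
  case (collapse F Fs L1 L2)
  have gF: "good F" using L unfolding collapse(1) good_list_def by auto
  have ne: "comps F \<noteq> []" using gF(1) by (auto simp: good_front_def)
  note same = overlap_removed_same[OF collapse(5)]
  have tFs: "tame_list Fs"
  proof -
    have "set (concat (map comps L')) = set (concat (map comps (L1 @ Fs @ L2)))" using same_list_maps(1)[OF same] by simp
    then have "set (concat (map comps Fs)) \<subseteq> set (concat (map comps L'))" by auto
    then show ?thesis using L' by (fastforce simp: tame_list_def)
  qed
  have "\<forall>k\<in>families S. 0 <= (0::real)"
    "\<forall>z v. gRP S (left_state F) (right_state F) (\<lambda>_. 0) z v --> (\<forall>k\<in>families S. (0::real) < 0 --> \<bar>z k\<bar> <= \<eta>')" by simp_all
  note og = outgoing_good[OF collapse(4) tFs this]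
  have jFs: "joined a' (concat (map comps Fs)) b'" if "joined a' (concat (map comps [F])) b'" for a' b'
    using that og(1) joined_hd[of a' "comps F" b'] ne by (auto simp: left_state_def right_state_def)
  have pp: "[F] \<noteq> []" "\<forall>H\<in>set [F]. pos H = pos F" by auto
  note rg = replace_good[OF L(1)[unfolded collapse(1)] pp jFs og(2)]
  show ?thesis
    using rg good_list_same[OF same] front_function_same[OF same] unfolding collapse(1) by simp
next
  case reversion
  let ?r = "\<lambda>F :: 'n front. if trev F = Some t then F\<lparr>spd := regspd F, trev := None\<rparr> else F"
  have r: "comps (?r F) = comps F" "pos (?r F) = pos F" for F by auto
  have g: "good (?r F)" if "good F" for F
  proof (cases "trev F = Some t")
    case True
    have "heavy P \<epsilon> (F\<lparr>spd := regspd F, trev := None\<rparr>) = heavy P \<epsilon> F"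
      "carrier (F\<lparr>spd := regspd F, trev := None\<rparr>) = carrier F" by (simp_all add: heavy_def carrier_def)
    then show ?thesis using that True \<eta>(2) by (simp add: good_front_def regular_speed_def)
  qed (use that in simp)
  have m: "map comps (map ?r L) = map comps L" "map pos (map ?r L) = map pos L" by (auto simp: r)
  have b: "sorted (map pos L)" "\<exists>w. joined u0 (concat (map comps L)) w" "\<forall>F\<in>set L. good F"
    using L(1) by (simp_all add: good_list_def)
  have gr: "\<forall>F\<in>set (map ?r L). good F"
    unfolding set_map
  proof (intro ballI, elim imageE)
    fix F F' assume F: "F' = ?r F" "F \<in> set L"
    show "good F'" unfolding F(1) by (rule g[OF bspec[OF b(3) F(2)]])
  qed
  have "good_list P C \<epsilon> \<eta> u0 (map ?r L)" unfolding good_list_def m by (rule conjI[OF b(1) conjI[OF b(2) gr]])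
  moreover have "front_function u0 (map ?r L) y = front_function u0 L y"
    unfolding front_function_def map_map comp_def r ..
  ultimately show ?thesis unfolding reversion(1) by simp
qed

end

section \<open>Runs\<close>

text \<open>A run with these smallness conditions and the uniform bound \<open>V\<close> on its variation.\<close>

locale fine_run = fine_scheme S K P C \<epsilon> \<eta> \<eta>' \<theta> \<Lambda> \<tau> \<delta>
  for S :: "'n::finite hsys" and K and P :: mft_params and C \<epsilon> \<eta> \<eta>' \<theta> \<Lambda> \<tau> \<delta> :: real +
  fixes uo :: "real => real^'n" and T xa xb V :: real and R :: "'n run"
  assumes run: "mft_run S P uo T K xa xb C \<epsilon> R" and T: "0 < T"
    and strengths: "\<epsilon> powr er P <= \<theta>" "\<epsilon> powr ec P <= \<theta>"
    and variation: "\<And>t. 0 <= t ==> t <= T ==> wave_variation R t < V"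
begin

abbreviation u0 where "u0 \<equiv> left0 R"

definition next_time :: "nat => real" where
  "next_time n = (if n < nev R then tim R (Suc n) else T)"

definition stage :: "nat => real => 'n front list" where
  "stage n t = map (advance (t - tim R n)) (frs R n)"

lemma run_initialized: "initialized S P C \<epsilon> uo u0 (frs R 0)" and run_start: "tim R 0 = 0" and run_stop: "tim R (nev R) <= T"
  and run_end: "quiet S (tim R (nev R)) T (frs R (nev R))" and run_left: "u0 \<in> K"
  using run by (simp_all add: mft_run_def)

lemmas run_steps = run[unfolded mft_run_def, THEN conjunct2, THEN conjunct2, THEN conjunct2, THEN conjunct2, THEN conjunct1]

lemma run_waves: "n <= nev R ==> F \<in> set (frs R n) ==> \<gamma> \<in> set (comps F) ==> uniform_wave S P K C \<epsilon> \<gamma>"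
  and run_positions: "t \<in> {0..T} ==> F \<in> set (fronts_at R t) ==> pos F \<in> {xa..xb}"
  using run unfolding mft_run_def by blast+

lemma next_time_ge: "n <= nev R ==> tim R n <= next_time n"
proof (cases "n = nev R")
  case False
  moreover assume "n <= nev R"
  ultimately have n: "n < nev R" by simp
  show ?thesis using run_steps[rule_format, OF n, THEN conjunct2, THEN conjunct1] n by (simp add: next_time_def)
qed (simp add: next_time_def run_stop)

lemma event_time_pos: "n < nev R ==> 0 < tim R (Suc n)"
  by (rule run_steps[rule_format, THEN conjunct1])

lemma tim_mono: "m <= n ==> n <= nev R ==> tim R m <= tim R n"
proof (induction n)
  case (Suc n)
  then show ?case using next_time_ge[of n] by (cases "m = Suc n") (auto simp: next_time_def)
qed simp

lemma tim_bounds: "n <= nev R ==> 0 <= tim R n \<and> tim R n <= T"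
  using tim_mono[of 0 n] tim_mono[of n "nev R"] run_start run_stop by auto

lemma quiet_stage: "n <= nev R ==> quiet S (tim R n) (next_time n) (frs R n)"
proof (cases "n = nev R")
  case False
  moreover assume "n <= nev R"
  ultimately have n: "n < nev R" by simp
  show ?thesis using run_steps[rule_format, OF n, THEN conjunct2, THEN conjunct2, THEN conjunct1] n by (simp add: next_time_def)
qed (simp add: next_time_def run_end)

lemma tame_frs: "n <= nev R ==> tame_list (frs R n)"
proof -
  assume n: "n <= nev R"
  have "tame C \<theta> \<gamma>" if "F \<in> set (frs R n)" "\<gamma> \<in> set (comps F)" for F \<gamma>
  proof -
    have "uniform_wave S P K C \<epsilon> \<gamma>" using run_waves n that by blast
    then show ?thesis using strengths unfolding uniform_wave_def tame_def by auto
  qed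
  then show ?thesis by (simp add: tame_list_def)
qed

lemma stage_sorted:
  assumes "n <= nev R" "sorted (map pos (frs R n))" "tim R n <= t" "t <= next_time n"
  shows "sorted (map (\<lambda>F. pos (advance (t - tim R n) F)) (frs R n))"
  by (rule sorted_between[where d = "t - tim R n" and ?d1.0 = "next_time n - tim R n"]) (use assms quiet_stage[OF assms(1)] in \<open>auto simp: quiet_def\<close>)

lemma stage_event:
  assumes n: "n < nev R" and g: "good_list P C \<epsilon> \<eta> u0 (frs R n)"
  shows "good_list P C \<epsilon> \<eta> u0 (frs R (Suc n)) \<and>
    front_function u0 (stage n (tim R (Suc n))) y = front_function u0 (frs R (Suc n)) y"
proof (rule event_good)
  have nt: "next_time n = tim R (Suc n)" using n by (simp add: next_time_def)
  show "mft_event S P C \<epsilon> (tim R (Suc n)) (stage n (tim R (Suc n))) (frs R (Suc n))"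
    unfolding stage_def by (rule run_steps[rule_format, OF n, THEN conjunct2, THEN conjunct2, THEN conjunct2])
  have s: "sorted (map pos (frs R n))" using g by (simp add: good_list_def)
  have le: "tim R n <= tim R (Suc n)" "tim R (Suc n) <= next_time n" using next_time_ge[of n] n by (simp_all add: nt)
  show "good_list P C \<epsilon> \<eta> u0 (stage n (tim R (Suc n)))"
    unfolding stage_def by (rule good_list_advance[OF g stage_sorted[OF _ s le]]) (use n in simp)
  show "tame_list (stage n (tim R (Suc n)))" unfolding stage_def tame_list_advance by (rule tame_frs) (use n in simp)
  show "tame_list (frs R (Suc n))" by (rule tame_frs) (use n in simp)
qed

lemma good_frs: "n <= nev R ==> good_list P C \<epsilon> \<eta> u0 (frs R n)"
proof (induction n)
  case 0
  show ?case by (rule initialized_good[OF run_initialized params \<eta>(2)])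
next
  case (Suc n)
  show ?case by (rule conjunct1[OF stage_event]) (use Suc in simp_all)
qed

lemma glue: "n < nev R ==> front_function u0 (stage n (tim R (Suc n))) = front_function u0 (frs R (Suc n))"
  by (rule ext, rule conjunct2[OF stage_event]) (simp_all add: good_frs)

lemma good_stage:
  assumes "n <= nev R" "tim R n <= t" "t <= next_time n"
  shows "good_list P C \<epsilon> \<eta> u0 (stage n t)"
proof -
  have s: "sorted (map pos (frs R n))" using good_frs[OF assms(1)] by (simp add: good_list_def)
  show ?thesis unfolding stage_def by (rule good_list_advance[OF good_frs[OF assms(1)] stage_sorted[OF assms(1) s assms(2,3)]])
qed

subsection \<open>The current stage\<close>

text \<open>Counting events, rather than taking the maximal index of a past one, makes measurability evident.\<close>

definition idx :: "real => nat" where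
  "idx t = (\<Sum>n\<in>{1..nev R}. if tim R n <= t then 1 else 0)"

lemma past_events:
  assumes "0 <= t"
  shows "{n. n <= nev R \<and> tim R n <= t} = {..idx t}"
proof -
  let ?A = "{n. n <= nev R \<and> tim R n <= t}"
  have fin: "finite ?A" by (rule finite_subset[of _ "{..nev R}"]) auto
  have 0: "0 \<in> ?A" using run_start assms by simp
  have eq: "?A = {..Max ?A}"
  proof (intro equalityI subsetI)
    fix m assume "m \<in> {..Max ?A}"
    moreover have "Max ?A \<in> ?A" using fin 0 by (intro Max_in) auto
    ultimately show "m \<in> ?A" using tim_mono[of m "Max ?A"] by auto
  qed (use fin in auto)
  have "idx t = card {n \<in> {1..nev R}. tim R n <= t}"
    unfolding idx_def by (simp add: sum.If_cases Int_def)
  also have "{n \<in> {1..nev R}. tim R n <= t} = ?A - {0}" by auto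
  also have "\<dots> = {1..Max ?A}" by (subst eq) auto
  finally have "idx t = Max ?A" by simp
  then show ?thesis using eq by simp
qed

lemma idx_stage:
  assumes "t \<in> {0..T}"
  shows "idx t <= nev R" "tim R (idx t) <= t" "t <= next_time (idx t)"
proof -
  have p: "{n. n <= nev R \<and> tim R n <= t} = {..idx t}" using past_events assms by simp
  then show "idx t <= nev R" "tim R (idx t) <= t" by auto
  have "Suc (idx t) \<notin> {n. n <= nev R \<and> tim R n <= t}" unfolding p by simp
  then show "t <= next_time (idx t)" using assms by (auto simp: next_time_def)
qed

lemma fronts_at_stage:
  assumes "0 <= t"
  shows "fronts_at R t = stage (idx t) t"
proof -
  have "Max {..idx t} = idx t" by (rule Max_eqI) auto
  then show ?thesis by (simp add: fronts_at_def past_events[OF assms] stage_def Let_def)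
qed

lemma measurable_idx: "idx \<in> lborel \<rightarrow>\<^sub>M count_space UNIV"
proof -
  have "(\<lambda>t. \<Sum>n\<in>{1..N}. if tim R n <= t then 1 else 0 :: nat) \<in> borel \<rightarrow>\<^sub>M count_space UNIV" for N
  proof (induction N)
    case (Suc N)
    note [measurable] = Suc.IH
    have "(\<lambda>t. \<Sum>n\<in>{1..Suc N}. if tim R n <= t then 1 else 0 :: nat) =
        (\<lambda>t. if tim R (Suc N) <= t then Suc (\<Sum>n\<in>{1..N}. if tim R n <= t then 1 else 0) else (\<Sum>n\<in>{1..N}. if tim R n <= t then 1 else 0))"
      by auto
    also have "\<dots> \<in> borel \<rightarrow>\<^sub>M count_space UNIV" by measurable
    finally show ?case .
  qed simp
  then show ?thesis unfolding idx_def[abs_def] by simp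
qed

lemma idx_locally_constant:
  assumes "t \<notin> tim R ` {..nev R}"
  shows "eventually (\<lambda>t'. idx t' = idx t) (nhds t)"
proof -
  have "eventually (\<lambda>t'. (tim R n <= t') = (tim R n <= t)) (nhds t)" if "n \<in> {1..nev R}" for n
  proof (cases "tim R n <= t")
    case True
    then have "tim R n < t" using assms that by force
    then have "eventually (\<lambda>t'. tim R n < t') (nhds t)" using eventually_nhds_in_open[of "{tim R n<..}" t] by simp
    then show ?thesis by eventually_elim (use True in auto)
  next
    case False
    have "eventually (\<lambda>t'. t' < tim R n) (nhds t)" using False eventually_nhds_in_open[of "{..<tim R n}" t] by simp
    then show ?thesis by eventually_elim (use False in auto)
  qed
  then have "eventually (\<lambda>t'. \<forall>n\<in>{1..nev R}. (tim R n <= t') = (tim R n <= t)) (nhds t)"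
    by (intro eventually_ball_finite) auto
  then show ?thesis by eventually_elim (auto simp: idx_def intro: sum.cong)
qed

subsection \<open>Estimates for the fronts of a run\<close>

lemma front_of_stage:
  assumes "n <= nev R" "F \<in> set (frs R n)"
  shows "good F" "\<forall>\<gamma>\<in>set (comps F). tame C \<theta> \<gamma>" "comps F \<noteq> []" "\<bar>spd F\<bar> <= \<Lambda> + \<eta>"
    "joined (left_state F) (comps F) (right_state F)" "left_state F \<in> K" "right_state F \<in> K"
proof -
  show g: "good F" using good_frs[OF assms(1)] assms(2) by (simp add: good_list_def)
  show t: "\<forall>\<gamma>\<in>set (comps F). tame C \<theta> \<gamma>" using tame_frs[OF assms(1)] assms(2) by (simp add: tame_list_def)
  show ne: "comps F \<noteq> []" using g by (auto simp: good_front_def)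
  have "\<bar>regspd F\<bar> <= \<Lambda>" using front_bound(1)[OF t] g by (simp add: good_front_def)
  then show "\<bar>spd F\<bar> <= \<Lambda> + \<eta>" using g unfolding good_front_def by linarith
  obtain w where "joined u0 (concat (map comps (frs R n))) w" using good_frs[OF assms(1)] by (auto simp: good_list_def)
  moreover obtain L1 L2 where "frs R n = L1 @ F # L2" using split_list[OF assms(2)] by blast
  ultimately obtain a b where ab: "joined a (comps F) b" by (auto simp: joined_append)
  then show "joined (left_state F) (comps F) (right_state F)"
    using joined_hd[OF ab ne] by (simp add: left_state_def right_state_def)
  show "left_state F \<in> K" "right_state F \<in> K"
    using t ne by (auto simp: left_state_def right_state_def tame_def)
qed

lemma front_size_nonneg: "0 <= front_size F"
  by (auto simp: front_size_def intro!: sum_list_nonneg)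

lemma jumps_le_size:
  assumes "n <= nev R" "F \<in> set (frs R n)"
  shows "norm (right_state F - left_state F) <= \<Lambda> * front_size F" "norm (qfun S (right_state F) - qfun S (left_state F)) <= \<Lambda> * front_size F"
proof -
  have t: "\<forall>\<gamma>\<in>set (comps F). tame C \<theta> \<gamma>" and j: "joined (left_state F) (comps F) (right_state F)"
    using front_of_stage[OF assms] by auto
  have b: "norm (\<Sum>\<gamma>\<leftarrow>ws. g \<gamma>) <= \<Lambda> * (\<Sum>\<gamma>\<leftarrow>ws. \<bar>str \<gamma>\<bar>)" if "\<forall>\<gamma>\<in>set ws. norm (g \<gamma>) <= \<Lambda> * \<bar>str \<gamma>\<bar>" for ws and g :: "'n wave => real^'n"
    using that
  proof (induction ws)
    case (Cons \<gamma> ws)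
    then show ?case using norm_triangle_ineq[of "g \<gamma>" "\<Sum>\<gamma>\<leftarrow>ws. g \<gamma>"] by (simp add: distrib_left)
  qed simp
  show "norm (right_state F - left_state F) <= \<Lambda> * front_size F"
    using b[of "comps F" "\<lambda>\<gamma>. rst \<gamma> - lst \<gamma>"] jump_bound t joined_sum[OF j, of "\<lambda>u. u"] by (simp add: front_size_def)
  show "norm (qfun S (right_state F) - qfun S (left_state F)) <= \<Lambda> * front_size F"
    using b[of "comps F" "qjump S"] jump_bound t joined_sum[OF j, of "qfun S"] by (simp add: front_size_def qjump_def)
qed

text \<open>The actual speed, possibly temporary, deviates from the regular one by at most \<open>\<eta>\<close>, which costs \<open>\<eta>\<close> times \<open>[q]\<close>.\<close>

lemma front_residual:
  assumes "n <= nev R" "F \<in> set (frs R n)"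
  shows "norm ((ffun S (right_state F) - ffun S (left_state F)) - spd F *\<^sub>R (qfun S (right_state F) - qfun S (left_state F))) <=
    \<Lambda> * ((\<theta> + Qlight P \<epsilon> + \<eta>) * front_size F + heavy_size P \<epsilon> F)"
proof -
  note fs = front_of_stage[OF assms]
  let ?f = "ffun S (right_state F) - ffun S (left_state F)" and ?q = "qfun S (right_state F) - qfun S (left_state F)"
  have "(\<Sum>\<gamma>\<leftarrow>comps F. fjump S \<gamma> - regspd F *\<^sub>R qjump S \<gamma>) = ?f - regspd F *\<^sub>R ?q"
    using joined_sum[OF fs(5), of "\<lambda>u. ffun S u - regspd F *\<^sub>R qfun S u"]
    by (simp add: fjump_def qjump_def algebra_simps)
  moreover have "norm (\<Sum>\<gamma>\<leftarrow>comps F. fjump S \<gamma> - regspd F *\<^sub>R qjump S \<gamma>) <= \<Lambda> * ((\<theta> + Qlight P \<epsilon>) * front_size F + heavy_size P \<epsilon> F)"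
    using front_bound(2)[OF fs(2)] fs(1) by (simp add: good_front_def)
  ultimately have 1: "norm (?f - regspd F *\<^sub>R ?q) <= \<Lambda> * ((\<theta> + Qlight P \<epsilon>) * front_size F + heavy_size P \<epsilon> F)" by (simp only:)
  have "norm ((spd F - regspd F) *\<^sub>R ?q) <= \<eta> * (\<Lambda> * front_size F)"
    unfolding norm_scaleR using fs(1) jumps_le_size(2)[OF assms] \<eta>(2) by (intro mult_mono) (auto simp: good_front_def)
  moreover have "?f - spd F *\<^sub>R ?q = (?f - regspd F *\<^sub>R ?q) - (spd F - regspd F) *\<^sub>R ?q" by (simp add: scaleR_diff_left)
  then have "norm (?f - spd F *\<^sub>R ?q) <= norm (?f - regspd F *\<^sub>R ?q) + norm ((spd F - regspd F) *\<^sub>R ?q)"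
    by (simp only: norm_triangle_ineq4)
  ultimately show ?thesis using 1 by (simp add: algebra_simps)
qed

definition fronts_size :: "nat => real" where
  "fronts_size n = (\<Sum>F\<leftarrow>frs R n. front_size F)"

lemma fronts_size_at:
  assumes "t \<in> {0..T}"
  shows "fronts_size (idx t) <= V"
proof -
  have "wave_variation R t = fronts_size (idx t)"
    using assms unfolding wave_variation_def fronts_size_def front_size_def
    by (subst fronts_at_stage) (auto simp: stage_def comp_def)
  then show ?thesis using variation[of t] assms by auto
qed

text \<open>Several events may happen at the same time, and the variation is only bounded for the stages that last for some
  time.\<close>

lemma fronts_size_stage:
  assumes "n <= nev R" "tim R n < next_time n"
  shows "fronts_size n <= V"
proof -
  have t: "tim R n \<in> {0..T}" using tim_bounds[OF assms(1)] by simp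
  have "{m. m <= nev R \<and> tim R m <= tim R n} = {..n}"
  proof (intro equalityI subsetI)
    fix m assume "m \<in> {m. m <= nev R \<and> tim R m <= tim R n}"
    then have m: "m <= nev R" "tim R m <= tim R n" by auto
    have False if "n < m"
      using tim_mono[of "Suc n" m] that m assms(2) by (simp add: next_time_def split: if_splits)
    then show "m \<in> {..n}" by force
  next
    fix m assume "m \<in> {..n}"
    then show "m \<in> {m. m <= nev R \<and> tim R m <= tim R n}" using tim_mono[of m n] assms(1) by simp
  qed
  then have "idx (tim R n) = n" using past_events[of "tim R n"] t by simp
  then show ?thesis using fronts_size_at[OF t] by simp
qed

lemma sum_front_bound:
  assumes "n <= nev R" "\<And>F. F \<in> set (frs R n) ==> g F <= c * front_size F"
  shows "(\<Sum>F\<leftarrow>frs R n. g F) <= c * fronts_size n"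
  unfolding fronts_size_def sum_list_const_mult[symmetric] by (rule sum_list_mono) (rule assms(2))

lemma V_nonneg: "0 <= V"
proof -
  have "0 <= fronts_size (idx 0)" unfolding fronts_size_def by (rule sum_list_nonneg) (auto simp: front_size_nonneg)
  then show ?thesis using fronts_size_at[of 0] T by simp
qed

lemma stage_L1:
  assumes n: "n <= nev R" and s: "tim R n <= s" "s <= t" "t <= next_time n"
  shows "L1_close (front_function u0 (stage n t)) (front_function u0 (stage n s)) ((\<Lambda> + \<eta>) * \<Lambda> * V * (t - s))"
proof (cases "s = t")
  case True
  then show ?thesis by (simp add: L1_close_refl)
next
  case False
  then have vis: "fronts_size n <= V" using s by (intro fronts_size_stage[OF n]) auto
  obtain w where j: "joined u0 (concat (map comps (frs R n))) w" using good_frs[OF n] by (auto simp: good_list_def)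
  have l: "L1_close (front_function u0 (stage n t)) (front_function u0 (stage n s))
    ((\<Lambda> + \<eta>) * \<bar>(t - tim R n) - (s - tim R n)\<bar> * (\<Sum>F\<leftarrow>frs R n. norm (right_state F - left_state F)))"
    unfolding stage_def by (rule front_function_advance_L1[OF j]) (use front_of_stage[OF n] in blast)
  have "(\<Sum>F\<leftarrow>frs R n. norm (right_state F - left_state F)) <= \<Lambda> * fronts_size n"
    by (rule sum_front_bound[OF n jumps_le_size(1)[OF n]])
  also have "\<dots> <= \<Lambda> * V" using vis \<Lambda> by simp
  finally have "(\<Lambda> + \<eta>) * \<bar>(t - tim R n) - (s - tim R n)\<bar> * (\<Sum>F\<leftarrow>frs R n. norm (right_state F - left_state F)) <=
      (\<Lambda> + \<eta>) * \<bar>(t - tim R n) - (s - tim R n)\<bar> * (\<Lambda> * V)"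
    using \<Lambda> \<eta>(2) by (intro mult_left_mono) auto
  also have "\<dots> = (\<Lambda> + \<eta>) * \<Lambda> * V * (t - s)" using s(2) by (simp add: mult_ac)
  finally show ?thesis using l by (auto simp: L1_close_def)
qed

text \<open>Estimates on single stages are chained; at an event the function does not change.\<close>

lemma stages_L1:
  assumes "m <= n" "n <= nev R" "tim R m <= s" "s <= next_time m" "tim R n <= t" "t <= next_time n" "s <= t"
  shows "L1_close (front_function u0 (stage n t)) (front_function u0 (stage m s)) ((\<Lambda> + \<eta>) * \<Lambda> * V * (t - s))"
  using assms
proof (induction n arbitrary: t)
  case 0
  then show ?case using stage_L1[of 0 s t] by simp
next
  case (Suc n)
  show ?case
  proof (cases "m = Suc n")
    case True
    then show ?thesis using stage_L1[of "Suc n" s t] Suc.prems by simp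
  next
    case False
    then have m: "m <= n" "n < nev R" using Suc.prems by auto
    let ?r = "tim R (Suc n)"
    have nt: "next_time n = ?r" using m by (simp add: next_time_def)
    have sr: "s <= ?r"
    proof -
      have "next_time m = tim R (Suc m)" using m by (simp add: next_time_def)
      then show ?thesis using tim_mono[of "Suc m" "Suc n"] m Suc.prems by simp
    qed
    have 1: "L1_close (front_function u0 (stage n ?r)) (front_function u0 (stage m s)) ((\<Lambda> + \<eta>) * \<Lambda> * V * (?r - s))"
      using next_time_ge[of n] m Suc.prems sr by (intro Suc.IH) (auto simp: nt)
    have 2: "L1_close (front_function u0 (stage (Suc n) t)) (front_function u0 (stage (Suc n) ?r)) ((\<Lambda> + \<eta>) * \<Lambda> * V * (t - ?r))"
      using Suc.prems by (intro stage_L1) auto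
    have "stage (Suc n) ?r = frs R (Suc n)" by (simp add: stage_def advance_def map_idI)
    then have e: "front_function u0 (stage (Suc n) ?r) = front_function u0 (stage n ?r)" using glue[OF m(2)] by simp
    from L1_close_trans[OF 2[unfolded e] 1] show ?thesis by (simp add: algebra_simps)
  qed
qed

lemma approx_L1:
  assumes "s \<in> {0..T}" "t \<in> {0..T}"
  shows "L1_close (approx R t) (approx R s) ((\<Lambda> + \<eta>) * \<Lambda> * V * \<bar>t - s\<bar>)"
proof -
  have le: "L1_close (approx R t) (approx R s) ((\<Lambda> + \<eta>) * \<Lambda> * V * (t - s))" if "s \<in> {0..T}" "t \<in> {0..T}" "s <= t" for s t
  proof -
    have "idx s <= idx t" unfolding idx_def using that by (intro sum_mono) auto
    then show ?thesis
      unfolding approx_def using that idx_stage[of s] idx_stage[of t]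
      by (simp add: fronts_at_stage) (rule stages_L1, simp_all)
  qed
  show ?thesis
  proof (cases "s <= t")
    case True
    then show ?thesis using le[OF assms] by simp
  next
    case False
    then show ?thesis using L1_close_sym[OF le[OF assms(2,1)]] by simp
  qed
qed

subsection \<open>The jumps of a run\<close>

definition jumps_at :: "real => 'n jump list" where
  "jumps_at t = map jump_of (fronts_at R t)"

definition stage_jumps :: "nat => 'n jump list" where
  "stage_jumps n = map (\<lambda>F. (pos F - tim R n * spd F, spd F, left_state F, right_state F)) (frs R n)"

lemma jumps_at_drift: "0 <= t ==> jumps_at t = drift t (stage_jumps (idx t))"
  by (simp add: jumps_at_def fronts_at_stage stage_def stage_jumps_def drift_def jump_of_def algebra_simps)

lemma jumps_at_bounds:
  assumes "t \<in> {0..T}" "(x, s, a, c) \<in> set (jumps_at t)"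
  shows "x \<in> {xa..xb} \<and> \<bar>s\<bar> <= \<Lambda> + \<eta> \<and> a \<in> K \<and> c \<in> K"
proof -
  obtain F where F: "F \<in> set (fronts_at R t)" "(x, s, a, c) = jump_of F" using assms(2) by (auto simp: jumps_at_def)
  then obtain G where G: "G \<in> set (frs R (idx t))" "F = advance (t - tim R (idx t)) G"
    using assms(1) by (auto simp: fronts_at_stage stage_def)
  have "pos F \<in> {xa..xb}" using run_positions assms(1) F(1) by blast
  then show ?thesis using front_of_stage[OF idx_stage(1)[OF assms(1)] G(1)] F(2) G(2) by (simp add: jump_of_def)
qed

lemma sum_jumps_at:
  assumes "0 <= t"
  shows "(\<Sum>(x, s, a, c)\<leftarrow>jumps_at t. g s a c) = (\<Sum>F\<leftarrow>frs R (idx t). g (spd F) (left_state F) (right_state F))"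
  by (simp add: jumps_at_def jump_of_def fronts_at_stage[OF assms] stage_def comp_def)

lemma jumps_variation:
  assumes t: "t \<in> {0..T}"
  shows "(\<Sum>(x, s, a, c)\<leftarrow>jumps_at t. norm (c - a)) <= \<Lambda> * V"
proof -
  note i = idx_stage(1)[OF t]
  have "(\<Sum>(x, s, a, c)\<leftarrow>jumps_at t. norm (c - a)) = (\<Sum>F\<leftarrow>frs R (idx t). norm (right_state F - left_state F))"
    using t by (intro sum_jumps_at[of t "\<lambda>s a c. norm (c - a)"]) simp
  also have "\<dots> <= \<Lambda> * fronts_size (idx t)" by (rule sum_front_bound[OF i jumps_le_size(1)[OF i]])
  also have "\<dots> <= \<Lambda> * V" using fronts_size_at[OF t] \<Lambda> by simp
  finally show ?thesis .
qed

lemma heavy_weight_eq: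
  assumes "t \<in> {0..T}"
  shows "heavy_weight P \<epsilon> R t = (\<Sum>F\<leftarrow>frs R (idx t). heavy_size P \<epsilon> F)"
proof -
  have "heavy_weight P \<epsilon> R t = (\<Sum>F\<leftarrow>fronts_at R t. heavy_size P \<epsilon> F)"
    unfolding heavy_weight_def sum_list_map_filter' by (intro arg_cong[of _ _ sum_list] map_cong) (auto simp: heavy_size_def)
  also have "\<dots> = (\<Sum>F\<leftarrow>frs R (idx t). heavy_size P \<epsilon> F)"
    using assms by (simp add: fronts_at_stage stage_def comp_def heavy_size_def cong: if_cong)
  finally show ?thesis .
qed

lemma jumps_residual:
  assumes t: "t \<in> {0..T}"
  shows "(\<Sum>(x, s, a, c)\<leftarrow>jumps_at t. norm ((ffun S c - ffun S a) - s *\<^sub>R (qfun S c - qfun S a))) <=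
    \<Lambda> * ((\<theta> + Qlight P \<epsilon> + \<eta>) * V + heavy_weight P \<epsilon> R t)"
proof -
  note i = idx_stage(1)[OF t]
  have Q: "0 <= \<theta> + Qlight P \<epsilon> + \<eta>" using params \<theta> \<eta>(2) by (simp add: valid_params_def)
  have "(\<Sum>(x, s, a, c)\<leftarrow>jumps_at t. norm ((ffun S c - ffun S a) - s *\<^sub>R (qfun S c - qfun S a))) =
      (\<Sum>F\<leftarrow>frs R (idx t). norm ((ffun S (right_state F) - ffun S (left_state F)) - spd F *\<^sub>R (qfun S (right_state F) - qfun S (left_state F))))"
    using t by (intro sum_jumps_at[of t "\<lambda>s a c. norm ((ffun S c - ffun S a) - s *\<^sub>R (qfun S c - qfun S a))"]) simp
  also have "\<dots> <= (\<Sum>F\<leftarrow>frs R (idx t). \<Lambda> * ((\<theta> + Qlight P \<epsilon> + \<eta>) * front_size F + heavy_size P \<epsilon> F))"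
    by (rule sum_list_mono) (rule front_residual[OF i])
  also have "\<dots> = \<Lambda> * ((\<theta> + Qlight P \<epsilon> + \<eta>) * fronts_size (idx t) + heavy_weight P \<epsilon> R t)"
    unfolding fronts_size_def heavy_weight_eq[OF t] by (simp add: sum_list_const_mult sum_list_addf)
  also have "\<dots> <= \<Lambda> * ((\<theta> + Qlight P \<epsilon> + \<eta>) * V + heavy_weight P \<epsilon> R t)"
    using fronts_size_at[OF t] Q \<Lambda> by (intro mult_left_mono add_right_mono) auto
  finally show ?thesis .
qed

lemma approx_states:
  assumes t: "t \<in> {0..T}" and x: "x \<notin> fst ` set (jumps_at t)"
  shows "approx R t x \<in> K \<and> h (approx R t x) = step_fn (h u0) (jumps_of h (jumps_at t)) x"
proof -
  note i = idx_stage[OF t]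
  have fs: "fronts_at R t = stage (idx t) t" using t by (simp add: fronts_at_stage)
  have g: "good_list P C \<epsilon> \<eta> u0 (stage (idx t) t)" by (rule good_stage[OF i])
  obtain w where w: "joined u0 (concat (map comps (stage (idx t) t))) w" using g by (auto simp: good_list_def)
  have s: "sorted (map pos (stage (idx t) t))" using g by (simp add: good_list_def)
  have xp: "x \<notin> pos ` set (stage (idx t) t)" using x by (simp add: jumps_at_def fs jump_of_def image_image)
  have c: "\<forall>F\<in>set (stage (idx t) t). comps F \<noteq> [] \<and> (\<forall>\<gamma>\<in>set (comps F). rst \<gamma> \<in> K)"
    using front_of_stage(2,3)[OF i(1)] by (auto simp: stage_def tame_def)
  show ?thesis unfolding approx_def jumps_at_def fs by (rule front_function_states[OF w s xp run_left c])
qed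

lemma initial_error:
  "integrable lborel (\<lambda>x. norm (approx R 0 x - uo x))" "(LINT x|lborel. norm (approx R 0 x - uo x)) < \<epsilon> powr ei P"
proof -
  have "{n. n <= nev R \<and> tim R n <= 0} = {0}"
  proof (intro equalityI subsetI)
    fix n assume n: "n \<in> {n. n <= nev R \<and> tim R n <= 0}"
    show "n \<in> {0}"
    proof (cases n)
      case (Suc m)
      then show ?thesis using n event_time_pos[of m] by auto
    qed simp
  qed (simp add: run_start)
  then have "idx 0 = 0" using past_events[of 0] by auto
  then have "approx R 0 = front_function u0 (frs R 0)"
    using run_start by (simp add: approx_def fronts_at_stage stage_def advance_def map_idI)
  then show "integrable lborel (\<lambda>x. norm (approx R 0 x - uo x))" "(LINT x|lborel. norm (approx R 0 x - uo x)) < \<epsilon> powr ei P"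
    using run_initialized by (simp_all add: initialized_def)
qed

end

section \<open>Data of bounded variation\<close>

text \<open>Appending \<open>x, y\<close> to a partition of \<open>[l,x]\<close> adds the last increment.\<close>

lemma variation_on_extend:
  fixes g :: "real => 'a::metric_space"
  assumes "l <= x" "x <= y"
  shows "variation_on {l..x} g + ennreal (dist (g x) (g y)) <= variation_on {l..y} g"
proof -
  let ?s = "\<lambda>xs. \<Sum>i<length xs - 1. dist (g (xs ! i)) (g (xs ! Suc i))"
  let ?A = "\<lambda>y. {xs. sorted xs \<and> set xs \<subseteq> {l..y}}"
  have ne: "?A x \<noteq> {}" by (auto intro: exI[of _ "[]"])
  have "variation_on {l..x} g + ennreal (dist (g x) (g y)) = (SUP xs\<in>?A x. ennreal (?s xs) + ennreal (dist (g x) (g y)))"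
    unfolding variation_on_def by (rule ennreal_SUP_add_left[OF ne, symmetric])
  also have "\<dots> <= variation_on {l..y} g"
  proof (rule SUP_least)
    fix xs assume xs: "xs \<in> ?A x"
    let ?n = "length xs" and ?ys = "xs @ [x, y]"
    let ?t = "\<lambda>i. dist (g (?ys ! i)) (g (?ys ! Suc i))"
    have "?s xs = (\<Sum>i<?n - 1. ?t i)" by (intro sum.cong) (auto simp: nth_append)
    also have "\<dots> <= (\<Sum>i<?n. ?t i)" by (rule sum_mono2) auto
    finally have "?s xs + dist (g x) (g y) <= ?s ?ys" by (simp add: nth_append)
    then have "ennreal (?s xs) + ennreal (dist (g x) (g y)) <= ennreal (?s ?ys)"
      by (subst ennreal_plus[symmetric]) (auto intro!: sum_nonneg ennreal_leI)
    also have "?ys \<in> ?A y" using xs assms by (auto simp: sorted_append)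
    then have "ennreal (?s ?ys) <= variation_on {l..y} g" unfolding variation_on_def by (rule SUP_upper)
    finally show "ennreal (?s xs) + ennreal (dist (g x) (g y)) <= variation_on {l..y} g" .
  qed
  finally show ?thesis .
qed

text \<open>The variation \<open>v\<close> from \<open>l\<close> on dominates the increments of every component, so \<open>v\<close> and the difference of \<open>v\<close> and the component
  are monotone. The cut-off point \<open>l\<close> then tends to \<open>-\<infinity>\<close>.\<close>

lemma BV_loc_measurable:
  fixes g :: "real => 'a::euclidean_space"
  assumes "BV_loc g"
  shows "g \<in> borel_measurable borel"
  unfolding borel_measurable_euclidean_space[of g]
proof
  fix b :: 'a assume b: "b \<in> Basis"
  have meas: "(\<lambda>x. g (max l x) \<bullet> b) \<in> borel_measurable borel" for l
  proof -
    define v where "v x = enn2real (variation_on {l..max l x} g)" for x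
    have inc: "\<bar>g (max l y) \<bullet> b - g (max l x) \<bullet> b\<bar> <= v y - v x" if "x <= y" for x y
    proof -
      have fin: "variation_on {l..z} g < top" for z using assms by (auto simp: BV_loc_def)
      have "variation_on {l..max l x} g + ennreal (dist (g (max l x)) (g (max l y))) <= variation_on {l..max l y} g"
        using that by (intro variation_on_extend) auto
      then have "enn2real (variation_on {l..max l x} g + ennreal (dist (g (max l x)) (g (max l y)))) <= v y"
        unfolding v_def by (rule enn2real_mono) (rule fin)
      then have "v x + dist (g (max l x)) (g (max l y)) <= v y"
        using fin by (subst (asm) enn2real_plus) (auto simp: v_def)
      moreover have "\<bar>g (max l y) \<bullet> b - g (max l x) \<bullet> b\<bar> <= dist (g (max l x)) (g (max l y))"
        using Basis_le_norm[OF b, of "g (max l y) - g (max l x)"] by (simp add: inner_diff_left dist_norm norm_minus_commute)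
      ultimately show ?thesis by linarith
    qed
    have "mono v"
    proof (rule monoI)
      fix x y :: real assume "x <= y" then show "v x <= v y" using inc[of x y] by linarith
    qed
    moreover have "mono (\<lambda>x. v x - g (max l x) \<bullet> b)"
    proof (rule monoI)
      fix x y :: real assume "x <= y" then show "v x - g (max l x) \<bullet> b <= v y - g (max l y) \<bullet> b" using inc[of x y] by linarith
    qed
    ultimately have "(\<lambda>x. v x - (v x - g (max l x) \<bullet> b)) \<in> borel_measurable borel"
      by (intro borel_measurable_diff borel_measurable_mono)
    then show ?thesis by simp
  qed
  show "(\<lambda>x. g x \<bullet> b) \<in> borel_measurable borel"
  proof (rule borel_measurable_LIMSEQ_real)
    fix x
    have "eventually (\<lambda>n. - real n < x) sequentially"
      using eventually_gt_at_top[of "nat \<lceil>- x\<rceil>"] by eventually_elim linarith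
    then have "eventually (\<lambda>n. g (max (- real n) x) \<bullet> b = g x \<bullet> b) sequentially"
      by eventually_elim (simp add: max_def)
    then show "(\<lambda>n. g (max (- real n) x) \<bullet> b) \<longlonglongrightarrow> g x \<bullet> b" by (rule tendsto_eventually)
  qed (rule meas)
qed

section \<open>Choice of the subsequence\<close>

lemma eventually_powr_less:
  assumes "0 < a" "0 < (c::real)"
  shows "eventually (\<lambda>\<epsilon>. \<epsilon> powr a < c) (at_right 0)"
proof -
  have "((\<lambda>\<epsilon>::real. \<epsilon> powr a) \<longlongrightarrow> 0) (at_right 0)"
    using assms(1) by (intro tendsto_zero_powrI[of _ _ _ a] tendsto_ident_at tendsto_const) (auto simp: eventually_at_filter)
  then show ?thesis using assms(2) by (rule order_tendstoD(2))
qed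

lemma subsequence_with_rates:
  fixes p :: "nat => real => bool" and eps :: "nat => real"
  assumes "\<And>j. eventually (p j) (at_right 0)" "\<And>n. 0 < eps n" "eps \<longlonglongrightarrow> 0"
  obtains s :: "nat => nat" where "strict_mono s" "\<And>j. p j (eps (s j))"
proof -
  have "eps n \<noteq> 0" for n using assms(2)[of n] by simp
  then have "filterlim eps (at_right 0) sequentially"
    using assms(2,3) by (auto simp: filterlim_at)
  then have "eventually (\<lambda>n. p j (eps n)) sequentially" for j
    using assms(1)[of j] by (rule eventually_compose_filterlim[rotated])
  then have "\<exists>n>m. p j (eps n)" for j m
    using eventually_conj[OF _ eventually_gt_at_top[of m]] eventually_happens'[OF sequentially_bot] by (smt (verit, best))
  then obtain s where "\<And>j. p j (eps (s j))" "\<And>j. s j < s (Suc j)"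
    using dependent_nat_choice[of "\<lambda>j n. p j (eps n)" "\<lambda>j n n'. n < n'"] by meson
  then have "strict_mono s" unfolding strict_mono_Suc_iff by blast
  then show ?thesis using that \<open>\<And>j. p j (eps (s j))\<close> by blast
qed

context hyperbolic_compact
begin

text \<open>\<open>\<eta>'\<close> is chosen first, according to the admissible error \<open>e\<close> of temporary speeds; uniform continuity gives \<open>\<delta>\<close>, and then \<open>\<epsilon>\<close> has
  to be small enough for the condition on \<open>\<delta>\<close>.\<close>

lemma eventually_fine:
  fixes P :: mft_params and C e :: real
  assumes e: "0 < e"
    and bounds: "front_bounds C \<Lambda> \<tau>"
    and P: "eventually (valid_params P) (at_right 0)"
  shows "eventually (\<lambda>\<epsilon>. \<exists>\<eta>' \<theta> \<delta>. fine_scheme S K P C \<epsilon> e \<eta>' \<theta> \<Lambda> \<tau> \<delta> \<and> \<epsilon> powr er P <= \<theta> \<and> \<epsilon> powr ec P <= \<theta> \<and> \<theta> <= e) (at_right 0)"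
proof -
  have \<Lambda>\<tau>: "1 <= \<Lambda>" "0 < \<tau>" using bounds by (auto simp: front_bounds_def)
  obtain \<epsilon>1 where "valid_params P \<epsilon>1" using eventually_happens'[OF trivial_limit_at_right_real P] by blast
  then have pos: "0 < er P" "0 < ec P" "0 < ep P" "0 < kap P" by (auto simp: valid_params_def)
  define \<eta>' where "\<eta>' = min \<tau> (kap P * e / (\<Lambda> * (\<bar>C\<bar> + 1)))"
  have d0: "0 < \<Lambda> * (\<bar>C\<bar> + 1)" using \<Lambda>\<tau> by simp
  have \<eta>': "0 < \<eta>'" "\<eta>' <= \<tau>" "\<eta>' <= kap P * e / (\<Lambda> * (\<bar>C\<bar> + 1))"
    using d0 \<Lambda>\<tau> pos e by (auto simp: \<eta>'_def)
  have \<eta>: "\<Lambda> * \<bar>C\<bar> * \<eta>' / kap P <= e"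
  proof -
    have "\<eta>' * (\<Lambda> * (\<bar>C\<bar> + 1)) <= kap P * e" using \<eta>'(3) d0 by (simp add: pos_le_divide_eq)
    moreover have "\<Lambda> * \<bar>C\<bar> * \<eta>' <= \<eta>' * (\<Lambda> * (\<bar>C\<bar> + 1))" using \<Lambda>\<tau> \<eta>'(1) by (simp add: algebra_simps)
    ultimately show ?thesis using pos by (simp add: pos_divide_le_eq mult.commute)
  qed
  obtain \<delta> where \<delta>: "0 < \<delta>" "gRP_close K \<delta> \<eta>'"
    using gRP_strength_uniform[OF K \<eta>'(1)] by blast
  \<comment> \<open>simple waves and passengers may use one half of \<open>\<delta>\<close> each\<close>
  define c where "c = min (min \<tau> e) (\<delta> / (4 * \<Lambda>))"
  have c: "0 < c" "c <= \<tau>" "c <= e" "c <= \<delta> / (4 * \<Lambda>)" using \<Lambda>\<tau> e \<delta>(1) by (auto simp: c_def)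
  define c' where "c' = \<delta> / (8 * (CARD('n) * \<Lambda>))"
  have c': "0 < c'" using \<Lambda>\<tau> \<delta>(1) by (simp add: c'_def)
  show ?thesis
    using P eventually_powr_less[OF pos(1) c(1)] eventually_powr_less[OF pos(2) c(1)] eventually_powr_less[OF pos(3) c']
  proof eventually_elim
    case (elim \<epsilon>)
    define \<theta> where "\<theta> = max (\<epsilon> powr er P) (\<epsilon> powr ec P)"
    have \<theta>: "0 <= \<theta>" "\<theta> < c" using elim by (auto simp: \<theta>_def le_max_iff_disj)
    have "fine_scheme S K P C \<epsilon> e \<eta>' \<theta> \<Lambda> \<tau> \<delta>"
    proof unfold_locales
      show "valid_params P \<epsilon>" by (rule elim(1))
      show "0 <= \<theta>" "\<theta> <= \<tau>" "\<eta>' <= \<tau>" "0 <= \<eta>'" "0 <= e" "\<Lambda> * \<bar>C\<bar> * \<eta>' / kap P <= e"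
        using \<theta> c \<Lambda>\<tau> \<eta>' \<eta> e by simp_all
      show "4 * (CARD('n) * \<Lambda> * \<epsilon> powr ep P) + 2 * (\<Lambda> * \<theta>) < \<delta>"
      proof -
        have "4 * (CARD('n) * \<Lambda>) * \<epsilon> powr ep P < 4 * (CARD('n) * \<Lambda>) * c'"
          using elim(4) \<Lambda>\<tau> by (intro mult_strict_left_mono) auto
        also have "\<dots> = \<delta> / 2" using \<Lambda>\<tau> by (simp add: c'_def)
        finally have 1: "4 * (CARD('n) * \<Lambda> * \<epsilon> powr ep P) < \<delta> / 2" by simp
        have "2 * \<Lambda> * \<theta> <= 2 * \<Lambda> * (\<delta> / (4 * \<Lambda>))" using \<theta> c \<Lambda>\<tau> by (intro mult_left_mono) auto
        also have "\<dots> = \<delta> / 2" using \<Lambda>\<tau> by simp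
        finally show ?thesis using 1 by simp
      qed
    qed (use bounds \<delta>(2) in simp_all)
    moreover have "\<epsilon> powr er P <= \<theta>" "\<epsilon> powr ec P <= \<theta>" "\<theta> <= e" using \<theta>(2) c(3) by (auto simp: \<theta>_def)
    ultimately show ?case by blast
  qed
qed

end

section \<open>Convergence of the scheme\<close>

theorem corollary7p4:
  fixes S :: "'n::finite hsys" and P :: mft_params and R :: "real \<Rightarrow> 'n run"
    and uo :: "real \<Rightarrow> real^'n" and K :: "(real^'n) set"
    and T xa xb C V \<epsilon>0 b :: real and eps :: "nat \<Rightarrow> real"
  assumes "hyperbolic_system S"
    and "BV_loc uo" and "range uo \<subseteq> states S"
    and "compact K" and "K \<subseteq> states S"
    and "0 < T" and "0 < \<epsilon>0"
    and scheme: "\<And>\<epsilon>. 0 < \<epsilon> \<Longrightarrow> \<epsilon> < \<epsilon>0 \<Longrightarrow> mft_run S P uo T K xa xb C \<epsilon> (R \<epsilon>)"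
    and variation: "\<And>\<epsilon> t. 0 < \<epsilon> \<Longrightarrow> \<epsilon> < \<epsilon>0 \<Longrightarrow> 0 \<le> t \<Longrightarrow> t \<le> T \<Longrightarrow> wave_variation (R \<epsilon>) t < V"
    and light: "(Qlight P \<longlongrightarrow> 0) (at_right 0)"
    and weight: "uniform_limit {0..T} (\<lambda>\<epsilon> t. heavy_weight P \<epsilon> (R \<epsilon>) t) (\<lambda>_. 0) (at_right 0)"
    and "1/2 < b"
    and eps: "\<And>n. 0 < eps n" "\<And>n. eps n < \<epsilon>0" "eps \<longlonglongrightarrow> 0"
  shows "\<exists>sub u. strict_mono sub \<and>
    (\<forall>l r. l < r \<longrightarrow>
       weakstar_converges S T b l r (\<lambda>n. approx (R (eps (sub n)))) u \<and>
       weakstar_solution S T b l r uo u)"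
proof -
  interpret hyperbolic_compact S K
    by unfold_locales (use assms in auto)
  obtain \<Lambda> \<tau> where bounds: "front_bounds C \<Lambda> \<tau>" using front_estimates by blast
  then have \<Lambda>\<tau>: "1 <= \<Lambda>" "0 < \<tau>" by (auto simp: front_bounds_def)
  have small: "eventually (\<lambda>\<epsilon>. 0 < \<epsilon> \<and> \<epsilon> < \<epsilon>0) (at_right 0)"
    using \<open>0 < \<epsilon>0\<close> by (auto simp: eventually_at_right)
  have valid: "eventually (valid_params P) (at_right 0)"
    using small by eventually_elim (use scheme in \<open>auto simp: mft_run_def\<close>)
  define e where "e j = 1 / (real j + 1)" for j :: nat
  have e: "0 < e j" "e j <= 1" for j by (auto simp: e_def)
  have e0: "e \<longlonglongrightarrow> 0" unfolding e_def using LIMSEQ_inverse_real_of_nat by (simp add: inverse_eq_divide add.commute)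
  \<comment> \<open>everything that has to vanish is bounded by \<open>e j\<close> for the \<open>j\<close>-th member of the subsequence\<close>
  define p where "p j \<epsilon> \<longleftrightarrow> (\<exists>\<eta>' \<theta> \<delta>. fine_scheme S K P C \<epsilon> (e j) \<eta>' \<theta> \<Lambda> \<tau> \<delta> \<and> \<epsilon> powr er P <= \<theta> \<and> \<epsilon> powr ec P <= \<theta> \<and> \<theta> <= e j) \<and>
     Qlight P \<epsilon> < e j \<and> (\<forall>t\<in>{0..T}. heavy_weight P \<epsilon> (R \<epsilon>) t < e j) \<and> \<epsilon> powr ei P < e j" for j \<epsilon>
  have ei: "0 < ei P" using scheme[OF eps(1,2)] by (auto simp: mft_run_def valid_params_def)
  have fine: "eventually (\<lambda>\<epsilon>. \<exists>\<eta>' \<theta> \<delta>. fine_scheme S K P C \<epsilon> (e j) \<eta>' \<theta> \<Lambda> \<tau> \<delta> \<and> \<epsilon> powr er P <= \<theta> \<and> \<epsilon> powr ec P <= \<theta> \<and> \<theta> <= e j) (at_right 0)" for j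
    by (rule eventually_fine[OF e(1) bounds valid])
  have p: "eventually (p j) (at_right 0)" for j
    using fine order_tendstoD(2)[OF light e(1)] uniform_limitD[OF weight e(1)]
      eventually_powr_less[OF ei e(1)]
    by eventually_elim (auto simp: p_def dist_real_def abs_less_iff)
  obtain s where s: "strict_mono s" "\<And>j. p j (eps (s j))"
    using subsequence_with_rates[where p = p and eps = eps, OF p eps(1,3)] by blast
  define \<epsilon> where "\<epsilon> j = eps (s j)" for j
  define Rj where "Rj j = R (\<epsilon> j)" for j
  have \<epsilon>: "0 < \<epsilon> j" "\<epsilon> j < \<epsilon>0" "p j (\<epsilon> j)" for j using eps s(2) by (auto simp: \<epsilon>_def)
  have ex: "\<exists>\<eta>' \<theta> \<delta>. fine_run S K P C (\<epsilon> j) (e j) \<eta>' \<theta> \<Lambda> \<tau> \<delta> uo T xa xb V (Rj j) \<and> \<theta> <= e j" for j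
  proof -
    obtain \<eta>' \<theta> \<delta> where f: "fine_scheme S K P C (\<epsilon> j) (e j) \<eta>' \<theta> \<Lambda> \<tau> \<delta>" "\<epsilon> j powr er P <= \<theta>" "\<epsilon> j powr ec P <= \<theta>" "\<theta> <= e j"
      using \<epsilon>(3)[of j] unfolding p_def by blast
    have "fine_run_axioms S K P C (\<epsilon> j) \<theta> uo T xa xb V (Rj j)"
      unfolding fine_run_axioms_def Rj_def using scheme variation \<epsilon>(1,2)[of j] f(2,3) \<open>0 < T\<close> by blast
    then show ?thesis using f fine_run.intro by blast
  qed
  then obtain \<eta>' \<theta> \<delta> where fr: "\<And>j. fine_run S K P C (\<epsilon> j) (e j) (\<eta>' j) (\<theta> j) \<Lambda> \<tau> (\<delta> j) uo T xa xb V (Rj j)" and \<theta>: "\<And>j. \<theta> j <= e j"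
    by metis
  have V: "0 <= V" by (rule fine_run.V_nonneg[OF fr[of 0]])
  define \<eta> where "\<eta> j = \<Lambda> * (3 * V + 1) * e j" for j
  let ?U = "\<lambda>j. approx (Rj j)" and ?J = "\<lambda>j. fine_run.jumps_at (Rj j)"
  \<comment> \<open>positions lie between \<open>min xa xb\<close> and \<open>max xa xb\<close> whatever the order of \<open>xa\<close> and \<open>xb\<close>\<close>
  interpret tr: tracking T "min xa xb" "max xa xb" "\<Lambda> + 1" "\<Lambda> * V" "(\<Lambda> + 1) * \<Lambda> * V" K "states S" ?U "\<lambda>j. left0 (Rj j)" ?J uo
  proof unfold_locales
    fix n t x s a c assume t: "t \<in> {0..T}"
    show "x \<in> {min xa xb..max xa xb} \<and> \<bar>s\<bar> <= \<Lambda> + 1 \<and> a \<in> K \<and> c \<in> K" if "(x, s, a, c) \<in> set (?J n t)"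
      using fine_run.jumps_at_bounds[OF fr t that] e(2)[of n] by auto
    show "(\<Sum>(x, s, a, b)\<leftarrow>?J n t. norm (b - a)) <= \<Lambda> * V" by (rule fine_run.jumps_variation[OF fr t])
    assume "x \<notin> fst ` set (?J n t)"
    note as = fine_run.approx_states[OF fr t this]
    show "?U n t x \<in> K" using as by blast
    show "h (?U n t x) = step_fn (h (left0 (Rj n))) (jumps_of h (?J n t)) x" for h using as by blast
  next
    fix n s t assume st: "s \<in> {0..T}" "t \<in> {0..T}"
    have "((\<Lambda> + e n) * \<Lambda> * V) * \<bar>t - s\<bar> <= ((\<Lambda> + 1) * \<Lambda> * V) * \<bar>t - s\<bar>"
      using e(2)[of n] \<Lambda>\<tau> V by (intro mult_right_mono) auto
    then show "integrable lborel (\<lambda>x. norm (?U n t x - ?U n s x)) \<and>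
        (LINT x|lborel. norm (?U n t x - ?U n s x)) <= (\<Lambda> + 1) * \<Lambda> * V * \<bar>t - s\<bar>"
      using fine_run.approx_L1[OF fr st, of n] by (auto simp: L1_close_def)
  next
    show "left0 (Rj n) \<in> K" for n by (rule fine_run.run_left[OF fr])
    show "uo \<in> borel_measurable borel" by (rule BV_loc_measurable[OF \<open>BV_loc uo\<close>])
    show "uo x \<in> states S" for x using \<open>range uo \<subseteq> states S\<close> by auto
    show "integrable lborel (\<lambda>x. norm (?U n 0 x - uo x))" for n by (rule fine_run.initial_error(1)[OF fr])
    show "(\<lambda>n. LINT x|lborel. norm (?U n 0 x - uo x)) \<longlonglongrightarrow> 0"
    proof (rule tendsto_sandwich[OF _ _ tendsto_const e0])
      show "\<forall>\<^sub>F n in sequentially. 0 <= (LINT x|lborel. norm (?U n 0 x - uo x))" by simp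
      have "(LINT x|lborel. norm (?U n 0 x - uo x)) <= e n" for n
        using fine_run.initial_error(2)[OF fr, of n] \<epsilon>(3)[of n] by (auto simp: p_def)
      then show "\<forall>\<^sub>F n in sequentially. (LINT x|lborel. norm (?U n 0 x - uo x)) <= e n" by simp
    qed
  qed (use \<open>0 < T\<close> K open_states in auto)
  have lip: "\<exists>B. tr.lip_on_K h B" if h: "C1_on (states S) h" for h
  proof -
    obtain L where L: "L-lipschitz_on K h" by (rule C1_on_lipschitz[OF h open_states K])
    obtain M where M: "\<And>u. u \<in> K ==> norm (h u) <= M"
      by (rule bounded_on_compact[OF K C1_on_continuous[OF h]]) blast
    have "(max L M)-lipschitz_on K h" by (rule lipschitz_on_le[OF L]) simp
    then show ?thesis using M C1_on_continuous[OF h] unfolding tr.lip_on_K_def by (intro exI[of _ "max L M"]) (auto simp: le_max_iff_disj)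
  qed
  obtain Bf Bq where B: "tr.lip_on_K (ffun S) Bf" "tr.lip_on_K (qfun S) Bq" using lip C1_f C1_q by blast
  have lip_mono: "tr.lip_on_K h B'" if "tr.lip_on_K h B" "B <= B'" for h B B'
    using that lipschitz_on_le[of B K h B'] unfolding tr.lip_on_K_def by force
  interpret ts: tracking_system T "min xa xb" "max xa xb" "\<Lambda> + 1" "\<Lambda> * V" "(\<Lambda> + 1) * \<Lambda> * V" K "states S" ?U "\<lambda>j. left0 (Rj j)" ?J uo
    "ffun S" "qfun S" "max Bf Bq" \<eta> "\<lambda>j. fine_run.idx (Rj j)" "\<lambda>j. fine_run.stage_jumps (Rj j)" "\<lambda>j. tim (Rj j) ` {..nev (Rj j)}" b
  proof unfold_locales
    show "tr.lip_on_K (ffun S) (max Bf Bq)" "tr.lip_on_K (qfun S) (max Bf Bq)" using lip_mono B by auto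
    show "?J n t = drift t (fine_run.stage_jumps (Rj n) (fine_run.idx (Rj n) t))" if "t \<in> {0..T}" for n t
      using that by (intro fine_run.jumps_at_drift[OF fr]) simp
    show "fine_run.idx (Rj n) \<in> lborel \<rightarrow>\<^sub>M count_space UNIV" for n by (rule fine_run.measurable_idx[OF fr])
    show "\<forall>\<^sub>F t' in nhds t. fine_run.idx (Rj n) t' = fine_run.idx (Rj n) t" if "t \<in> {0<..<T} - tim (Rj n) ` {..nev (Rj n)}" for n t
      using that by (intro fine_run.idx_locally_constant[OF fr]) simp
    show "(\<Sum>(x, s, a, b)\<leftarrow>?J n t. norm ((ffun S b - ffun S a) - s *\<^sub>R (qfun S b - qfun S a))) <= \<eta> n" if t: "t \<in> {0..T}" for n t
    proof -
      have "(\<theta> n + Qlight P (\<epsilon> n) + e n) * V + heavy_weight P (\<epsilon> n) (Rj n) t <= (e n + e n + e n) * V + e n"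
      proof -
        have "heavy_weight P (\<epsilon> n) (Rj n) t < e n" "Qlight P (\<epsilon> n) < e n" using \<epsilon>(3)[of n] t unfolding p_def Rj_def by blast+
        then show ?thesis using \<theta>[of n] V by (intro add_mono mult_right_mono) auto
      qed
      then have "\<Lambda> * ((\<theta> n + Qlight P (\<epsilon> n) + e n) * V + heavy_weight P (\<epsilon> n) (Rj n) t) <= \<Lambda> * ((e n + e n + e n) * V + e n)"
        using \<Lambda>\<tau> by (intro mult_left_mono) auto
      also have "\<dots> = \<eta> n" by (simp add: \<eta>_def algebra_simps)
      finally show ?thesis using fine_run.jumps_residual[OF fr t, of n] by linarith
    qed
    show "\<eta> \<longlonglongrightarrow> 0" unfolding \<eta>_def using tendsto_mult_right_zero[OF e0] by simp
  qed (use \<Lambda>\<tau> \<open>1/2 < b\<close> in auto)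
  obtain k u where ku: "strict_mono k" "\<And>t. t \<in> {0..T} ==> AE x in lborel. (\<lambda>j. ?U (k j) t x) \<longlonglongrightarrow> u t x"
    "\<And>t. t \<in> {0..T} ==> AE x in lborel. u t x \<in> K" "\<And>t x. u t x \<in> states S" "u 0 = uo" "\<And>t. t \<in> {0..T} ==> u t \<in> borel_measurable borel"
    by (rule tr.exists_limit) blast
  interpret tl: tracking_limit T "min xa xb" "max xa xb" "\<Lambda> + 1" "\<Lambda> * V" "(\<Lambda> + 1) * \<Lambda> * V" K "states S" ?U "\<lambda>j. left0 (Rj j)" ?J uo
    "ffun S" "qfun S" "max Bf Bq" \<eta> "\<lambda>j. fine_run.idx (Rj j)" "\<lambda>j. fine_run.stage_jumps (Rj j)" "\<lambda>j. tim (Rj j) ` {..nev (Rj j)}" b k u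
    by unfold_locales (fact ku)+
  obtain Bi where Bi: "tr.lip_on_K (\<lambda>x. x) Bi" by (rule tr.lip_id)
  have sub: "approx (R (eps ((s \<circ> k) n))) = ?U (k n)" for n by (simp add: Rj_def \<epsilon>_def)
  show ?thesis
  proof (intro exI[of _ "s \<circ> k"] exI[of _ u] conjI allI impI)
    show "strict_mono (s \<circ> k)" using s(1) ku(1) by (rule strict_mono_o)
    fix l r :: real assume lr: "l < r"
    show "weakstar_converges S T b l r (\<lambda>n. approx (R (eps ((s \<circ> k) n)))) u"
      unfolding weakstar_converges_def sub
    proof (intro conjI exI[of _ "\<lambda>n. ts.rate (k n)"] exI[of _ "tl.limit_rate l r"] allI)
      show "weakstar_lim_H T (1 - b) l r (\<lambda>n. ?U (k n)) u" using tl.weakstar_lim_H_U[OF Bi lr] .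
    qed (rule tl.weakstar_lim_H_U[OF ts.f lr] tl.weakstar_lim_H_U[OF ts.q lr] ts.W1inf_U[OF lr] tl.W1inf_u[OF lr] tl.weakstar_lim_dual_rate[OF lr])+
    show "weakstar_solution S T b l r uo u"
      unfolding weakstar_solution_def
    proof (intro conjI ballI allI)
      show "u t x \<in> states S" for t x by (rule ku(4))
      show "Linf_H T (1 - b) l r (\<lambda>t x. ffun S (u t x))" by (rule tl.Linf_H_u[OF ts.f lr])
      show "\<exists>D. W1inf T b l r (\<lambda>t x. qfun S (u t x)) D" using tl.W1inf_u[OF lr] by blast
      fix t and \<phi> :: "real => real^'n" assume "t \<in> {0..<T}" and \<phi>: "\<phi> \<in> Htest b l r"
      then show "hpair (cut_hat l r (\<lambda>x. qfun S (u t x))) (fourier \<phi>) - hpair (cut_hat l r (\<lambda>x. qfun S (uo x))) (fourier \<phi>) -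
          (LINT \<tau>:{0<..<t}|lborel. hpair (cut_hat l r (\<lambda>x. ffun S (u \<tau> x))) (Dx (fourier \<phi>))) = 0"
        using tl.limit_conservation[OF \<phi> lr, of t] ku(5) by (simp add: tl.limit_rate_def)
    qed
  qed
qed

end
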